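(* Let $\kappa=1$ and $c_0\neq0$. Suppose that $\lambda$ is an $r$-partition of $n$ and that the spectrum of $M(\lambda)$ is simple. Suppose that for every outside corner $b$ of $\lambda$ there exist a sequence $b=b_0,b_1,\dots,b_{2m-1},b_{2m}$ of boxes of $\lambda$ and positive integers $k_0,k_1,\dots,k_m$ (with $m\ge0$ depending on $b$) such that (a) for $1\le i\le m$, we have $\beta(b_{2i})=\beta(b_{2i-1})$ and $b_{2i}$ appears (weakly) to the right of and (weakly) below $b_{2i-1}$, (b) for $0\le i\le m-1$ the set $M_{b_{2i},b_{2i+1},k_i}$ is an $\mathbb{H}$-submodule of $M(\lambda)$, and (c) the set $M_{b_{2m},k_m}$ is an $\mathbb{H}$-submodule of $M(\lambda)$. Then $L(\lambda)$ is finite dimensional.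
   Context: **Group and tableaux.** Let $r,n\ge 1$, $\zeta=e^{2\pi i/r}$, and let $W=G(r,1,n)$ be the group of $n\times n$ monomial matrices whose nonzero entries are $r$th roots of $1$. $\zeta_i\in W$ is the diagonal matrix with $\zeta$ in position $i$ and $1$'s elsewhere; $s_{ij}$ is the transposition interchanging $i$ and $j$; $s_i=s_{i,i+1}$; $t_w$ is the group-algebra element of $w\in W$. An $r$-partition $\lambda=(\lambda^0,\dots,\lambda^{r-1})$ of $n$ is a sequence of $r$ (possibly empty) partitions with $n$ boxes in total. For a box $b$ of $\lambda^l$ in row $p$ and column $q$ put $\mathrm{ct}(b)=q-p$ and $\beta(b)=l$. A standard Young tableau on $\lambda$ is a bijection $T$ from $\{1,\dots,n\}$ to the boxes of $\lambda$ ($T(i)$ is the box containing $i$) such that within each $\lambda^l$ entries strictly increase left to right and top to bottom; $\mathrm{SYT}(\lambda)$ is the set of these. An outside corner of $\lambda$ is a box $b$ for which there exists $T\in\mathrm{SYT}(\lambda)$ with $T^{-1}(b)=n$. $s_i.T$ is obtained from $T$ by interchanging $i$ and $i+1$. $S^\lambda$ is the irreducible $\mathbb{C}W$-module with basis $v_T$, $T\in\mathrm{SYT}(\lambda)$, on which $t_{\zeta_i}v_T=\zeta^{\beta(T(i))}v_T$; $t_{s_i}v_T=v_{s_i.T}$ if $\beta(T(i))\ne\beta(T(i+1))$; and if $\beta(T(i))=\beta(T(i+1))$ then with $a=\mathrm{ct}(T(i+1))-\mathrm{ct}(T(i))$, $t_{s_i}v_T=\frac1a v_T+(1-\frac1{a^2})^{1/2}v_{s_i.T}$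 (second term read as $0$ if $s_i.T$ is not standard). **Compositions.** $S_n$ acts on $\mathbb{Z}_{\ge0}^n$ by $(w.\mu)_i=\mu_{w^{-1}(i)}$. $\mu^+$ (resp. $\mu^-$) is the non-increasing (resp. non-decreasing) rearrangement of $\mu$; $w_\mu$ is the longest $w\in S_n$ with $w.\mu=\mu^-$, i.e. $w_\mu(i)=|\{j<i:\mu_j<\mu_i\}|+|\{j\ge i:\mu_j\le\mu_i\}|$. $\epsilon_i$ is the $i$th standard basis vector. Define $\mu<\nu$ iff $\mu^+<_d\nu^+$, or $\mu^+=\nu^+$ and $w_\mu<w_\nu$ in Bruhat order on $S_n$; here $\mu>_d\nu$ (strict dominance) means $\mu\neq\nu$ and $\mu-\nu=\sum_{i=1}^{n-1}k_i(\epsilon_i-\epsilon_{i+1})$ with integers $k_i\ge 0$. Put $v_T^\mu=t_{w_\mu}^{-1}.v_T$. **Algebra.** Base field $\mathbb{C}$, $\kappa=1$, parameters $c_0,d_1,\dots,d_{r-1}\in\mathbb{C}$; define $d_i$ for all $i\in\mathbb{Z}$ by $d_0+\cdots+d_{r-1}=0$ and $d_i=d_j$ if $i=j$ mod $r$. Let $y_1,\dots,y_n$ be the standard basis of $\mathfrak{h}=\mathbb{C}^n$ and $x_1,\dots,x_n$ the dual basis of $\mathfrak{h}^*$. The rational Cherednik algebra $\mathbb{H}$ is the algebra generated by $\mathbb{C}[x_1,\dots,x_n]$, $\mathbb{C}[y_1,\dots,y_n]$ and $\mathbb{C}W$ with relations $t_wx=(wx)t_w$, $t_wy=(wy)t_w$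 ($w\in W,x\in\mathfrak{h}^*,y\in\mathfrak{h}$), $$y_ix_j=x_jy_i+c_0\sum_{l=0}^{r-1}\zeta^{-l}t_{\zeta_i^ls_{ij}\zeta_i^{-l}}\ (i\ne j),$$ $$y_ix_i=x_iy_i+\kappa-\sum_{j=0}^{r-1}(d_j-d_{j-1})e_{ij}-c_0\sum_{j\ne i}\sum_{l=0}^{r-1}t_{\zeta_i^ls_{ij}\zeta_i^{-l}},$$ where $e_{ij}=\frac1r\sum_{l=0}^{r-1}\zeta^{-lj}t_{\zeta_i^l}$. Put $z_i=y_ix_i+c_0\phi_i$ with $\phi_i=\sum_{1\le j<i}\sum_{l=0}^{r-1}t_{\zeta_i^ls_{ij}\zeta_i^{-l}}$. $\mathfrak{t}\subseteq\mathbb{H}$ is the commutative subalgebra generated by $z_1,\dots,z_n,t_{\zeta_1},\dots,t_{\zeta_n}$. The standard module is $M(\lambda)=\mathrm{Ind}_{\mathbb{C}W\otimes \mathbb{C}[y_1,\dots,y_n]}^{\mathbb{H}}S^\lambda$ (each $y_i$ acting on $S^\lambda$ by $0$); as a vector space $M(\lambda)\simeq\mathbb{C}[x_1,\dots,x_n]\otimes S^\lambda$, with basis the elements $x^\mu v_T^\mu$. $L(\lambda)$ is the irreducible head of $M(\lambda)$, i.e. its quotient by its unique maximal proper submodule. **Simple spectrum and the sets $\Gamma$.** The spectrum of $M(\lambda)$ is simple if all (generalized) $\mathfrak{t}$-eigenspaces (weight spaces) of $M(\lambda)$ are one-dimensional. In that case, for each $\mu\in\mathbb{Z}_{\ge0}^n$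 and $T\in\mathrm{SYT}(\lambda)$, $f_{\mu,T}$ is the unique $\mathfrak{t}$-eigenvector in $M(\lambda)$ equal to $x^\mu v_T^\mu$ plus a linear combination of elements $x^\nu v_S^\nu$ with $\nu<\mu$. Let $\Gamma=\mathbb{Z}_{\ge0}^n\times\mathrm{SYT}(\lambda)$. For a box $b$ of $\lambda$ and $k\in\mathbb{Z}_{>0}$, $\Gamma_{b,k}=\{(\mu,T)\in\Gamma:\mu^-_{T^{-1}(b)}\ge k\}$. For distinct boxes $b_1,b_2$ of $\lambda$ and $k\in\mathbb{Z}_{>0}$, $\Gamma_{b_1,b_2,k}$ is the set of $(\mu,T)\in\Gamma$ such that either $\mu^-_{T^{-1}(b_1)}-\mu^-_{T^{-1}(b_2)}>k$, or $\mu^-_{T^{-1}(b_1)}-\mu^-_{T^{-1}(b_2)}=k$ and $w_\mu^{-1}(T^{-1}(b_1))<w_\mu^{-1}(T^{-1}(b_2))$. $M_{b,k}$ and $M_{b_1,b_2,k}$ are the $\mathbb{C}$-spans of the $f_{\mu,T}$ with $(\mu,T)\in\Gamma_{b,k}$, respectively $(\mu,T)\in\Gamma_{b_1,b_2,k}$. *)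

theory Defs
  imports
    "HOL-Algebra.QuotRing"
    "HOL-Algebra.Module"
    "HOL-Algebra.Generated_Rings"
    "HOL-Combinatorics.Permutations"
    "HOL-Library.Poly_Mapping"
    "Jordan_Normal_Form.Matrix"
begin

text \<open>
  Indices run over \<open>{..<n}\<close> throughout (matrix rows and columns, variables, entries of tableaux,
  positions of compositions), and rows and columns of boxes also start at 0. Compared with the
  usual indexing by \<open>1, \<dots>, n\<close> every index is lowered by one.
\<close>

section \<open>Free algebras\<close>

text \<open>Words are a copy of lists, made into a monoid (written additively, because that is what
  the convolution product of \<^theory>\<open>HOL-Library.Poly_Mapping\<close> expects) under concatenation.\<close>

datatype 'g word = Word (letters: "'g list")

instantiation word :: (type) monoid_add
begin

definition zero_word :: "'a word" where "0 = Word []"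

definition plus_word :: "'a word \<Rightarrow> 'a word \<Rightarrow> 'a word"
  where "u + v = Word (letters u @ letters v)"

instance by standard (auto simp: zero_word_def plus_word_def)

end

type_synonym 'g free = "'g word \<Rightarrow>\<^sub>0 complex"

definition const :: "complex \<Rightarrow> 'g free"
  where "const c = Poly_Mapping.single 0 c"

definition gen :: "'g \<Rightarrow> 'g free"
  where "gen g = Poly_Mapping.single (Word [g]) 1"

definition free_algebra :: "'g set \<Rightarrow> 'g free ring"
  where "free_algebra G =
    \<lparr>carrier = {p. \<forall>u\<in>Poly_Mapping.keys p. set (letters u) \<subseteq> G},
     monoid.mult = (*), one = 1, zero = 0, add = (+)\<rparr>"

section \<open>Left modules over a ring that need not be commutative\<close>

text \<open>We reuse the record \<^typ>\<open>('a, 'b) module\<close> and the predicate \<^const>\<open>submodule\<close>, neither of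
  which involves commutativity of the ring of scalars. The fields \<open>mult\<close> and \<open>one\<close> of
  the record play no role.\<close>

definition gen_submodule :: "('a, 'c) ring_scheme \<Rightarrow> ('a, 'b) module \<Rightarrow> 'b set \<Rightarrow> 'b set"
  where "gen_submodule R M A = \<Inter>{N. submodule N R M \<and> A \<subseteq> N}"

definition quot_module :: "('a, 'b) module \<Rightarrow> 'b set \<Rightarrow> ('a, 'b set) module"
  where "quot_module M N =
    \<lparr>carrier = a_rcosets\<^bsub>M\<^esub> N, monoid.mult = undefined, one = undefined,
     zero = N, add = set_add M,
     smult = (\<lambda>a X. \<Union>m\<in>X. N +>\<^bsub>M\<^esub> (a \<odot>\<^bsub>M\<^esub> m))\<rparr>"

definition fun_module :: "('a, 'c) ring_scheme \<Rightarrow> 'i set \<Rightarrow> ('a, 'i \<Rightarrow> 'a) module"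
  where "fun_module R I =
    \<lparr>carrier = (\<Pi>\<^sub>E i\<in>I. carrier R), monoid.mult = undefined, one = undefined,
     zero = (\<lambda>i\<in>I. \<zero>\<^bsub>R\<^esub>), add = (\<lambda>f g. \<lambda>i\<in>I. f i \<oplus>\<^bsub>R\<^esub> g i),
     smult = (\<lambda>a f. \<lambda>i\<in>I. a \<otimes>\<^bsub>R\<^esub> f i)\<rparr>"

definition maximal_proper_submodule ::
    "'b set \<Rightarrow> ('a, 'c) ring_scheme \<Rightarrow> ('a, 'b) module \<Rightarrow> bool"
  where "maximal_proper_submodule N R M \<longleftrightarrow>
    submodule N R M \<and> N \<noteq> carrier M \<and>
    (\<forall>N'. submodule N' R M \<and> N \<subseteq> N' \<longrightarrow> N' = N \<or> N' = carrier M)"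

definition complex_ring :: "complex ring"
  where "complex_ring = \<lparr>carrier = UNIV, monoid.mult = (*), one = 1, zero = 0, add = (+)\<rparr>"

section \<open>Multipartitions and tableaux\<close>

text \<open>A box \<open>(l, p, q)\<close> lies in row \<open>p\<close> and column \<open>q\<close> of the \<open>l\<close>-th component.\<close>

type_synonym box = "nat \<times> nat \<times> nat"
type_synonym tableau = "nat \<Rightarrow> box"

definition beta :: "box \<Rightarrow> nat" where "beta b = fst b"
definition box_row :: "box \<Rightarrow> nat" where "box_row b = fst (snd b)"
definition box_col :: "box \<Rightarrow> nat" where "box_col b = snd (snd b)"
definition ct :: "box \<Rightarrow> int" where "ct b = int (box_col b) - int (box_row b)"

definition is_partition :: "nat list \<Rightarrow> bool"
  where "is_partition p \<longleftrightarrow> sorted_wrt (\<ge>) p \<and> (\<forall>x\<in>set p. 0 < x)"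

definition is_multipartition :: "nat \<Rightarrow> nat \<Rightarrow> nat list list \<Rightarrow> bool"
  where "is_multipartition r n lam \<longleftrightarrow>
    length lam = r \<and> (\<forall>p\<in>set lam. is_partition p) \<and> sum_list (map sum_list lam) = n"

definition boxes :: "nat list list \<Rightarrow> box set"
  where "boxes lam =
    {(l, p, q). l < length lam \<and> p < length (lam ! l) \<and> q < lam ! l ! p}"

definition SYT :: "nat \<Rightarrow> nat list list \<Rightarrow> tableau set"
  where "SYT n lam =
    {T \<in> extensional {..<n}. bij_betw T {..<n} (boxes lam) \<and>
      (\<forall>i<n. \<forall>j<n. beta (T i) = beta (T j) \<longrightarrow>
        (box_row (T i) = box_row (T j) \<and> box_col (T i) < box_col (T j) \<longrightarrow> i < j) \<and>
        (box_col (T i) = box_col (T j) \<and> box_row (T i) < box_row (T j) \<longrightarrow> i < j))}"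

definition entry :: "nat \<Rightarrow> tableau \<Rightarrow> box \<Rightarrow> nat"
  where "entry n T b = inv_into {..<n} T b"

definition outside_corner :: "nat \<Rightarrow> nat list list \<Rightarrow> box \<Rightarrow> bool"
  where "outside_corner n lam b \<longleftrightarrow>
    b \<in> boxes lam \<and> (\<exists>T\<in>SYT n lam. entry n T b = n - 1)"

definition swap_tab :: "nat \<Rightarrow> tableau \<Rightarrow> tableau"
  where "swap_tab i T = T \<circ> Transposition.transpose i (Suc i)"

section \<open>Compositions\<close>

definition compositions :: "nat \<Rightarrow> (nat \<Rightarrow> nat) set"
  where "compositions n = {mu. \<forall>i\<ge>n. mu i = 0}"

definition mu_minus :: "nat \<Rightarrow> (nat \<Rightarrow> nat) \<Rightarrow> nat \<Rightarrow> nat"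
  where "mu_minus n mu i = (if i < n then sort (map mu [0..<n]) ! i else 0)"

definition mu_plus :: "nat \<Rightarrow> (nat \<Rightarrow> nat) \<Rightarrow> nat \<Rightarrow> nat"
  where "mu_plus n mu i = (if i < n then rev (sort (map mu [0..<n])) ! i else 0)"

text \<open>With indices starting at 0, the term \<open>j = i\<close> (which would always contribute 1) is dropped
  from the second count.\<close>

definition w_of :: "nat \<Rightarrow> (nat \<Rightarrow> nat) \<Rightarrow> nat \<Rightarrow> nat"
  where "w_of n mu i = (if i < n then
      card {j. j < i \<and> mu j < mu i} + card {j. i < j \<and> j < n \<and> mu j \<le> mu i} else i)"

definition perm_length :: "nat \<Rightarrow> (nat \<Rightarrow> nat) \<Rightarrow> nat"
  where "perm_length n w = card {(i, j). i < j \<and> j < n \<and> w j < w i}"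

definition bruhat_less :: "nat \<Rightarrow> ((nat \<Rightarrow> nat) \<times> (nat \<Rightarrow> nat)) set"
  where "bruhat_less n =
    {(u, u \<circ> Transposition.transpose i j) |u i j.
      u permutes {..<n} \<and> i < j \<and> j < n \<and>
      perm_length n u < perm_length n (u \<circ> Transposition.transpose i j)}\<^sup>+"

definition dom_less :: "nat \<Rightarrow> (nat \<Rightarrow> nat) \<Rightarrow> (nat \<Rightarrow> nat) \<Rightarrow> bool"
  where "dom_less n nu mu \<longleftrightarrow> mu \<noteq> nu \<and>
    (\<exists>k::nat \<Rightarrow> nat. \<forall>a<n. int (mu a) - int (nu a) =
      (\<Sum>i<n-1. int (k i) * (of_bool (a = i) - of_bool (a = Suc i))))"

definition comp_less :: "nat \<Rightarrow> (nat \<Rightarrow> nat) \<Rightarrow> (nat \<Rightarrow> nat) \<Rightarrow> bool"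
  where "comp_less n nu mu \<longleftrightarrow>
    dom_less n (mu_plus n nu) (mu_plus n mu) \<or>
    mu_plus n nu = mu_plus n mu \<and> (w_of n nu, w_of n mu) \<in> bruhat_less n"

section \<open>The group \<open>G(r,1,n)\<close>\<close>

definition zeta :: "nat \<Rightarrow> complex"
  where "zeta r = cis (2 * pi / real r)"

definition Grp :: "nat \<Rightarrow> nat \<Rightarrow> complex mat set"
  where "Grp r n = {A \<in> carrier_mat n n.
    (\<forall>i<n. \<exists>!j. j < n \<and> A $$ (i, j) \<noteq> 0) \<and>
    (\<forall>j<n. \<exists>!i. i < n \<and> A $$ (i, j) \<noteq> 0) \<and>
    (\<forall>i<n. \<forall>j<n. A $$ (i, j) \<noteq> 0 \<longrightarrow> A $$ (i, j) ^ r = 1)}"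

text \<open>\<open>zeta_mat r n i k\<close> is the \<open>k\<close>-th power of \<open>\<zeta>\<^sub>i\<close>.\<close>

definition zeta_mat :: "nat \<Rightarrow> nat \<Rightarrow> nat \<Rightarrow> int \<Rightarrow> complex mat"
  where "zeta_mat r n i k =
    mat n n (\<lambda>(a, b). if a = b then (if a = i then zeta r powi k else 1) else 0)"

definition perm_mat :: "nat \<Rightarrow> (nat \<Rightarrow> nat) \<Rightarrow> complex mat"
  where "perm_mat n w = mat n n (\<lambda>(a, b). if a = w b then 1 else 0)"

definition swap_mat :: "nat \<Rightarrow> nat \<Rightarrow> nat \<Rightarrow> complex mat"
  where "swap_mat n i j = perm_mat n (Transposition.transpose i j)"

definition refl_mat :: "nat \<Rightarrow> nat \<Rightarrow> nat \<Rightarrow> nat \<Rightarrow> nat \<Rightarrow> complex mat"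
  where "refl_mat r n i j l =
    zeta_mat r n i (int l) * swap_mat n i j * zeta_mat r n i (- int l)"

section \<open>The rational Cherednik algebra with \<open>\<kappa> = 1\<close>\<close>

datatype generator = GX nat | GY nat | GT "complex mat"

type_synonym word_poly = "generator free"

definition X :: "nat \<Rightarrow> word_poly" where "X i = gen (GX i)"
definition Y :: "nat \<Rightarrow> word_poly" where "Y i = gen (GY i)"
definition T\<^sub>g :: "complex mat \<Rightarrow> word_poly" where "T\<^sub>g w = gen (GT w)"

text \<open>The elements of the algebra are cosets of non-commutative polynomials; \<open>hcl\<close> is the
  coset map. Elements of the standard module are cosets of families of algebra elements.\<close>

type_synonym rca_elem = "word_poly set"
type_synonym std_elem = "(tableau \<Rightarrow> rca_elem) set"

text \<open>
  Only \<open>d 1, \<dots>, d (r - 1)\<close> matter; \<open>dd\<close> extends them to all integers.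

  \<open>rho w\<close> is the action of \<open>w\<close> on \<open>S\<^sup>\<lambda>\<close>, whose underlying space consists of the
  coordinate vectors \<open>tableau \<Rightarrow> complex\<close> with respect to the basis \<open>v\<^sub>T\<close>.
\<close>

locale cherednik =
  fixes r n :: nat
    and c0 :: complex
    and d :: "nat \<Rightarrow> complex"
    and lam :: "nat list list"
    and rho :: "complex mat \<Rightarrow> (tableau \<Rightarrow> complex) \<Rightarrow> tableau \<Rightarrow> complex"
begin

definition dd :: "int \<Rightarrow> complex"
  where "dd i = (let k = nat (i mod int r)
    in if k = 0 then - (\<Sum>j=1..<r. d j) else d k)"

definition ee :: "nat \<Rightarrow> nat \<Rightarrow> word_poly"
  where "ee i j = const (1 / of_nat r) *
    (\<Sum>l<r. const (zeta r powi (- (int l * int j))) * T\<^sub>g (zeta_mat r n i (int l)))"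

text \<open>\<open>w x\<^sub>j = x\<^sub>j \<circ> w\<^sup>-\<^sup>1\<close> has coordinates \<open>(w\<^sup>-\<^sup>1)\<^sub>j\<^sub>i\<close>; below \<open>w'\<close> is the inverse of \<open>w\<close>.\<close>

definition relators :: "word_poly set"
  where "relators =
      {X i * X j - X j * X i |i j. i < n \<and> j < n}
    \<union> {Y i * Y j - Y j * Y i |i j. i < n \<and> j < n}
    \<union> {T\<^sub>g w * T\<^sub>g w' - T\<^sub>g (w * w') |w w'. w \<in> Grp r n \<and> w' \<in> Grp r n}
    \<union> {T\<^sub>g (1\<^sub>m n) - 1}
    \<union> {T\<^sub>g w * X j - (\<Sum>i<n. const (w' $$ (j, i)) * X i) * T\<^sub>g w |w w' j.
        w \<in> Grp r n \<and> w' \<in> Grp r n \<and> w * w' = 1\<^sub>m n \<and> j < n}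
    \<union> {T\<^sub>g w * Y j - (\<Sum>i<n. const (w $$ (i, j)) * Y i) * T\<^sub>g w |w j.
        w \<in> Grp r n \<and> j < n}
    \<union> {Y i * X j - (X j * Y i +
        const c0 * (\<Sum>l<r. const (zeta r powi (- int l)) * T\<^sub>g (refl_mat r n i j l))) |i j.
        i < n \<and> j < n \<and> i \<noteq> j}
    \<union> {Y i * X i - (X i * Y i + 1
        - (\<Sum>j<r. const (dd (int j) - dd (int j - 1)) * ee i j)
        - const c0 * (\<Sum>j\<in>{..<n} - {i}. \<Sum>l<r. T\<^sub>g (refl_mat r n i j l))) |i. i < n}"

definition FF :: "word_poly ring"
  where "FF = free_algebra (GX ` {..<n} \<union> GY ` {..<n} \<union> GT ` Grp r n)"

definition HH :: "rca_elem ring"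
  where "HH = FF Quot (genideal FF relators)"

definition hcl :: "word_poly \<Rightarrow> rca_elem"
  where "hcl p = genideal FF relators +>\<^bsub>FF\<^esub> p"

definition restrict_scalars :: "(rca_elem, 'b) module \<Rightarrow> (complex, 'b) module"
  where "restrict_scalars M =
    \<lparr>carrier = carrier M, monoid.mult = monoid.mult M, one = one M, zero = zero M, add = add M,
     smult = (\<lambda>c m. hcl (const c) \<odot>\<^bsub>M\<^esub> m)\<rparr>"

definition cspan :: "(rca_elem, 'b) module \<Rightarrow> 'b set \<Rightarrow> 'b set"
  where "cspan M A = gen_submodule complex_ring (restrict_scalars M) A"

definition finite_dimensional :: "(rca_elem, 'b) module \<Rightarrow> bool"
  where "finite_dimensional M \<longleftrightarrow> (\<exists>A. finite A \<and> A \<subseteq> carrier M \<and> cspan M A = carrier M)"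

subsection \<open>The module \<open>S\<^sup>\<lambda>\<close>\<close>

definition SS :: "(complex, tableau \<Rightarrow> complex) module"
  where "SS =
    \<lparr>carrier = {f. \<forall>T. T \<notin> SYT n lam \<longrightarrow> f T = 0},
     monoid.mult = undefined, one = undefined,
     zero = (\<lambda>T. 0), add = (\<lambda>f g T. f T + g T),
     smult = (\<lambda>c f T. c * f T)\<rparr>"

definition vv :: "tableau \<Rightarrow> tableau \<Rightarrow> complex"
  where "vv T = (\<lambda>U. if U = T then 1 else 0)"

definition specht_module :: bool
  where "specht_module \<longleftrightarrow>
    (\<forall>w\<in>Grp r n. \<forall>f\<in>carrier SS. rho w f \<in> carrier SS) \<and>
    (\<forall>w\<in>Grp r n. \<forall>f\<in>carrier SS. \<forall>g\<in>carrier SS.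
      rho w (f \<oplus>\<^bsub>SS\<^esub> g) = rho w f \<oplus>\<^bsub>SS\<^esub> rho w g) \<and>
    (\<forall>w\<in>Grp r n. \<forall>c. \<forall>f\<in>carrier SS. rho w (c \<odot>\<^bsub>SS\<^esub> f) = c \<odot>\<^bsub>SS\<^esub> rho w f) \<and>
    (\<forall>f\<in>carrier SS. rho (1\<^sub>m n) f = f) \<and>
    (\<forall>w\<in>Grp r n. \<forall>w'\<in>Grp r n. \<forall>f\<in>carrier SS. rho (w * w') f = rho w (rho w' f)) \<and>
    carrier SS \<noteq> {\<zero>\<^bsub>SS\<^esub>} \<and>
    (\<forall>U. submodule U complex_ring SS \<and> (\<forall>w\<in>Grp r n. rho w ` U \<subseteq> U) \<longrightarrow>
      U = {\<zero>\<^bsub>SS\<^esub>} \<or> U = carrier SS) \<and>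
    (\<forall>i<n. \<forall>T\<in>SYT n lam.
      rho (zeta_mat r n i 1) (vv T) = zeta r ^ beta (T i) \<odot>\<^bsub>SS\<^esub> vv T) \<and>
    (\<forall>i. Suc i < n \<longrightarrow> (\<forall>T\<in>SYT n lam.
      rho (swap_mat n i (Suc i)) (vv T) =
      (if beta (T i) \<noteq> beta (T (Suc i)) then vv (swap_tab i T)
       else let a = real_of_int (ct (T (Suc i)) - ct (T i)) in
         complex_of_real (1 / a) \<odot>\<^bsub>SS\<^esub> vv T \<oplus>\<^bsub>SS\<^esub>
         (if swap_tab i T \<in> SYT n lam
          then complex_of_real (sqrt (1 - 1 / a\<^sup>2)) \<odot>\<^bsub>SS\<^esub> vv (swap_tab i T)
          else \<zero>\<^bsub>SS\<^esub>))))"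

subsection \<open>The standard module\<close>

text \<open>Since \<open>S\<^sup>\<lambda>\<close> has basis \<open>v\<^sub>T\<close>, the tensor product over the complex numbers of the algebra with
  \<open>S\<^sup>\<lambda>\<close> is the module of families indexed by tableaux, and \<open>h \<otimes> f\<close> is the family \<open>tensor h f\<close>. The
  induced module is the quotient by the relations \<open>h b \<otimes> f = h \<otimes> b f\<close>, where it suffices that
  \<open>b\<close> runs over the generators \<open>t\<^sub>w\<close> and \<open>y\<^sub>i\<close>, the latter acting by 0.\<close>

definition tensor :: "rca_elem \<Rightarrow> (tableau \<Rightarrow> complex) \<Rightarrow> tableau \<Rightarrow> rca_elem"
  where "tensor h f = (\<lambda>T\<in>SYT n lam. h \<otimes>\<^bsub>HH\<^esub> hcl (const (f T)))"

definition ind_relations :: "(tableau \<Rightarrow> rca_elem) set"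
  where "ind_relations = gen_submodule HH (fun_module HH (SYT n lam))
    ({tensor (h \<otimes>\<^bsub>HH\<^esub> hcl (T\<^sub>g w)) f \<ominus>\<^bsub>fun_module HH (SYT n lam)\<^esub> tensor h (rho w f) |h w f.
        h \<in> carrier HH \<and> w \<in> Grp r n \<and> f \<in> carrier SS}
     \<union> {tensor (h \<otimes>\<^bsub>HH\<^esub> hcl (Y i)) f |h i f. h \<in> carrier HH \<and> i < n \<and> f \<in> carrier SS})"

definition MM :: "(rca_elem, std_elem) module"
  where "MM = quot_module (fun_module HH (SYT n lam)) ind_relations"

definition mcl :: "(tableau \<Rightarrow> rca_elem) \<Rightarrow> std_elem"
  where "mcl f = ind_relations +>\<^bsub>fun_module HH (SYT n lam)\<^esub> f"

definition LL :: "(rca_elem, std_elem set) module"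
  where "LL = quot_module MM (THE N. maximal_proper_submodule N HH MM)"

definition xmon :: "(nat \<Rightarrow> nat) \<Rightarrow> word_poly"
  where "xmon mu = prod_list (map (\<lambda>i. X i ^ mu i) [0..<n])"

text \<open>\<open>x\<^sup>\<mu> v\<^sub>T\<^sup>\<mu>\<close>\<close>

definition xv :: "(nat \<Rightarrow> nat) \<Rightarrow> tableau \<Rightarrow> std_elem"
  where "xv mu T =
    mcl (tensor (hcl (xmon mu)) (rho (perm_mat n (inv_into UNIV (w_of n mu))) (vv T)))"

subsection \<open>Weight spaces\<close>

definition phi :: "nat \<Rightarrow> word_poly"
  where "phi i = (\<Sum>j<i. \<Sum>l<r. T\<^sub>g (refl_mat r n i j l))"

definition zz :: "nat \<Rightarrow> word_poly"
  where "zz i = Y i * X i + const c0 * phi i"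

definition tt :: "rca_elem set"
  where "tt = generate_ring HH (range (\<lambda>c. hcl (const c))
    \<union> (\<lambda>i. hcl (zz i)) ` {..<n} \<union> (\<lambda>i. hcl (T\<^sub>g (zeta_mat r n i 1))) ` {..<n})"

definition gen_weight_space :: "(rca_elem \<Rightarrow> complex) \<Rightarrow> std_elem set"
  where "gen_weight_space \<alpha> = {m \<in> carrier MM. \<forall>a\<in>tt. \<exists>k::nat.
    ((\<lambda>u. (a \<odot>\<^bsub>MM\<^esub> u) \<ominus>\<^bsub>MM\<^esub> (hcl (const (\<alpha> a)) \<odot>\<^bsub>MM\<^esub> u)) ^^ k) m = \<zero>\<^bsub>MM\<^esub>}"

definition simple_spectrum :: bool
  where "simple_spectrum \<longleftrightarrow> (\<forall>\<alpha>. gen_weight_space \<alpha> \<noteq> {\<zero>\<^bsub>MM\<^esub>} \<longrightarrow>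
    (\<exists>m\<in>carrier MM. m \<noteq> \<zero>\<^bsub>MM\<^esub> \<and> gen_weight_space \<alpha> = cspan MM {m}))"

definition eigenvector :: "std_elem \<Rightarrow> bool"
  where "eigenvector m \<longleftrightarrow> m \<in> carrier MM \<and> m \<noteq> \<zero>\<^bsub>MM\<^esub> \<and>
    (\<forall>a\<in>tt. \<exists>c. a \<odot>\<^bsub>MM\<^esub> m = hcl (const c) \<odot>\<^bsub>MM\<^esub> m)"

definition ff :: "(nat \<Rightarrow> nat) \<Rightarrow> tableau \<Rightarrow> std_elem"
  where "ff mu T = (THE m. eigenvector m \<and>
    m \<ominus>\<^bsub>MM\<^esub> xv mu T \<in>
      cspan MM {xv nu U |nu U. nu \<in> compositions n \<and> U \<in> SYT n lam \<and> comp_less n nu mu})"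

subsection \<open>The sets \<open>\<Gamma>\<close> and their spans\<close>

definition Gamma :: "((nat \<Rightarrow> nat) \<times> tableau) set"
  where "Gamma = compositions n \<times> SYT n lam"

definition Gamma1 :: "box \<Rightarrow> nat \<Rightarrow> ((nat \<Rightarrow> nat) \<times> tableau) set"
  where "Gamma1 b k = {(mu, T) \<in> Gamma. mu_minus n mu (entry n T b) \<ge> k}"

definition Gamma2 :: "box \<Rightarrow> box \<Rightarrow> nat \<Rightarrow> ((nat \<Rightarrow> nat) \<times> tableau) set"
  where "Gamma2 b1 b2 k = {(mu, T) \<in> Gamma.
    (let diff = int (mu_minus n mu (entry n T b1)) - int (mu_minus n mu (entry n T b2)) in
      diff > int k \<or>
      diff = int k \<and>
        inv_into UNIV (w_of n mu) (entry n T b1) < inv_into UNIV (w_of n mu) (entry n T b2))}"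

definition M1 :: "box \<Rightarrow> nat \<Rightarrow> std_elem set"
  where "M1 b k = cspan MM ((\<lambda>(mu, T). ff mu T) ` Gamma1 b k)"

definition M2 :: "box \<Rightarrow> box \<Rightarrow> nat \<Rightarrow> std_elem set"
  where "M2 b1 b2 k = cspan MM ((\<lambda>(mu, T). ff mu T) ` Gamma2 b1 b2 k)"

end

end

theory Submission
  imports Defs "HOL-Library.Function_Algebras"
begin

text \<open>
  The standard module is spanned by eigenvectors \<open>f\<^bsub>\<mu>,T\<^esub>\<close>, and the kernel of the map onto
  \<open>L(\<lambda>)\<close> is spanned by some of them; the hypotheses force all but finitely many into that kernel.

  More precisely, the operators \<open>z\<^sub>i\<close> and \<open>t\<^bsub>\<zeta>\<^sub>i\<^esub>\<close> commute and act triangularly on the basis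
  \<open>x\<^sup>\<mu> v\<^sub>T\<^sup>\<mu>\<close> (\<open>zo_commute\<close>, \<open>zo_em\<close>). When the spectrum is simple this yields a basis of
  simultaneous eigenvectors with pairwise different weights, so a submodule is spanned by the
  eigenvectors it contains (\<open>ef_separate\<close>). Let \<open>K\<close> be the set of indices whose eigenvector lies
  in some proper submodule. A submodule containing \<open>f\<^bsub>0,T\<^esub>\<close>, a nonzero vector of \<open>S\<^sup>\<lambda>\<close>, is everything,
  because \<open>S\<^sup>\<lambda>\<close> is irreducible and generates; hence \<open>(0,T)\<close> is not in \<open>K\<close>, the span \<open>J\<close> of the eigenvectors
  indexed by \<open>K\<close> is proper, and it is the unique maximal proper submodule (\<open>the_maximal\<close>). Thus
  \<open>L(\<lambda>)\<close> is spanned by the images of the eigenvectors with index outside \<open>K\<close>.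

  As \<open>k > 0\<close>, the sets \<open>\<Gamma>\<^bsub>b,k\<^esub>\<close> and \<open>\<Gamma>\<^bsub>b,b',k\<^esub>\<close> do not contain \<open>(0,T)\<close>; whenever one of them
  spans a submodule, it is therefore contained in \<open>K\<close>. Take \<open>(\<mu>,T)\<close> outside \<open>K\<close> and apply the
  hypothesis to the outside corner occupied by the largest entry of \<open>T\<close>, whose part is the
  largest part of \<open>\<mu>\<close>. Along the chain of boxes, the part drops by at most \<open>k\<^sub>i\<close> from the first to the
  second box of a pair linked by a submodule, it does not drop between boxes of one component
  because the entries of \<open>T\<close> increase to the right and downwards, and it is less than \<open>k\<^sub>m\<close> at the
  last box. So all parts of \<open>\<mu>\<close>
  are at most the sum of the \<open>k\<^sub>i\<close> (\<open>composition_bounded\<close>), which leaves finitely many \<open>\<mu>\<close>.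

  To compute in the standard module, which is a quotient of families over a quotient of a free
  algebra, it is identified with the space \<open>V\<close> of polynomials with values in \<open>S\<^sup>\<lambda>\<close>, where the
  \<open>y\<^sub>i\<close> act by Dunkl operators. These commute (\<open>yo_commute\<close>) and satisfy the relations of the
  algebra, so the free algebra acts on \<open>V\<close> through the quotient (\<open>act_relator\<close>). Sending a
  polynomial to the same expression in the generators gives a linear map \<open>psi\<close> from \<open>V\<close> to the
  standard module; it is surjective since the module is generated by \<open>S\<^sup>\<lambda>\<close>, and injective since
  applying families of algebra elements to the basis of \<open>S\<^sup>\<lambda>\<close> inverts it (\<open>psi_inj\<close>).
\<close>

section \<open>Linear maps on spaces of finitely supported functions\<close>

abbreviation "lookup \<equiv> Poly_Mapping.lookup"
abbreviation "keys \<equiv> Poly_Mapping.keys"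

definition psc :: "complex \<Rightarrow> ('a \<Rightarrow>\<^sub>0 complex) \<Rightarrow> 'a \<Rightarrow>\<^sub>0 complex"
  where "psc c = Poly_Mapping.map ((*) c)"

lemma lookup_psc [simp]: "lookup (psc c p) k = c * lookup p k"
  unfolding psc_def by transfer (auto simp: when_def)

lemma vector_space_psc: "vector_space psc"
  by unfold_locales (auto intro!: poly_mapping_eqI simp: lookup_add algebra_simps)

interpretation psc: vector_space psc
  by (rule vector_space_psc)

lemma psc_single [simp]: "psc c (Poly_Mapping.single m a) = Poly_Mapping.single m (c * a)"
  by (rule poly_mapping_eqI) (auto simp: lookup_single when_def)

lemma psc_conv_mult: "psc c p = Poly_Mapping.single 0 c * (p :: 'a::monoid_add \<Rightarrow>\<^sub>0 complex)"
  unfolding psc_def by (rule mult_map_scale_conv_mult)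

text \<open>Polynomials, and elements of the free algebra, are treated one monomial at a time.\<close>

lemma pm_induct [case_names single add]:
  assumes "\<And>m c. Q (Poly_Mapping.single m c)"
    and "\<And>f g. Q f \<Longrightarrow> Q g \<Longrightarrow> Q (f + g)"
  shows "Q (f :: 'a \<Rightarrow>\<^sub>0 'b::comm_monoid_add)"
proof -
  have z: "Q 0" using assms(1)[of undefined 0] by simp
  have *: "Q (\<Sum>m\<in>A. Poly_Mapping.single m (lookup f m))" if "finite A" for A
    using that by (induction A) (auto simp: z assms)
  have "f = (\<Sum>m\<in>keys f. Poly_Mapping.single m (lookup f m))"
    by (rule poly_mapping_eqI) (auto simp: lookup_sum lookup_single when_def in_keys_iff sum.delta)
  then show ?thesis using *[of "keys f"] by simp
qed

lemma single_comm: "Poly_Mapping.single 0 c * p = p * Poly_Mapping.single (0::'a::monoid_add) (c::complex)"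
  by (induction p rule: pm_induct) (auto simp: mult_single algebra_simps)

lemma mult_psc_left: "psc c p * q = psc c (p * (q :: 'a::monoid_add \<Rightarrow>\<^sub>0 complex))"
  by (simp add: psc_conv_mult mult.assoc)

lemma mult_psc_right: "p * psc c q = psc c (p * (q :: 'a::monoid_add \<Rightarrow>\<^sub>0 complex))"
  by (simp only: psc_conv_mult mult.assoc[symmetric] single_comm[of c p])

definition lext :: "('a \<Rightarrow> 'b \<Rightarrow>\<^sub>0 complex) \<Rightarrow> ('a \<Rightarrow>\<^sub>0 complex) \<Rightarrow> 'b \<Rightarrow>\<^sub>0 complex"
  where "lext \<phi> f = (\<Sum>m\<in>keys f. psc (lookup f m) (\<phi> m))"

lemma lext_superset: "finite A \<Longrightarrow> keys f \<subseteq> A \<Longrightarrow> lext \<phi> f = (\<Sum>m\<in>A. psc (lookup f m) (\<phi> m))"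
  unfolding lext_def by (rule sum.mono_neutral_left) (auto simp: in_keys_iff)

lemma lext_single [simp]: "lext \<phi> (Poly_Mapping.single m c) = psc c (\<phi> m)"
  by (subst lext_superset[of "{m}"]) (auto simp: in_keys_iff lookup_single when_def)

abbreviation plin :: "(('a \<Rightarrow>\<^sub>0 complex) \<Rightarrow> 'b \<Rightarrow>\<^sub>0 complex) \<Rightarrow> bool"
  where "plin \<equiv> module_hom psc psc"

lemma plinI:
  assumes "\<And>f g. D (f + g) = D f + D g" "\<And>c f. D (psc c f) = psc c (D f)"
  shows "plin D"
  using assms by (simp add: module_hom_iff psc.module_axioms)

lemma plin_lext: "plin (lext \<phi>)"
proof (rule plinI)
  fix f g :: "'a \<Rightarrow>\<^sub>0 complex"
  let ?A = "keys f \<union> keys g"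
  have "keys (f + g) \<subseteq> ?A" by (rule keys_add)
  then show "lext \<phi> (f + g) = lext \<phi> f + lext \<phi> g"
    by (simp add: lext_superset[of ?A] lookup_add psc.scale_left_distrib sum.distrib)
next
  fix c and f :: "'a \<Rightarrow>\<^sub>0 complex"
  have "keys (psc c f) \<subseteq> keys f" by (auto simp: in_keys_iff)
  then show "lext \<phi> (psc c f) = psc c (lext \<phi> f)"
    by (simp add: lext_superset[of "keys f"] psc.scale_sum_right)
qed

lemmas lin_add = module_hom.add
lemmas lin_scale = module_hom.scale
lemmas lin_zero = module_hom.zero
lemmas lin_neg = module_hom.neg
lemmas lin_diff = module_hom.diff
lemmas lin_sum = module_hom.sum

lemma plin_eqI:
  assumes "plin D" "plin E" "\<And>m. D (Poly_Mapping.single m 1) = E (Poly_Mapping.single m 1)"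
  shows "D f = E f"
proof (induction f rule: pm_induct)
  case (single m c)
  have "Poly_Mapping.single m c = psc c (Poly_Mapping.single m 1)" by simp
  then show ?case using assms by (simp only: lin_scale)
qed (simp add: lin_add[OF assms(1)] lin_add[OF assms(2)])

lemma plin_mult: "plin ((*) (a :: 'a::monoid_add \<Rightarrow>\<^sub>0 complex))"
  by (rule plinI) (auto simp: algebra_simps mult_psc_right)

lemma plin_compose: "plin D \<Longrightarrow> plin E \<Longrightarrow> plin (\<lambda>f. D (E f))"
  by (rule plinI) (simp_all add: lin_add lin_scale)

lemma plin_id: "plin (\<lambda>f. f)"
  by (rule plinI) simp_all

lemma plin_add: "plin D \<Longrightarrow> plin E \<Longrightarrow> plin (\<lambda>f. D f + E f)"
  by (rule plinI) (simp_all add: lin_add lin_scale psc.scale_right_distrib)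

section \<open>Polynomials: substitutions, derivatives and divided differences\<close>

type_synonym mpoly = "(nat \<Rightarrow>\<^sub>0 nat) \<Rightarrow>\<^sub>0 complex"

definition var :: "nat \<Rightarrow> mpoly"
  where "var k = Poly_Mapping.single (Poly_Mapping.single k 1) 1"

abbreviation mon :: "(nat \<Rightarrow>\<^sub>0 nat) \<Rightarrow> mpoly"
  where "mon m \<equiv> Poly_Mapping.single m 1"

lemma var_mult_mon: "var k * mon m = mon (m + Poly_Mapping.single k 1)"
  by (simp add: var_def mult_single add.commute)

lemma exponent_pred:
  assumes "lookup (m :: nat \<Rightarrow>\<^sub>0 nat) k \<noteq> 0"
  shows "m = (m - Poly_Mapping.single k 1) + Poly_Mapping.single k 1"
  by (rule poly_mapping_eqI) (use assms in \<open>auto simp: lookup_add lookup_minus lookup_single when_def\<close>)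

text \<open>Identities between polynomials that are multiplicative in nature are proved by adjoining one
variable at a time; the set \<open>K\<close> keeps track of the variables that are allowed.\<close>

lemma exponent_induct [case_names zero step]:
  assumes "Q 0"
    and step: "\<And>m k. Q m \<Longrightarrow> keys m \<subseteq> K \<Longrightarrow> k \<in> K \<Longrightarrow> Q (m + Poly_Mapping.single k 1)"
    and "keys (m :: nat \<Rightarrow>\<^sub>0 nat) \<subseteq> K"
  shows "Q m"
  using assms(3)
proof (induction "\<Sum>k\<in>keys m. lookup m k" arbitrary: m rule: less_induct)
  case less
  show ?case
  proof (cases "m = 0")
    case True
    then show ?thesis using assms(1) by simp
  next
    case False
    then obtain k where k: "lookup m k \<noteq> 0" by (metis lookup_zero poly_mapping_eqI)
    let ?m = "m - Poly_Mapping.single k 1"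
    have kk: "keys ?m \<subseteq> keys m" by (auto simp: in_keys_iff lookup_minus)
    have "(\<Sum>j\<in>keys ?m. lookup ?m j) = (\<Sum>j\<in>keys m. lookup ?m j)"
      by (rule sum.mono_neutral_left) (use kk in \<open>auto simp: in_keys_iff\<close>)
    also have "\<dots> < (\<Sum>j\<in>keys m. lookup m j)"
    proof (rule sum_strict_mono_ex1)
      show "\<exists>a\<in>keys m. lookup ?m a < lookup m a"
        using k by (intro bexI[of _ k]) (auto simp: lookup_minus in_keys_iff)
    qed (auto simp: lookup_minus)
    finally have "Q ?m" using less kk by blast
    then have "Q (?m + Poly_Mapping.single k 1)"
      using less.prems kk k by (intro step) (auto simp: in_keys_iff)
    then show ?thesis using exponent_pred[OF k] by simp
  qed
qed

definition subst :: "(nat \<Rightarrow> mpoly) \<Rightarrow> mpoly \<Rightarrow> mpoly"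
  where "subst \<theta> = lext (\<lambda>m. \<Prod>k\<in>keys m. \<theta> k ^ lookup m k)"

lemma plin_subst: "plin (subst \<theta>)"
  unfolding subst_def by (rule plin_lext)

lemma subst_mon: "finite A \<Longrightarrow> keys m \<subseteq> A \<Longrightarrow> subst \<theta> (mon m) = (\<Prod>k\<in>A. \<theta> k ^ lookup m k)"
  unfolding subst_def lext_single
  by (simp, rule prod.mono_neutral_left) (auto simp: in_keys_iff)

lemma subst_1 [simp]: "subst \<theta> 1 = 1"
  using subst_mon[of "{}" 0 \<theta>] by simp

lemma subst_var [simp]: "subst \<theta> (var k) = \<theta> k"
  unfolding var_def by (subst subst_mon[of "{k}"]) auto

lemma subst_mult: "subst \<theta> (f * g) = subst \<theta> f * subst \<theta> g"
proof (induction f rule: pm_induct)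
  case (single m c)
  show ?case
  proof (induction g rule: pm_induct)
    case (single m' c')
    let ?A = "keys m \<union> keys m'"
    have "subst \<theta> (mon (m + m')) = subst \<theta> (mon m) * subst \<theta> (mon m')"
      using keys_add[of m m']
      by (simp add: subst_mon[of ?A] lookup_add power_add prod.distrib)
    then have "subst \<theta> (psc (c * c') (mon (m + m'))) = subst \<theta> (psc c (mon m)) * subst \<theta> (psc c' (mon m'))"
      by (simp only: lin_scale[OF plin_subst] mult_psc_left mult_psc_right psc.scale_scale mult.commute[of c' c])
    then show ?case by (simp add: mult_single mult.commute[of c' c])
  qed (simp add: distrib_left lin_add[OF plin_subst])
qed (simp add: distrib_right lin_add[OF plin_subst])

definition pdv :: "nat \<Rightarrow> mpoly \<Rightarrow> mpoly"
  where "pdv i = lext (\<lambda>m. Poly_Mapping.single (m - Poly_Mapping.single i 1) (of_nat (lookup m i)))"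

lemma plin_pdv: "plin (pdv i)"
  unfolding pdv_def by (rule plin_lext)

lemma pdv_1 [simp]: "pdv i 1 = 0"
  unfolding pdv_def single_one[symmetric] lext_single by simp

lemma pdv_var_mult: "pdv i (var k * f) = var k * pdv i f + (if i = k then f else 0)"
proof -
  have 1: "plin (\<lambda>f. pdv i (var k * f))"
    by (rule plin_compose[OF plin_pdv plin_mult])
  have 2: "plin (\<lambda>f. var k * pdv i f + (if i = k then f else 0))"
    using plin_add[OF plin_compose[OF plin_mult plin_pdv] plin_id, of "var k" i]
      plin_compose[OF plin_mult plin_pdv, of "var k" i] by (cases "i = k") simp_all
  show ?thesis
  proof (rule plin_eqI[OF 1 2])
    fix m :: "nat \<Rightarrow>\<^sub>0 nat"
    show "pdv i (var k * mon m) = var k * pdv i (mon m) + (if i = k then mon m else 0)"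
    proof (cases "i = k")
      case True
      show ?thesis
      proof (cases "lookup m k = 0")
        case True
        then show ?thesis unfolding \<open>i = k\<close> var_mult_mon
          by (simp add: pdv_def var_def lookup_add)
      next
        case False
        then have "m = Poly_Mapping.single k 1 + (m - Poly_Mapping.single k 1)"
          using exponent_pred by (metis add.commute)
        then have "var k * pdv k (mon m) = Poly_Mapping.single m (of_nat (lookup m k))"
          by (simp add: pdv_def var_def mult_single)
        then show ?thesis unfolding \<open>i = k\<close> var_mult_mon
          by (simp add: pdv_def lookup_add algebra_simps flip: single_add)
      qed
    next
      case False
      show ?thesis
      proof (cases "lookup m i = 0")
        case True
        then show ?thesis unfolding var_mult_mon using False
          by (simp add: pdv_def lookup_add lookup_single)
      next
        case F2: False
        have "m + Poly_Mapping.single k 1 - Poly_Mapping.single i 1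
            = Poly_Mapping.single k 1 + (m - Poly_Mapping.single i 1)"
          by (rule poly_mapping_eqI)
            (use False F2 in \<open>auto simp: lookup_add lookup_minus lookup_single when_def\<close>)
        then show ?thesis unfolding var_mult_mon using False
          by (simp add: pdv_def var_def mult_single lookup_add lookup_single)
      qed
    qed
  qed
qed

text \<open>The quotient exists whenever \<open>\<theta>\<close> changes each variable by a multiple of \<open>\<alpha>\<close>, because both
sides of the equation below obey a twisted Leibniz rule. Choosing it by \<open>SOME\<close> avoids a
division algorithm; uniqueness comes from the absence of zero divisors.\<close>

definition ddiv :: "(nat \<Rightarrow> mpoly) \<Rightarrow> mpoly \<Rightarrow> mpoly \<Rightarrow> mpoly"
  where "ddiv \<theta> \<alpha> f = (SOME g. \<alpha> * g = f - subst \<theta> f)"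

locale divided_difference =
  fixes \<theta> :: "nat \<Rightarrow> mpoly" and \<alpha> :: mpoly and \<beta> :: "nat \<Rightarrow> complex"
  assumes nz: "\<alpha> \<noteq> 0" and refl: "\<And>k. var k - \<theta> k = psc (\<beta> k) \<alpha>"
begin

lemma ddiv: "\<alpha> * ddiv \<theta> \<alpha> f = f - subst \<theta> f"
proof -
  have "\<exists>g. \<alpha> * g = f - subst \<theta> f" for f
  proof (induction f rule: pm_induct)
    case (single m c)
    have "\<exists>g. \<alpha> * g = mon m - subst \<theta> (mon m)"
    proof (induction m rule: exponent_induct[where K = UNIV])
      case zero
      have "\<alpha> * 0 = mon 0 - subst \<theta> (mon 0)" by simp
      then show ?case by blast
    next
      case (step m k)
      then obtain g where g: "\<alpha> * g = mon m - subst \<theta> (mon m)" by blast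
      have "\<alpha> * (var k * g + psc (\<beta> k) (subst \<theta> (mon m)))
          = var k * (mon m - subst \<theta> (mon m)) + (var k - \<theta> k) * subst \<theta> (mon m)"
        unfolding refl g[symmetric] by (simp add: algebra_simps mult_psc_left mult_psc_right)
      also have "\<dots> = var k * mon m - subst \<theta> (var k * mon m)"
        by (simp add: subst_mult algebra_simps)
      finally show ?case unfolding var_mult_mon by blast
    qed simp
    then obtain g where "\<alpha> * g = mon m - subst \<theta> (mon m)" by blast
    then have "\<alpha> * psc c g = psc c (mon m) - subst \<theta> (psc c (mon m))"
      by (simp only: mult_psc_right lin_scale[OF plin_subst] psc.scale_right_diff_distrib)
    then show ?case by (auto simp: psc_single)
  next
    case (add f g)
    then obtain f' g' where "\<alpha> * f' = f - subst \<theta> f" "\<alpha> * g' = g - subst \<theta> g" by blast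
    then have "\<alpha> * (f' + g') = (f + g) - subst \<theta> (f + g)"
      by (simp add: lin_add[OF plin_subst] algebra_simps)
    then show ?case by blast
  qed
  then show ?thesis unfolding ddiv_def by (rule someI_ex)
qed

lemma ddiv_unique: "\<alpha> * g = f - subst \<theta> f \<Longrightarrow> ddiv \<theta> \<alpha> f = g"
  using ddiv[of f] nz by (metis mult_left_cancel)

lemma plin_ddiv: "plin (ddiv \<theta> \<alpha>)"
proof (rule plinI; rule ddiv_unique)
  show "\<alpha> * (ddiv \<theta> \<alpha> f + ddiv \<theta> \<alpha> g) = f + g - subst \<theta> (f + g)" for f g
    by (simp add: distrib_left ddiv lin_add[OF plin_subst])
  show "\<alpha> * psc c (ddiv \<theta> \<alpha> f) = psc c f - subst \<theta> (psc c f)" for c f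
    by (simp add: mult_psc_right ddiv lin_scale[OF plin_subst] psc.scale_right_diff_distrib)
qed

lemma ddiv_1 [simp]: "ddiv \<theta> \<alpha> 1 = 0"
  by (rule ddiv_unique) simp

lemma ddiv_var_mult:
  "ddiv \<theta> \<alpha> (var k * f) = var k * ddiv \<theta> \<alpha> f + psc (\<beta> k) (subst \<theta> f)"
proof (rule ddiv_unique)
  have "\<alpha> * (var k * ddiv \<theta> \<alpha> f + psc (\<beta> k) (subst \<theta> f))
      = var k * (f - subst \<theta> f) + (var k - \<theta> k) * subst \<theta> f"
    unfolding refl ddiv[symmetric] by (simp add: algebra_simps mult_psc_left mult_psc_right)
  then show "\<alpha> * (var k * ddiv \<theta> \<alpha> f + psc (\<beta> k) (subst \<theta> f)) = var k * f - subst \<theta> (var k * f)"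
    by (simp add: subst_mult algebra_simps)
qed

end

section \<open>Families of polynomials\<close>

definition fsc :: "complex \<Rightarrow> ('i \<Rightarrow> 'a \<Rightarrow>\<^sub>0 complex) \<Rightarrow> 'i \<Rightarrow> 'a \<Rightarrow>\<^sub>0 complex"
  where "fsc c F = (\<lambda>T. psc c (F T))"

lemma fsc_apply: "fsc c F T = psc c (F T)"
  by (simp add: fsc_def)

declare plus_fun_apply [simp del] zero_fun_apply [simp del]

lemmas fapp = fsc_apply plus_fun_apply zero_fun_apply

lemma vector_space_fsc: "vector_space fsc"
  by unfold_locales (auto simp: fapp fun_eq_iff psc.scale_right_distrib psc.scale_left_distrib)

interpretation fsc: vector_space fsc
  by (rule vector_space_fsc)

lemma fun_sum_apply [simp]: "(\<Sum>x\<in>A. f x) T = (\<Sum>x\<in>A. f x T)"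
  by (induction A rule: infinite_finite_induct) (auto simp: fapp)

abbreviation flin :: "(('i \<Rightarrow> 'a \<Rightarrow>\<^sub>0 complex) \<Rightarrow> 'j \<Rightarrow> 'b \<Rightarrow>\<^sub>0 complex) \<Rightarrow> bool"
  where "flin \<equiv> module_hom fsc fsc"

lemma flinI:
  assumes "\<And>f g. D (f + g) = D f + D g" "\<And>c f. D (fsc c f) = fsc c (D f)"
  shows "flin D"
  using assms by (simp add: module_hom_iff fsc.module_axioms)

lemma flin_compose: "flin D \<Longrightarrow> flin E \<Longrightarrow> flin (\<lambda>f. D (E f))"
  by (rule flinI) (simp_all add: lin_add lin_scale)

lemma flin_add: "flin D \<Longrightarrow> flin E \<Longrightarrow> flin (\<lambda>f. D f + E f)"
  by (rule flinI) (simp_all add: lin_add lin_scale fsc.scale_right_distrib)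

lemma flin_diff: "flin D \<Longrightarrow> flin E \<Longrightarrow> flin (\<lambda>f. D f - E f)"
  by (rule flinI) (simp_all add: lin_add lin_scale fsc.scale_right_diff_distrib)

lemma flin_fsc: "flin D \<Longrightarrow> flin (\<lambda>f. fsc c (D f))"
  by (rule flinI) (simp_all add: lin_add lin_scale fsc.scale_right_distrib mult.commute)

lemma flin_sum:
  assumes "\<And>s. s \<in> A \<Longrightarrow> flin (D s)"
  shows "flin (\<lambda>f. \<Sum>s\<in>A. D s f)"
  by (rule flinI) (simp_all add: lin_add[OF assms] lin_scale[OF assms] sum.distrib fsc.scale_sum_right)

lemma closed_sum:
  assumes "Q 0" "\<And>x y. Q x \<Longrightarrow> Q y \<Longrightarrow> Q (x + y)" "\<And>s. s \<in> A \<Longrightarrow> Q (g s)"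
  shows "Q (sum g A)"
  using assms(3) by (induction A rule: infinite_finite_induct) (auto simp: assms(1,2))

lemma flin_pointwise: "plin D \<Longrightarrow> flin (\<lambda>F T. D (F T))"
  by (rule flinI) (simp_all add: fapp fun_eq_iff lin_add lin_scale)

text \<open>The pure tensor of a polynomial and a coordinate vector.\<close>

definition pt :: "mpoly \<Rightarrow> ('i \<Rightarrow> complex) \<Rightarrow> 'i \<Rightarrow> mpoly"
  where "pt f u = (\<lambda>T. psc (u T) f)"

lemma pt_add_left: "pt (f + g) u = pt f u + pt g u"
  by (simp add: pt_def fapp fun_eq_iff psc.scale_right_distrib)

lemma pt_add_right: "pt f (\<lambda>T. u T + v T) = pt f u + pt f v"
  by (simp add: pt_def fapp fun_eq_iff psc.scale_left_distrib)

lemma pt_psc: "pt (psc c f) u = fsc c (pt f u)"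
  by (simp add: pt_def fapp fun_eq_iff mult.commute)

lemma pt_scale: "pt f (\<lambda>T. c * u T) = fsc c (pt f u)"
  by (simp add: pt_def fapp fun_eq_iff)

section \<open>Monomial matrices\<close>

definition mono_mat :: "nat \<Rightarrow> (nat \<Rightarrow> nat) \<Rightarrow> (nat \<Rightarrow> complex) \<Rightarrow> complex mat"
  where "mono_mat n \<pi> \<omega> = mat n n (\<lambda>(i, j). if i = \<pi> j then \<omega> j else 0)"

text \<open>The permutation and the phases of a monomial matrix.\<close>

definition pm :: "nat \<Rightarrow> complex mat \<Rightarrow> nat \<Rightarrow> nat"
  where "pm n w j = (if j < n then (THE i. i < n \<and> w $$ (i, j) \<noteq> 0) else j)"

definition ph :: "nat \<Rightarrow> complex mat \<Rightarrow> nat \<Rightarrow> complex"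
  where "ph n w j = (if j < n then w $$ (pm n w j, j) else 1)"

lemma mono_mat_cong:
  "(\<And>j. j < n \<Longrightarrow> \<pi> j = \<pi>' j) \<Longrightarrow> (\<And>j. j < n \<Longrightarrow> \<omega> j = \<omega>' j) \<Longrightarrow> mono_mat n \<pi> \<omega> = mono_mat n \<pi>' \<omega>'"
  by (auto simp: mono_mat_def intro!: cong_mat)

lemma mono_mat_index [simp]:
  "i < n \<Longrightarrow> j < n \<Longrightarrow> mono_mat n \<pi> \<omega> $$ (i, j) = (if i = \<pi> j then \<omega> j else 0)"
  "mono_mat n \<pi> \<omega> \<in> carrier_mat n n"
  "dim_row (mono_mat n \<pi> \<omega>) = n" "dim_col (mono_mat n \<pi> \<omega>) = n"
  by (auto simp: mono_mat_def)

lemma permutes_lt: "\<pi> permutes {..<n} \<Longrightarrow> \<pi> j < n \<longleftrightarrow> j < (n::nat)"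
  by (metis lessThan_iff permutes_in_image)

lemma mono_mat_mult:
  assumes "\<pi>' permutes {..<n}"
  shows "mono_mat n \<pi> \<omega> * mono_mat n \<pi>' \<omega>' = mono_mat n (\<pi> \<circ> \<pi>') (\<lambda>j. \<omega> (\<pi>' j) * \<omega>' j)"
proof (rule eq_matI)
  fix i j assume "i < dim_row (mono_mat n (\<pi> \<circ> \<pi>') (\<lambda>j. \<omega> (\<pi>' j) * \<omega>' j))"
    "j < dim_col (mono_mat n (\<pi> \<circ> \<pi>') (\<lambda>j. \<omega> (\<pi>' j) * \<omega>' j))"
  then have ij: "i < n" "j < n" by auto
  have l: "\<pi>' j < n" using ij permutes_lt[OF assms] by simp
  have "(mono_mat n \<pi> \<omega> * mono_mat n \<pi>' \<omega>') $$ (i, j)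
      = (\<Sum>k\<in>{0..<n}. (if i = \<pi> k then \<omega> k else 0) * (if k = \<pi>' j then \<omega>' j else 0))"
    using ij by (simp add: scalar_prod_def)
  also have "\<dots> = (\<Sum>k\<in>{0..<n}. if k = \<pi>' j then (if i = \<pi> k then \<omega> k else 0) * \<omega>' j else 0)"
    by (intro sum.cong) auto
  also have "\<dots> = (if i = \<pi> (\<pi>' j) then \<omega> (\<pi>' j) else 0) * \<omega>' j"
    using l by (simp add: sum.delta)
  finally show "(mono_mat n \<pi> \<omega> * mono_mat n \<pi>' \<omega>') $$ (i, j)
      = mono_mat n (\<pi> \<circ> \<pi>') (\<lambda>j. \<omega> (\<pi>' j) * \<omega>' j) $$ (i, j)"
    using ij by simp
qed auto

lemma mono_mat_one: "1\<^sub>m n = mono_mat n id (\<lambda>_. 1)"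
  by (rule eq_matI) auto

lemma pm_mono_mat:
  assumes "\<pi> permutes {..<n}" "\<And>j. j < n \<Longrightarrow> \<omega> j \<noteq> 0"
  shows "pm n (mono_mat n \<pi> \<omega>) j = \<pi> j"
proof (cases "j < n")
  case True
  then have "\<pi> j < n" using permutes_lt[OF assms(1)] by simp
  then have "(THE i. i < n \<and> mono_mat n \<pi> \<omega> $$ (i, j) \<noteq> 0) = \<pi> j"
    using True assms(2)[OF True] by (intro the_equality) (auto split: if_splits)
  then show ?thesis using True by (simp add: pm_def)
next
  case False
  then show ?thesis using assms(1) by (simp add: pm_def permutes_def)
qed

lemma ph_mono_mat:
  assumes "\<pi> permutes {..<n}" "\<And>j. j < n \<Longrightarrow> \<omega> j \<noteq> 0"
  shows "ph n (mono_mat n \<pi> \<omega>) j = (if j < n then \<omega> j else 1)"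
  using permutes_lt[OF assms(1), of j] by (simp add: ph_def pm_mono_mat[OF assms])

lemma root_nonzero: "r \<ge> 1 \<Longrightarrow> z ^ r = 1 \<Longrightarrow> (z::complex) \<noteq> 0"
  by (auto simp: power_0_left split: if_splits)

lemma GrpI:
  assumes "r \<ge> 1" "\<pi> permutes {..<n}" "\<And>j. j < n \<Longrightarrow> \<omega> j ^ r = 1"
  shows "mono_mat n \<pi> \<omega> \<in> Grp r n"
proof -
  have nz: "\<omega> j \<noteq> 0" if "j < n" for j using assms root_nonzero that by blast
  have lt: "\<pi> j < n" if "j < n" for j using permutes_lt[OF assms(2)] that by simp
  have inj: "\<pi> i = \<pi> j \<longleftrightarrow> i = j" for i j using permutes_inj[OF assms(2)] by (auto dest: injD)
  have 1: "\<exists>!j. j < n \<and> mono_mat n \<pi> \<omega> $$ (i, j) \<noteq> 0" if "i < n" for i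
  proof -
    obtain j where j: "\<pi> j = i" using permutes_surj[OF assms(2)] by (metis surjD)
    then have "j < n" using permutes_lt[OF assms(2)] that by blast
    then show ?thesis using j nz that by (intro ex1I[of _ j]) (auto simp: inj split: if_splits)
  qed
  have 2: "\<exists>!i. i < n \<and> mono_mat n \<pi> \<omega> $$ (i, j) \<noteq> 0" if "j < n" for j
    using lt nz that by (intro ex1I[of _ "\<pi> j"]) (auto split: if_splits)
  have 3: "mono_mat n \<pi> \<omega> $$ (i, j) ^ r = 1" if "i < n" "j < n" "mono_mat n \<pi> \<omega> $$ (i, j) \<noteq> 0" for i j
    using that assms(3) by (auto split: if_splits)
  show ?thesis unfolding Grp_def using 1 2 3 by simp
qed

text \<open>The uniqueness of the nonzero entry in each row makes \<open>pm\<close> injective; on a finite set it is then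
a permutation.\<close>

lemma GrpD:
  assumes "r \<ge> 1" "w \<in> Grp r n"
  shows "pm n w permutes {..<n}" and "ph n w j ^ r = 1" and "w = mono_mat n (pm n w) (ph n w)"
proof -
  have w: "w \<in> carrier_mat n n"
    and row: "\<And>i. i < n \<Longrightarrow> \<exists>!j. j < n \<and> w $$ (i, j) \<noteq> 0"
    and col: "\<And>j. j < n \<Longrightarrow> \<exists>!i. i < n \<and> w $$ (i, j) \<noteq> 0"
    and pow: "\<And>i j. i < n \<Longrightarrow> j < n \<Longrightarrow> w $$ (i, j) \<noteq> 0 \<Longrightarrow> w $$ (i, j) ^ r = 1"
    using assms(2) unfolding Grp_def by auto
  have pm: "pm n w j < n \<and> w $$ (pm n w j, j) \<noteq> 0" if "j < n" for j
    using theI'[OF col[OF that]] that by (simp add: pm_def)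
  have pm_eq: "i = pm n w j" if "i < n" "j < n" "w $$ (i, j) \<noteq> 0" for i j
    using col[OF \<open>j < n\<close>] pm[OF \<open>j < n\<close>] that by blast
  have "inj_on (pm n w) {..<n}"
    by (rule inj_onI) (use row pm in \<open>metis lessThan_iff\<close>)
  moreover have sub: "pm n w ` {..<n} \<subseteq> {..<n}" using pm by auto
  ultimately have "bij_betw (pm n w) {..<n} {..<n}"
    by (simp add: bij_betw_def endo_inj_surj)
  then show "pm n w permutes {..<n}"
    by (rule bij_imp_permutes) (simp add: pm_def)
  show "ph n w j ^ r = 1"
    using pm[of j] pow by (auto simp: ph_def)
  show "w = mono_mat n (pm n w) (ph n w)"
  proof (rule eq_matI)
    fix i j assume "i < dim_row (mono_mat n (pm n w) (ph n w))" "j < dim_col (mono_mat n (pm n w) (ph n w))"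
    then have "i < n" "j < n" by auto
    then show "w $$ (i, j) = mono_mat n (pm n w) (ph n w) $$ (i, j)"
      using pm_eq[of i j] by (auto simp: ph_def)
  qed (use w in auto)
qed

lemma Grp_mult:
  assumes "r \<ge> 1" "w \<in> Grp r n" "w' \<in> Grp r n"
  shows "w * w' \<in> Grp r n" and "pm n (w * w') j = pm n w (pm n w' j)"
    and "ph n (w * w') j = ph n w (pm n w' j) * ph n w' j"
proof -
  note w = GrpD[OF assms(1,2)] and w' = GrpD[OF assms(1,3)]
  let ?\<omega> = "\<lambda>j. ph n w (pm n w' j) * ph n w' j"
  have e: "w * w' = mono_mat n (pm n w \<circ> pm n w') ?\<omega>"
    by (subst w(3), subst w'(3)) (rule mono_mat_mult[OF w'(1)])
  have perm: "pm n w \<circ> pm n w' permutes {..<n}" by (rule permutes_compose[OF w'(1) w(1)])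
  have pow: "?\<omega> j ^ r = 1" for j by (simp add: power_mult_distrib w(2) w'(2))
  then have nz: "?\<omega> j \<noteq> 0" for j using root_nonzero assms(1) by blast
  show "w * w' \<in> Grp r n" unfolding e by (rule GrpI[OF assms(1) perm pow])
  show "pm n (w * w') j = pm n w (pm n w' j)" unfolding e by (simp add: pm_mono_mat[OF perm nz])
  have "\<not> j < n \<Longrightarrow> pm n w' j = j" by (simp add: pm_def)
  then show "ph n (w * w') j = ph n w (pm n w' j) * ph n w' j" unfolding e ph_mono_mat[OF perm nz]
    by (auto simp: ph_def)
qed

lemma Grp_one: "r \<ge> 1 \<Longrightarrow> 1\<^sub>m n \<in> Grp r n"
  unfolding mono_mat_one by (rule GrpI) (auto simp: permutes_id)

lemma zeta_mat_mono: "zeta_mat r n i k = mono_mat n id (\<lambda>j. if j = i then zeta r powi k else 1)"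
  by (rule eq_matI) (auto simp: zeta_mat_def)

lemma perm_mat_mono: "perm_mat n w = mono_mat n w (\<lambda>_. 1)"
  by (rule eq_matI) (auto simp: perm_mat_def)

lemma transpose_permutes: "i < n \<Longrightarrow> j < n \<Longrightarrow> Transposition.transpose i j permutes {..<n::nat}"
  by (rule permutes_swap_id) auto

text \<open>The reflection sending \<open>y\<^sub>a\<close> to \<open>z\<^sup>-\<^sup>1 y\<^sub>b\<close> and \<open>y\<^sub>b\<close> to \<open>z y\<^sub>a\<close>; for \<open>a = b\<close>, the diagonal
  matrix multiplying \<open>y\<^sub>a\<close> by \<open>z\<close>.\<close>

definition rmat :: "nat \<Rightarrow> nat \<Rightarrow> nat \<Rightarrow> complex \<Rightarrow> complex mat"
  where "rmat n a b z = mono_mat n (Transposition.transpose a b)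
    (\<lambda>j. if a = b then (if j = a then z else 1)
      else if j = a then inverse z else if j = b then z else 1)"

lemma
  assumes "r \<ge> 1" "a < n" "b < n" "z ^ r = 1"
  shows rmat_Grp: "rmat n a b z \<in> Grp r n"
    and pm_rmat: "pm n (rmat n a b z) j = Transposition.transpose a b j"
    and ph_rmat: "ph n (rmat n a b z) j = (if a = b then (if j = a then z else 1)
      else if j = a then inverse z else if j = b then z else 1)"
proof -
  have z: "z \<noteq> 0" using root_nonzero assms by blast
  note t = transpose_permutes[OF assms(2,3)]
  show "rmat n a b z \<in> Grp r n" unfolding rmat_def
    by (rule GrpI[OF assms(1) t]) (use assms in \<open>auto simp: power_inverse\<close>)
  show "pm n (rmat n a b z) j = Transposition.transpose a b j" unfolding rmat_def
    by (rule pm_mono_mat[OF t]) (use z in auto)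
  show "ph n (rmat n a b z) j = (if a = b then (if j = a then z else 1)
      else if j = a then inverse z else if j = b then z else 1)" unfolding rmat_def
    by (subst ph_mono_mat[OF t]) (use z assms in auto)
qed

lemma rmat_swap: "a \<noteq> b \<Longrightarrow> rmat n b a z = rmat n a b (inverse z)"
  unfolding rmat_def by (rule mono_mat_cong) (auto simp: transpose_commute)

lemma zeta_nonzero [simp]: "zeta r \<noteq> 0"
  by (simp add: zeta_def)

lemma zeta_pow: "r \<ge> 1 \<Longrightarrow> zeta r ^ r = 1"
  by (simp add: zeta_def DeMoivre)

lemma zeta_mat_rmat: "zeta_mat r n i (int l) = rmat n i i (zeta r ^ l)"
  unfolding zeta_mat_mono rmat_def by (rule mono_mat_cong) auto

lemma refl_mat_rmat:
  assumes "i < n" "j < n" "i \<noteq> j"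
  shows "refl_mat r n i j l = rmat n i j (zeta r ^ l)"
proof -
  note t = transpose_permutes[OF assms(1,2)]
  show ?thesis
    unfolding refl_mat_def swap_mat_def perm_mat_mono zeta_mat_mono rmat_def
      mono_mat_mult[OF t] mono_mat_mult[OF permutes_id]
    by (rule mono_mat_cong) (use assms in \<open>auto simp: power_int_minus transpose_eq_iff\<close>)
qed

definition roots :: "nat \<Rightarrow> complex set"
  where "roots r = {z. z ^ r = 1}"

lemma finite_roots: "r \<ge> 1 \<Longrightarrow> finite (roots r)"
  unfolding roots_def by (rule finite_roots_unity)

lemma bij_zeta_roots: "r \<ge> 1 \<Longrightarrow> bij_betw (\<lambda>l. zeta r ^ l) {..<r} (roots r)"
  using bij_betw_roots_unity[of r] by (simp add: zeta_def DeMoivre roots_def mult.commute)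

lemma sum_zeta_roots: "r \<ge> 1 \<Longrightarrow> (\<Sum>l<r. f (zeta r ^ l)) = (\<Sum>z\<in>roots r. f z)"
  by (rule sum.reindex_bij_betw[OF bij_zeta_roots])

lemma sum_roots_mult:
  assumes "r \<ge> 1" "u \<in> roots r"
  shows "(\<Sum>z\<in>roots r. f (z * u)) = (\<Sum>z\<in>roots r. f z)"
proof (rule sum.reindex_bij_witness[where j = "\<lambda>z. z * u" and i = "\<lambda>z. z / u"])
  show "z / u \<in> roots r" "z * u \<in> roots r" if "z \<in> roots r" for z
    using assms that by (auto simp: roots_def power_divide power_mult_distrib)
qed (use assms root_nonzero in \<open>auto simp: roots_def\<close>)

lemma sum_roots_inverse: "(\<Sum>z\<in>roots r. f (inverse z)) = (\<Sum>z\<in>roots r. f z)"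
  by (rule sum.reindex_bij_witness[where j = inverse and i = inverse])
    (auto simp: roots_def power_inverse)

text \<open>Conjugation permutes the reflections and changes the parameter by a ratio of phases; this is
what makes sums over classes of reflections equivariant.\<close>

lemma rmat_conj:
  assumes "r \<ge> 1" "w \<in> Grp r n" "a < n" "b < n" "z ^ r = 1"
  shows "w * rmat n a b z = rmat n (pm n w a) (pm n w b) (z * (ph n w a / ph n w b)) * w"
proof -
  note w = GrpD[OF assms(1,2)]
  have lt: "pm n w a < n" "pm n w b < n" using permutes_lt[OF w(1)] assms by auto
  have z: "z \<noteq> 0" and nz: "ph n w j \<noteq> 0" for j using root_nonzero assms w(2) by blast+
  have inj: "pm n w i = pm n w j \<longleftrightarrow> i = j" for i j using permutes_inj[OF w(1)] by (auto dest: injD)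
  have "mono_mat n (pm n w) (ph n w) * rmat n a b z
      = rmat n (pm n w a) (pm n w b) (z * (ph n w a / ph n w b)) * mono_mat n (pm n w) (ph n w)"
    unfolding rmat_def mono_mat_mult[OF transpose_permutes[OF assms(3,4)]] mono_mat_mult[OF w(1)]
    by (rule mono_mat_cong) (use z nz in \<open>auto simp: Transposition.transpose_def inj field_simps\<close>)
  then show ?thesis using w(3) by simp
qed

section \<open>Left modules and their quotients\<close>

text \<open>A module over a possibly noncommutative ring: the locale for modules over commutative rings,
without commutativity.\<close>

locale lmodule = R?: ring R + M?: abelian_group M
  for R :: "('a, 'c) ring_scheme" (structure) and M :: "('a, 'b) module" (structure) +
  assumes smult_closed [simp, intro]: "a \<in> carrier R \<Longrightarrow> x \<in> carrier M \<Longrightarrow> a \<odot>\<^bsub>M\<^esub> x \<in> carrier M"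
    and smult_l_distr: "a \<in> carrier R \<Longrightarrow> b \<in> carrier R \<Longrightarrow> x \<in> carrier M \<Longrightarrow>
      (a \<oplus>\<^bsub>R\<^esub> b) \<odot>\<^bsub>M\<^esub> x = a \<odot>\<^bsub>M\<^esub> x \<oplus>\<^bsub>M\<^esub> b \<odot>\<^bsub>M\<^esub> x"
    and smult_r_distr: "a \<in> carrier R \<Longrightarrow> x \<in> carrier M \<Longrightarrow> y \<in> carrier M \<Longrightarrow>
      a \<odot>\<^bsub>M\<^esub> (x \<oplus>\<^bsub>M\<^esub> y) = a \<odot>\<^bsub>M\<^esub> x \<oplus>\<^bsub>M\<^esub> a \<odot>\<^bsub>M\<^esub> y"
    and smult_assoc1: "a \<in> carrier R \<Longrightarrow> b \<in> carrier R \<Longrightarrow> x \<in> carrier M \<Longrightarrow>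
      (a \<otimes>\<^bsub>R\<^esub> b) \<odot>\<^bsub>M\<^esub> x = a \<odot>\<^bsub>M\<^esub> (b \<odot>\<^bsub>M\<^esub> x)"
    and smult_one [simp]: "x \<in> carrier M \<Longrightarrow> \<one>\<^bsub>R\<^esub> \<odot>\<^bsub>M\<^esub> x = x"
begin

lemma smult_zero_left [simp]: "x \<in> carrier M \<Longrightarrow> \<zero>\<^bsub>R\<^esub> \<odot>\<^bsub>M\<^esub> x = \<zero>\<^bsub>M\<^esub>"
  using smult_l_distr[of "\<zero>\<^bsub>R\<^esub>" "\<zero>\<^bsub>R\<^esub>" x] M.add.r_cancel_one'[of "\<zero>\<^bsub>R\<^esub> \<odot>\<^bsub>M\<^esub> x" "\<zero>\<^bsub>R\<^esub> \<odot>\<^bsub>M\<^esub> x"]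
  by simp

lemma smult_zero_right [simp]: "a \<in> carrier R \<Longrightarrow> a \<odot>\<^bsub>M\<^esub> \<zero>\<^bsub>M\<^esub> = \<zero>\<^bsub>M\<^esub>"
  using smult_r_distr[of a "\<zero>\<^bsub>M\<^esub>" "\<zero>\<^bsub>M\<^esub>"] M.add.r_cancel_one'[of "a \<odot>\<^bsub>M\<^esub> \<zero>\<^bsub>M\<^esub>" "a \<odot>\<^bsub>M\<^esub> \<zero>\<^bsub>M\<^esub>"]
  by simp

lemma minus_smult:
  assumes "x \<in> carrier M"
  shows "(\<ominus>\<^bsub>R\<^esub> \<one>\<^bsub>R\<^esub>) \<odot>\<^bsub>M\<^esub> x = \<ominus>\<^bsub>M\<^esub> x"
proof -
  have "(\<ominus>\<^bsub>R\<^esub> \<one>\<^bsub>R\<^esub>) \<odot>\<^bsub>M\<^esub> x \<oplus>\<^bsub>M\<^esub> x = (\<ominus>\<^bsub>R\<^esub> \<one>\<^bsub>R\<^esub> \<oplus>\<^bsub>R\<^esub> \<one>\<^bsub>R\<^esub>) \<odot>\<^bsub>M\<^esub> x"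
    using assms by (subst smult_l_distr) auto
  also have "\<dots> = \<zero>\<^bsub>M\<^esub>" using assms by (simp add: R.l_neg)
  finally show ?thesis using assms by (simp add: M.minus_equality)
qed

lemma smult_r_minus:
  assumes "a \<in> carrier R" "x \<in> carrier M"
  shows "a \<odot>\<^bsub>M\<^esub> (\<ominus>\<^bsub>M\<^esub> x) = \<ominus>\<^bsub>M\<^esub> (a \<odot>\<^bsub>M\<^esub> x)"
proof -
  have "a \<odot>\<^bsub>M\<^esub> (\<ominus>\<^bsub>M\<^esub> x) \<oplus>\<^bsub>M\<^esub> a \<odot>\<^bsub>M\<^esub> x = \<zero>\<^bsub>M\<^esub>"
    using assms by (simp add: M.l_neg flip: smult_r_distr)
  then show ?thesis using assms by (simp add: M.minus_equality)
qed

lemma smult_diff_right: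
  "a \<in> carrier R \<Longrightarrow> x \<in> carrier M \<Longrightarrow> y \<in> carrier M \<Longrightarrow>
    a \<odot>\<^bsub>M\<^esub> (x \<ominus>\<^bsub>M\<^esub> y) = a \<odot>\<^bsub>M\<^esub> x \<ominus>\<^bsub>M\<^esub> a \<odot>\<^bsub>M\<^esub> y"
  by (simp add: a_minus_def smult_r_distr smult_r_minus)

text \<open>Closure under negatives is automatic, as it is multiplication by \<open>-1\<close>.\<close>

lemma submodule_iff:
  "submodule H R M \<longleftrightarrow> H \<subseteq> carrier M \<and> \<zero>\<^bsub>M\<^esub> \<in> H \<and>
    (\<forall>x\<in>H. \<forall>y\<in>H. x \<oplus>\<^bsub>M\<^esub> y \<in> H) \<and> (\<forall>a\<in>carrier R. \<forall>x\<in>H. a \<odot>\<^bsub>M\<^esub> x \<in> H)"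
  (is "_ \<longleftrightarrow> ?r")
proof
  assume "submodule H R M"
  then interpret s: submodule H R M .
  show ?r using s.subset s.m_closed s.one_closed s.smult_closed by auto
next
  assume h: ?r
  have "\<ominus>\<^bsub>M\<^esub> x \<in> H" if "x \<in> H" for x
  proof -
    have x: "x \<in> carrier M" using h that by blast
    have "(\<ominus>\<^bsub>R\<^esub> \<one>\<^bsub>R\<^esub>) \<odot>\<^bsub>M\<^esub> x \<in> H" using h that by simp
    then show ?thesis unfolding minus_smult[OF x] .
  qed
  then show "submodule H R M"
    using h by (intro submodule.intro subgroup.intro) (auto simp: submodule_axioms_def a_inv_def)
qed

lemma submoduleD:
  assumes "submodule H R M"
  shows "H \<subseteq> carrier M" "\<zero>\<^bsub>M\<^esub> \<in> H" "x \<in> H \<Longrightarrow> y \<in> H \<Longrightarrow> x \<oplus>\<^bsub>M\<^esub> y \<in> H"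
    "a \<in> carrier R \<Longrightarrow> x \<in> H \<Longrightarrow> a \<odot>\<^bsub>M\<^esub> x \<in> H"
  using assms by (simp_all add: submodule_iff)

lemma submodule_carrier: "submodule (carrier M) R M"
  unfolding submodule_iff by auto

lemma gen_submodule_submodule:
  assumes "A \<subseteq> carrier M"
  shows "submodule (gen_submodule R M A) R M"
  unfolding submodule_iff
proof (intro conjI ballI)
  show "gen_submodule R M A \<subseteq> carrier M"
    unfolding gen_submodule_def using assms submodule_carrier by (intro Inter_lower) simp
qed (auto simp: gen_submodule_def submoduleD)

lemma gen_submodule_superset: "A \<subseteq> gen_submodule R M A"
  unfolding gen_submodule_def by blast

lemma gen_submodule_minimal: "submodule N R M \<Longrightarrow> A \<subseteq> N \<Longrightarrow> gen_submodule R M A \<subseteq> N"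
  unfolding gen_submodule_def by blast

lemma abelian_subgroup_submodule:
  assumes "submodule N R M"
  shows "abelian_subgroup N M"
  by (rule abelian_subgroupI3) (auto intro!: additive_subgroup.intro
    submodule.axioms(1)[OF assms] M.abelian_group_axioms)

end

locale lmodule_quotient = lmodule + fixes N assumes N: "submodule N R M"
begin

interpretation N: abelian_subgroup N M
  by (rule abelian_subgroup_submodule[OF N])

abbreviation "Q \<equiv> quot_module M N"
abbreviation "cl x \<equiv> N +>\<^bsub>M\<^esub> x"

lemma carrier_quot: "carrier Q = cl ` carrier M"
  by (auto simp: quot_module_def A_RCOSETS_def')

lemma cl_closed: "x \<in> carrier M \<Longrightarrow> cl x \<in> carrier Q"
  by (simp add: carrier_quot)

lemma cl_eq:
  assumes "x \<in> carrier M" "y \<in> carrier M"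
  shows "cl x = cl y \<longleftrightarrow> x \<ominus>\<^bsub>M\<^esub> y \<in> N"
proof -
  have "cl x = cl y \<longleftrightarrow> x \<in> cl y"
    using N.a_repr_independenceD[OF assms(1), of y] N.a_repr_independence'[OF _ assms(2), of x]
    by metis
  then show ?thesis using N.a_rcos_module[of y x] assms by (simp add: a_minus_def)
qed

lemma add_quot: "x \<in> carrier M \<Longrightarrow> y \<in> carrier M \<Longrightarrow> cl x \<oplus>\<^bsub>Q\<^esub> cl y = cl (x \<oplus>\<^bsub>M\<^esub> y)"
  by (simp add: quot_module_def N.a_rcos_sum)

lemma zero_quot: "\<zero>\<^bsub>Q\<^esub> = cl \<zero>\<^bsub>M\<^esub>"
  by (simp add: quot_module_def N.a_rcos_const)

lemma smult_quot:
  assumes a: "a \<in> carrier R" and x: "x \<in> carrier M"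
  shows "a \<odot>\<^bsub>Q\<^esub> cl x = cl (a \<odot>\<^bsub>M\<^esub> x)"
proof -
  have "cl (a \<odot>\<^bsub>M\<^esub> m) = cl (a \<odot>\<^bsub>M\<^esub> x)" if "m \<in> cl x" for m
  proof -
    have m: "m \<in> carrier M" using that x N.a_elemrcos_carrier by blast
    then have "m \<ominus>\<^bsub>M\<^esub> x \<in> N" using that x N.a_rcos_module[of x m] by (simp add: a_minus_def)
    then have "a \<odot>\<^bsub>M\<^esub> (m \<ominus>\<^bsub>M\<^esub> x) \<in> N" using N a unfolding submodule_iff by blast
    then show ?thesis using a m x by (simp add: cl_eq smult_diff_right)
  qed
  moreover have "x \<in> cl x" using x by (simp add: N.a_rcos_self)
  ultimately have "(\<Union>m\<in>cl x. cl (a \<odot>\<^bsub>M\<^esub> m)) = cl (a \<odot>\<^bsub>M\<^esub> x)" by blast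
  then show ?thesis by (simp add: quot_module_def)
qed

lemma quotient_lmodule: "lmodule R Q"
proof (intro lmodule.intro lmodule_axioms.intro)
  show "ring R" by (rule R.ring_axioms)
  have neg: "\<exists>y\<in>carrier Q. y \<oplus>\<^bsub>Q\<^esub> x = \<zero>\<^bsub>Q\<^esub>" if x: "x \<in> carrier Q" for x
  proof -
    obtain u where u: "x = cl u" "u \<in> carrier M" using x by (auto simp: carrier_quot)
    then have "cl (\<ominus>\<^bsub>M\<^esub> u) \<oplus>\<^bsub>Q\<^esub> x = \<zero>\<^bsub>Q\<^esub>" by (simp add: add_quot zero_quot M.l_neg)
    then show ?thesis using u by (intro bexI[of _ "cl (\<ominus>\<^bsub>M\<^esub> u)"]) (auto simp: cl_closed)
  qed
  show "abelian_group Q"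
    by (rule abelian_groupI)
      (use neg in \<open>auto simp: carrier_quot add_quot zero_quot M.a_ac\<close>)
qed (auto simp: carrier_quot smult_quot add_quot smult_l_distr smult_r_distr smult_assoc1)

end

section \<open>Dunkl operators on polynomials with values in \<open>S\<^sup>\<lambda>\<close>\<close>

locale cherednik_rep = cherednik r n c0 d lam rho
  for r n c0 d lam rho +
  assumes r_pos: "r \<ge> 1" and n_pos: "n \<ge> 1"
    and mp: "is_multipartition r n lam"
    and sp: "specht_module"
begin

abbreviation "ST \<equiv> SYT n lam"

definition Ssp :: "(tableau \<Rightarrow> complex) set"
  where "Ssp = {f. \<forall>T. T \<notin> ST \<longrightarrow> f T = 0}"

lemma carrier_SS: "carrier SS = Ssp"
  by (simp add: SS_def Ssp_def)

lemma SS_simps: "ring.add SS f g = (\<lambda>T. f T + g T)" "module.smult SS c f = (\<lambda>T. c * f T)" "ring.zero SS = (\<lambda>T. 0)"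
  by (simp_all add: SS_def)

lemma rho_closed: "w \<in> Grp r n \<Longrightarrow> f \<in> Ssp \<Longrightarrow> rho w f \<in> Ssp"
  and rho_add: "w \<in> Grp r n \<Longrightarrow> f \<in> Ssp \<Longrightarrow> g \<in> Ssp \<Longrightarrow> rho w (\<lambda>T. f T + g T) = (\<lambda>T. rho w f T + rho w g T)"
  and rho_scale: "w \<in> Grp r n \<Longrightarrow> f \<in> Ssp \<Longrightarrow> rho w (\<lambda>T. c * f T) = (\<lambda>T. c * rho w f T)"
  and rho_one: "f \<in> Ssp \<Longrightarrow> rho (1\<^sub>m n) f = f"
  and rho_mult: "w \<in> Grp r n \<Longrightarrow> w' \<in> Grp r n \<Longrightarrow> f \<in> Ssp \<Longrightarrow> rho (w * w') f = rho w (rho w' f)"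
  and rho_zeta: "i < n \<Longrightarrow> T \<in> ST \<Longrightarrow> rho (zeta_mat r n i 1) (vv T) = (\<lambda>U. zeta r ^ beta (T i) * vv T U)"
  and Ssp_nontrivial: "Ssp \<noteq> {\<lambda>T. 0}"
  and rho_irreducible: "submodule U complex_ring SS \<Longrightarrow> \<forall>w\<in>Grp r n. rho w ` U \<subseteq> U \<Longrightarrow>
      U = {\<lambda>T. 0} \<or> U = Ssp"
  and rho_swap: "Suc i < n \<Longrightarrow> T \<in> ST \<Longrightarrow>
      rho (swap_mat n i (Suc i)) (vv T) =
      (if beta (T i) \<noteq> beta (T (Suc i)) then vv (swap_tab i T)
       else let a = real_of_int (ct (T (Suc i)) - ct (T i)) in
         (\<lambda>U. complex_of_real (1 / a) * vv T U +
         (if swap_tab i T \<in> ST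
          then \<lambda>U. complex_of_real (sqrt (1 - 1 / a\<^sup>2)) * vv (swap_tab i T) U
          else (\<lambda>U. 0)) U))"
  using sp unfolding specht_module_def carrier_SS SS_simps by auto

lemma Ssp_zero [simp]: "(\<lambda>T. 0) \<in> Ssp"
  and Ssp_add [intro]: "f \<in> Ssp \<Longrightarrow> g \<in> Ssp \<Longrightarrow> (\<lambda>T. f T + g T) \<in> Ssp"
  and Ssp_scale [intro]: "f \<in> Ssp \<Longrightarrow> (\<lambda>T. c * f T) \<in> Ssp"
  and Ssp_vv [intro]: "T \<in> ST \<Longrightarrow> vv T \<in> Ssp"
  by (auto simp: Ssp_def vv_def)

lemma Ssp_sum: "(\<And>s. s \<in> A \<Longrightarrow> g s \<in> Ssp) \<Longrightarrow> (\<lambda>U. \<Sum>s\<in>A. g s U) \<in> Ssp"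
  by (auto simp: Ssp_def)

lemma finite_boxes: "finite (boxes lam)"
proof -
  have "boxes lam \<subseteq> (\<Union>l<length lam. \<Union>p<length (lam ! l). {l} \<times> {p} \<times> {..<lam ! l ! p})"
    by (auto simp: boxes_def)
  then show ?thesis by (rule finite_subset) auto
qed

lemma finite_ST: "finite ST"
proof -
  have "ST \<subseteq> ({..<n} \<rightarrow>\<^sub>E boxes lam)"
    by (auto simp: SYT_def bij_betw_def PiE_def)
  then show ?thesis by (rule finite_subset) (auto intro: finite_PiE finite_boxes)
qed

lemma rho_sum:
  assumes "w \<in> Grp r n" "\<And>s. s \<in> A \<Longrightarrow> g s \<in> Ssp"
  shows "rho w (\<lambda>U. \<Sum>s\<in>A. g s U) = (\<lambda>U. \<Sum>s\<in>A. rho w (g s) U)"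
  using assms(2)
proof (induction A rule: infinite_finite_induct)
  case (insert s A)
  then have "rho w (\<lambda>U. g s U + (\<Sum>s\<in>A. g s U)) = (\<lambda>U. rho w (g s) U + rho w (\<lambda>U. \<Sum>s\<in>A. g s U) U)"
    by (intro rho_add[OF assms(1)] Ssp_sum) auto
  then show ?case using insert by simp
qed (use rho_scale[OF assms(1) Ssp_zero, of 0] in simp_all)

lemma Ssp_expand: "u \<in> Ssp \<Longrightarrow> u = (\<lambda>U. \<Sum>T\<in>ST. u T * vv T U)"
  by (rule ext) (auto simp: vv_def Ssp_def finite_ST if_distrib sum.delta cong: if_cong)

definition R :: "complex mat \<Rightarrow> tableau \<Rightarrow> tableau \<Rightarrow> complex"
  where "R w U T = rho w (vv T) U"

lemma rho_expand:
  assumes "w \<in> Grp r n" "u \<in> Ssp"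
  shows "rho w u U = (\<Sum>T\<in>ST. R w U T * u T)"
proof -
  have "rho w (\<lambda>U. \<Sum>T\<in>ST. u T * vv T U) = (\<lambda>U. \<Sum>T\<in>ST. rho w (\<lambda>U. u T * vv T U) U)"
    by (rule rho_sum[OF assms(1)]) auto
  also have "\<dots> = (\<lambda>U. \<Sum>T\<in>ST. R w U T * u T)"
    by (rule ext, rule sum.cong) (auto simp: R_def rho_scale[OF assms(1)] Ssp_vv mult.commute)
  finally show ?thesis using Ssp_expand[OF assms(2)] by metis
qed

subsection \<open>Tensor products of operators\<close>

text \<open>\<open>D \<otimes> M\<close> for an operator \<open>D\<close> on polynomials and a matrix \<open>M\<close> acting on coordinate vectors.\<close>

definition tens :: "(mpoly \<Rightarrow> mpoly) \<Rightarrow> (tableau \<Rightarrow> tableau \<Rightarrow> complex) \<Rightarrow>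
    (tableau \<Rightarrow> mpoly) \<Rightarrow> tableau \<Rightarrow> mpoly"
  where "tens D M F = (\<lambda>U. if U \<in> ST then \<Sum>T\<in>ST. psc (M U T) (D (F T)) else 0)"

lemma flin_tens: "plin D \<Longrightarrow> flin (tens D M)"
  by (rule flinI) (auto simp: tens_def fapp fun_eq_iff lin_add lin_scale psc.scale_right_distrib
    sum.distrib psc.scale_sum_right mult.commute)

lemma tens_pt:
  assumes "plin D" "w \<in> Grp r n" "u \<in> Ssp"
  shows "tens D (R w) (pt f u) = pt (D f) (rho w u)"
proof
  fix U
  have "rho w u U = 0" if "U \<notin> ST" using rho_closed[OF assms(2,3)] that by (simp add: Ssp_def)
  then show "tens D (R w) (pt f u) U = pt (D f) (rho w u) U"
    by (cases "U \<in> ST")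
      (simp_all add: tens_def pt_def lin_scale[OF assms(1)] rho_expand[OF assms(2,3)]
        flip: psc.scale_sum_left)
qed

definition xo :: "nat \<Rightarrow> (tableau \<Rightarrow> mpoly) \<Rightarrow> tableau \<Rightarrow> mpoly"
  where "xo k F = (\<lambda>T. var k * F T)"

lemma flin_xo: "flin (xo k)"
  unfolding xo_def by (rule flin_pointwise[OF plin_mult])

lemma xo_pt: "xo k (pt f u) = pt (var k * f) u"
  by (simp add: xo_def pt_def mult_psc_right)

lemma xo_commute: "xo k (xo j F) = xo j (xo k F)"
  by (simp add: xo_def mult.left_commute)

text \<open>Contragredient action of \<open>w\<close> on the coordinate functions.\<close>

definition theta :: "complex mat \<Rightarrow> nat \<Rightarrow> mpoly"
  where "theta w k = psc (inverse (ph n w k)) (var (pm n w k))"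

text \<open>The diagonal action of \<open>w\<close> on polynomials tensored with \<open>S\<^sup>\<lambda>\<close>.\<close>

definition tw :: "complex mat \<Rightarrow> (tableau \<Rightarrow> mpoly) \<Rightarrow> tableau \<Rightarrow> mpoly"
  where "tw w = tens (subst (theta w)) (R w)"

lemma flin_tw: "flin (tw w)"
  unfolding tw_def by (rule flin_tens[OF plin_subst])

lemma tw_pt: "w \<in> Grp r n \<Longrightarrow> u \<in> Ssp \<Longrightarrow> tw w (pt f u) = pt (subst (theta w) f) (rho w u)"
  unfolding tw_def by (rule tens_pt[OF plin_subst])

lemma tw_xo: "tw w (xo k F) = fsc (inverse (ph n w k)) (xo (pm n w k) (tw w F))"
  by (auto simp: tw_def tens_def xo_def fapp fun_eq_iff subst_mult theta_def mult_psc_left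
    mult_psc_right sum_distrib_left psc.scale_sum_right mult.commute)

subsection \<open>The model of the standard module\<close>

definition Pn :: "mpoly set"
  where "Pn = {f. \<forall>m\<in>keys f. keys m \<subseteq> {..<n}}"

definition V :: "(tableau \<Rightarrow> mpoly) set"
  where "V = {F. (\<forall>T. T \<notin> ST \<longrightarrow> F T = 0) \<and> (\<forall>T. F T \<in> Pn)}"

lemma Pn_0 [simp]: "0 \<in> Pn"
  by (simp add: Pn_def)

lemma Pn_add: "f \<in> Pn \<Longrightarrow> g \<in> Pn \<Longrightarrow> f + g \<in> Pn"
  using keys_add[of f g] unfolding Pn_def by blast

lemma Pn_psc: "f \<in> Pn \<Longrightarrow> psc c f \<in> Pn"
  by (auto simp: Pn_def in_keys_iff)

lemma Pn_mon: "keys m \<subseteq> {..<n} \<Longrightarrow> mon m \<in> Pn"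
  by (simp add: Pn_def)

lemma Pn_var_mult:
  assumes "k < n" "f \<in> Pn"
  shows "var k * f \<in> Pn"
proof -
  have "keys m \<subseteq> {..<n}" if m: "m \<in> keys (var k * f)" for m
  proof -
    obtain a b where "m = a + b" "a \<in> keys (var k)" "b \<in> keys f"
      using m keys_mult[of "var k" f] by blast
    then have "keys m \<subseteq> keys a \<union> keys b" "a = Poly_Mapping.single k 1" "keys b \<subseteq> {..<n}"
      using keys_add[of a b] assms(2) by (auto simp: var_def Pn_def)
    then show ?thesis using assms(1) by auto
  qed
  then show ?thesis by (simp add: Pn_def)
qed

lemma subspace_V: "fsc.subspace V"
  by (auto simp: fsc.subspace_def V_def Pn_add Pn_psc fapp)

lemma V_add: "F \<in> V \<Longrightarrow> G \<in> V \<Longrightarrow> F + G \<in> V"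
  and V_fsc: "F \<in> V \<Longrightarrow> fsc c F \<in> V"
  and V_0: "0 \<in> V"
  and V_diff: "F \<in> V \<Longrightarrow> G \<in> V \<Longrightarrow> F - G \<in> V"
  and V_uminus: "F \<in> V \<Longrightarrow> - F \<in> V"
  and V_sum: "(\<And>s. s \<in> A \<Longrightarrow> g s \<in> V) \<Longrightarrow> sum g A \<in> V"
  using subspace_V fsc.subspace_add fsc.subspace_scale fsc.subspace_0 fsc.subspace_diff
    fsc.subspace_neg fsc.subspace_sum by metis+

lemma V_pt: "f \<in> Pn \<Longrightarrow> u \<in> Ssp \<Longrightarrow> pt f u \<in> V"
  by (auto simp: V_def pt_def Ssp_def Pn_psc)

lemma V_xo: "k < n \<Longrightarrow> F \<in> V \<Longrightarrow> xo k F \<in> V"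
  by (auto simp: V_def xo_def Pn_var_mult)

lemma Pn_1 [simp]: "1 \<in> Pn"
  by (simp add: Pn_def)

lemma V_expand:
  assumes "F \<in> V"
  shows "F = (\<Sum>T\<in>ST. \<Sum>m\<in>keys (F T). pt (mon m) (\<lambda>U. lookup (F T) m * vv T U))"
proof
  fix U
  have e: "f = (\<Sum>m\<in>keys f. Poly_Mapping.single m (lookup f m))" for f :: mpoly
    by (rule poly_mapping_eqI) (auto simp: lookup_sum lookup_single when_def in_keys_iff sum.delta)
  have "(\<Sum>T\<in>ST. \<Sum>m\<in>keys (F T). pt (mon m) (\<lambda>U. lookup (F T) m * vv T U)) U
      = (\<Sum>T\<in>ST. if T = U then (\<Sum>m\<in>keys (F U). Poly_Mapping.single m (lookup (F U) m)) else 0)"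
    by (auto simp: pt_def vv_def fapp intro!: sum.cong)
  also have "\<dots> = (if U \<in> ST then F U else 0)"
    using e[of "F U"] by (simp add: finite_ST)
  also have "\<dots> = F U" using assms by (simp add: V_def)
  finally show "F U = (\<Sum>T\<in>ST. \<Sum>m\<in>keys (F T). pt (mon m) (\<lambda>U. lookup (F T) m * vv T U)) U" ..
qed

text \<open>The model is generated by the constants under the multiplication operators, which makes
  identities between operators provable from their commutators with the \<^term>\<open>xo k\<close>.\<close>

lemma V_induct [consumes 1, case_names const add xo]:
  assumes "F \<in> V"
    and const: "\<And>u. u \<in> Ssp \<Longrightarrow> Q (pt 1 u)"
    and add: "\<And>F G. F \<in> V \<Longrightarrow> G \<in> V \<Longrightarrow> Q F \<Longrightarrow> Q G \<Longrightarrow> Q (F + G)"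
    and xo: "\<And>k F. k < n \<Longrightarrow> F \<in> V \<Longrightarrow> Q F \<Longrightarrow> Q (xo k F)"
  shows "Q F"
proof -
  have "pt 1 (\<lambda>T. 0) = (0 :: tableau \<Rightarrow> mpoly)" by (simp add: pt_def zero_fun_def)
  then have z: "Q 0" using const[OF Ssp_zero] by metis
  have mon: "Q (pt (mon m) u)" if "keys m \<subseteq> {..<n}" "u \<in> Ssp" for m u
    using that(1)
  proof (induction m rule: exponent_induct[where K = "{..<n}"])
    case zero
    then show ?case using const[OF that(2)] by simp
  next
    case (step m k)
    then show ?case using xo[of k "pt (mon m) u"] V_pt[OF Pn_mon that(2)]
      by (simp add: xo_pt var_mult_mon)
  qed (use that(1) in simp)
  let ?Q = "\<lambda>F. F \<in> V \<and> Q F"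
  have "?Q (\<Sum>T\<in>ST. \<Sum>m\<in>keys (F T). pt (mon m) (\<lambda>U. lookup (F T) m * vv T U))"
  proof (intro closed_sum[where Q = ?Q])
    fix T m assume Tm: "T \<in> ST" "m \<in> keys (F T)"
    then have "keys m \<subseteq> {..<n}" using assms(1) by (auto simp: V_def Pn_def)
    moreover have "(\<lambda>U. lookup (F T) m * vv T U) \<in> Ssp" using Tm by auto
    ultimately show "?Q (pt (mon m) (\<lambda>U. lookup (F T) m * vv T U))"
      by (simp add: mon V_pt Pn_mon)
  qed (auto simp: z V_0 add V_add)
  then show ?thesis using V_expand[OF assms(1)] by simp
qed

lemma V_tw:
  assumes "w \<in> Grp r n" "F \<in> V"
  shows "tw w F \<in> V"
  using assms(2)
proof (induction F rule: V_induct)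
  case (const u)
  then show ?case using assms(1) by (simp add: tw_pt V_pt rho_closed)
next
  case (add F G)
  then show ?case by (simp add: lin_add[OF flin_tw] V_add)
next
  case (xo k F)
  then show ?case using permutes_lt[OF GrpD(1)[OF r_pos assms(1)]]
    by (simp add: tw_xo V_fsc V_xo)
qed

lemma tw_one: "F \<in> V \<Longrightarrow> tw (1\<^sub>m n) F = F"
proof (induction F rule: V_induct)
  case (const u)
  then show ?case by (simp add: tw_pt[OF Grp_one[OF r_pos]] rho_one)
next
  case (add F G)
  then show ?case by (simp add: lin_add[OF flin_tw])
next
  case (xo k F)
  have "pm n (1\<^sub>m n) k = k" "ph n (1\<^sub>m n) k = 1"
    unfolding mono_mat_one by (simp_all add: pm_mono_mat ph_mono_mat permutes_id)
  then show ?case using xo by (simp add: tw_xo)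
qed

lemma tw_mult:
  assumes "w \<in> Grp r n" "w' \<in> Grp r n" "F \<in> V"
  shows "tw (w * w') F = tw w (tw w' F)"
  using assms(3)
proof (induction F rule: V_induct)
  case (const u)
  then show ?case using assms by (simp add: tw_pt Grp_mult[OF r_pos] rho_mult rho_closed)
next
  case (add F G)
  then show ?case by (simp add: lin_add[OF flin_tw])
next
  case (xo k F)
  then show ?case using assms
    by (simp add: tw_xo Grp_mult[OF r_pos] lin_scale[OF flin_tw] mult.commute)
qed

subsection \<open>Dunkl operators\<close>

text \<open>The triple \<open>(a, b, z)\<close> stands for the reflection \<open>s =\<close> \<^term>\<open>rmat n a b z\<close>. It fixes the kernel of
the linear form \<^term>\<open>alv a b z\<close>, whose value at \<open>y\<^sub>k\<close> is \<^term>\<open>al a b z k\<close>, and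
\<open>x\<^sub>k - s x\<^sub>k\<close> is \<^term>\<open>be a b z k\<close> times that form.\<close>

definition alv :: "nat \<Rightarrow> nat \<Rightarrow> complex \<Rightarrow> mpoly"
  where "alv a b z = (if a = b then var a else var a - psc z (var b))"

definition al :: "nat \<Rightarrow> nat \<Rightarrow> complex \<Rightarrow> nat \<Rightarrow> complex"
  where "al a b z k = (if k = a then 1 else if k = b then - z else 0)"

definition be :: "nat \<Rightarrow> nat \<Rightarrow> complex \<Rightarrow> nat \<Rightarrow> complex"
  where "be a b z k = (if a = b then (if k = a then 1 - inverse z else 0)
    else if k = a then 1 else if k = b then - inverse z else 0)"

text \<open>The discrete Fourier transform of the parameters attached to the idempotents \<open>e\<^sub>i\<^sub>j\<close>, that is, the
coefficient of \<open>t\<close> for the diagonal reflection with entry \<open>z\<close>.\<close>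

definition gam :: "complex \<Rightarrow> complex"
  where "gam z = (1 / of_nat r) * (\<Sum>j<r. (dd (int j) - dd (int j - 1)) * inverse z ^ j)"

text \<open>For \<open>a \<noteq> b\<close> every reflection occurs twice among the triples, as \<open>(a, b, z)\<close> and as
\<open>(b, a, z\<^sup>-\<^sup>1)\<close>, which accounts for the factor \<open>1/2\<close>. For \<open>a = b\<close> and \<open>z = 1\<close> the matrix is
the identity and the value is \<open>0\<close>, division by zero being zero.\<close>

definition cc :: "nat \<Rightarrow> nat \<Rightarrow> complex \<Rightarrow> complex"
  where "cc a b z = (if a = b then gam z / (1 - inverse z) else c0 / 2)"

definition Rf :: "(nat \<times> nat \<times> complex) set"
  where "Rf = {..<n} \<times> {..<n} \<times> roots r"

text \<open>The operator \<open>(1 - s)/\<alpha>\<^sub>s \<otimes> s\<close> for a reflection \<open>s\<close>.\<close>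

definition dl :: "nat \<Rightarrow> nat \<Rightarrow> complex \<Rightarrow> (tableau \<Rightarrow> mpoly) \<Rightarrow> tableau \<Rightarrow> mpoly"
  where "dl a b z = tens (ddiv (theta (rmat n a b z)) (alv a b z)) (R (rmat n a b z))"

text \<open>The Dunkl operator of \<open>y\<^sub>i\<close> with coefficients in \<open>S\<^sup>\<lambda>\<close>.\<close>

definition yo :: "nat \<Rightarrow> (tableau \<Rightarrow> mpoly) \<Rightarrow> tableau \<Rightarrow> mpoly"
  where "yo i F = (\<lambda>T. pdv i (F T)) - (\<Sum>(a, b, z)\<in>Rf. fsc (cc a b z * al a b z i) (dl a b z F))"

text \<open>The commutator of \<open>y\<^sub>i\<close> with \<open>x\<^sub>k\<close>, as dictated by the Leibniz rule for divided differences
(\<open>yo_xo\<close>); it only involves the group.\<close>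

definition Ko :: "nat \<Rightarrow> nat \<Rightarrow> (tableau \<Rightarrow> mpoly) \<Rightarrow> tableau \<Rightarrow> mpoly"
  where "Ko i k F = fsc (if i = k then 1 else 0) F
    - (\<Sum>(a, b, z)\<in>Rf. fsc (cc a b z * al a b z i * be a b z k) (tw (rmat n a b z) F))"

lemma RfD: "(a, b, z) \<in> Rf \<Longrightarrow> a < n" "(a, b, z) \<in> Rf \<Longrightarrow> b < n" "(a, b, z) \<in> Rf \<Longrightarrow> z ^ r = 1"
  "(a, b, z) \<in> Rf \<Longrightarrow> z \<noteq> 0"
  using root_nonzero[OF r_pos] by (auto simp: Rf_def roots_def)

lemma divided_difference_rmat:
  assumes "(a, b, z) \<in> Rf"
  shows "divided_difference (theta (rmat n a b z)) (alv a b z) (be a b z)"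
proof
  have "Poly_Mapping.single b (1::nat) = Poly_Mapping.single a 1 \<longleftrightarrow> a = b"
    by (metis lookup_single_eq lookup_single_not_eq zero_neq_one)
  then have "lookup (alv a b z) (Poly_Mapping.single a 1) = 1"
    by (auto simp: alv_def var_def lookup_minus lookup_single when_def)
  then show "alv a b z \<noteq> 0" by auto
  fix k
  note r = pm_rmat[OF r_pos RfD(1-3)[OF assms]] ph_rmat[OF r_pos RfD(1-3)[OF assms]]
  show "var k - theta (rmat n a b z) k = psc (be a b z k) (alv a b z)"
    using RfD(4)[OF assms] unfolding theta_def r
    by (auto simp: be_def alv_def psc.scale_left_diff_distrib psc.scale_right_diff_distrib)
qed

lemma flin_dl: "s \<in> Rf \<Longrightarrow> flin (case s of (a, b, z) \<Rightarrow> dl a b z)"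
  by (cases s) (auto simp: dl_def intro!: flin_tens divided_difference.plin_ddiv divided_difference_rmat)

lemma flin_yo: "flin (yo i)"
proof -
  have "flin (\<lambda>F. (\<lambda>T. pdv i (F T)) - (\<Sum>s\<in>Rf. fsc (case s of (a, b, z) \<Rightarrow> cc a b z * al a b z i)
      ((case s of (a, b, z) \<Rightarrow> dl a b z) F)))"
    by (intro flin_diff flin_pointwise plin_pdv flin_sum flin_fsc flin_dl)
  moreover have "yo i = (\<lambda>F. (\<lambda>T. pdv i (F T)) - (\<Sum>s\<in>Rf. fsc (case s of (a, b, z) \<Rightarrow> cc a b z * al a b z i)
      ((case s of (a, b, z) \<Rightarrow> dl a b z) F)))"
    by (auto simp: yo_def fapp fun_eq_iff intro!: sum.cong)
  ultimately show ?thesis by simp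
qed

lemma dl_xo:
  assumes "(a, b, z) \<in> Rf"
  shows "dl a b z (xo k F) = xo k (dl a b z F) + fsc (be a b z k) (tw (rmat n a b z) F)"
  by (auto simp: dl_def tens_def xo_def tw_def fapp fun_eq_iff psc.scale_right_distrib
    divided_difference.ddiv_var_mult[OF divided_difference_rmat[OF assms]]
    mult_psc_right sum_distrib_left psc.scale_sum_right sum.distrib mult.commute[of "be a b z k"])

lemma yo_xo: "yo i (xo k F) = xo k (yo i F) + Ko i k F"
proof -
  let ?c = "\<lambda>(a, b, z). cc a b z * al a b z i"
  let ?f = "\<lambda>(a, b, z). dl a b z F" and ?g = "\<lambda>(a, b, z). fsc (be a b z k) (tw (rmat n a b z) F)"
  have "(\<Sum>(a, b, z)\<in>Rf. fsc (cc a b z * al a b z i) (dl a b z (xo k F)))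
      = (\<Sum>s\<in>Rf. fsc (?c s) (xo k (?f s)) + fsc (?c s) (?g s))"
    by (rule sum.cong) (auto simp: dl_xo fsc.scale_right_distrib)
  also have "\<dots> = xo k (\<Sum>s\<in>Rf. fsc (?c s) (?f s)) + (\<Sum>s\<in>Rf. fsc (?c s) (?g s))"
    by (simp add: sum.distrib lin_sum[OF flin_xo] lin_scale[OF flin_xo])
  also have "(\<Sum>s\<in>Rf. fsc (?c s) (?f s)) = (\<Sum>(a, b, z)\<in>Rf. fsc (cc a b z * al a b z i) (dl a b z F))"
    by (rule sum.cong) auto
  also have "(\<Sum>s\<in>Rf. fsc (?c s) (?g s))
      = (\<Sum>(a, b, z)\<in>Rf. fsc (cc a b z * al a b z i * be a b z k) (tw (rmat n a b z) F))"
    by (rule sum.cong) auto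
  finally have 1: "(\<Sum>(a, b, z)\<in>Rf. fsc (cc a b z * al a b z i) (dl a b z (xo k F)))
      = xo k (\<Sum>(a, b, z)\<in>Rf. fsc (cc a b z * al a b z i) (dl a b z F))
        + (\<Sum>(a, b, z)\<in>Rf. fsc (cc a b z * al a b z i * be a b z k) (tw (rmat n a b z) F))" .
  have 2: "(\<lambda>T. pdv i (xo k F T)) = xo k (\<lambda>T. pdv i (F T)) + fsc (if i = k then 1 else 0) F"
    by (auto simp: xo_def pdv_var_mult fapp fun_eq_iff)
  show ?thesis unfolding yo_def Ko_def 1 2 by (simp add: lin_diff[OF flin_xo])
qed

text \<open>Divided differences and derivatives annihilate constants, which is why \<open>y\<^sub>i\<close> acts by \<open>0\<close> on
\<open>S\<^sup>\<lambda>\<close>.\<close>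

lemma yo_const [simp]: "yo i (pt 1 u) = 0"
proof -
  have "dl a b z (pt 1 u) = 0" if "(a, b, z) \<in> Rf" for a b z
  proof -
    interpret divided_difference "theta (rmat n a b z)" "alv a b z" "be a b z"
      by (rule divided_difference_rmat[OF that])
    show ?thesis by (auto simp: dl_def tens_def pt_def fapp fun_eq_iff lin_scale[OF plin_ddiv])
  qed
  then have "(\<Sum>(a, b, z)\<in>Rf. fsc (cc a b z * al a b z i) (dl a b z (pt 1 u))) = 0"
    by (intro sum.neutral) auto
  then show ?thesis
    unfolding yo_def by (auto simp: pt_def fapp fun_eq_iff lin_scale[OF plin_pdv])
qed

lemma rmat_in_Grp: "(a, b, z) \<in> Rf \<Longrightarrow> rmat n a b z \<in> Grp r n"
  using rmat_Grp[OF r_pos RfD(1-3)] .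

lemma V_Ko: "F \<in> V \<Longrightarrow> Ko i k F \<in> V"
  unfolding Ko_def by (intro V_diff V_fsc V_sum) (auto intro!: V_fsc V_tw rmat_in_Grp)

lemma V_yo: "F \<in> V \<Longrightarrow> yo i F \<in> V"
proof (induction F rule: V_induct)
  case (add F G)
  then show ?case by (simp add: lin_add[OF flin_yo] V_add)
next
  case (xo k F)
  then show ?case by (simp add: yo_xo V_add V_xo V_Ko)
qed (simp add: V_0)

lemma finite_Rf: "finite Rf"
  unfolding Rf_def by (intro finite_cartesian_product finite_roots r_pos) auto

text \<open>Conjugation by \<open>w\<close> permutes the reflections and rescales the two linear forms by opposite phases.\<close>

lemma tw_Ko:
  assumes w: "w \<in> Grp r n" and F: "F \<in> V" and jk: "j < n" "k < n"
  shows "tw w (Ko j k F) = fsc (ph n w j / ph n w k) (Ko (pm n w j) (pm n w k) (tw w F))"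
proof -
  let ?\<pi> = "pm n w" and ?\<omega> = "ph n w"
  let ?g = "\<lambda>(a, b, z). (?\<pi> a, ?\<pi> b, z * (?\<omega> a / ?\<omega> b))"
  let ?h = "\<lambda>(a, b, z). fsc (cc a b z * al a b z (?\<pi> j) * be a b z (?\<pi> k)) (tw (rmat n a b z) (tw w F))"
  note W = GrpD[OF r_pos w]
  have nz: "?\<omega> i \<noteq> 0" for i using W(2) root_nonzero[OF r_pos] by blast
  have inj: "?\<pi> a = ?\<pi> b \<longleftrightarrow> a = b" for a b using permutes_inj[OF W(1)] by (auto dest: injD)
  have g: "?g s \<in> Rf" if "s \<in> Rf" for s
    using that permutes_lt[OF W(1)] W(2)
    by (auto simp: Rf_def roots_def power_mult_distrib power_divide)
  have "inj_on ?g Rf" by (rule inj_onI) (auto simp: inj nz)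
  then have bij: "bij_betw ?g Rf Rf"
    using g finite_Rf by (simp add: bij_betw_def endo_inj_surj image_subsetI)
  have "(\<Sum>(a, b, z)\<in>Rf. fsc (cc a b z * al a b z j * be a b z k) (tw w (tw (rmat n a b z) F)))
      = (\<Sum>s\<in>Rf. fsc (?\<omega> j / ?\<omega> k) (?h (?g s)))"
  proof (rule sum.cong[OF refl])
    fix s assume "s \<in> Rf"
    obtain a b z where e: "s = (a, b, z)" by (cases s)
    have s: "(a, b, z) \<in> Rf" using \<open>s \<in> Rf\<close> e by simp
    let ?z = "z * (?\<omega> a / ?\<omega> b)"
    have s': "(?\<pi> a, ?\<pi> b, ?z) \<in> Rf" using g[OF s] by simp
    have 1: "tw w (tw (rmat n a b z) F) = tw (rmat n (?\<pi> a) (?\<pi> b) ?z) (tw w F)"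
      using tw_mult[OF w rmat_in_Grp[OF s] F] tw_mult[OF rmat_in_Grp[OF s'] w F]
        rmat_conj[OF r_pos w RfD(1-3)[OF s]] by simp
    have 2: "cc (?\<pi> a) (?\<pi> b) ?z = cc a b z" by (auto simp: cc_def inj nz)
    have 3: "al a b z j * be a b z k = ?\<omega> j / ?\<omega> k * (al (?\<pi> a) (?\<pi> b) ?z (?\<pi> j) * be (?\<pi> a) (?\<pi> b) ?z (?\<pi> k))"
      using nz RfD(4)[OF s] by (auto simp: al_def be_def inj field_simps)
    show "(case s of (a, b, z) \<Rightarrow> fsc (cc a b z * al a b z j * be a b z k) (tw w (tw (rmat n a b z) F)))
        = fsc (?\<omega> j / ?\<omega> k) (?h (?g s))"
      unfolding e prod.case 1 using 2 3 by (simp add: mult.assoc mult.left_commute)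
  qed
  also have "\<dots> = fsc (?\<omega> j / ?\<omega> k) (\<Sum>s\<in>Rf. ?h s)"
    by (simp only: fsc.scale_sum_right[symmetric] sum.reindex_bij_betw[OF bij, of ?h])
  finally have "(\<Sum>(a, b, z)\<in>Rf. fsc (cc a b z * al a b z j * be a b z k) (tw w (tw (rmat n a b z) F)))
      = fsc (?\<omega> j / ?\<omega> k) (\<Sum>(a, b, z)\<in>Rf. fsc (cc a b z * al a b z (?\<pi> j) * be a b z (?\<pi> k))
          (tw (rmat n a b z) (tw w F)))" .
  moreover have "tw w (\<Sum>(a, b, z)\<in>Rf. fsc (cc a b z * al a b z j * be a b z k) (tw (rmat n a b z) F))
      = (\<Sum>(a, b, z)\<in>Rf. fsc (cc a b z * al a b z j * be a b z k) (tw w (tw (rmat n a b z) F)))"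
    unfolding lin_sum[OF flin_tw] by (rule sum.cong) (auto simp: lin_scale[OF flin_tw])
  ultimately show ?thesis
    unfolding Ko_def lin_diff[OF flin_tw] lin_scale[OF flin_tw] fsc.scale_right_diff_distrib
    using nz[of k] by (auto simp: inj)
qed

text \<open>By induction over the model: both sides vanish on constants and have the same commutators with
the \<open>x\<^sub>k\<close>.\<close>

lemma tw_yo:
  assumes w: "w \<in> Grp r n" and F: "F \<in> V" and j: "j < n"
  shows "tw w (yo j F) = fsc (ph n w j) (yo (pm n w j) (tw w F))"
  using F
proof (induction F rule: V_induct)
  case (const u)
  then show ?case using w by (simp add: tw_pt lin_zero[OF flin_tw] lin_zero[OF flin_yo])
next
  case (add F G)
  then show ?case
    by (simp add: lin_add[OF flin_tw] lin_add[OF flin_yo] fsc.scale_right_distrib)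
next
  case (xo k F)
  have nz: "ph n w k \<noteq> 0" using GrpD(2)[OF r_pos w] root_nonzero[OF r_pos] by blast
  show ?case using xo nz
    by (simp add: yo_xo lin_add[OF flin_tw] lin_scale[OF flin_tw] lin_scale[OF flin_yo] tw_xo
      lin_scale[OF flin_xo] tw_Ko w j fsc.scale_right_distrib divide_inverse mult.commute)
qed

text \<open>\<open>\<langle>\<alpha>\<^sub>s, y\<^sub>i\<rangle>\<close> times this operator is the difference between \<open>y\<^sub>i\<close> and \<open>s y\<^sub>i\<close>; it is a fixed linear
combination of Dunkl operators, independent of \<open>i\<close>.\<close>

definition Bo :: "nat \<Rightarrow> nat \<Rightarrow> complex \<Rightarrow> (tableau \<Rightarrow> mpoly) \<Rightarrow> tableau \<Rightarrow> mpoly"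
  where "Bo a b z H = (if a = b then fsc (1 - z) (yo a H) else yo a H - fsc (inverse z) (yo b H))"

lemma yo_tw:
  assumes s: "(a, b, z) \<in> Rf" and G: "G \<in> V" and i: "i < n"
  shows "yo i (tw (rmat n a b z) G) = tw (rmat n a b z) (yo i G)
    + fsc (al a b z i) (Bo a b z (tw (rmat n a b z) G))"
  unfolding tw_yo[OF rmat_in_Grp[OF s] G i] pm_rmat[OF r_pos RfD(1-3)[OF s]]
    ph_rmat[OF r_pos RfD(1-3)[OF s]]
  using RfD(4)[OF s]
  by (auto simp: al_def Bo_def Transposition.transpose_def fsc.scale_left_diff_distrib
    fsc.scale_right_diff_distrib)

lemma yo_Ko:
  assumes G: "G \<in> V" and i: "i < n"
  shows "yo i (Ko j k G) = Ko j k (yo i G)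
    - (\<Sum>(a, b, z)\<in>Rf. fsc (cc a b z * al a b z j * be a b z k * al a b z i) (Bo a b z (tw (rmat n a b z) G)))"
proof -
  have "yo i (\<Sum>(a, b, z)\<in>Rf. fsc (cc a b z * al a b z j * be a b z k) (tw (rmat n a b z) G))
      = (\<Sum>s\<in>Rf. (case s of (a, b, z) \<Rightarrow> fsc (cc a b z * al a b z j * be a b z k) (tw (rmat n a b z) (yo i G)))
        + (case s of (a, b, z) \<Rightarrow> fsc (cc a b z * al a b z j * be a b z k * al a b z i) (Bo a b z (tw (rmat n a b z) G))))"
    unfolding lin_sum[OF flin_yo]
    by (rule sum.cong) (auto simp: lin_scale[OF flin_yo] yo_tw G i fsc.scale_right_distrib)
  then show ?thesis
    unfolding Ko_def lin_diff[OF flin_yo] lin_scale[OF flin_yo] by (simp add: sum.distrib)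
qed

text \<open>By induction over the model: on a product with \<open>x\<^sub>k\<close> the correction term of \<open>yo_Ko\<close> appears, and it is symmetric
  in \<open>i\<close> and \<open>j\<close>.\<close>

lemma yo_commute:
  assumes "F \<in> V" "i < n" "j < n"
  shows "yo i (yo j F) = yo j (yo i F)"
  using assms(1)
proof (induction F rule: V_induct)
  case (const u)
  then show ?case by (simp add: lin_zero[OF flin_yo])
next
  case (add F G)
  then show ?case by (simp add: lin_add[OF flin_yo])
next
  case (xo k F)
  have "(\<Sum>(a, b, z)\<in>Rf. fsc (cc a b z * al a b z j * be a b z k * al a b z i) (Bo a b z (tw (rmat n a b z) F)))
      = (\<Sum>(a, b, z)\<in>Rf. fsc (cc a b z * al a b z i * be a b z k * al a b z j) (Bo a b z (tw (rmat n a b z) F)))"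
    by (rule sum.cong) (auto simp: mult_ac)
  then show ?case using xo
    by (simp add: yo_xo lin_add[OF flin_yo] yo_Ko assms)
qed

end

declare fun_sum_apply [simp del] uminus_apply [simp del] minus_apply [simp del]

section \<open>The free algebra acts on the model\<close>

lemma free_algebra_simps [simp]:
  "p \<oplus>\<^bsub>free_algebra G\<^esub> q = p + q" "p \<otimes>\<^bsub>free_algebra G\<^esub> q = p * q"
  "\<one>\<^bsub>free_algebra G\<^esub> = 1" "\<zero>\<^bsub>free_algebra G\<^esub> = 0"
  by (simp_all add: free_algebra_def)

text \<open>The words in the support of a product are concatenations of words in the supports of the factors.\<close>

lemma ring_free_algebra: "ring (free_algebra G)"
proof -
  let ?F = "free_algebra G"
  have add: "p + q \<in> carrier ?F" if p: "p \<in> carrier ?F" and q: "q \<in> carrier ?F" for p q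
    using keys_add[of p q] p q unfolding free_algebra_def by auto
  have neg: "- p \<in> carrier ?F" if p: "p \<in> carrier ?F" for p
    using p by (auto simp: free_algebra_def in_keys_iff)
  have mult: "p * q \<in> carrier ?F" if p: "p \<in> carrier ?F" and q: "q \<in> carrier ?F" for p q
  proof -
    have "set (letters u) \<subseteq> G" if u: "u \<in> keys (p * q)" for u
    proof -
      obtain a b where "u = a + b" "a \<in> keys p" "b \<in> keys q" using u keys_mult[of p q] by blast
      then show ?thesis using p q by (auto simp: free_algebra_def plus_word_def)
    qed
    then show ?thesis by (simp add: free_algebra_def)
  qed
  have one: "1 \<in> carrier ?F" and zero: "0 \<in> carrier ?F"
    by (auto simp: free_algebra_def zero_word_def)
  show ?thesis
  proof (rule ringI)
    show "abelian_group ?F"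
    proof (rule abelian_groupI)
      show "\<exists>q\<in>carrier ?F. q \<oplus>\<^bsub>?F\<^esub> p = \<zero>\<^bsub>?F\<^esub>" if p: "p \<in> carrier ?F" for p
        by (rule bexI[OF _ neg[OF p]]) simp
    qed (simp_all add: add zero add_ac)
    show "Group.monoid ?F"
      by (rule monoidI) (simp_all add: mult one mult.assoc)
  qed (simp_all add: algebra_simps)
qed

lemma free_algebra_uminus: "p \<in> carrier (free_algebra G) \<Longrightarrow> \<ominus>\<^bsub>free_algebra G\<^esub> p = - p"
proof -
  interpret ring "free_algebra G" by (rule ring_free_algebra)
  assume p: "p \<in> carrier (free_algebra G)"
  then have "- p \<in> carrier (free_algebra G)" by (auto simp: free_algebra_def in_keys_iff)
  then show ?thesis using p minus_equality[of "- p" p] by simp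
qed

lemma const_0 [simp]: "const 0 = 0" and const_1 [simp]: "const 1 = 1"
  and const_add: "const (a + b) = const a + const b"
  and const_mult: "const (a * b) = const a * const b"
  by (simp_all add: const_def single_add mult_single)

lemma psc_const: "psc c p = const c * p"
  by (simp add: const_def psc_conv_mult)

lemma const_commute: "p * const c = const c * p"
  by (simp add: const_def single_comm)

context cherednik_rep
begin

lemma FF_ring: "ring FF"
  unfolding FF_def by (rule ring_free_algebra)

interpretation FF: ring FF by (rule FF_ring)

lemma FF_simps [simp]:
  "p \<oplus>\<^bsub>FF\<^esub> q = p + q" "p \<otimes>\<^bsub>FF\<^esub> q = p * q" "\<one>\<^bsub>FF\<^esub> = 1" "\<zero>\<^bsub>FF\<^esub> = 0"
  by (simp_all add: FF_def)

lemma FF_add: "p \<in> carrier FF \<Longrightarrow> q \<in> carrier FF \<Longrightarrow> p + q \<in> carrier FF"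
  and FF_mult: "p \<in> carrier FF \<Longrightarrow> q \<in> carrier FF \<Longrightarrow> p * q \<in> carrier FF"
  and FF_0: "0 \<in> carrier FF" and FF_1: "1 \<in> carrier FF"
  using FF.a_closed FF.m_closed FF.zero_closed FF.one_closed by (simp_all del: FF.zero_closed FF.one_closed)

lemma FF_uminus: "p \<in> carrier FF \<Longrightarrow> - p \<in> carrier FF"
  by (auto simp: FF_def free_algebra_def in_keys_iff)

lemma FF_minus: "p \<in> carrier FF \<Longrightarrow> q \<in> carrier FF \<Longrightarrow> p - q \<in> carrier FF"
  using FF_add[of p "- q"] FF_uminus by simp

lemma FF_uminus_eq: "p \<in> carrier FF \<Longrightarrow> \<ominus>\<^bsub>FF\<^esub> p = - p"
  unfolding FF_def by (rule free_algebra_uminus)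

lemma FF_minus_eq: "p \<in> carrier FF \<Longrightarrow> q \<in> carrier FF \<Longrightarrow> p \<ominus>\<^bsub>FF\<^esub> q = p - q"
  by (simp add: a_minus_def FF_uminus_eq)

lemma FF_sum: "(\<And>s. s \<in> A \<Longrightarrow> g s \<in> carrier FF) \<Longrightarrow> sum g A \<in> carrier FF"
  by (rule closed_sum) (auto simp: FF_0 FF_add)

lemma FF_const: "const c \<in> carrier FF"
  by (auto simp: FF_def free_algebra_def const_def zero_word_def)

lemma FF_X: "i < n \<Longrightarrow> X i \<in> carrier FF" and FF_Y: "i < n \<Longrightarrow> Y i \<in> carrier FF"
  and FF_T: "w \<in> Grp r n \<Longrightarrow> T\<^sub>g w \<in> carrier FF"
  by (auto simp: FF_def free_algebra_def X_def Y_def T\<^sub>g_def gen_def)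

lemmas FF_intros = FF_add FF_mult FF_0 FF_1 FF_minus FF_uminus FF_sum FF_const FF_X FF_Y FF_T

lemma zeta_pow_pow: "(zeta r ^ l) ^ r = 1"
  by (metis mult.commute power_mult power_one r_pos zeta_pow)

lemma refl_in_Grp:
  assumes "i < n" "j < n" "i \<noteq> j"
  shows "refl_mat r n i j l \<in> Grp r n"
  unfolding refl_mat_rmat[OF assms] by (rule rmat_Grp[OF r_pos assms(1,2) zeta_pow_pow])

lemma zeta_in_Grp: "i < n \<Longrightarrow> zeta_mat r n i (int l) \<in> Grp r n"
  unfolding zeta_mat_rmat by (rule rmat_Grp[OF r_pos _ _ zeta_pow_pow])

subsection \<open>The action\<close>

text \<open>The generators act by multiplications, Dunkl operators and the group; words act by composition
and elements of the free algebra by linear extension.\<close>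

definition actl :: "generator \<Rightarrow> (tableau \<Rightarrow> mpoly) \<Rightarrow> tableau \<Rightarrow> mpoly"
  where "actl g = (case g of GX i \<Rightarrow> xo i | GY i \<Rightarrow> yo i | GT w \<Rightarrow> tw w)"

definition actw :: "generator word \<Rightarrow> (tableau \<Rightarrow> mpoly) \<Rightarrow> tableau \<Rightarrow> mpoly"
  where "actw u F = foldr actl (letters u) F"

definition act :: "word_poly \<Rightarrow> (tableau \<Rightarrow> mpoly) \<Rightarrow> tableau \<Rightarrow> mpoly"
  where "act p F = (\<lambda>T. lext (\<lambda>u. actw u F T) p)"

lemma act_single: "act (Poly_Mapping.single u c) F = fsc c (actw u F)"
  by (simp add: act_def fsc_def)

lemma act_add: "act (p + q) F = act p F + act q F"
  by (simp add: act_def fapp fun_eq_iff lin_add[OF plin_lext])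

lemma act_psc: "act (psc c p) F = fsc c (act p F)"
  by (simp add: act_def fapp fun_eq_iff lin_scale[OF plin_lext])

lemma act_0 [simp]: "act 0 F = 0"
  by (simp add: act_def fapp fun_eq_iff lin_zero[OF plin_lext])

lemma act_minus: "act (p - q) F = act p F - act q F"
  by (simp add: act_def minus_apply fun_eq_iff lin_diff[OF plin_lext])

lemma act_uminus: "act (- p) F = - act p F"
  by (simp add: act_def uminus_apply fun_eq_iff lin_neg[OF plin_lext])

lemma act_sum: "act (sum g A) F = (\<Sum>s\<in>A. act (g s) F)"
  by (simp add: act_def fun_eq_iff lin_sum[OF plin_lext] fun_sum_apply)

lemma flin_actl: "flin (actl g)"
  by (cases g) (simp_all add: actl_def flin_xo flin_yo flin_tw)

lemma flin_id: "flin (\<lambda>F. F)"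
  by (rule flinI) simp_all

lemma flin_actw: "flin (actw u)"
proof -
  have "flin (foldr actl us)" for us
  proof (induction us)
    case Nil
    then show ?case using flin_id by (simp add: id_def)
  next
    case (Cons g us)
    show ?case using flin_compose[OF flin_actl[of g] Cons] by (simp add: comp_def)
  qed
  then show ?thesis unfolding actw_def by simp
qed

lemma flin_act: "flin (act p)"
proof (induction p rule: pm_induct)
  case (single u c)
  show ?case using flin_fsc[OF flin_actw[of u], of c] by (simp add: act_single[abs_def])
next
  case (add p q)
  then show ?case using flin_add[OF add] by (simp add: act_add[abs_def])
qed

lemma act_mult: "act (p * q) F = act p (act q F)"
proof (induction p rule: pm_induct)
  case (single u c)
  show ?case
  proof (induction q rule: pm_induct)
    case (single v c')
    have "actw (u + v) F = actw u (actw v F)" by (simp add: actw_def plus_word_def)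
    then show ?case
      by (simp add: mult_single act_single lin_scale[OF flin_actw])
  next
    case (add p q)
    then show ?case by (simp add: distrib_left act_add lin_add[OF flin_act])
  qed
next
  case (add p q)
  then show ?case by (simp add: distrib_right act_add)
qed

lemma act_const: "act (const c) F = fsc c F"
  by (simp add: const_def act_single actw_def zero_word_def)

lemma act_1 [simp]: "act 1 F = F"
  using act_const[of 1 F] by simp

lemma act_X: "act (X i) F = xo i F" and act_Y: "act (Y i) F = yo i F"
  and act_T: "act (T\<^sub>g w) F = tw w F"
  by (simp_all add: X_def Y_def T\<^sub>g_def gen_def act_single actw_def actl_def)

lemmas act_simps = act_add act_minus act_uminus act_sum act_mult act_const act_X act_Y act_T

text \<open>Elements of the free algebra are built from generators by sums and products; this is how facts
about generators are transferred to the whole algebra.\<close>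

lemma FF_induct [consumes 1, case_names const X Y T add mult]:
  assumes p: "p \<in> carrier FF"
    and const: "\<And>c. P (const c)"
    and X: "\<And>i. i < n \<Longrightarrow> P (X i)"
    and Y: "\<And>i. i < n \<Longrightarrow> P (Y i)"
    and T: "\<And>w. w \<in> Grp r n \<Longrightarrow> P (T\<^sub>g w)"
    and add: "\<And>p q. p \<in> carrier FF \<Longrightarrow> q \<in> carrier FF \<Longrightarrow> P p \<Longrightarrow> P q \<Longrightarrow> P (p + q)"
    and mult: "\<And>p q. p \<in> carrier FF \<Longrightarrow> q \<in> carrier FF \<Longrightarrow> P p \<Longrightarrow> P q \<Longrightarrow> P (p * q)"
  shows "P p"
proof -
  let ?G = "GX ` {..<n} \<union> GY ` {..<n} \<union> GT ` Grp r n"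
  have word: "P (Poly_Mapping.single (Word us) 1) \<and> Poly_Mapping.single (Word us) 1 \<in> carrier FF"
    if "set us \<subseteq> ?G" for us
    using that
  proof (induction us)
    case Nil
    then show ?case using const[of 1] FF_1 by (simp add: const_def zero_word_def flip: single_one)
  next
    case (Cons g us)
    have e: "Poly_Mapping.single (Word (g # us)) (1::complex) = gen g * Poly_Mapping.single (Word us) 1"
      by (simp add: gen_def mult_single plus_word_def)
    have "P (gen g) \<and> gen g \<in> carrier FF"
      using Cons.prems X Y T FF_X FF_Y FF_T by (auto simp: X_def Y_def T\<^sub>g_def)
    then show ?case unfolding e using Cons by (auto intro: mult FF_mult)
  qed
  have e: "p = (\<Sum>u\<in>keys p. const (lookup p u) * Poly_Mapping.single (Word (letters u)) 1)"
    by (rule poly_mapping_eqI)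
      (auto simp: const_def mult_single lookup_sum lookup_single when_def in_keys_iff sum.delta)
  have "P (\<Sum>u\<in>keys p. const (lookup p u) * Poly_Mapping.single (Word (letters u)) 1) \<and>
      (\<Sum>u\<in>keys p. const (lookup p u) * Poly_Mapping.single (Word (letters u)) 1) \<in> carrier FF"
  proof (rule closed_sum[where Q = "\<lambda>p. P p \<and> p \<in> carrier FF"])
    fix u assume "u \<in> keys p"
    then have "set (letters u) \<subseteq> ?G" using p by (auto simp: FF_def free_algebra_def)
    from word[OF this]
    show "P (const (lookup p u) * Poly_Mapping.single (Word (letters u)) 1) \<and>
        const (lookup p u) * Poly_Mapping.single (Word (letters u)) 1 \<in> carrier FF"
      using const FF_const by (auto intro: mult FF_mult)
  qed (use const[of 0] FF_0 in \<open>auto intro: add FF_add\<close>)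
  then show ?thesis using e by simp
qed

lemma V_act: "p \<in> carrier FF \<Longrightarrow> F \<in> V \<Longrightarrow> act p F \<in> V"
  by (induction p arbitrary: F rule: FF_induct)
    (simp_all add: act_simps V_fsc V_xo V_yo V_tw V_add)

subsection \<open>The commutators as elements of the algebra\<close>

text \<open>The right-hand side of the commutation relation between \<open>y\<^sub>i\<close> and \<open>x\<^sub>j\<close>.\<close>

definition Kp :: "nat \<Rightarrow> nat \<Rightarrow> word_poly"
  where "Kp i j = (if i = j
    then 1 - (\<Sum>j<r. const (dd (int j) - dd (int j - 1)) * ee i j)
        - const c0 * (\<Sum>j\<in>{..<n} - {i}. \<Sum>l<r. T\<^sub>g (refl_mat r n i j l))
    else const c0 * (\<Sum>l<r. const (zeta r powi (- int l)) * T\<^sub>g (refl_mat r n i j l)))"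

lemma sum_Rf:
  "(\<Sum>(a, b, z)\<in>Rf. f a b z) = (\<Sum>a<n. \<Sum>b<n. \<Sum>z\<in>roots r. f a b z)"
  by (simp add: Rf_def sum.cartesian_product)

text \<open>The coefficients are differences of a periodic sequence, so they sum to zero.\<close>

lemma gam_1: "gam 1 = 0"
proof -
  have "(\<Sum>j<k. dd (int j) - dd (int j - 1)) = dd (int k - 1) - dd (-1)" for k
    by (induction k) auto
  moreover have "dd (int r - 1) = dd (- 1)"
    by (simp add: dd_def)
  ultimately show ?thesis by (simp add: gam_def)
qed

text \<open>Only the reflections exchanging \<open>i\<close> and \<open>j\<close> contribute, each of them twice.\<close>

lemma Ko_offdiag:
  assumes ij: "i < n" "j < n" "i \<noteq> j"
  shows "Ko i j F = fsc c0 (\<Sum>l<r. fsc (zeta r powi (- int l)) (tw (refl_mat r n i j l) F))"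
proof -
  let ?t = "\<lambda>z. fsc (inverse z) (tw (rmat n i j z) F)"
  let ?f = "\<lambda>a b z. fsc (cc a b z * al a b z i * be a b z j) (tw (rmat n a b z) F)"
  have two: "p \<noteq> q \<Longrightarrow> (\<Sum>s\<in>{p, q}. f s) = f p + f q" for p q and f :: "nat \<times> nat \<Rightarrow> tableau \<Rightarrow> mpoly"
    by simp
  have 1: "(\<Sum>z\<in>roots r. ?f a b z) = (if a = i \<and> b = j \<or> a = j \<and> b = i
      then fsc (- c0 / 2) (\<Sum>z\<in>roots r. ?t z) else 0)" for a b
  proof -
    consider "a = i" "b = j" | "a = j" "b = i" | "\<not> (a = i \<and> b = j \<or> a = j \<and> b = i)" by blast
    then show ?thesis
    proof cases
      case 1
      then show ?thesis using ij
        by (auto simp: cc_def al_def be_def fsc.scale_sum_right intro!: sum.cong)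
    next
      case 2
      have "(\<Sum>z\<in>roots r. ?f j i z) = (\<Sum>z\<in>roots r. fsc (- c0 / 2) (?t (inverse z)))"
        using ij by (auto simp: cc_def al_def be_def rmat_swap[of i j] intro!: sum.cong)
      also have "\<dots> = (\<Sum>z\<in>roots r. fsc (- c0 / 2) (?t z))"
        by (rule sum_roots_inverse)
      finally show ?thesis using 2 by (simp add: fsc.scale_sum_right)
    next
      case 3
      then have "al a b z i * be a b z j = 0" for z using ij by (auto simp: al_def be_def)
      then have "(\<Sum>z\<in>roots r. ?f a b z) = 0" by (intro sum.neutral) (simp add: mult.assoc)
      then show ?thesis using 3 by auto
    qed
  qed
  have "(\<Sum>(a, b, z)\<in>Rf. ?f a b z)
      = (\<Sum>a<n. \<Sum>b<n. if a = i \<and> b = j \<or> a = j \<and> b = i then fsc (- c0 / 2) (\<Sum>z\<in>roots r. ?t z) else 0)"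
    unfolding sum_Rf 1 ..
  also have "\<dots> = (\<Sum>(a, b)\<in>{..<n} \<times> {..<n}. if (a, b) \<in> {(i, j), (j, i)} then fsc (- c0 / 2) (\<Sum>z\<in>roots r. ?t z) else 0)"
    by (simp add: sum.cartesian_product)
  also have "\<dots> = (\<Sum>(a, b)\<in>{(i, j), (j, i)}. fsc (- c0 / 2) (\<Sum>z\<in>roots r. ?t z))"
    by (rule sum.mono_neutral_cong_right) (use ij in auto)
  also have "\<dots> = fsc (- c0 / 2) (\<Sum>z\<in>roots r. ?t z) + fsc (- c0 / 2) (\<Sum>z\<in>roots r. ?t z)"
    using ij by (subst two) auto
  also have "\<dots> = fsc (- c0) (\<Sum>z\<in>roots r. ?t z)"
    by (simp only: fsc.scale_left_distrib[symmetric]) simp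
  also have "(\<Sum>z\<in>roots r. ?t z) = (\<Sum>l<r. ?t (zeta r ^ l))"
    by (rule sum_zeta_roots[OF r_pos, symmetric])
  also have "\<dots> = (\<Sum>l<r. fsc (zeta r powi (- int l)) (tw (refl_mat r n i j l) F))"
    using ij by (intro sum.cong) (auto simp: refl_mat_rmat power_int_minus)
  finally show ?thesis using ij by (simp add: Ko_def)
qed

text \<open>The diagonal reflections at \<open>i\<close> and the reflections exchanging \<open>i\<close> with another index
contribute; each of the latter occurs twice.\<close>

lemma Ko_diag:
  assumes i: "i < n"
  shows "Ko i i F = F - (\<Sum>l<r. fsc (gam (zeta r ^ l)) (tw (zeta_mat r n i (int l)) F))
    - fsc c0 (\<Sum>j\<in>{..<n} - {i}. \<Sum>l<r. tw (refl_mat r n i j l) F)"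
proof -
  let ?s = "\<lambda>b. \<Sum>z\<in>roots r. tw (rmat n i b z) F"
  let ?d = "\<Sum>z\<in>roots r. fsc (gam z) (tw (rmat n i i z) F)"
  let ?f = "\<lambda>a b z. fsc (cc a b z * al a b z i * be a b z i) (tw (rmat n a b z) F)"
  have diag: "(\<Sum>z\<in>roots r. ?f i i z) = ?d"
  proof (rule sum.cong)
    fix z assume "z \<in> roots r"
    show "?f i i z = fsc (gam z) (tw (rmat n i i z) F)"
      by (cases "z = 1") (auto simp: cc_def al_def be_def gam_1)
  qed simp
  have off1: "(\<Sum>z\<in>roots r. ?f i b z) = fsc (c0 / 2) (?s b)" if "b \<noteq> i" for b
    using that by (auto simp: cc_def al_def be_def fsc.scale_sum_right intro!: sum.cong)
  have off2: "(\<Sum>z\<in>roots r. ?f a i z) = fsc (c0 / 2) (?s a)" if a: "a \<noteq> i" for a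
  proof -
    have "(\<Sum>z\<in>roots r. ?f a i z) = (\<Sum>z\<in>roots r. fsc (c0 / 2) (tw (rmat n i a (inverse z)) F))"
      using a root_nonzero[OF r_pos]
      by (auto simp: cc_def al_def be_def rmat_swap[of i a] roots_def intro!: sum.cong)
    also have "\<dots> = (\<Sum>z\<in>roots r. fsc (c0 / 2) (tw (rmat n i a z) F))"
      by (rule sum_roots_inverse)
    finally show ?thesis by (simp add: fsc.scale_sum_right)
  qed
  have none: "(\<Sum>z\<in>roots r. ?f a b z) = 0" if "a \<noteq> i" "b \<noteq> i" for a b
    using that by (auto simp: al_def)
  have row: "(\<Sum>b<n. \<Sum>z\<in>roots r. ?f a b z) = (if a = i then ?d + (\<Sum>b\<in>{..<n} - {i}. fsc (c0 / 2) (?s b))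
      else fsc (c0 / 2) (?s a))" if "a < n" for a
  proof (cases "a = i")
    case True
    then show ?thesis using i diag off1 by (simp add: sum.remove[of "{..<n}" i])
  next
    case False
    then show ?thesis using i off2 none
      by (simp add: sum.remove[of "{..<n}" i] sum.neutral)
  qed
  have "(\<Sum>(a, b, z)\<in>Rf. ?f a b z)
      = ?d + (\<Sum>b\<in>{..<n} - {i}. fsc (c0 / 2) (?s b)) + (\<Sum>a\<in>{..<n} - {i}. fsc (c0 / 2) (?s a))"
    unfolding sum_Rf using i by (simp add: row sum.remove[of "{..<n}" i])
  also have "\<dots> = ?d + fsc c0 (\<Sum>b\<in>{..<n} - {i}. ?s b)"
    by (simp add: fsc.scale_sum_right add.assoc flip: sum.distrib fsc.scale_left_distrib)
  also have "?d = (\<Sum>l<r. fsc (gam (zeta r ^ l)) (tw (zeta_mat r n i (int l)) F))"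
    by (simp add: sum_zeta_roots[OF r_pos, symmetric] zeta_mat_rmat)
  also have "(\<Sum>b\<in>{..<n} - {i}. ?s b) = (\<Sum>j\<in>{..<n} - {i}. \<Sum>l<r. tw (refl_mat r n i j l) F)"
    using i by (intro sum.cong) (auto simp: sum_zeta_roots[OF r_pos, symmetric] refl_mat_rmat)
  finally show ?thesis by (simp add: Ko_def diff_diff_eq)
qed

text \<open>Connects the commutators found from the Leibniz rule with the presentation: the idempotents
\<open>e\<^sub>i\<^sub>j\<close> are expanded, and sums over powers of \<open>\<zeta>\<close> are sums over all roots of unity.\<close>

lemma act_Kp:
  assumes "i < n" "j < n"
  shows "act (Kp i j) F = Ko i j F"
proof (cases "i = j")
  case False
  then show ?thesis using assms by (simp add: Kp_def act_simps Ko_offdiag)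
next
  case True
  have "(\<Sum>j<r. act (const (dd (int j) - dd (int j - 1)) * ee i j) F)
      = (\<Sum>j<r. \<Sum>l<r. fsc ((dd (int j) - dd (int j - 1)) * (1 / of_nat r) * zeta r powi (- (int l * int j)))
          (tw (zeta_mat r n i (int l)) F))"
    by (simp add: ee_def act_simps fsc.scale_sum_right mult.assoc)
  also have "\<dots> = (\<Sum>l<r. \<Sum>j<r. fsc ((dd (int j) - dd (int j - 1)) * (1 / of_nat r) * zeta r powi (- (int l * int j)))
          (tw (zeta_mat r n i (int l)) F))"
    by (rule sum.swap)
  also have "\<dots> = (\<Sum>l<r. fsc (gam (zeta r ^ l)) (tw (zeta_mat r n i (int l)) F))"
  proof (rule sum.cong[OF refl])
    fix l
    have "zeta r powi (- (int l * int j)) = inverse (zeta r ^ l) ^ j" for j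
      by (simp add: power_int_minus power_inverse flip: power_mult of_nat_mult)
    then show "(\<Sum>j<r. fsc ((dd (int j) - dd (int j - 1)) * (1 / of_nat r) * zeta r powi (- (int l * int j)))
          (tw (zeta_mat r n i (int l)) F)) = fsc (gam (zeta r ^ l)) (tw (zeta_mat r n i (int l)) F)"
      by (simp add: gam_def sum_distrib_left mult_ac flip: fsc.scale_sum_left)
  qed
  finally show ?thesis using assms True by (simp add: Kp_def act_simps Ko_diag)
qed

end

section \<open>The model is the standard module\<close>

context cherednik_rep
begin

interpretation FF: ring FF by (rule FF_ring)

lemma Grp_entry:
  assumes "w \<in> Grp r n" "i < n" "j < n"
  shows "w $$ (i, j) = (if i = pm n w j then ph n w j else 0)"
  by (subst GrpD(3)[OF r_pos assms(1)]) (simp add: assms)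

lemma Grp_inverse_entry:
  assumes w: "w \<in> Grp r n" and w': "w' \<in> Grp r n" and inv: "w * w' = 1\<^sub>m n" and ij: "i < n" "j < n"
  shows "w' $$ (j, i) = (if i = pm n w j then inverse (ph n w j) else 0)"
proof -
  have one: "pm n (1\<^sub>m n) k = k" "ph n (1\<^sub>m n) k = 1" for k
    unfolding mono_mat_one by (simp_all add: pm_mono_mat ph_mono_mat permutes_id)
  have 1: "pm n w (pm n w' k) = k" and 2: "ph n w (pm n w' k) * ph n w' k = 1" for k
    using Grp_mult(2,3)[OF r_pos w w', where j = k] unfolding inv one by simp_all
  have inj: "pm n w a = pm n w b \<longleftrightarrow> a = b" for a b
    using permutes_inj[OF GrpD(1)[OF r_pos w]] by (auto dest: injD)
  have 3: "j = pm n w' i \<longleftrightarrow> i = pm n w j" using 1[of i] inj by metis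
  show ?thesis
    using Grp_entry[OF w' ij(2,1)] 3 inverse_unique[OF 2[of i]] by auto
qed

lemma sum_const_delta: "k < n \<Longrightarrow> (\<Sum>i<n. const (if i = k then c else 0) * g i) = const c * g k"
  by (subst sum.remove[of _ k]) auto

lemma pm_lt: "w \<in> Grp r n \<Longrightarrow> j < n \<Longrightarrow> pm n w j < n"
  using permutes_lt[OF GrpD(1)[OF r_pos]] by blast

lemma sum_inverse_X:
  assumes "w \<in> Grp r n" "w' \<in> Grp r n" "w * w' = 1\<^sub>m n" "j < n"
  shows "(\<Sum>i<n. const (w' $$ (j, i)) * X i) = const (inverse (ph n w j)) * X (pm n w j)"
  using sum_const_delta[of "pm n w j" "inverse (ph n w j)" X] Grp_inverse_entry[OF assms(1-3) _ assms(4)]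
    pm_lt[OF assms(1,4)] by simp

lemma sum_entry_Y:
  assumes "w \<in> Grp r n" "j < n"
  shows "(\<Sum>i<n. const (w $$ (i, j)) * Y i) = const (ph n w j) * Y (pm n w j)"
  using sum_const_delta[of "pm n w j" "ph n w j" Y] Grp_entry[OF assms(1) _ assms(2)]
    pm_lt[OF assms] by simp

definition YX_rel :: "nat \<Rightarrow> nat \<Rightarrow> word_poly"
  where "YX_rel i j = Y i * X j - (X j * Y i + Kp i j)"

text \<open>The two kinds of mixed relations are treated together through \<^const>\<open>Kp\<close>.\<close>

lemma relators_cases:
  assumes "p \<in> relators"
  obtains (XX) i j where "i < n" "j < n" "p = X i * X j - X j * X i"
  | (YY) i j where "i < n" "j < n" "p = Y i * Y j - Y j * Y i"
  | (TT) w w' where "w \<in> Grp r n" "w' \<in> Grp r n" "p = T\<^sub>g w * T\<^sub>g w' - T\<^sub>g (w * w')"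
  | (one) "p = T\<^sub>g (1\<^sub>m n) - 1"
  | (TX) w w' j where "w \<in> Grp r n" "w' \<in> Grp r n" "w * w' = 1\<^sub>m n" "j < n"
      "p = T\<^sub>g w * X j - (\<Sum>i<n. const (w' $$ (j, i)) * X i) * T\<^sub>g w"
  | (TY) w j where "w \<in> Grp r n" "j < n" "p = T\<^sub>g w * Y j - (\<Sum>i<n. const (w $$ (i, j)) * Y i) * T\<^sub>g w"
  | (YX) i j where "i < n" "j < n" "p = YX_rel i j"
proof -
  have diag: "Y i * X i - (X i * Y i + 1
        - (\<Sum>j<r. const (dd (int j) - dd (int j - 1)) * ee i j)
        - const c0 * (\<Sum>j\<in>{..<n} - {i}. \<Sum>l<r. T\<^sub>g (refl_mat r n i j l))) = YX_rel i i" for i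
    by (simp add: YX_rel_def Kp_def algebra_simps)
  have off: "Y i * X j - (X j * Y i + const c0 *
      (\<Sum>l<r. const (zeta r powi (- int l)) * T\<^sub>g (refl_mat r n i j l))) = YX_rel i j" if "i \<noteq> j" for i j
    using that by (simp add: YX_rel_def Kp_def)
  show ?thesis
    using assms unfolding relators_def
    apply (elim UnE)
    subgoal using XX by auto
    subgoal using YY by auto
    subgoal using TT by auto
    subgoal using one by auto
    subgoal using TX by auto
    subgoal using TY by auto
    subgoal using YX off by auto
    subgoal using YX diag by auto
    done
qed

lemma YX_rel_relator:
  assumes "i < n" "j < n"
  shows "YX_rel i j \<in> relators"
proof (cases "i = j")
  case True
  have "YX_rel i i = Y i * X i - (X i * Y i + 1
        - (\<Sum>j<r. const (dd (int j) - dd (int j - 1)) * ee i j)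
        - const c0 * (\<Sum>j\<in>{..<n} - {i}. \<Sum>l<r. T\<^sub>g (refl_mat r n i j l)))"
    by (simp add: YX_rel_def Kp_def algebra_simps)
  then show ?thesis using assms True unfolding relators_def by blast
next
  case False
  then have "YX_rel i j = Y i * X j - (X j * Y i + const c0 *
      (\<Sum>l<r. const (zeta r powi (- int l)) * T\<^sub>g (refl_mat r n i j l)))"
    by (simp add: YX_rel_def Kp_def)
  then show ?thesis using assms False unfolding relators_def by blast
qed

lemma FF_Kp: "i < n \<Longrightarrow> Kp i j \<in> carrier FF" if "j < n"
  using that unfolding Kp_def ee_def
  by (auto intro!: FF_intros refl_in_Grp zeta_in_Grp)

lemma relators_sub: "relators \<subseteq> carrier FF"
proof
  fix p assume "p \<in> relators"
  then show "p \<in> carrier FF"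
    by (cases rule: relators_cases)
      (auto intro!: FF_intros FF_Kp Grp_mult(1) Grp_one r_pos simp: YX_rel_def)
qed

text \<open>Every defining relation has been proved above as an identity between operators on \<open>V\<close>.\<close>

lemma act_relator:
  assumes "p \<in> relators" "F \<in> V"
  shows "act p F = 0"
  using assms(1)
proof (cases rule: relators_cases)
  case (XX i j)
  then show ?thesis by (simp add: act_simps xo_commute)
next
  case (YY i j)
  then show ?thesis using yo_commute[OF assms(2), of i j] by (simp add: act_simps)
next
  case (TT w w')
  then show ?thesis by (simp add: act_simps tw_mult assms(2))
next
  case one
  then show ?thesis by (simp add: act_simps tw_one assms(2))
next
  case (TX w w' j)
  then show ?thesis by (simp add: sum_inverse_X act_simps tw_xo)
next
  case (TY w j)
  then show ?thesis by (simp add: sum_entry_Y act_simps tw_yo assms(2))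
next
  case (YX i j)
  then show ?thesis by (simp add: YX_rel_def act_simps act_Kp yo_xo)
qed

abbreviation "II \<equiv> genideal FF relators"

lemma ideal_II: "ideal II FF"
  by (rule FF.genideal_ideal[OF relators_sub])

text \<open>The elements annihilating \<open>V\<close> form an ideal because \<open>V\<close> is stable.\<close>

lemma act_II:
  assumes "p \<in> II" "F \<in> V"
  shows "act p F = 0"
proof -
  let ?A = "{p \<in> carrier FF. \<forall>F\<in>V. act p F = 0}"
  have "ideal ?A FF"
  proof (rule idealI[OF FF_ring])
    show "subgroup ?A (add_monoid FF)"
    proof (rule FF.add.subgroupI)
      show "?A \<noteq> {}" using FF_0 by auto
    qed (auto simp: FF_add act_add FF_uminus_eq FF_uminus act_uminus)
  qed (auto simp: FF_mult act_mult lin_zero[OF flin_act] V_act)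
  moreover have "relators \<subseteq> ?A" using relators_sub act_relator by auto
  ultimately have "II \<subseteq> ?A" by (rule FF.genideal_minimal)
  then show ?thesis using assms by auto
qed

subsection \<open>The algebra as a quotient\<close>

lemma ring_HH: "ring HH"
  unfolding HH_def by (rule ideal.quotient_is_ring[OF ideal_II])

lemma hcl_hom_ring: "ring_hom_ring FF HH hcl"
  using ideal.rcos_ring_hom_ring[OF ideal_II] unfolding HH_def hcl_def[abs_def] .

interpretation HH: ring HH by (rule ring_HH)

interpretation hh: ring_hom_ring FF HH hcl
  by (rule hcl_hom_ring)

lemma hcl_closed: "p \<in> carrier FF \<Longrightarrow> hcl p \<in> carrier HH"
  and hcl_add: "p \<in> carrier FF \<Longrightarrow> q \<in> carrier FF \<Longrightarrow> hcl (p + q) = hcl p \<oplus>\<^bsub>HH\<^esub> hcl q"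
  and hcl_mult: "p \<in> carrier FF \<Longrightarrow> q \<in> carrier FF \<Longrightarrow> hcl (p * q) = hcl p \<otimes>\<^bsub>HH\<^esub> hcl q"
  and hcl_1: "hcl 1 = \<one>\<^bsub>HH\<^esub>" and hcl_0: "hcl 0 = \<zero>\<^bsub>HH\<^esub>"
  and hcl_uminus: "p \<in> carrier FF \<Longrightarrow> hcl (- p) = \<ominus>\<^bsub>HH\<^esub> hcl p"
  using hh.hom_closed hh.hom_add[of p q] hh.hom_mult[of p q] hh.hom_one hh.hom_zero hh.hom_a_inv[of p]
  by (simp_all add: FF_uminus_eq)

lemma carrier_HH: "carrier HH = hcl ` carrier FF"
  by (auto simp: HH_def FactRing_def A_RCOSETS_def' hcl_def)

lemma hcl_eq_iff:
  assumes "p \<in> carrier FF" "q \<in> carrier FF"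
  shows "hcl p = hcl q \<longleftrightarrow> p - q \<in> II"
proof -
  interpret II: ideal II FF by (rule ideal_II)
  have "hcl p = hcl q \<longleftrightarrow> p \<in> II +>\<^bsub>FF\<^esub> q"
    unfolding hcl_def using II.a_repr_independenceD[OF assms(1), of q] II.a_repr_independence'[OF _ assms(2), of p]
    by metis
  then show ?thesis using II.a_rcos_module_minus[OF FF_ring assms(2,1)] by (simp add: FF_minus_eq assms)
qed

text \<open>The action descends to the Cherednik algebra.\<close>

lemma hcl_act: "p \<in> carrier FF \<Longrightarrow> q \<in> carrier FF \<Longrightarrow> hcl p = hcl q \<Longrightarrow> F \<in> V \<Longrightarrow> act p F = act q F"
  using act_II[of "p - q" F] by (simp add: hcl_eq_iff act_minus)

lemma hcl_relator: "p \<in> carrier FF \<Longrightarrow> q \<in> carrier FF \<Longrightarrow> p - q \<in> relators \<Longrightarrow> hcl p = hcl q"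
  using FF.genideal_self[OF relators_sub] by (auto simp: hcl_eq_iff)

lemma hcl_XX:
  assumes "i < n" "j < n"
  shows "hcl (X i * X j) = hcl (X j * X i)"
proof (rule hcl_relator)
  show "X i * X j - X j * X i \<in> relators"
    using assms unfolding relators_def by blast
qed (intro FF_intros assms)+

lemma hcl_YX: "i < n \<Longrightarrow> j < n \<Longrightarrow> hcl (Y i * X j) = hcl (X j * Y i + Kp i j)"
  using YX_rel_relator[of i j] unfolding YX_rel_def
  by (intro hcl_relator FF_add FF_mult FF_X FF_Y FF_Kp) simp_all

lemma Grp_inverse_ex:
  assumes w: "w \<in> Grp r n"
  shows "\<exists>w'\<in>Grp r n. w * w' = 1\<^sub>m n"
proof -
  note W = GrpD[OF r_pos w]
  let ?\<pi> = "inv_into UNIV (pm n w)"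
  have perm: "?\<pi> permutes {..<n}" by (rule permutes_inv[OF W(1)])
  let ?w = "mono_mat n ?\<pi> (\<lambda>j. inverse (ph n w (?\<pi> j)))"
  have nz: "ph n w j \<noteq> 0" for j using W(2) root_nonzero[OF r_pos] by blast
  have "?w \<in> Grp r n"
    by (rule GrpI[OF r_pos perm]) (simp add: power_inverse W(2))
  moreover have "mono_mat n (pm n w) (ph n w) * ?w = 1\<^sub>m n"
    unfolding mono_mat_mult[OF perm] mono_mat_one
    by (rule mono_mat_cong) (use nz permutes_inv_o(1)[OF W(1)] in \<open>auto simp: fun_eq_iff\<close>)
  ultimately show ?thesis using W(3) by auto
qed

lemma hcl_TX:
  assumes w: "w \<in> Grp r n" and j: "j < n"
  shows "hcl (T\<^sub>g w * X j) = hcl (const (inverse (ph n w j)) * X (pm n w j) * T\<^sub>g w)"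
proof -
  obtain w' where w': "w' \<in> Grp r n" "w * w' = 1\<^sub>m n" using Grp_inverse_ex[OF w] by blast
  have "T\<^sub>g w * X j - (\<Sum>i<n. const (w' $$ (j, i)) * X i) * T\<^sub>g w \<in> relators"
    using w w' j unfolding relators_def by blast
  then show ?thesis unfolding sum_inverse_X[OF w w' j]
    by (rule hcl_relator[rotated 2]) (auto intro!: FF_intros w j pm_lt)
qed

subsection \<open>Families over the algebra\<close>

abbreviation "FM \<equiv> fun_module HH ST"

lemma FM_simps: "carrier FM = (\<Pi>\<^sub>E i\<in>ST. carrier HH)"
  "f \<oplus>\<^bsub>FM\<^esub> g = (\<lambda>i\<in>ST. f i \<oplus>\<^bsub>HH\<^esub> g i)" "\<zero>\<^bsub>FM\<^esub> = (\<lambda>i\<in>ST. \<zero>\<^bsub>HH\<^esub>)"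
  "a \<odot>\<^bsub>FM\<^esub> f = (\<lambda>i\<in>ST. a \<otimes>\<^bsub>HH\<^esub> f i)"
  by (simp_all add: fun_module_def)

lemma PiE_HH: "f \<in> ST \<rightarrow>\<^sub>E carrier HH \<Longrightarrow> i \<in> ST \<Longrightarrow> f i \<in> carrier HH"
  by auto

lemma lmodule_FM: "lmodule HH FM"
proof (intro lmodule.intro lmodule_axioms.intro ring_HH)
  show "abelian_group FM"
  proof (rule abelian_groupI)
    fix f assume f: "f \<in> carrier FM"
    have fi: "f i \<in> carrier HH" if "i \<in> ST" for i
      using f that by (auto simp: FM_simps)
    show "\<exists>g\<in>carrier FM. g \<oplus>\<^bsub>FM\<^esub> f = \<zero>\<^bsub>FM\<^esub>"
      by (rule bexI[of _ "\<lambda>i\<in>ST. \<ominus>\<^bsub>HH\<^esub> f i"])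
        (auto simp: FM_simps fi HH.l_neg cong: restrict_cong)
  qed (auto simp: FM_simps PiE_HH HH.a_ac PiE_restrict cong: restrict_cong)
qed (auto simp: FM_simps PiE_HH HH.l_distr HH.r_distr HH.m_assoc PiE_restrict intro!: restrict_ext
    cong: restrict_cong)

interpretation FM: lmodule HH FM by (rule lmodule_FM)

text \<open>Elements of the induced module are represented by families of elements of the free algebra;
\<open>fam\<close> passes to classes componentwise, so that calculations can take place in the free algebra.\<close>

definition fam :: "(tableau \<Rightarrow> word_poly) \<Rightarrow> tableau \<Rightarrow> rca_elem"
  where "fam P = (\<lambda>T\<in>ST. hcl (P T))"

lemma fam_closed: "(\<And>T. P T \<in> carrier FF) \<Longrightarrow> fam P \<in> carrier FM"
  by (auto simp: FM_simps fam_def hcl_closed)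

lemma fam_add: "(\<And>T. P T \<in> carrier FF) \<Longrightarrow> (\<And>T. Q T \<in> carrier FF) \<Longrightarrow> fam P \<oplus>\<^bsub>FM\<^esub> fam Q = fam (\<lambda>T. P T + Q T)"
  by (auto simp: FM_simps fam_def hcl_add intro!: restrict_ext)

lemma fam_smult: "(\<And>T. P T \<in> carrier FF) \<Longrightarrow> p \<in> carrier FF \<Longrightarrow> hcl p \<odot>\<^bsub>FM\<^esub> fam P = fam (\<lambda>T. p * P T)"
  by (auto simp: FM_simps fam_def hcl_mult intro!: restrict_ext)

lemma fam_zero: "fam (\<lambda>T. 0) = \<zero>\<^bsub>FM\<^esub>"
  by (simp add: FM_simps fam_def hcl_0)

lemma fam_minus:
  assumes "\<And>T. P T \<in> carrier FF" "\<And>T. Q T \<in> carrier FF"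
  shows "fam P \<ominus>\<^bsub>FM\<^esub> fam Q = fam (\<lambda>T. P T - Q T)"
proof -
  have m: "(\<lambda>T. - Q T) \<in> UNIV \<rightarrow> carrier FF" using assms FF_uminus by auto
  have "fam (\<lambda>T. - Q T) \<oplus>\<^bsub>FM\<^esub> fam Q = \<zero>\<^bsub>FM\<^esub>"
    using assms by (simp add: fam_add FF_uminus fam_zero)
  then have "\<ominus>\<^bsub>FM\<^esub> fam Q = fam (\<lambda>T. - Q T)"
    using assms by (intro FM.M.minus_equality) (auto intro: fam_closed FF_uminus)
  then show ?thesis using assms by (simp add: a_minus_def fam_add FF_uminus)
qed

lemma fam_surj:
  assumes "f \<in> carrier FM"
  obtains P where "\<And>T. P T \<in> carrier FF" "f = fam P"
proof -
  have "\<forall>T. \<exists>p\<in>carrier FF. T \<in> ST \<longrightarrow> f T = hcl p"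
    using assms FF_0 by (auto simp: FM_simps carrier_HH PiE_def Pi_def image_iff)
  then obtain P where P: "\<And>T. P T \<in> carrier FF" "\<And>T. T \<in> ST \<Longrightarrow> f T = hcl (P T)"
    by metis
  have "f = fam P"
    using assms P(2) by (auto simp: FM_simps fam_def PiE_def extensional_def fun_eq_iff)
  then show ?thesis using P(1) that by blast
qed

lemma tensor_fam: "p \<in> carrier FF \<Longrightarrow> tensor (hcl p) f = fam (\<lambda>T. p * const (f T))"
  by (auto simp: tensor_def fam_def hcl_mult FF_const intro!: restrict_ext)

definition ind_gens :: "(tableau \<Rightarrow> rca_elem) set"
  where "ind_gens = {tensor (h \<otimes>\<^bsub>HH\<^esub> hcl (T\<^sub>g w)) f \<ominus>\<^bsub>FM\<^esub> tensor h (rho w f) |h w f.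
        h \<in> carrier HH \<and> w \<in> Grp r n \<and> f \<in> carrier SS}
     \<union> {tensor (h \<otimes>\<^bsub>HH\<^esub> hcl (Y i)) f |h i f. h \<in> carrier HH \<and> i < n \<and> f \<in> carrier SS}"

text \<open>The generators of the relations in terms of representatives; every element of the algebra is a
class of some \<open>p\<close>.\<close>

lemma ind_gens_fam: "g \<in> ind_gens \<longleftrightarrow>
    (\<exists>p\<in>carrier FF. \<exists>w\<in>Grp r n. \<exists>f\<in>Ssp.
      g = fam (\<lambda>T. p * T\<^sub>g w * const (f T) - p * const (rho w f T))) \<or>
    (\<exists>p\<in>carrier FF. \<exists>i\<in>{..<n}. \<exists>f\<in>Ssp. g = fam (\<lambda>T. p * Y i * const (f T)))"
proof -
  have 1: "tensor (hcl p \<otimes>\<^bsub>HH\<^esub> hcl (T\<^sub>g w)) f \<ominus>\<^bsub>FM\<^esub> tensor (hcl p) (rho w f)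
      = fam (\<lambda>T. p * T\<^sub>g w * const (f T) - p * const (rho w f T))"
    if "p \<in> carrier FF" "w \<in> Grp r n" for p w f
    using that by (simp add: hcl_mult[symmetric] tensor_fam fam_minus FF_intros)
  have 2: "tensor (hcl p \<otimes>\<^bsub>HH\<^esub> hcl (Y i)) f = fam (\<lambda>T. p * Y i * const (f T))"
    if "p \<in> carrier FF" "i \<in> {..<n}" for p i f
    using that by (simp add: hcl_mult[symmetric] tensor_fam FF_intros)
  have "g \<in> ind_gens \<longleftrightarrow>
      (\<exists>p\<in>carrier FF. \<exists>w\<in>Grp r n. \<exists>f\<in>Ssp.
        g = tensor (hcl p \<otimes>\<^bsub>HH\<^esub> hcl (T\<^sub>g w)) f \<ominus>\<^bsub>FM\<^esub> tensor (hcl p) (rho w f)) \<or>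
      (\<exists>p\<in>carrier FF. \<exists>i\<in>{..<n}. \<exists>f\<in>Ssp. g = tensor (hcl p \<otimes>\<^bsub>HH\<^esub> hcl (Y i)) f)"
    unfolding ind_gens_def carrier_HH carrier_SS by blast
  then show ?thesis using 1 2 by (simp cong: bex_cong del: lessThan_iff)
qed

lemma ind_gens_closed: "ind_gens \<subseteq> carrier FM"
  by (auto simp: ind_gens_fam intro!: fam_closed FF_intros)

lemma ind_relations_eq: "ind_relations = gen_submodule HH FM ind_gens"
  by (simp add: ind_relations_def ind_gens_def)

lemma submodule_ind_relations: "submodule ind_relations HH FM"
  unfolding ind_relations_eq by (rule FM.gen_submodule_submodule[OF ind_gens_closed])

interpretation MQ: lmodule_quotient HH FM ind_relations
  by (intro lmodule_quotient.intro lmodule_FM lmodule_quotient_axioms.intro submodule_ind_relations)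

lemma lmodule_MM: "lmodule HH MM"
  unfolding MM_def by (rule MQ.quotient_lmodule)

lemma mcl_closed: "f \<in> carrier FM \<Longrightarrow> mcl f \<in> carrier MM"
  and mcl_add: "f \<in> carrier FM \<Longrightarrow> g \<in> carrier FM \<Longrightarrow> mcl f \<oplus>\<^bsub>MM\<^esub> mcl g = mcl (f \<oplus>\<^bsub>FM\<^esub> g)"
  and mcl_smult: "h \<in> carrier HH \<Longrightarrow> f \<in> carrier FM \<Longrightarrow> h \<odot>\<^bsub>MM\<^esub> mcl f = mcl (h \<odot>\<^bsub>FM\<^esub> f)"
  and mcl_zero: "\<zero>\<^bsub>MM\<^esub> = mcl \<zero>\<^bsub>FM\<^esub>"
  and mcl_eq: "f \<in> carrier FM \<Longrightarrow> g \<in> carrier FM \<Longrightarrow> mcl f = mcl g \<longleftrightarrow> f \<ominus>\<^bsub>FM\<^esub> g \<in> ind_relations"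
  and carrier_MM: "carrier MM = mcl ` carrier FM"
  unfolding MM_def mcl_def[abs_def]
  using MQ.cl_closed MQ.add_quot MQ.smult_quot MQ.zero_quot MQ.cl_eq MQ.carrier_quot by auto

lemma mcl_gens: "g \<in> ind_gens \<Longrightarrow> mcl g = \<zero>\<^bsub>MM\<^esub>"
proof -
  assume g: "g \<in> ind_gens"
  then have g: "g \<in> ind_relations" "g \<in> carrier FM"
    using FM.gen_submodule_superset ind_gens_closed unfolding ind_relations_eq by blast+
  have "\<ominus>\<^bsub>FM\<^esub> \<zero>\<^bsub>FM\<^esub> = \<zero>\<^bsub>FM\<^esub>" by (rule FM.M.minus_equality) auto
  then have "g \<ominus>\<^bsub>FM\<^esub> \<zero>\<^bsub>FM\<^esub> = g" using \<open>g \<in> carrier FM\<close> by (simp only: a_minus_def FM.M.r_zero)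
  then show ?thesis
    using mcl_eq[OF g(2) FM.M.zero_closed] g(1) by (simp only: mcl_zero)
qed

end

context cherednik_rep
begin

interpretation FF: ring FF by (rule FF_ring)
interpretation HH: ring HH by (rule ring_HH)
interpretation FM: lmodule HH FM by (rule lmodule_FM)
interpretation MM: lmodule HH MM by (rule lmodule_MM)

subsection \<open>Polynomials inside the algebra\<close>

text \<open>Polynomials are written with the variables in increasing order; a section of the algebra map from
the free algebra to polynomials, multiplicative only modulo the relations (\<open>hcl_emb_var\<close>).\<close>

definition emb :: "mpoly \<Rightarrow> word_poly"
  where "emb = lext (\<lambda>m. xmon (lookup m))"

lemma plin_emb: "plin emb"
  unfolding emb_def by (rule plin_lext)

lemma FF_power: "p \<in> carrier FF \<Longrightarrow> p ^ k \<in> carrier FF"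
  by (induction k) (auto intro: FF_1 FF_mult)

lemma FF_prod_list: "(\<And>p. p \<in> set ps \<Longrightarrow> p \<in> carrier FF) \<Longrightarrow> prod_list ps \<in> carrier FF"
  by (induction ps) (auto intro: FF_1 FF_mult)

lemma FF_xmon: "xmon \<mu> \<in> carrier FF"
  unfolding xmon_def by (rule FF_prod_list) (auto intro!: FF_power FF_X)

lemma FF_psc: "p \<in> carrier FF \<Longrightarrow> psc c p \<in> carrier FF"
  by (simp add: psc_const FF_mult FF_const)

lemma FF_emb: "emb f \<in> carrier FF"
  unfolding emb_def lext_def by (intro FF_sum FF_psc FF_xmon)

lemma hcl_mult_cong:
  "p \<in> carrier FF \<Longrightarrow> p' \<in> carrier FF \<Longrightarrow> q \<in> carrier FF \<Longrightarrow> q' \<in> carrier FF \<Longrightarrow>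
    hcl p = hcl p' \<Longrightarrow> hcl q = hcl q' \<Longrightarrow> hcl (p * q) = hcl (p' * q')"
  by (simp add: hcl_mult)

lemma hcl_X_power: "i < n \<Longrightarrow> k < n \<Longrightarrow> hcl (X k * X i ^ e) = hcl (X i ^ e * X k)"
proof (induction e)
  case (Suc e)
  note m = FF_X[OF Suc(2)] FF_X[OF Suc(3)] FF_power[OF FF_X[OF Suc(2)], of e]
  have "hcl (X k * (X i * X i ^ e)) = hcl ((X k * X i) * X i ^ e)" by (simp add: mult.assoc)
  also have "\<dots> = hcl ((X i * X k) * X i ^ e)"
    by (intro hcl_mult_cong hcl_XX FF_mult m Suc refl)
  also have "\<dots> = hcl (X i * (X k * X i ^ e))" by (simp add: mult.assoc)
  also have "\<dots> = hcl (X i * (X i ^ e * X k))"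
    by (rule hcl_mult_cong) (intro FF_mult m | rule Suc(1)[OF Suc(2,3)] refl)+
  finally show ?case by (simp add: mult.assoc)
qed simp

text \<open>Since the \<open>x\<^sub>i\<close> commute modulo the relations, a further factor can be moved to its place.\<close>

lemma hcl_X_prod:
  assumes "k < n" "distinct is" "k \<in> set is" "set is \<subseteq> {..<n}"
  shows "hcl (X k * prod_list (map (\<lambda>i. X i ^ \<mu> i) is)) = hcl (prod_list (map (\<lambda>i. X i ^ (\<mu>(k := Suc (\<mu> k))) i) is))"
  using assms(2-)
proof (induction "is")
  case (Cons i "is")
  let ?p = "\<lambda>\<mu>. prod_list (map (\<lambda>i. X i ^ \<mu> i) is)"
  have p: "?p \<nu> \<in> carrier FF" for \<nu>
    using Cons(4) by (intro FF_prod_list) (auto intro!: FF_power FF_X)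
  have i: "i < n" using Cons by auto
  show ?case
  proof (cases "i = k")
    case True
    have e: "map (\<lambda>i. X i ^ (\<mu>(k := Suc (\<mu> k))) i) is = map (\<lambda>i. X i ^ \<mu> i) is"
      by (rule map_cong) (use Cons True in auto)
    then show ?thesis unfolding True list.map prod_list.Cons e by (simp add: mult.assoc)
  next
    case False
    have "hcl (X k * (X i ^ \<mu> i * ?p \<mu>)) = hcl ((X k * X i ^ \<mu> i) * ?p \<mu>)" by (simp add: mult.assoc)
    also have "\<dots> = hcl ((X i ^ \<mu> i * X k) * ?p \<mu>)"
      by (intro hcl_mult_cong hcl_X_power FF_mult FF_X FF_power p i assms(1) refl)
    also have "\<dots> = hcl (X i ^ \<mu> i * (X k * ?p \<mu>))" by (simp add: mult.assoc)
    also have "\<dots> = hcl (X i ^ \<mu> i * ?p (\<mu>(k := Suc (\<mu> k))))"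
    proof (intro hcl_mult_cong FF_mult FF_X FF_power p i assms(1) refl)
      show "hcl (X k * ?p \<mu>) = hcl (?p (\<mu>(k := Suc (\<mu> k))))"
        using Cons False by simp
    qed
    finally show ?thesis using False by simp
  qed
qed simp

lemma hcl_xmon:
  assumes "k < n"
  shows "hcl (xmon (lookup (m + Poly_Mapping.single k 1))) = hcl (X k * xmon (lookup m))"
proof -
  have "lookup (m + Poly_Mapping.single k 1) = (lookup m)(k := Suc (lookup m k))"
    by (auto simp: lookup_add lookup_single when_def fun_eq_iff)
  moreover have "set [0..<n] \<subseteq> {..<n}" by auto
  ultimately show ?thesis
    unfolding xmon_def using hcl_X_prod[OF assms distinct_upt, where \<mu> = "lookup m"] assms by simp
qed

lemma hcl_emb_var:
  assumes k: "k < n"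
  shows "hcl (emb (var k * f)) = hcl (X k * emb f)"
proof (induction f rule: pm_induct)
  case (single m c)
  have e: "emb (Poly_Mapping.single m c) = const c * xmon (lookup m)" for m c
    by (simp add: emb_def psc_const)
  have "var k * Poly_Mapping.single m c = Poly_Mapping.single (m + Poly_Mapping.single k 1) c"
    by (simp add: var_def mult_single add.commute)
  then have "hcl (emb (var k * Poly_Mapping.single m c)) = hcl (const c * xmon (lookup (m + Poly_Mapping.single k 1)))"
    by (simp only: e)
  also have "\<dots> = hcl (const c * (X k * xmon (lookup m)))"
    by (intro hcl_mult_cong hcl_xmon k FF_const FF_xmon FF_mult FF_X refl)
  also have "\<dots> = hcl (X k * (const c * xmon (lookup m)))"
    by (metis const_commute mult.assoc)
  finally show ?case by (simp only: e)
next
  case (add f g)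
  then show ?case using k
    by (simp add: distrib_left lin_add[OF plin_emb] hcl_add FF_emb FF_mult FF_X)
qed

subsection \<open>The isomorphism\<close>

text \<open>The identification of the model with the standard module: the polynomial \<open>f\<close> with value \<open>v\<^sub>T\<close>
corresponds to \<open>f \<otimes> v\<^sub>T\<close>.\<close>

definition psi :: "(tableau \<Rightarrow> mpoly) \<Rightarrow> std_elem"
  where "psi F = mcl (fam (\<lambda>T. emb (F T)))"

lemma psi_closed: "psi F \<in> carrier MM"
  unfolding psi_def by (intro mcl_closed fam_closed FF_emb)

lemma psi_add: "psi (F + G) = psi F \<oplus>\<^bsub>MM\<^esub> psi G"
  by (simp add: psi_def mcl_add fam_closed FF_emb fam_add fapp lin_add[OF plin_emb])

lemma hcl_psi:
  assumes "p \<in> carrier FF"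
  shows "hcl p \<odot>\<^bsub>MM\<^esub> psi F = mcl (fam (\<lambda>T. p * emb (F T)))"
  using assms by (simp add: psi_def mcl_smult fam_closed FF_emb fam_smult hcl_closed)

lemma psi_fsc: "psi (fsc c F) = hcl (const c) \<odot>\<^bsub>MM\<^esub> psi F"
  unfolding hcl_psi[OF FF_const] by (simp add: psi_def fapp lin_scale[OF plin_emb] psc_const)

lemma fam_cong: "(\<And>T. hcl (P T) = hcl (Q T)) \<Longrightarrow> fam P = fam Q"
  by (simp add: fam_def)

lemma psi_xo: "k < n \<Longrightarrow> psi (xo k F) = hcl (X k) \<odot>\<^bsub>MM\<^esub> psi F"
  unfolding hcl_psi[OF FF_X] unfolding psi_def xo_def
  by (rule arg_cong[where f = mcl], rule fam_cong) (rule hcl_emb_var)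

lemma psi_0: "psi 0 = \<zero>\<^bsub>MM\<^esub>"
  by (simp add: psi_def fapp lin_zero[OF plin_emb] fam_zero mcl_zero)

lemma emb_const: "emb (psc c 1) = const c"
proof -
  have "xmon (lookup 0) = 1"
    unfolding xmon_def by (induction "[0..<n]" arbitrary: rule: list.induct) (simp_all add: map_replicate_const)
  moreover have "psc c (1 :: mpoly) = Poly_Mapping.single 0 c" by (metis mult_1_right psc_single single_one)
  moreover have "emb (Poly_Mapping.single 0 c) = psc c (xmon (lookup 0))" by (simp only: emb_def lext_single)
  ultimately show ?thesis by (simp add: psc_const)
qed

lemma psi_const: "psi (pt 1 u) = mcl (fam (\<lambda>T. const (u T)))"
  by (simp add: psi_def pt_def emb_const)

text \<open>The elements of the free algebra that \<open>psi\<close> intertwines. They are closed under sums and products,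
so it is enough to treat the generators.\<close>

definition good :: "word_poly \<Rightarrow> bool"
  where "good p \<longleftrightarrow> p \<in> carrier FF \<and> (\<forall>F\<in>V. psi (act p F) = hcl p \<odot>\<^bsub>MM\<^esub> psi F)"

lemma good_const: "good (const c)"
  by (simp add: good_def FF_const act_const psi_fsc)

lemma good_X: "k < n \<Longrightarrow> good (X k)"
  by (simp add: good_def FF_X act_X psi_xo)

lemma good_add: "good p \<Longrightarrow> good q \<Longrightarrow> good (p + q)"
  by (auto simp: good_def FF_add act_add psi_add hcl_add MM.smult_l_distr hcl_closed psi_closed)

lemma good_mult: "good p \<Longrightarrow> good q \<Longrightarrow> good (p * q)"
  by (auto simp: good_def FF_mult act_mult hcl_mult MM.smult_assoc1 hcl_closed psi_closed V_act)

lemma good_sum: "(\<And>s. s \<in> A \<Longrightarrow> good (g s)) \<Longrightarrow> good (sum g A)"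
  by (rule closed_sum) (use good_const[of 0] in \<open>simp_all add: good_add\<close>)

lemma good_minus: "good p \<Longrightarrow> good q \<Longrightarrow> good (p - q)"
proof -
  have "const (-1) = - (1 :: word_poly)" by (simp add: const_def single_uminus)
  then show "good p \<Longrightarrow> good q \<Longrightarrow> ?thesis"
    using good_add[of p "const (-1) * q"] good_mult[OF good_const[of "-1"], of q] by simp
qed

text \<open>By induction over the model. On constants this is the relation \<open>t\<^sub>w \<otimes> v = 1 \<otimes> w v\<close> of the induced
module, and multiplication by \<open>x\<^sub>k\<close> is moved past \<open>t\<^sub>w\<close> on both sides in the same way.\<close>

lemma good_T:
  assumes w: "w \<in> Grp r n"
  shows "good (T\<^sub>g w)"
proof -
  have "psi (tw w F) = hcl (T\<^sub>g w) \<odot>\<^bsub>MM\<^esub> psi F" if "F \<in> V" for F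
    using that
  proof (induction F rule: V_induct)
    case (const u)
    let ?A = "fam (\<lambda>T. T\<^sub>g w * const (u T))" and ?B = "fam (\<lambda>T. const (rho w u T))"
    have "fam (\<lambda>T. 1 * T\<^sub>g w * const (u T) - 1 * const (rho w u T)) \<in> ind_gens"
      unfolding ind_gens_fam using w const FF_1 by blast
    moreover have "?A \<ominus>\<^bsub>FM\<^esub> ?B = fam (\<lambda>T. 1 * T\<^sub>g w * const (u T) - 1 * const (rho w u T))"
      using w by (simp add: fam_minus FF_intros)
    ultimately have "?A \<ominus>\<^bsub>FM\<^esub> ?B \<in> ind_gens" by simp
    then have "?A \<ominus>\<^bsub>FM\<^esub> ?B \<in> ind_relations"
      unfolding ind_relations_eq by (rule subsetD[OF FM.gen_submodule_superset])
    then have "mcl ?A = mcl ?B"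
      using w by (subst mcl_eq) (auto intro!: fam_closed FF_intros)
    then show ?case using w const
      by (simp add: tw_pt psi_const mcl_smult hcl_closed fam_closed fam_smult FF_T FF_const)
  next
    case (add F G)
    then show ?case using w
      by (simp add: lin_add[OF flin_tw] psi_add MM.smult_r_distr hcl_closed FF_T psi_closed)
  next
    case (xo k F)
    note c = hcl_closed[OF FF_T[OF w]] hcl_closed[OF FF_X[OF xo(1)]] hcl_closed[OF FF_const]
      hcl_closed[OF FF_X[OF pm_lt[OF w xo(1)]]]
    have "hcl (T\<^sub>g w) \<odot>\<^bsub>MM\<^esub> psi (xo k F) = hcl (T\<^sub>g w * X k) \<odot>\<^bsub>MM\<^esub> psi F"
      using xo w c by (simp add: psi_xo hcl_mult FF_T FF_X MM.smult_assoc1 psi_closed)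
    also have "\<dots> = hcl (const (inverse (ph n w k))) \<odot>\<^bsub>MM\<^esub> (hcl (X (pm n w k)) \<odot>\<^bsub>MM\<^esub> (hcl (T\<^sub>g w) \<odot>\<^bsub>MM\<^esub> psi F))"
      unfolding hcl_TX[OF w xo(1)]
      using xo w c by (simp add: hcl_mult FF_intros pm_lt MM.smult_assoc1 psi_closed)
    also have "\<dots> = psi (tw w (xo k F))"
      using xo w by (simp add: tw_xo psi_fsc psi_xo pm_lt)
    finally show ?case ..
  qed
  then show ?thesis using w by (simp add: good_def FF_T act_T)
qed

lemma good_Kp:
  assumes "i < n" "j < n"
  shows "good (Kp i j)"
proof -
  have 1: "good 1" using good_const[of 1] by simp
  have refl: "good (T\<^sub>g (refl_mat r n i j l))" if "j < n" "i \<noteq> j" for j l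
    using that assms by (intro good_T refl_in_Grp)
  have zeta: "good (ee i k)" for k
    unfolding ee_def by (intro good_mult good_const good_sum good_T zeta_in_Grp assms)
  have "good (\<Sum>j\<in>{..<n} - {i}. \<Sum>l<r. T\<^sub>g (refl_mat r n i j l))"
    by (intro good_sum refl) auto
  then have "good (1 - (\<Sum>j<r. const (dd (int j) - dd (int j - 1)) * ee i j)
        - const c0 * (\<Sum>j\<in>{..<n} - {i}. \<Sum>l<r. T\<^sub>g (refl_mat r n i j l)))"
    by (intro good_minus good_mult good_const 1 good_sum[where g = "\<lambda>j. const (dd (int j) - dd (int j - 1)) * ee i j"] zeta)
  moreover have "good (const c0 * (\<Sum>l<r. const (zeta r powi (- int l)) * T\<^sub>g (refl_mat r n i j l)))" if "i \<noteq> j"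
    using that assms by (intro good_mult good_const good_sum refl)
  ultimately show ?thesis unfolding Kp_def by (split if_split) blast
qed

text \<open>By induction over the model. On constants \<open>y\<^sub>i\<close> acts by \<open>0\<close> on both sides, and the commutators with
\<open>x\<^sub>k\<close> agree.\<close>

lemma good_Y:
  assumes i: "i < n"
  shows "good (Y i)"
proof -
  have "psi (yo i F) = hcl (Y i) \<odot>\<^bsub>MM\<^esub> psi F" if "F \<in> V" for F
    using that
  proof (induction F rule: V_induct)
    case (const u)
    have "fam (\<lambda>T. 1 * Y i * const (u T)) \<in> ind_gens"
      unfolding ind_gens_fam using i const FF_1 by blast
    then have "mcl (fam (\<lambda>T. Y i * const (u T))) = \<zero>\<^bsub>MM\<^esub>" using mcl_gens by simp
    then show ?case using i const
      by (simp add: psi_0 psi_const mcl_smult hcl_closed fam_closed fam_smult FF_Y FF_const)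
  next
    case (add F G)
    then show ?case using i
      by (simp add: lin_add[OF flin_yo] psi_add MM.smult_r_distr hcl_closed FF_Y psi_closed)
  next
    case (xo k F)
    note c = hcl_closed[OF FF_Y[OF i]] hcl_closed[OF FF_X[OF xo(1)]] hcl_closed[OF FF_Kp[OF xo(1) i]]
    have K: "psi (Ko i k F) = hcl (Kp i k) \<odot>\<^bsub>MM\<^esub> psi F"
      using good_Kp[OF i xo(1)] xo(2) by (simp add: good_def act_Kp i xo(1))
    have "hcl (Y i) \<odot>\<^bsub>MM\<^esub> psi (xo k F) = hcl (Y i * X k) \<odot>\<^bsub>MM\<^esub> psi F"
      using xo i c by (simp add: psi_xo hcl_mult FF_Y FF_X MM.smult_assoc1 psi_closed)
    also have "\<dots> = hcl (X k) \<odot>\<^bsub>MM\<^esub> (hcl (Y i) \<odot>\<^bsub>MM\<^esub> psi F) \<oplus>\<^bsub>MM\<^esub> hcl (Kp i k) \<odot>\<^bsub>MM\<^esub> psi F"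
      unfolding hcl_YX[OF i xo(1)]
      using xo i c by (simp add: hcl_add hcl_mult FF_intros FF_Kp MM.smult_assoc1 MM.smult_l_distr psi_closed)
    also have "\<dots> = psi (yo i (xo k F))"
      using xo i K by (simp add: yo_xo psi_add psi_xo)
    finally show ?case ..
  qed
  then show ?thesis using i by (simp add: good_def FF_Y act_Y)
qed

lemma psi_act: "p \<in> carrier FF \<Longrightarrow> F \<in> V \<Longrightarrow> psi (act p F) = hcl p \<odot>\<^bsub>MM\<^esub> psi F"
proof -
  assume "p \<in> carrier FF"
  then have "good p"
    by (induction p rule: FF_induct) (simp_all add: good_const good_X good_Y good_T good_add good_mult)
  then show "F \<in> V \<Longrightarrow> ?thesis" by (simp add: good_def)
qed

text \<open>The candidate for the inverse of \<open>psi\<close>: a family of algebra elements is applied to the basis of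
\<open>S\<^sup>\<lambda>\<close> inside the model.\<close>

definition ev :: "(tableau \<Rightarrow> word_poly) \<Rightarrow> tableau \<Rightarrow> mpoly"
  where "ev P = (\<Sum>T\<in>ST. act (P T) (pt 1 (vv T)))"

lemma V_basis: "T \<in> ST \<Longrightarrow> pt 1 (vv T) \<in> V"
  by (intro V_pt Ssp_vv) simp

lemma V_ev: "(\<And>T. P T \<in> carrier FF) \<Longrightarrow> ev P \<in> V"
  unfolding ev_def by (intro V_sum V_act V_basis)

lemma psi_sum_act:
  assumes P: "\<And>T. P T \<in> carrier FF" and A: "A \<subseteq> ST"
  shows "psi (\<Sum>T\<in>A. act (P T) (pt 1 (vv T))) = mcl (fam (\<lambda>T. if T \<in> A then P T else 0))"
proof -
  have "finite A" using A finite_ST by (rule finite_subset)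
  then show ?thesis using A
  proof (induction A)
    case empty
    then show ?case by (simp add: psi_0 fam_zero mcl_zero)
  next
    case (insert S A)
    have "psi (act (P S) (pt 1 (vv S))) = mcl (fam (\<lambda>T. if T = S then P S else 0))"
    proof -
      have "psi (act (P S) (pt 1 (vv S))) = mcl (fam (\<lambda>T. P S * const (vv S T)))"
        using insert P by (simp add: psi_act V_basis psi_const mcl_smult hcl_closed fam_closed fam_smult FF_const)
      also have "(\<lambda>T. P S * const (vv S T)) = (\<lambda>T. if T = S then P S else 0)"
        by (auto simp: vv_def)
      finally show ?thesis .
    qed
    then show ?case using insert P
      by (simp add: psi_add mcl_add fam_closed fam_add FF_0)
        (rule arg_cong[where f = mcl], rule arg_cong[where f = fam], auto)
  qed
qed

lemma fam_cong_ST: "(\<And>T. T \<in> ST \<Longrightarrow> hcl (P T) = hcl (Q T)) \<Longrightarrow> fam P = fam Q"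
  unfolding fam_def by (rule restrict_ext)

lemma psi_ev: "(\<And>T. P T \<in> carrier FF) \<Longrightarrow> psi (ev P) = mcl (fam P)"
  unfolding ev_def by (subst psi_sum_act) (auto intro!: arg_cong[where f = mcl] fam_cong_ST)

text \<open>A family is the image of its evaluation, because \<open>psi\<close> intertwines the actions and is the
identity on \<open>S\<^sup>\<lambda>\<close>.\<close>

lemma psi_surj: "psi ` V = carrier MM"
proof
  show "psi ` V \<subseteq> carrier MM" using psi_closed by auto
  show "carrier MM \<subseteq> psi ` V"
  proof
    fix m assume "m \<in> carrier MM"
    then obtain f where f: "f \<in> carrier FM" "m = mcl f" by (auto simp: carrier_MM)
    obtain P where "\<And>T. P T \<in> carrier FF" "f = fam P" using fam_surj[OF f(1)] by blast
    then show "m \<in> psi ` V" using f psi_ev V_ev by (metis imageI)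
  qed
qed

lemma pt_1_expand: "u \<in> Ssp \<Longrightarrow> pt 1 u = (\<Sum>T\<in>ST. fsc (u T) (pt 1 (vv T)))"
  by (subst (1) Ssp_expand) (auto simp: pt_def fsc_apply fun_sum_apply fun_eq_iff psc.scale_sum_left)

lemma ev_tensor:
  assumes "p \<in> carrier FF" "u \<in> Ssp"
  shows "ev (\<lambda>T. p * const (u T)) = act p (pt 1 u)"
  unfolding ev_def pt_1_expand[OF assms(2)] lin_sum[OF flin_act]
  by (simp add: act_mult act_const)

lemma ev_minus: "ev (\<lambda>T. P T - Q T) = ev P - ev Q"
  by (simp add: ev_def act_minus sum_subtractf)

lemma ev_add: "ev (\<lambda>T. P T + Q T) = ev P + ev Q"
  by (simp add: ev_def act_add sum.distrib)

lemma ev_cong: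
  assumes PQ: "fam P = fam Q" "\<And>T. P T \<in> carrier FF" "\<And>T. Q T \<in> carrier FF"
  shows "ev P = ev Q"
  unfolding ev_def
proof (rule sum.cong[OF refl])
  fix T assume T: "T \<in> ST"
  then have "hcl (P T) = hcl (Q T)" using PQ(1) by (metis fam_def restrict_apply')
  then show "act (P T) (pt 1 (vv T)) = act (Q T) (pt 1 (vv T))"
    by (rule hcl_act[OF PQ(2,3) _ V_basis[OF T]])
qed

text \<open>In the model, \<open>t\<^sub>w\<close> acts on \<open>S\<^sup>\<lambda>\<close> by \<open>rho w\<close> and \<open>y\<^sub>i\<close> by zero.\<close>

lemma ev_gens: "fam P \<in> ind_gens \<Longrightarrow> (\<And>T. P T \<in> carrier FF) \<Longrightarrow> ev P = 0"
proof -
  assume g: "fam P \<in> ind_gens" and P: "\<And>T. P T \<in> carrier FF"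
  note ev_eq = ev_cong[OF _ P]
  from g[unfolded ind_gens_fam] show ?thesis
  proof (elim disjE bexE)
    fix p w f assume h: "p \<in> carrier FF" "w \<in> Grp r n" "f \<in> Ssp"
      "fam P = fam (\<lambda>T. p * T\<^sub>g w * const (f T) - p * const (rho w f T))"
    have "ev P = ev (\<lambda>T. p * T\<^sub>g w * const (f T) - p * const (rho w f T))"
      using h by (intro ev_eq) (auto intro!: FF_intros)
    also have "\<dots> = act (p * T\<^sub>g w) (pt 1 f) - act p (pt 1 (rho w f))"
      unfolding ev_minus using h by (simp add: ev_tensor FF_intros rho_closed)
    also have "\<dots> = 0" using h by (simp add: act_simps tw_pt)
    finally show ?thesis .
  next
    fix p i f assume h: "p \<in> carrier FF" "i \<in> {..<n}" "f \<in> Ssp" "fam P = fam (\<lambda>T. p * Y i * const (f T))"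
    have "ev P = ev (\<lambda>T. p * Y i * const (f T))"
      using h by (intro ev_eq) (auto intro!: FF_intros)
    also have "\<dots> = act (p * Y i) (pt 1 f)"
      using h by (intro ev_tensor) (auto intro!: FF_intros)
    also have "\<dots> = 0" using h by (simp add: act_simps lin_zero[OF flin_act])
    finally show ?thesis .
  qed
qed

text \<open>The families evaluating to zero form a submodule, and it contains the generating relations. The
definition of that submodule quantifies over all representatives, as evaluation does not depend
on them.\<close>

lemma ev_relations:
  assumes "fam P \<in> ind_relations" "\<And>T. P T \<in> carrier FF"
  shows "ev P = 0"
proof -
  let ?N = "{f \<in> carrier FM. \<forall>P. (\<forall>T. P T \<in> carrier FF) \<longrightarrow> f = fam P \<longrightarrow> ev P = 0}"
  have N: "fam P \<in> ?N \<longleftrightarrow> ev P = 0" if P: "\<And>T. P T \<in> carrier FF" for P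
  proof
    show "fam P \<in> ?N \<Longrightarrow> ev P = 0" using P by blast
    assume 0: "ev P = 0"
    have "ev Q = 0" if Q: "\<forall>T. Q T \<in> carrier FF" "fam P = fam Q" for Q
      using ev_cong[OF Q(2) P] Q(1) 0 by simp
    then show "fam P \<in> ?N" using P by (simp add: fam_closed)
  qed
  have "submodule ?N HH FM"
    unfolding FM.submodule_iff
  proof (intro conjI ballI)
    show "\<zero>\<^bsub>FM\<^esub> \<in> ?N"
      unfolding fam_zero[symmetric] by (subst N) (auto simp: FF_0 ev_def)
  next
    fix x y assume x: "x \<in> ?N" and y: "y \<in> ?N"
    have "x \<in> carrier FM" "y \<in> carrier FM" using x y by auto
    obtain P where P: "\<And>T. P T \<in> carrier FF" "x = fam P" using fam_surj[OF \<open>x \<in> carrier FM\<close>] by blast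
    obtain Q where Q: "\<And>T. Q T \<in> carrier FF" "y = fam Q" using fam_surj[OF \<open>y \<in> carrier FM\<close>] by blast
    have "ev P = 0" "ev Q = 0" using x y P Q N[OF P(1)] N[OF Q(1)] by auto
    then show "x \<oplus>\<^bsub>FM\<^esub> y \<in> ?N"
      unfolding P(2) Q(2) fam_add[OF P(1) Q(1)] by (subst N) (auto simp: P Q FF_add ev_add)
  next
    fix a x assume a: "a \<in> carrier HH" and x: "x \<in> ?N"
    have "x \<in> carrier FM" using x by auto
    obtain P where P: "\<And>T. P T \<in> carrier FF" "x = fam P" using fam_surj[OF \<open>x \<in> carrier FM\<close>] by blast
    obtain p where p: "p \<in> carrier FF" "a = hcl p" using a by (auto simp: carrier_HH)
    have "ev P = 0" using x N[OF P(1)] P by auto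
    then have "ev (\<lambda>T. p * P T) = 0"
      by (simp add: ev_def act_mult lin_zero[OF flin_act] flip: lin_sum[OF flin_act])
    then show "a \<odot>\<^bsub>FM\<^esub> x \<in> ?N"
      unfolding P(2) p(2) fam_smult[OF P(1) p(1)] by (subst N) (auto simp: P p FF_mult)
  qed auto
  moreover have "ind_gens \<subseteq> ?N" using ind_gens_closed ev_gens by auto
  ultimately have "ind_relations \<subseteq> ?N" unfolding ind_relations_eq by (rule FM.gen_submodule_minimal)
  then show ?thesis using N[of P] assms by blast
qed

lemma act_xmon: "keys m \<subseteq> {..<n} \<Longrightarrow> act (xmon (lookup m)) (pt 1 u) = pt (mon m) u"
proof -
  have pow: "act (X i ^ e) (pt f u) = pt (var i ^ e * f) u" for i e f
    by (induction e) (simp_all add: act_mult act_X xo_pt mult.assoc)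
  have prod: "act (prod_list (map (\<lambda>i. X i ^ lookup m i) is)) (pt f u)
      = pt (prod_list (map (\<lambda>i. var i ^ lookup m i) is) * f) u" for "is" f
    by (induction "is" arbitrary: f) (simp_all add: act_mult pow mult.assoc)
  assume m: "keys m \<subseteq> {..<n}"
  have vp: "var k ^ e = mon (Poly_Mapping.single k e)" for k e
    by (induction e) (simp_all add: var_def mult_single flip: single_add)
  have "subst var (mon m) = (\<Prod>k<n. var k ^ lookup m k)"
    by (rule subst_mon) (use m in auto)
  moreover have "subst var (mon m) = mon m"
    using m
  proof (induction m rule: exponent_induct[where K = "{..<n}"])
    case (step m k)
    then show ?case unfolding var_mult_mon[symmetric] subst_mult by simp
  qed (use m in simp_all)
  moreover have "prod_list (map (\<lambda>i. var i ^ lookup m i) [0..<n]) = (\<Prod>k<n. var k ^ lookup m k)"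
    by (simp add: prod.list_conv_set_nth prod.atLeast0_lessThan_Suc lessThan_atLeast0 
      flip: prod.distinct_set_conv_list)
  ultimately show ?thesis
    unfolding xmon_def using prod[of "[0..<n]" 1] by simp
qed

lemma ev_emb:
  assumes "F \<in> V"
  shows "ev (\<lambda>T. emb (F T)) = F"
proof -
  have "ev (\<lambda>T. emb (F T)) = (\<Sum>T\<in>ST. \<Sum>m\<in>keys (F T). pt (mon m) (\<lambda>U. lookup (F T) m * vv T U))"
    unfolding ev_def
  proof (rule sum.cong[OF refl])
    fix T assume T: "T \<in> ST"
    have "act (emb (F T)) (pt 1 (vv T)) = (\<Sum>m\<in>keys (F T). fsc (lookup (F T) m) (act (xmon (lookup m)) (pt 1 (vv T))))"
      by (simp add: emb_def lext_def act_sum act_psc)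
    also have "\<dots> = (\<Sum>m\<in>keys (F T). pt (mon m) (\<lambda>U. lookup (F T) m * vv T U))"
      using assms by (intro sum.cong) (auto simp: V_def Pn_def act_xmon pt_scale)
    finally show "act (emb (F T)) (pt 1 (vv T)) = (\<Sum>m\<in>keys (F T). pt (mon m) (\<lambda>U. lookup (F T) m * vv T U))" .
  qed
  then show ?thesis using V_expand[OF assms] by simp
qed

text \<open>Evaluation is well defined on the standard module and inverts \<open>psi\<close>.\<close>

lemma psi_inj: "inj_on psi V"
proof (rule inj_onI)
  fix F G assume F: "F \<in> V" and G: "G \<in> V" and eq: "psi F = psi G"
  have "fam (\<lambda>T. emb (F T)) \<ominus>\<^bsub>FM\<^esub> fam (\<lambda>T. emb (G T)) \<in> ind_relations"
    using eq unfolding psi_def by (subst (asm) mcl_eq) (auto intro: fam_closed FF_emb)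
  then have "fam (\<lambda>T. emb (F T) - emb (G T)) \<in> ind_relations"
    by (simp add: fam_minus FF_emb)
  then have "ev (\<lambda>T. emb (F T) - emb (G T)) = 0"
    by (rule ev_relations) (intro FF_minus FF_emb)
  then show "F = G" using ev_emb[OF F] ev_emb[OF G] by (simp add: ev_minus)
qed

end

section \<open>The order on compositions\<close>

subsection \<open>Dominance\<close>

lemma mu_plus_perm:
  "\<exists>\<pi>. bij_betw \<pi> {..<n} {..<n} \<and> (\<forall>i<n. mu_plus n \<mu> i = \<mu> (\<pi> i))"
proof -
  let ?xs = "rev (sort (map \<mu> [0..<n]))" and ?ys = "map \<mu> [0..<n]"
  have "mset ?xs = mset ?ys" by simp
  then obtain f where f: "f permutes {..<length ?ys}" "permute_list f ?ys = ?xs"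
    by (rule mset_eq_permutation)
  have "mu_plus n \<mu> i = \<mu> (f i)" if "i < n" for i
  proof -
    have "f i < n" using f(1) that by (metis length_map length_upt diff_zero lessThan_iff permutes_in_image)
    then show ?thesis using permute_list_nth[OF f(1), of i] f(2) that by (simp add: mu_plus_def)
  qed
  then show ?thesis using permutes_imp_bij[OF f(1)] by auto
qed

lemma mu_plus_antitone: "i \<le> j \<Longrightarrow> j < n \<Longrightarrow> mu_plus n \<mu> j \<le> mu_plus n \<mu> i"
  by (auto simp: mu_plus_def rev_nth intro!: sorted_nth_mono)

lemma sum_mu_plus: "(\<Sum>i<n. f (mu_plus n \<mu> i)) = (\<Sum>i<n. f (\<mu> i))"
proof -
  obtain \<pi> where \<pi>: "bij_betw \<pi> {..<n} {..<n}" "\<forall>i<n. mu_plus n \<mu> i = \<mu> (\<pi> i)"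
    using mu_plus_perm by blast
  then have "(\<Sum>i<n. f (mu_plus n \<mu> i)) = (\<Sum>i<n. f (\<mu> (\<pi> i)))" by simp
  then show ?thesis using sum.reindex_bij_betw[OF \<pi>(1), of "\<lambda>i. f (\<mu> i)"] by simp
qed

text \<open>The largest sum of \<open>m\<close> parts (\<open>topsum_ge\<close>, \<open>topsum_attained\<close>); this description makes
rearrangements easy to compare in dominance order.\<close>

definition topsum :: "nat \<Rightarrow> (nat \<Rightarrow> nat) \<Rightarrow> nat \<Rightarrow> nat"
  where "topsum n \<mu> m = (\<Sum>i<m. mu_plus n \<mu> i)"

text \<open>Replace the elements of \<open>S\<close> outside the initial segment by the equally many missing elements of the
initial segment, where the values are at least as large.\<close>

lemma antitone_sum_le:
  fixes a :: "nat \<Rightarrow> nat"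
  assumes anti: "\<And>i j. i \<le> j \<Longrightarrow> j < n \<Longrightarrow> a j \<le> a i" and S: "S \<subseteq> {..<n}"
  shows "sum a S \<le> sum a {..<card S}"
proof -
  let ?m = "card S"
  have fin: "finite S" using S finite_subset by blast
  have c: "card (S - {..<?m}) = card ({..<?m} - S)"
  proof -
    have "card (S - {..<?m}) + card (S \<inter> {..<?m}) = card S"
      using fin by (metis Diff_Int_distrib2 add.commute card_Int_Diff)
    moreover have "card ({..<?m} - S) + card (S \<inter> {..<?m}) = ?m"
      by (metis Int_commute add.commute card_Int_Diff card_lessThan finite_lessThan)
    ultimately show ?thesis by simp
  qed
  have "sum a (S - {..<?m}) \<le> card (S - {..<?m}) * a ?m"
  proof -
    have "a i \<le> a ?m" if "i \<in> S - {..<?m}" for i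
      using anti[of ?m i] that S by auto
    then show ?thesis using sum_bounded_above[of "S - {..<?m}" a "a ?m"] by simp
  qed
  also have "\<dots> \<le> sum a ({..<?m} - S)"
  proof (cases "S \<subseteq> {..<?m}")
    case True
    then show ?thesis by (simp add: Diff_eq_empty_iff[THEN iffD2])
  next
    case False
    then have "?m < n" using S by auto
    then have "a ?m \<le> a i" if "i \<in> {..<?m} - S" for i
      using anti[of i ?m] that by auto
    then show ?thesis
      using sum_bounded_below[of "{..<?m} - S" "a ?m" a] c by simp
  qed
  finally have "sum a (S - {..<?m}) \<le> sum a ({..<?m} - S)" .
  moreover have "sum a S = sum a (S - {..<?m}) + sum a (S \<inter> {..<?m})"
    using fin by (metis add.commute sum.Int_Diff)
  moreover have "sum a {..<?m} = sum a ({..<?m} - S) + sum a (S \<inter> {..<?m})"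
    by (metis Int_commute add.commute finite_lessThan sum.Int_Diff)
  ultimately show ?thesis by simp
qed

lemma topsum_ge:
  assumes "S \<subseteq> {..<n}"
  shows "sum \<mu> S \<le> topsum n \<mu> (card S)"
proof -
  obtain \<pi> where \<pi>: "bij_betw \<pi> {..<n} {..<n}" "\<forall>i<n. mu_plus n \<mu> i = \<mu> (\<pi> i)"
    using mu_plus_perm by blast
  let ?P = "{i \<in> {..<n}. \<pi> i \<in> S}"
  have inj: "inj_on \<pi> ?P" using \<pi>(1) by (auto simp: bij_betw_def intro: inj_on_subset)
  have im: "\<pi> ` ?P = S" using \<pi>(1) assms unfolding bij_betw_def by (auto simp: image_iff)
  have "sum \<mu> S = (\<Sum>i\<in>?P. mu_plus n \<mu> i)"
    using \<pi>(2) sum.reindex[OF inj, of \<mu>] im by simp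
  also have "\<dots> \<le> sum (mu_plus n \<mu>) {..<card ?P}"
    by (rule antitone_sum_le[where n = n]) (auto simp: mu_plus_antitone)
  also have "card ?P = card S" using card_image[OF inj] im by simp
  finally show ?thesis by (simp add: topsum_def)
qed

lemma topsum_attained:
  assumes "m \<le> n"
  shows "\<exists>S\<subseteq>{..<n}. card S = m \<and> sum \<mu> S = topsum n \<mu> m"
proof -
  obtain \<pi> where \<pi>: "bij_betw \<pi> {..<n} {..<n}" "\<forall>i<n. mu_plus n \<mu> i = \<mu> (\<pi> i)"
    using mu_plus_perm by blast
  have inj: "inj_on \<pi> {..<m}" using \<pi>(1) assms by (auto simp: bij_betw_def intro: inj_on_subset)
  have "\<pi> ` {..<m} \<subseteq> {..<n}" using \<pi>(1) assms by (auto simp: bij_betw_def)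
  moreover have "sum \<mu> (\<pi> ` {..<m}) = topsum n \<mu> m"
    using inj \<pi>(2) assms by (simp add: sum.reindex topsum_def)
  ultimately show ?thesis using card_image[OF inj] by (intro exI[of _ "\<pi> ` {..<m}"]) auto
qed

text \<open>The coefficients \<open>k\<^sub>i\<close> are the differences of the partial sums.\<close>

lemma dom_less_iff:
  "dom_less n \<nu> \<mu> \<longleftrightarrow> \<mu> \<noteq> \<nu> \<and> (\<forall>m\<le>n. sum \<nu> {..<m} \<le> sum \<mu> {..<m}) \<and> sum \<nu> {..<n} = sum \<mu> {..<n}"
proof (intro iffI conjI)
  assume h: "dom_less n \<nu> \<mu>"
  show "\<mu> \<noteq> \<nu>" using h by (simp add: dom_less_def)
  obtain k :: "nat \<Rightarrow> nat" where k: "\<And>a. a < n \<Longrightarrow> int (\<mu> a) - int (\<nu> a) =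
      (\<Sum>i<n-1. int (k i) * (of_bool (a = i) - of_bool (a = Suc i)))"
    using h unfolding dom_less_def by blast
  have s: "int (sum \<mu> {..<m}) - int (sum \<nu> {..<m})
      = (\<Sum>i<n-1. int (k i) * (of_bool (i < m) - of_bool (Suc i < m)))" if "m \<le> n" for m
  proof -
    have "int (sum \<mu> {..<m}) - int (sum \<nu> {..<m}) = (\<Sum>a<m. int (\<mu> a) - int (\<nu> a))"
      by (simp add: sum_subtractf)
    also have "\<dots> = (\<Sum>a<m. \<Sum>i<n-1. int (k i) * (of_bool (a = i) - of_bool (a = Suc i)))"
      using k that by (intro sum.cong) auto
    also have "\<dots> = (\<Sum>i<n-1. \<Sum>a<m. int (k i) * (of_bool (a = i) - of_bool (a = Suc i)))"
      by (rule sum.swap)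
    also have "\<dots> = (\<Sum>i<n-1. int (k i) * (of_bool (i < m) - of_bool (Suc i < m)))"
      by (intro sum.cong) (auto simp: of_bool_def sum.delta sum_subtractf simp flip: sum_distrib_left)
    finally show ?thesis .
  qed
  show "\<forall>m\<le>n. sum \<nu> {..<m} \<le> sum \<mu> {..<m}"
  proof (intro allI impI)
    fix m assume "m \<le> n"
    have "(\<Sum>i<n-1. int (k i) * (of_bool (i < m) - of_bool (Suc i < m))) \<ge> 0"
      by (intro sum_nonneg mult_nonneg_nonneg) (auto simp: of_bool_def)
    then show "sum \<nu> {..<m} \<le> sum \<mu> {..<m}" using s[OF \<open>m \<le> n\<close>] by linarith
  qed
  have "(\<Sum>i<n-1. int (k i) * (of_bool (i < n) - of_bool (Suc i < n))) = 0"
    by (intro sum.neutral) (auto simp: of_bool_def)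
  then show "sum \<nu> {..<n} = sum \<mu> {..<n}" using s[of n] by linarith
next
  assume h: "\<mu> \<noteq> \<nu> \<and> (\<forall>m\<le>n. sum \<nu> {..<m} \<le> sum \<mu> {..<m}) \<and> sum \<nu> {..<n} = sum \<mu> {..<n}"
  let ?k = "\<lambda>i. sum \<mu> {..<Suc i} - sum \<nu> {..<Suc i}"
  have "int (\<mu> a) - int (\<nu> a) = (\<Sum>i<n-1. int (?k i) * (of_bool (a = i) - of_bool (a = Suc i)))"
    if a: "a < n" for a
  proof -
    have le: "sum \<nu> {..<Suc i} \<le> sum \<mu> {..<Suc i}" if "i < n" for i
    proof -
      have "Suc i \<le> n" using that by simp
      then show ?thesis using h by blast
    qed
    have kk: "int (?k i) = int (sum \<mu> {..<Suc i}) - int (sum \<nu> {..<Suc i})" if "i < n" for i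
      using le[OF that] by (simp only: of_nat_diff)
    have "(\<Sum>i<n-1. int (?k i) * (of_bool (a = i) - of_bool (a = Suc i)))
      = (\<Sum>i<n-1. if i = a then int (?k i) else 0) - (\<Sum>i<n-1. if Suc i = a then int (?k i) else 0)"
      unfolding sum_subtractf[symmetric] by (intro sum.cong) (auto simp: of_bool_def)
    also have "(\<Sum>i<n-1. if i = a then int (?k i) else 0) = int (?k a)"
    proof (cases "a < n - 1")
      case False
      then have "Suc a = n" using a by simp
      then have "?k a = 0" using h by simp
      then show ?thesis using False by (simp add: sum.delta)
    qed (simp add: sum.delta)
    also have "(\<Sum>i<n-1. if Suc i = a then int (?k i) else 0) = (if a = 0 then 0 else int (?k (a - 1)))"
    proof (cases a)
      case (Suc b)
      then have "(\<Sum>i<n-1. if Suc i = a then int (?k i) else 0) = (\<Sum>i<n-1. if i = b then int (?k i) else 0)"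
        by (intro sum.cong) auto
      then show ?thesis using Suc a by (simp add: sum.delta del: sum.lessThan_Suc)
    qed simp
    also have "int (?k a) - (if a = 0 then 0 else int (?k (a - 1))) = int (\<mu> a) - int (\<nu> a)"
    proof (cases a)
      case 0
      then show ?thesis using kk[OF a] by simp
    next
      case (Suc b)
      have "int (?k a) = int (sum \<mu> {..<a}) + int (\<mu> a) - (int (sum \<nu> {..<a}) + int (\<nu> a))"
        using kk[OF a] by simp
      moreover have "int (?k b) = int (sum \<mu> {..<a}) - int (sum \<nu> {..<a})"
        using kk[of b] a Suc by (simp only: Suc_lessD)
      ultimately show ?thesis unfolding Suc diff_Suc_1 by simp
    qed
    finally show ?thesis by simp
  qed
  then have "\<forall>a<n. int (\<mu> a) - int (\<nu> a) = (\<Sum>i<n-1. int (?k i) * (of_bool (a = i) - of_bool (a = Suc i)))"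
    by blast
  then have "\<exists>k::nat \<Rightarrow> nat. \<forall>a<n. int (\<mu> a) - int (\<nu> a) = (\<Sum>i<n-1. int (k i) * (of_bool (a = i) - of_bool (a = Suc i)))"
    by (rule exI[of _ ?k])
  then show "dom_less n \<nu> \<mu>" using h unfolding dom_less_def by (intro conjI) simp_all
qed

lemma mu_plus_ext:
  assumes "\<And>m. m \<le> n \<Longrightarrow> topsum n \<mu> m = topsum n \<nu> m"
  shows "mu_plus n \<mu> = mu_plus n \<nu>"
proof
  fix i show "mu_plus n \<mu> i = mu_plus n \<nu> i"
  proof (cases "i < n")
    case True
    then show ?thesis using assms[of i] assms[of "Suc i"] by (simp add: topsum_def)
  qed (simp add: mu_plus_def)
qed

text \<open>A natural number that increases strictly in dominance order, for well-foundedness.\<close>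

definition dom_measure :: "nat \<Rightarrow> (nat \<Rightarrow> nat) \<Rightarrow> nat"
  where "dom_measure n \<mu> = (\<Sum>m\<le>n. topsum n \<mu> m)"

lemma dom_less_mu_plus:
  "dom_less n (mu_plus n \<nu>) (mu_plus n \<mu>) \<longleftrightarrow> mu_plus n \<mu> \<noteq> mu_plus n \<nu> \<and>
    (\<forall>m\<le>n. topsum n \<nu> m \<le> topsum n \<mu> m) \<and> topsum n \<nu> n = topsum n \<mu> n"
  by (simp add: dom_less_iff topsum_def)

lemma dom_less_measure:
  assumes "dom_less n (mu_plus n \<nu>) (mu_plus n \<mu>)"
  shows "dom_measure n \<nu> < dom_measure n \<mu>"
proof -
  have h: "\<forall>m\<le>n. topsum n \<nu> m \<le> topsum n \<mu> m" "mu_plus n \<mu> \<noteq> mu_plus n \<nu>"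
    using assms by (auto simp: dom_less_mu_plus)
  then obtain m where "m \<le> n" "topsum n \<mu> m \<noteq> topsum n \<nu> m" using mu_plus_ext by blast
  then show ?thesis unfolding dom_measure_def
    using h(1) by (intro sum_strict_mono_ex1) (auto simp: le_neq_implies_less intro!: bexI[of _ m])
qed

subsection \<open>Bruhat order\<close>

definition inversions :: "nat \<Rightarrow> (nat \<Rightarrow> nat) \<Rightarrow> (nat \<times> nat) set"
  where "inversions n w = {(i, j). i < j \<and> j < n \<and> w j < w i}"

lemma finite_inversions: "finite (inversions n w)"
  by (rule finite_subset[of _ "{..<n} \<times> {..<n}"]) (auto simp: inversions_def)

text \<open>The inversions after the exchange inject into the inversions before it, missing \<open>(i, j)\<close>.\<close>

lemma perm_length_swap:
  assumes ij: "i < j" "j < n" and w: "w j < w i"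
  shows "perm_length n (w \<circ> Transposition.transpose i j) < perm_length n w"
proof -
  let ?s = "Transposition.transpose i j"
  \<comment> \<open>move an inverted pair along with the exchange unless this reverses its order\<close>
  let ?\<phi> = "\<lambda>(a, b). if ?s a < ?s b then (?s a, ?s b) else (a, b)"
  have s: "?s a < n \<longleftrightarrow> a < n" for a using ij by (auto simp: Transposition.transpose_def)
  have inj: "inj_on ?\<phi> (inversions n (w \<circ> ?s))"
  proof (rule inj_onI)
    fix x y assume h: "x \<in> inversions n (w \<circ> ?s)" "y \<in> inversions n (w \<circ> ?s)" "?\<phi> x = ?\<phi> y"
    obtain a b a' b' where e: "x = (a, b)" "y = (a', b')" by (cases x, cases y)
    have "a < b" "a' < b'" using h unfolding e inversions_def by auto
    then show "x = y" using h(3) unfolding e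
      by (auto simp: transpose_eq_iff split: if_splits)
  qed
  have sub: "?\<phi> ` inversions n (w \<circ> ?s) \<subseteq> inversions n w - {(i, j)}"
  proof (rule image_subsetI)
    fix x assume "x \<in> inversions n (w \<circ> ?s)"
    then obtain a b where x: "x = (a, b)" and h: "(a, b) \<in> inversions n (w \<circ> ?s)" by (cases x) auto
    then have ab: "a < b" "b < n" "w (?s b) < w (?s a)" by (auto simp: inversions_def)
    show "?\<phi> x \<in> inversions n w - {(i, j)}"
    proof (cases "?s a < ?s b")
      case True
      have "(?s a, ?s b) \<noteq> (i, j)"
        using ab(1) ij by (auto simp: Transposition.transpose_def split: if_splits)
      then show ?thesis using True ab s by (simp add: inversions_def x)
    next
      case False
      then have "a = i \<and> b \<noteq> j \<or> b = j \<and> a \<noteq> i"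
        using ab w ij by (auto simp: Transposition.transpose_def split: if_splits)
      moreover have "w b < w a"
        using False ab w ij by (auto simp: Transposition.transpose_def split: if_splits)
      ultimately show ?thesis using ab False by (auto simp: inversions_def x)
    qed
  qed
  have "card (inversions n (w \<circ> ?s)) \<le> card (inversions n w - {(i, j)})"
    using card_mono[OF _ sub] finite_inversions card_image[OF inj] by simp
  also have "\<dots> < card (inversions n w)"
    by (rule card_Diff1_less[OF finite_inversions]) (use ij w in \<open>simp add: inversions_def\<close>)
  finally show ?thesis by (simp add: perm_length_def inversions_def)
qed

lemma bruhat_less_length: "(u, v) \<in> bruhat_less n \<Longrightarrow> perm_length n u < perm_length n v"
  unfolding bruhat_less_def
proof (induction rule: trancl_induct)
  case (base y)
  then show ?case by blast
next
  case (step y z)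
  then have "perm_length n y < perm_length n z" by blast
  then show ?case using step by linarith
qed

lemma bruhat_less_trans: "(u, v) \<in> bruhat_less n \<Longrightarrow> (v, w) \<in> bruhat_less n \<Longrightarrow> (u, w) \<in> bruhat_less n"
  unfolding bruhat_less_def by (rule trancl_trans)

text \<open>The strict total order on positions whose ranking is \<^const>\<open>w_of\<close>.\<close>

definition precedes :: "(nat \<Rightarrow> nat) \<Rightarrow> nat \<Rightarrow> nat \<Rightarrow> bool"
  where "precedes \<mu> j i \<longleftrightarrow> \<mu> j < \<mu> i \<or> \<mu> j = \<mu> i \<and> i < j"

lemma w_of_eq: "i < n \<Longrightarrow> w_of n \<mu> i = card {j. j < n \<and> precedes \<mu> j i}"
proof -
  assume i: "i < n"
  have "{j. j < n \<and> precedes \<mu> j i} = {j. j < i \<and> \<mu> j < \<mu> i} \<union> {j. i < j \<and> j < n \<and> \<mu> j \<le> \<mu> i}"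
    using i by (auto simp: precedes_def) 
      (metis antisym_conv3 less_le_not_le nle_le)+
  moreover have "card ({j. j < i \<and> \<mu> j < \<mu> i} \<union> {j. i < j \<and> j < n \<and> \<mu> j \<le> \<mu> i})
      = card {j. j < i \<and> \<mu> j < \<mu> i} + card {j. i < j \<and> j < n \<and> \<mu> j \<le> \<mu> i}"
    by (rule card_Un_disjoint) auto
  ultimately show ?thesis using i by (simp add: w_of_def)
qed

lemma w_of_mono:
  assumes "i < n" "j < n" "precedes \<mu> j i"
  shows "w_of n \<mu> j < w_of n \<mu> i"
proof -
  have "{k. k < n \<and> precedes \<mu> k j} \<subset> {k. k < n \<and> precedes \<mu> k i}"
    using assms by (auto simp: precedes_def)
  then show ?thesis unfolding w_of_eq[OF assms(1)] w_of_eq[OF assms(2)]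
    by (intro psubset_card_mono) auto
qed

lemma w_of_less_iff: "i < n \<Longrightarrow> j < n \<Longrightarrow> w_of n \<mu> j < w_of n \<mu> i \<longleftrightarrow> precedes \<mu> j i"
  using w_of_mono[of i n j \<mu>] w_of_mono[of j n i \<mu>]
  by (cases "i = j") (auto simp: precedes_def, (metis linorder_neqE_nat order.asym)+)

lemma w_of_lt: "i < n \<Longrightarrow> w_of n \<mu> i < n"
proof -
  assume i: "i < n"
  have "{j. j < n \<and> precedes \<mu> j i} \<subset> {..<n}" using i by (auto simp: precedes_def)
  then show ?thesis unfolding w_of_eq[OF i]
    using psubset_card_mono[of "{..<n}" "{j. j < n \<and> precedes \<mu> j i}"] by simp
qed

lemma w_of_permutes: "w_of n \<mu> permutes {..<n}"
proof (rule bij_imp_permutes)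
  have "inj_on (w_of n \<mu>) {..<n}"
  proof (rule inj_onI)
    fix i j assume "i \<in> {..<n}" "j \<in> {..<n}" "w_of n \<mu> i = w_of n \<mu> j"
    then have "\<not> precedes \<mu> i j" "\<not> precedes \<mu> j i" using w_of_mono by fastforce+
    then show "i = j" by (auto simp: precedes_def)
  qed
  moreover have "w_of n \<mu> ` {..<n} \<subseteq> {..<n}" using w_of_lt by auto
  ultimately show "bij_betw (w_of n \<mu>) {..<n} {..<n}"
    by (simp add: bij_betw_def endo_inj_surj)
qed (simp add: w_of_def)

text \<open>If no value strictly between the positions equals one of the exchanged values, no tie is affected.\<close>

lemma w_of_swap:
  assumes ij: "i < j" "j < n" and ne: "\<mu> i \<noteq> \<mu> j"
    and between: "\<And>k. i < k \<Longrightarrow> k < j \<Longrightarrow> \<mu> k \<noteq> \<mu> i \<and> \<mu> k \<noteq> \<mu> j"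
  shows "w_of n (\<mu> \<circ> Transposition.transpose i j) = w_of n \<mu> \<circ> Transposition.transpose i j"
proof
  let ?s = "Transposition.transpose i j"
  have s: "?s a < n \<longleftrightarrow> a < n" for a using ij by (auto simp: Transposition.transpose_def)
  have prec: "precedes (\<mu> \<circ> ?s) a b \<longleftrightarrow> precedes \<mu> (?s a) (?s b)" for a b
  proof -
    have "b < a \<longleftrightarrow> ?s b < ?s a" if "\<mu> (?s a) = \<mu> (?s b)"
      using that ij ne between[of a] between[of b]
      by (auto simp: Transposition.transpose_def split: if_splits)
        (metis linorder_neqE_nat order.strict_trans)+
    then show ?thesis by (auto simp: precedes_def)
  qed
  fix b show "w_of n (\<mu> \<circ> ?s) b = (w_of n \<mu> \<circ> ?s) b"
  proof (cases "b < n")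
    case True
    have "{a. a < n \<and> precedes \<mu> a (?s b)} = ?s ` {a. a < n \<and> precedes \<mu> (?s a) (?s b)}"
      by (auto simp: image_iff s) (metis s transpose_involutory)
    then have "card {a. a < n \<and> precedes \<mu> a (?s b)} = card {a. a < n \<and> precedes \<mu> (?s a) (?s b)}"
      by (simp add: card_image inj_on_subset[OF inj_transpose])
    then show ?thesis using True s by (simp add: w_of_eq prec)
  next
    case False
    then show ?thesis using ij by (simp add: w_of_def Transposition.transpose_def)
  qed
qed

text \<open>When an intermediate position carries one of the two exchanged values, the exchange is a
composition of two exchanges over shorter distances that have the same effect on the composition.
This reduces to the case where \<^const>\<open>w_of\<close> changes by a transposition.\<close>

lemma bruhat_swap:
  assumes "i < j" "j < n" "\<mu> j < \<mu> i"
  shows "(w_of n (\<mu> \<circ> Transposition.transpose i j), w_of n \<mu>) \<in> bruhat_less n"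
  using assms
proof (induction "j - i" arbitrary: i j \<mu> rule: less_induct)
  case less
  let ?s = "Transposition.transpose i j"
  consider (none) "\<And>k. i < k \<Longrightarrow> k < j \<Longrightarrow> \<mu> k \<noteq> \<mu> i \<and> \<mu> k \<noteq> \<mu> j"
    | (eqi) k where "i < k" "k < j" "\<mu> k = \<mu> i" | (eqj) k where "i < k" "k < j" "\<mu> k = \<mu> j"
    by blast
  then show ?case
  proof cases
    case none
    have e: "w_of n (\<mu> \<circ> ?s) = w_of n \<mu> \<circ> ?s"
      using less.prems by (intro w_of_swap none) auto
    have "w_of n \<mu> j < w_of n \<mu> i"
      using less.prems by (intro w_of_mono) (auto simp: precedes_def)
    then have l: "perm_length n (w_of n \<mu> \<circ> ?s) < perm_length n (w_of n \<mu> \<circ> ?s \<circ> ?s)"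
      using perm_length_swap[OF less.prems(1,2)] by (simp add: comp_assoc)
    have "(w_of n (\<mu> \<circ> ?s), w_of n (\<mu> \<circ> ?s) \<circ> ?s) \<in> bruhat_less n"
      unfolding bruhat_less_def
      using less.prems w_of_permutes l by (intro r_into_trancl) (auto simp: e[symmetric])
    then show ?thesis by (simp add: e comp_assoc)
  next
    case (eqi k)
    let ?\<nu> = "\<mu> \<circ> Transposition.transpose k j"
    have 1: "(w_of n ?\<nu>, w_of n \<mu>) \<in> bruhat_less n"
      using less eqi by (intro less.hyps) auto
    have "(w_of n (?\<nu> \<circ> Transposition.transpose i k), w_of n ?\<nu>) \<in> bruhat_less n"
      using less.prems eqi by (intro less.hyps) (auto simp: Transposition.transpose_def)
    moreover have "?\<nu> \<circ> Transposition.transpose i k = \<mu> \<circ> ?s"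
      using less.prems eqi by (auto simp: Transposition.transpose_def fun_eq_iff)
    ultimately show ?thesis using 1 bruhat_less_trans by metis
  next
    case (eqj k)
    let ?\<nu> = "\<mu> \<circ> Transposition.transpose i k"
    have 1: "(w_of n ?\<nu>, w_of n \<mu>) \<in> bruhat_less n"
      using less eqj by (intro less.hyps) auto
    have "(w_of n (?\<nu> \<circ> Transposition.transpose k j), w_of n ?\<nu>) \<in> bruhat_less n"
      using less.prems eqj by (intro less.hyps) (auto simp: Transposition.transpose_def)
    moreover have "?\<nu> \<circ> Transposition.transpose k j = \<mu> \<circ> ?s"
      using less.prems eqj by (auto simp: Transposition.transpose_def fun_eq_iff)
    ultimately show ?thesis using 1 bruhat_less_trans by metis
  qed
qed

subsection \<open>The order\<close>

lemma mu_plus_swap: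
  assumes "i < n" "j < n"
  shows "mu_plus n (\<mu> \<circ> Transposition.transpose i j) = mu_plus n \<mu>"
proof -
  let ?s = "Transposition.transpose i j"
  have "image_mset ?s (mset_set {..<n}) = mset_set (?s ` {..<n})"
    by (rule image_mset_mset_set) (rule inj_on_subset[OF inj_transpose], simp)
  also have "?s ` {..<n} = {..<n}"
    by (rule permutes_image[OF permutes_swap_id]) (use assms in auto)
  finally have "image_mset \<mu> (image_mset ?s (mset_set {..<n})) = image_mset \<mu> (mset_set {..<n})" by simp
  then have "mset (map (\<mu> \<circ> ?s) [0..<n]) = mset (map \<mu> [0..<n])"
    by (simp add: image_mset.compositionality lessThan_atLeast0)
  then have "sort (map (\<mu> \<circ> ?s) [0..<n]) = sort (map \<mu> [0..<n])"
    by (intro properties_for_sort) simp_all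
  then show ?thesis by (simp add: mu_plus_def fun_eq_iff)
qed

lemma comp_less_swap:
  "i < j \<Longrightarrow> j < n \<Longrightarrow> \<mu> j < \<mu> i \<Longrightarrow> comp_less n (\<mu> \<circ> Transposition.transpose i j) \<mu>"
  by (simp add: comp_less_def mu_plus_swap bruhat_swap)

text \<open>Moving two parts closer together decreases all sums of largest parts; the sum of squares shows
that the sorted composition really changes.\<close>

lemma comp_less_squeeze:
  assumes ij: "i < n" "j < n" "i \<noteq> j"
    and other: "\<And>k. k \<noteq> i \<Longrightarrow> k \<noteq> j \<Longrightarrow> \<nu> k = \<mu> k"
    and sum: "\<nu> i + \<nu> j = \<mu> i + \<mu> j"
    and less: "\<nu> i < max (\<mu> i) (\<mu> j)" "\<nu> j < max (\<mu> i) (\<mu> j)"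
  shows "comp_less n \<nu> \<mu>"
proof -
  have total: "sum f {..<n} = f i + f j + sum f ({..<n} - {i, j})" for f :: "nat \<Rightarrow> nat"
    using ij by (subst sum.subset_diff[of "{i, j}"]) auto
  have rest: "sum (\<lambda>k. g (\<nu> k)) ({..<n} - {i, j}) = sum (\<lambda>k. g (\<mu> k)) ({..<n} - {i, j})" for g :: "nat \<Rightarrow> nat"
    using other by (intro sum.cong) auto
  have le: "topsum n \<nu> m \<le> topsum n \<mu> m" if m: "m \<le> n" for m
  proof -
    obtain S where S: "S \<subseteq> {..<n}" "card S = m" "sum \<nu> S = topsum n \<nu> m"
      using topsum_attained[OF m] by blast
    have fin: "finite S" using S finite_subset by blast
    have one: "sum \<nu> S \<le> topsum n \<mu> m"
      if h: "p \<in> S" "q \<notin> S" "{p, q} = {i, j}" for p q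
    proof -
      have pq: "p < n" "q < n" using h ij by auto
      have o: "sum \<nu> (S - {p}) = sum \<mu> (S - {p})"
        using other h by (intro sum.cong) auto
      have "\<nu> p < max (\<mu> p) (\<mu> q)" using less h(3) by (auto simp: doubleton_eq_iff max.commute)
      then consider "\<nu> p \<le> \<mu> p" | "\<nu> p \<le> \<mu> q" by linarith
      then show ?thesis
      proof cases
        case 1
        then have "sum \<nu> S \<le> sum \<mu> S" using o fin h by (simp add: sum.remove[of S p])
        then show ?thesis using topsum_ge[OF S(1), of \<mu>] S(2) by simp
      next
        case 2
        let ?S = "insert q (S - {p})"
        have "sum \<nu> S \<le> sum \<mu> ?S" using 2 o fin h by (simp add: sum.remove[of S p])
        moreover have "card S > 0" using h fin by (auto simp: card_gt_0_iff)
        then have "card ?S = m" "?S \<subseteq> {..<n}"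
          using S fin h pq by (auto simp: card_insert_if card_Suc_Diff1)
        ultimately show ?thesis using topsum_ge[of ?S n \<mu>] by simp
      qed
    qed
    have "sum \<nu> S \<le> topsum n \<mu> m"
    proof (cases "i \<in> S"; cases "j \<in> S")
      assume "i \<in> S" "j \<notin> S"
      then show ?thesis using one by blast
    next
      assume "i \<notin> S" "j \<in> S"
      then show ?thesis using one[of j i] by blast
    next
      assume h: "i \<in> S" "j \<in> S"
      have t: "sum f S = f i + f j + sum f (S - {i, j})" for f :: "nat \<Rightarrow> nat"
        using h ij fin by (subst sum.subset_diff[of "{i, j}"]) auto
      have "sum \<nu> (S - {i, j}) = sum \<mu> (S - {i, j})" using other by (intro sum.cong) auto
      then have "sum \<nu> S = sum \<mu> S" using t[of \<nu>] t[of \<mu>] sum by simp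
      then show ?thesis using topsum_ge[OF S(1), of \<mu>] S(2) by simp
    next
      assume h: "i \<notin> S" "j \<notin> S"
      then have "sum \<nu> S = sum \<mu> S" using other by (intro sum.cong) metis+
      then show ?thesis using topsum_ge[OF S(1), of \<mu>] S(2) by simp
    qed
    then show ?thesis using S by simp
  qed
  have eq: "topsum n \<nu> n = topsum n \<mu> n"
    using sum_mu_plus[of id n \<nu>] sum_mu_plus[of id n \<mu>] total[of \<nu>] total[of \<mu>] rest[of id] sum
    by (simp add: topsum_def)
  \<comment> \<open>strictness: the sorted compositions differ since the sums of squares do\<close>
  have "\<nu> i ^ 2 + \<nu> j ^ 2 < \<mu> i ^ 2 + \<mu> j ^ 2"
  proof -
    have *: "p ^ 2 + q ^ 2 < a ^ 2 + b ^ 2" if "p + q = a + b" "p < a" "q < a" for p q a b :: nat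
    proof -
      obtain t where t: "a = p + t" "t > 0" using \<open>p < a\<close> less_imp_add_positive by blast
      then have "q = b + t" "b < p" using that by auto
      then have "b * t + b * t < p * t + p * t" using t add_strict_mono[of "b * t" "p * t"] by simp
      then show ?thesis using t \<open>q = b + t\<close> by (simp add: power2_eq_square algebra_simps)
    qed
    show ?thesis
    proof (cases "\<mu> i \<le> \<mu> j")
      case True
      then show ?thesis using *[of "\<nu> i" "\<nu> j" "\<mu> j" "\<mu> i"] sum less by simp
    next
      case False
      then show ?thesis using *[of "\<nu> i" "\<nu> j" "\<mu> i" "\<mu> j"] sum less by simp
    qed
  qed
  then have "(\<Sum>k<n. \<nu> k ^ 2) < (\<Sum>k<n. \<mu> k ^ 2)"
    using total[of "\<lambda>k. \<nu> k ^ 2"] total[of "\<lambda>k. \<mu> k ^ 2"] rest[of "\<lambda>x. x ^ 2"] by simp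
  then have "mu_plus n \<mu> \<noteq> mu_plus n \<nu>"
    using sum_mu_plus[of "\<lambda>x. x ^ 2" n \<nu>] sum_mu_plus[of "\<lambda>x. x ^ 2" n \<mu>] by auto
  then show ?thesis using le eq by (simp add: comp_less_def dom_less_mu_plus)
qed

lemma comp_less_trans:
  assumes "comp_less n \<rho> \<nu>" "comp_less n \<nu> \<mu>"
  shows "comp_less n \<rho> \<mu>"
proof -
  have dom_trans: "dom_less n (mu_plus n a) (mu_plus n c)"
    if "dom_less n (mu_plus n a) (mu_plus n b)" "dom_less n (mu_plus n b) (mu_plus n c)" for a b c
  proof -
    have "dom_measure n a < dom_measure n c" using dom_less_measure that by (meson less_trans)
    then have "mu_plus n c \<noteq> mu_plus n a" by (auto simp: dom_measure_def topsum_def)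
    then show ?thesis using that unfolding dom_less_mu_plus by (metis order_trans)
  qed
  show ?thesis
    using assms dom_trans[of \<rho> \<nu> \<mu>] bruhat_less_trans unfolding comp_less_def by metis
qed

text \<open>Dominance is measured by \<^const>\<open>dom_measure\<close>, and Bruhat order by the length.\<close>

lemma wf_comp_less: "wf {(\<nu>, \<mu>). comp_less n \<nu> \<mu>}"
proof (rule wf_subset)
  show "wf (inv_image (less_than <*lex*> less_than) (\<lambda>\<mu>. (dom_measure n \<mu>, perm_length n (w_of n \<mu>))))"
    by (intro wf_inv_image wf_lex_prod wf_less_than)
  show "{(\<nu>, \<mu>). comp_less n \<nu> \<mu>}
      \<subseteq> inv_image (less_than <*lex*> less_than) (\<lambda>\<mu>. (dom_measure n \<mu>, perm_length n (w_of n \<mu>)))"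
    using dom_less_measure bruhat_less_length
    by (auto simp: comp_less_def dom_measure_def topsum_def)
qed

lemma comp_less_irrefl: "\<not> comp_less n \<mu> \<mu>"
  using wf_comp_less[of n] by (metis (mono_tags) case_prodI mem_Collect_eq wf_not_refl)

lemma comp_less_total: "comp_less n \<nu> \<mu> \<Longrightarrow> (\<Sum>k<n. \<nu> k) = (\<Sum>k<n. \<mu> k)"
  using sum_mu_plus[of id n \<nu>] sum_mu_plus[of id n \<mu>]
  by (auto simp: comp_less_def dom_less_mu_plus topsum_def)

section \<open>The commuting operators\<close>

text \<open>Orthogonality of characters of the group of roots of unity.\<close>

lemma sum_roots_power:
  assumes r: "r \<ge> 1" and pq: "p < r" "q < r"
  shows "(\<Sum>z\<in>roots r. z ^ p * inverse z ^ q) = (if p = q then of_nat r else 0)"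
proof (cases "p = q")
  case True
  have "z ^ p * inverse z ^ q = 1" if "z \<in> roots r" for z
    using root_nonzero[OF r, of z] that True by (simp add: roots_def field_simps)
  then have "(\<Sum>z\<in>roots r. z ^ p * inverse z ^ q) = of_nat (card (roots r))" by simp
  moreover have "card (roots r) = r" using bij_betw_same_card[OF bij_zeta_roots[OF r]] by simp
  ultimately show ?thesis using True by simp
next
  case False
  let ?z = "zeta r" and ?S = "\<Sum>z\<in>roots r. z ^ p * inverse z ^ q"
  have z: "?z \<in> roots r" using zeta_pow[OF r] by (simp add: roots_def)
  have "?z ^ p \<noteq> ?z ^ q"
    using bij_zeta_roots[OF r] pq False by (auto simp: bij_betw_def inj_on_def)
  then have ne: "?z ^ p * inverse ?z ^ q \<noteq> 1" by (simp add: field_simps)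
  have "?S = (\<Sum>z\<in>roots r. (z * ?z) ^ p * inverse (z * ?z) ^ q)"
    by (rule sum_roots_mult[OF r z, symmetric])
  also have "\<dots> = (?z ^ p * inverse ?z ^ q) * ?S"
    by (simp add: sum_distrib_left power_mult_distrib mult_ac)
  finally have "?S * (1 - ?z ^ p * inverse ?z ^ q) = 0" by (simp add: algebra_simps)
  then show ?thesis using ne False by simp
qed

context cherednik_rep
begin

subsection \<open>Sums over a class of reflections\<close>

text \<open>The sum of all reflections exchanging \<open>a\<close> and \<open>b\<close>; it lies in the group algebra and is invariant
under rescaling the coordinates.\<close>

definition sgo :: "nat \<Rightarrow> nat \<Rightarrow> (tableau \<Rightarrow> mpoly) \<Rightarrow> tableau \<Rightarrow> mpoly"
  where "sgo a b F = (\<Sum>z\<in>roots r. tw (rmat n a b z) F)"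

text \<open>The Jucys-Murphy element \<open>\<phi>\<^sub>i\<close>.\<close>

definition jmo :: "nat \<Rightarrow> (tableau \<Rightarrow> mpoly) \<Rightarrow> tableau \<Rightarrow> mpoly"
  where "jmo i F = (\<Sum>j<i. sgo i j F)"

definition ao :: "nat \<Rightarrow> (tableau \<Rightarrow> mpoly) \<Rightarrow> tableau \<Rightarrow> mpoly"
  where "ao i F = yo i (xo i F)"

definition zo :: "nat \<Rightarrow> (tableau \<Rightarrow> mpoly) \<Rightarrow> tableau \<Rightarrow> mpoly"
  where "zo i F = ao i F + fsc c0 (jmo i F)"

lemma flin_sgo: "flin (sgo a b)"
  unfolding sgo_def[abs_def] by (intro flin_sum flin_tw)

lemma flin_jmo: "flin (jmo i)"
  unfolding jmo_def[abs_def] by (intro flin_sum flin_sgo)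

lemma flin_ao: "flin (ao i)"
  unfolding ao_def[abs_def] by (rule flin_compose[OF flin_yo flin_xo])

lemma flin_zo: "flin (zo i)"
  unfolding zo_def[abs_def] by (intro flin_add flin_fsc flin_ao flin_jmo)

lemma rmat_roots: "a < n \<Longrightarrow> b < n \<Longrightarrow> z \<in> roots r \<Longrightarrow> rmat n a b z \<in> Grp r n"
  by (rule rmat_Grp[OF r_pos]) (simp_all add: roots_def)

lemma V_sgo: "a < n \<Longrightarrow> b < n \<Longrightarrow> F \<in> V \<Longrightarrow> sgo a b F \<in> V"
  unfolding sgo_def by (intro V_sum V_tw rmat_roots)

lemma V_jmo: "i < n \<Longrightarrow> F \<in> V \<Longrightarrow> jmo i F \<in> V"
  unfolding jmo_def by (intro V_sum V_sgo) auto

lemma V_ao: "i < n \<Longrightarrow> F \<in> V \<Longrightarrow> ao i F \<in> V"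
  unfolding ao_def by (intro V_yo V_xo)

lemma V_zo: "i < n \<Longrightarrow> F \<in> V \<Longrightarrow> zo i F \<in> V"
  unfolding zo_def by (intro V_add V_fsc V_ao V_jmo)

lemma sgo_commute: "a \<noteq> b \<Longrightarrow> sgo b a F = sgo a b F"
  unfolding sgo_def rmat_swap[of a b] by (rule sum_roots_inverse)

lemma act_phi: "i < n \<Longrightarrow> act (phi i) F = jmo i F"
  unfolding phi_def jmo_def sgo_def act_sum act_T
  by (intro sum.cong refl) (simp add: refl_mat_rmat sum_zeta_roots[OF r_pos, of "\<lambda>z. tw (rmat n i _ z) F"])

lemma act_zz: "i < n \<Longrightarrow> act (zz i) F = zo i F"
  by (simp add: zz_def act_simps act_phi zo_def ao_def)

text \<open>Conjugation only reparametrizes the sum over roots of unity.\<close>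

lemma tw_sgo:
  assumes w: "w \<in> Grp r n" and ab: "a < n" "b < n" and F: "F \<in> V"
  shows "tw w (sgo a b F) = sgo (pm n w a) (pm n w b) (tw w F)"
proof -
  note W = GrpD[OF r_pos w]
  let ?u = "ph n w a / ph n w b"
  have u: "?u \<in> roots r" using W(2) by (simp add: roots_def power_divide)
  have "tw w (sgo a b F) = (\<Sum>z\<in>roots r. tw w (tw (rmat n a b z) F))"
    by (simp add: sgo_def lin_sum[OF flin_tw])
  also have "\<dots> = (\<Sum>z\<in>roots r. tw (rmat n (pm n w a) (pm n w b) (z * ?u)) (tw w F))"
  proof (rule sum.cong[OF refl])
    fix z assume z: "z \<in> roots r"
    have zu: "z * ?u \<in> roots r" using z W(2) by (simp add: roots_def power_mult_distrib power_divide)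
    have zr: "z ^ r = 1" using z by (simp add: roots_def)
    show "tw w (tw (rmat n a b z) F) = tw (rmat n (pm n w a) (pm n w b) (z * ?u)) (tw w F)"
      using tw_mult[OF w rmat_roots[OF ab z] F] tw_mult[OF rmat_roots[OF pm_lt[OF w ab(1)] pm_lt[OF w ab(2)] zu] w F]
        rmat_conj[OF r_pos w ab zr] by simp
  qed
  also have "\<dots> = sgo (pm n w a) (pm n w b) (tw w F)"
    unfolding sgo_def by (rule sum_roots_mult[OF r_pos u])
  finally show ?thesis .
qed

lemma tw_ao:
  assumes w: "w \<in> Grp r n" and i: "i < n" and F: "F \<in> V"
  shows "tw w (ao i F) = ao (pm n w i) (tw w F)"
proof -
  have nz: "ph n w i \<noteq> 0" using GrpD(2)[OF r_pos w] root_nonzero[OF r_pos] by blast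
  show ?thesis unfolding ao_def tw_yo[OF w V_xo[OF i F] i] tw_xo lin_scale[OF flin_yo]
    using nz by simp
qed

lemma pm_rmat_roots: "a < n \<Longrightarrow> b < n \<Longrightarrow> z \<in> roots r \<Longrightarrow> pm n (rmat n a b z) j = Transposition.transpose a b j"
  by (rule pm_rmat[OF r_pos]) (simp_all add: roots_def)

lemma sgo_ao:
  assumes "a < n" "b < n" "i < n" "F \<in> V"
  shows "sgo a b (ao i F) = ao (Transposition.transpose a b i) (sgo a b F)"
  using assms unfolding sgo_def lin_sum[OF flin_ao]
  by (intro sum.cong refl) (simp add: tw_ao rmat_roots pm_rmat_roots)

lemma jmo_ao_less:
  assumes "i < j" "j < n" "F \<in> V"
  shows "jmo i (ao j F) = ao j (jmo i F)"
  using assms unfolding jmo_def lin_sum[OF flin_ao]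
  by (intro sum.cong refl) (auto simp: sgo_ao Transposition.transpose_def)

lemma jmo_ao_greater:
  assumes "i < j" "j < n" "F \<in> V"
  shows "jmo j (ao i F) = ao i (jmo j F) - ao i (sgo i j F) + ao j (sgo i j F)"
proof -
  have "jmo j (ao i F) = sgo j i (ao i F) + (\<Sum>k\<in>{..<j} - {i}. sgo j k (ao i F))"
    unfolding jmo_def using assms by (subst sum.remove[of _ i]) auto
  also have "(\<Sum>k\<in>{..<j} - {i}. sgo j k (ao i F)) = (\<Sum>k\<in>{..<j} - {i}. ao i (sgo j k F))"
    using assms by (intro sum.cong refl) (auto simp: sgo_ao Transposition.transpose_def)
  also have "sgo j i (ao i F) = ao j (sgo i j F)"
    using assms by (simp add: sgo_ao sgo_commute[of i j])
  also have "(\<Sum>k\<in>{..<j} - {i}. ao i (sgo j k F)) = ao i (jmo j F) - ao i (sgo i j F)"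
    unfolding jmo_def lin_sum[OF flin_ao] using assms
    by (subst (2) sum.remove[of _ i]) (auto simp: sgo_commute[of i j])
  finally show ?thesis by (simp add: algebra_simps)
qed

lemma tw_jmo:
  assumes w: "w \<in> Grp r n" and j: "j < n" and F: "F \<in> V"
    and fixed: "pm n w j = j" and below: "pm n w ` {..<j} = {..<j}"
  shows "tw w (jmo j F) = jmo j (tw w F)"
proof -
  have inj: "inj_on (pm n w) {..<j}"
    using permutes_inj[OF GrpD(1)[OF r_pos w]] by (rule inj_on_subset) simp
  have "tw w (jmo j F) = (\<Sum>k<j. sgo j (pm n w k) (tw w F))"
    unfolding jmo_def lin_sum[OF flin_tw] using j
    by (intro sum.cong refl) (simp add: tw_sgo[OF w _ _ F] fixed)
  also have "\<dots> = (\<Sum>k\<in>pm n w ` {..<j}. sgo j k (tw w F))"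
    by (simp add: sum.reindex[OF inj])
  finally show ?thesis by (simp add: below jmo_def)
qed

text \<open>The Jucys-Murphy element \<open>\<phi>\<^sub>j\<close> is invariant under the group elements moving only smaller indices.\<close>

lemma jmo_jmo:
  assumes "i < j" "j < n" "F \<in> V"
  shows "jmo i (jmo j F) = jmo j (jmo i F)"
proof -
  have "tw (rmat n i k z) (jmo j F) = jmo j (tw (rmat n i k z) F)" if "k < i" "z \<in> roots r" for k z
  proof (rule tw_jmo)
    have p: "pm n (rmat n i k z) = Transposition.transpose i k"
      using that assms by (auto simp: pm_rmat_roots)
    show "pm n (rmat n i k z) j = j" unfolding p using that assms by (auto simp: Transposition.transpose_def)
    have "Transposition.transpose i k permutes {..<j}"
      using that assms by (intro permutes_swap_id) auto
    then show "pm n (rmat n i k z) ` {..<j} = {..<j}" unfolding p by (rule permutes_image)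
  qed (use assms that in \<open>auto intro: rmat_roots\<close>)
  then show ?thesis
    by (simp add: jmo_def[of i] sgo_def lin_sum[OF flin_jmo])
qed

text \<open>Moving \<open>x\<^sub>j\<close> through the reflection turns it into \<open>x\<^sub>i\<close> and cancels the phase.\<close>

lemma Ko_xo:
  assumes "i < n" "j < n" "i \<noteq> j"
  shows "Ko j i (xo j F) = fsc c0 (xo i (sgo i j F))"
proof -
  have "(\<Sum>l<r. fsc (zeta r powi (- int l)) (tw (refl_mat r n j i l) (xo j F)))
      = (\<Sum>l<r. fsc (inverse (zeta r ^ l)) (tw (rmat n j i (zeta r ^ l)) (xo j F)))"
    using assms by (intro sum.cong refl) (simp add: refl_mat_rmat power_int_minus)
  also have "\<dots> = (\<Sum>z\<in>roots r. fsc (inverse z) (tw (rmat n j i z) (xo j F)))"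
    by (rule sum_zeta_roots[OF r_pos, of "\<lambda>z. fsc (inverse z) (tw (rmat n j i z) (xo j F))"])
  also have "\<dots> = (\<Sum>z\<in>roots r. xo i (tw (rmat n j i z) F))"
  proof (rule sum.cong[OF refl])
    fix z assume z: "z \<in> roots r"
    then have zr: "z ^ r = 1" by (simp add: roots_def)
    then have "z \<noteq> 0" using root_nonzero[OF r_pos] by blast
    then show "fsc (inverse z) (tw (rmat n j i z) (xo j F)) = xo i (tw (rmat n j i z) F)"
      using assms zr by (simp add: tw_xo pm_rmat[OF r_pos] ph_rmat[OF r_pos])
  qed
  also have "\<dots> = xo i (sgo i j F)"
    using assms by (simp add: sgo_commute[of i j, symmetric]) (simp add: sgo_def lin_sum[OF flin_xo])
  finally show ?thesis using assms by (simp add: Ko_offdiag)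
qed

text \<open>The operators \<open>x\<^sub>i\<close> commute, and so do the \<open>y\<^sub>i\<close>; only the two mixed commutators survive.\<close>

lemma ao_ao:
  assumes "i < n" "j < n" "i \<noteq> j" "F \<in> V"
  shows "ao i (ao j F) - ao j (ao i F) = fsc c0 (ao j (sgo i j F) - ao i (sgo i j F))"
proof -
  have *: "ao i (ao j F) = yo i (yo j (xo i (xo j F))) - fsc c0 (ao i (sgo i j F))"
    if "i < n" "j < n" "i \<noteq> j" for i j
  proof -
    have "xo i (yo j (xo j F)) = yo j (xo i (xo j F)) - Ko j i (xo j F)" by (simp add: yo_xo)
    then show ?thesis
      using that by (simp add: ao_def lin_diff[OF flin_yo] Ko_xo lin_scale[OF flin_yo])
  qed
  have "yo i (yo j (xo i (xo j F))) = yo j (yo i (xo j (xo i F)))"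
    using assms by (subst yo_commute) (auto simp: V_xo xo_commute)
  then show ?thesis
    using *[of i j] *[of j i] assms by (simp add: sgo_commute[of i j] fsc.scale_right_diff_distrib)
qed

text \<open>The commutator of \<open>y\<^sub>i x\<^sub>i\<close> and \<open>y\<^sub>j x\<^sub>j\<close> cancels against the failure of the larger Jucys-Murphy
element to commute with \<open>y\<^sub>i x\<^sub>i\<close>.\<close>

lemma zo_commute:
  assumes "i < n" "j < n" "F \<in> V"
  shows "zo i (zo j F) = zo j (zo i F)"
proof -
  have *: "zo i (zo j F) = zo j (zo i F)" if h: "i < j" "j < n" for i j
  proof -
    have "ao i (ao j F) = ao j (ao i F) + fsc c0 (ao j (sgo i j F)) - fsc c0 (ao i (sgo i j F))"
      using ao_ao[of i j F] h assms(3) by (simp add: algebra_simps fsc.scale_right_diff_distrib)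
    then show ?thesis
      using h assms(3)
      by (simp add: zo_def lin_add[OF flin_ao] lin_add[OF flin_jmo] lin_scale[OF flin_ao]
          lin_scale[OF flin_jmo] jmo_ao_less jmo_ao_greater jmo_jmo[OF h assms(3)] fsc.scale_right_distrib
          fsc.scale_right_diff_distrib algebra_simps)
  qed
  show ?thesis using *[of i j] *[of j i] assms by (cases i j rule: linorder_cases) auto
qed

lemma zeta_mat_1: "zeta_mat r n k 1 = rmat n k k (zeta r)"
  using zeta_mat_rmat[of r n k 1] by simp

lemma zeta_mat_1_Grp: "k < n \<Longrightarrow> zeta_mat r n k 1 \<in> Grp r n"
  using zeta_in_Grp[of k 1] by simp

lemma zeta_in_roots: "zeta r \<in> roots r"
  using zeta_pow[OF r_pos] by (simp add: roots_def)

lemma pm_zeta: "k < n \<Longrightarrow> pm n (zeta_mat r n k 1) j = j"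
  unfolding zeta_mat_1 by (simp add: pm_rmat_roots zeta_in_roots)

lemma tw_zeta_zo:
  assumes "k < n" "i < n" "F \<in> V"
  shows "tw (zeta_mat r n k 1) (zo i F) = zo i (tw (zeta_mat r n k 1) F)"
  using assms
  by (simp add: zo_def lin_add[OF flin_tw] lin_scale[OF flin_tw] tw_ao tw_jmo zeta_mat_1_Grp pm_zeta)

lemma tw_zeta_commute:
  assumes "k < n" "i < n" "F \<in> V"
  shows "tw (zeta_mat r n k 1) (tw (zeta_mat r n i 1) F) = tw (zeta_mat r n i 1) (tw (zeta_mat r n k 1) F)"
proof -
  have "zeta_mat r n k 1 * zeta_mat r n i 1 = zeta_mat r n i 1 * zeta_mat r n k 1"
    unfolding zeta_mat_mono mono_mat_mult[OF permutes_id]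
    by (rule mono_mat_cong) auto
  then show ?thesis using assms by (simp add: zeta_mat_1_Grp flip: tw_mult)
qed

subsection \<open>Standard tableaux\<close>

lemma boxes_down:
  assumes "(l, p, q) \<in> boxes lam" "p' \<le> p" "q' \<le> q"
  shows "(l, p', q') \<in> boxes lam"
proof -
  have h: "l < length lam" "p < length (lam ! l)" "q < lam ! l ! p" using assms by (auto simp: boxes_def)
  have "is_partition (lam ! l)" using mp h by (simp add: is_multipartition_def)
  then have "sorted_wrt (\<ge>) (lam ! l)" by (simp add: is_partition_def)
  then have "lam ! l ! p \<le> lam ! l ! p'"
    using assms(2) h sorted_wrt_nth_less[of "(\<ge>)" "lam ! l" p' p] by (cases "p = p'") auto
  then show ?thesis using assms h by (auto simp: boxes_def)
qed

lemma ST_bij: "T \<in> ST \<Longrightarrow> bij_betw T {..<n} (boxes lam)"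
  by (simp add: SYT_def)

lemma ST_image: "T \<in> ST \<Longrightarrow> T ` {..<n} = boxes lam"
  using ST_bij by (simp add: bij_betw_def)

lemma ST_box: "T \<in> ST \<Longrightarrow> i < n \<Longrightarrow> T i \<in> boxes lam"
  using ST_image by blast

lemma ST_ex: "T \<in> ST \<Longrightarrow> b \<in> boxes lam \<Longrightarrow> \<exists>i<n. T i = b"
  using ST_image[of T] by (metis imageE lessThan_iff)

lemma ST_inj: "T \<in> ST \<Longrightarrow> i < n \<Longrightarrow> j < n \<Longrightarrow> T i = T j \<Longrightarrow> i = j"
  using ST_bij[of T] unfolding bij_betw_def by (meson inj_onD lessThan_iff)

lemma ST_row: "T \<in> ST \<Longrightarrow> i < n \<Longrightarrow> j < n \<Longrightarrow> beta (T i) = beta (T j) \<Longrightarrow>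
    box_row (T i) = box_row (T j) \<Longrightarrow> box_col (T i) < box_col (T j) \<Longrightarrow> i < j"
  and ST_col: "T \<in> ST \<Longrightarrow> i < n \<Longrightarrow> j < n \<Longrightarrow> beta (T i) = beta (T j) \<Longrightarrow>
    box_col (T i) = box_col (T j) \<Longrightarrow> box_row (T i) < box_row (T j) \<Longrightarrow> i < j"
  unfolding SYT_def by blast+

lemma box_eqI: "beta a = beta b \<Longrightarrow> box_row a = box_row b \<Longrightarrow> box_col a = box_col b \<Longrightarrow> a = b"
  by (simp add: beta_def box_row_def box_col_def prod_eq_iff)

lemma boxes_corner: "b \<in> boxes lam \<Longrightarrow> p \<le> box_row b \<Longrightarrow> q \<le> box_col b \<Longrightarrow> (beta b, p, q) \<in> boxes lam"
  using boxes_down[of "beta b" "box_row b" "box_col b" p q]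
  by (simp add: beta_def box_row_def box_col_def)

lemma box_sel [simp]: "beta (l, p, q) = l" "box_row (l, p, q) = p" "box_col (l, p, q) = q"
  by (simp_all add: beta_def box_row_def box_col_def)

text \<open>Compare both entries with the entry of the box that shares a row with one and a column with the
other; it belongs to the diagram.\<close>

lemma ST_mono:
  assumes T: "T \<in> ST" and ij: "i < n" "j < n" and b: "beta (T i) = beta (T j)"
    and le: "box_row (T i) \<le> box_row (T j)" "box_col (T i) \<le> box_col (T j)"
  shows "i \<le> j"
proof -
  have "(beta (T j), box_row (T j), box_col (T i)) \<in> boxes lam"
    using ST_box[OF T ij(2)] le by (intro boxes_corner) simp_all
  then obtain k where k: "k < n" "T k = (beta (T j), box_row (T j), box_col (T i))"
    using ST_ex[OF T] by blast
  have "i \<le> k"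
  proof (cases "box_row (T i) = box_row (T j)")
    case True
    then have "T i = T k" using k(2) b by (intro box_eqI) simp_all
    then show ?thesis using ST_inj[OF T ij(1) k(1)] by simp
  next
    case False
    then have "i < k"
      by (intro ST_col[OF T ij(1) k(1)]) (use k(2) b le in simp_all)
    then show ?thesis by simp
  qed
  also have "k \<le> j"
  proof (cases "box_col (T i) = box_col (T j)")
    case True
    then have "T k = T j" using k(2) by (intro box_eqI) simp_all
    then show ?thesis using ST_inj[OF T k(1) ij(2)] by simp
  next
    case False
    then have "k < j"
      by (intro ST_row[OF T k(1) ij(2)]) (use k(2) le in simp_all)
    then show ?thesis by simp
  qed
  finally show ?thesis .
qed

text \<open>Two boxes on a diagonal are separated by a box whose entry lies strictly between.\<close>

lemma ct_consecutive:
  assumes T: "T \<in> ST" and i: "Suc i < n" and b: "beta (T i) = beta (T (Suc i))"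
  shows "ct (T (Suc i)) \<noteq> ct (T i)"
proof
  assume c: "ct (T (Suc i)) = ct (T i)"
  have ne: "T i \<noteq> T (Suc i)" using ST_inj[OF T _ i, of i] i by auto
  consider "box_row (T (Suc i)) \<le> box_row (T i)" | "box_row (T i) < box_row (T (Suc i))" by linarith
  then show False
  proof cases
    case 1
    then have "box_col (T (Suc i)) \<le> box_col (T i)" using c by (simp add: ct_def)
    then have "Suc i \<le> i" by (intro ST_mono[OF T i _ b[symmetric] 1]) (use i in simp_all)
    then show False by simp
  next
    case 2
    then have col: "box_col (T i) < box_col (T (Suc i))" using c by (simp add: ct_def)
    have "(beta (T (Suc i)), box_row (T i), Suc (box_col (T i))) \<in> boxes lam"
      using ST_box[OF T i] 2 col by (intro boxes_corner) simp_all
    then obtain k where k: "k < n" "T k = (beta (T (Suc i)), box_row (T i), Suc (box_col (T i)))"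
      using ST_ex[OF T] by blast
    have "i < k" by (rule ST_row[OF T _ k(1)]) (use k(2) b i in simp_all)
    moreover have "k \<le> Suc i" by (rule ST_mono[OF T k(1) i]) (use k(2) 2 col in simp_all)
    moreover have "box_row (T k) = box_row (T i)" using k(2) by simp
    then have "k \<noteq> Suc i" using 2 by auto
    ultimately show False by simp
  qed
qed

text \<open>The smallest entry sits in the corner of its component.\<close>

lemma ct_first:
  assumes T: "T \<in> ST"
  shows "ct (T 0) = 0"
proof -
  have n: "0 < n" using n_pos by simp
  have "box_row (T 0) = 0"
  proof (rule ccontr)
    assume h: "box_row (T 0) \<noteq> 0"
    then have "(beta (T 0), box_row (T 0) - 1, box_col (T 0)) \<in> boxes lam"
      using ST_box[OF T n] by (intro boxes_corner) simp_all
    then obtain k where k: "k < n" "T k = (beta (T 0), box_row (T 0) - 1, box_col (T 0))"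
      using ST_ex[OF T] by blast
    have "k < 0" by (rule ST_col[OF T k(1) n]) (use k(2) h in simp_all)
    then show False by simp
  qed
  moreover have "box_col (T 0) = 0"
  proof (rule ccontr)
    assume h: "box_col (T 0) \<noteq> 0"
    then have "(beta (T 0), box_row (T 0), box_col (T 0) - 1) \<in> boxes lam"
      using ST_box[OF T n] by (intro boxes_corner) simp_all
    then obtain k where k: "k < n" "T k = (beta (T 0), box_row (T 0), box_col (T 0) - 1)"
      using ST_ex[OF T] by blast
    have "k < 0" by (rule ST_row[OF T k(1) n]) (use k(2) h in simp_all)
    then show False by simp
  qed
  ultimately show ?thesis by (simp add: ct_def)
qed

lemma beta_less: "T \<in> ST \<Longrightarrow> i < n \<Longrightarrow> beta (T i) < r"
  using ST_box[of T i] mp by (auto simp: boxes_def is_multipartition_def beta_def)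

lemma swap_tab_ST:
  assumes T: "T \<in> ST" and i: "Suc i < n" and b: "beta (T i) \<noteq> beta (T (Suc i))"
  shows "swap_tab i T \<in> ST"
proof -
  let ?s = "Transposition.transpose i (Suc i)"
  have s: "?s permutes {..<n}" using i by (intro permutes_swap_id) auto
  have lt: "?s a < n \<longleftrightarrow> a < n" for a using permutes_lt[OF s] .
  have ord: "a < c" if "?s a < ?s c" "beta (T (?s a)) = beta (T (?s c))" for a c
    using that b by (auto simp: Transposition.transpose_def split: if_splits)
  have "T \<in> extensional {..<n}" using T unfolding SYT_def by blast
  then have "swap_tab i T \<in> extensional {..<n}"
    using i by (auto simp: swap_tab_def extensional_def Transposition.transpose_def)
  moreover have "bij_betw (swap_tab i T) {..<n} (boxes lam)"
    unfolding swap_tab_def by (rule bij_betw_trans[OF permutes_imp_bij[OF s] ST_bij[OF T]])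
  moreover have "\<forall>a<n. \<forall>c<n. beta (swap_tab i T a) = beta (swap_tab i T c) \<longrightarrow>
      (box_row (swap_tab i T a) = box_row (swap_tab i T c) \<and>
        box_col (swap_tab i T a) < box_col (swap_tab i T c) \<longrightarrow> a < c) \<and>
      (box_col (swap_tab i T a) = box_col (swap_tab i T c) \<and>
        box_row (swap_tab i T a) < box_row (swap_tab i T c) \<longrightarrow> a < c)"
    unfolding swap_tab_def o_apply
  proof (intro allI impI conjI)
    fix a c assume a: "a < n" and c: "c < n" and b: "beta (T (?s a)) = beta (T (?s c))"
    have l: "?s a < n" "?s c < n" using a c lt by simp_all
    show "a < c" if "box_row (T (?s a)) = box_row (T (?s c)) \<and> box_col (T (?s a)) < box_col (T (?s c))"
      by (rule ord[OF ST_row[OF T l b] b]) (use that in simp_all)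
    show "a < c" if "box_col (T (?s a)) = box_col (T (?s c)) \<and> box_row (T (?s a)) < box_row (T (?s c))"
      by (rule ord[OF ST_col[OF T l b] b]) (use that in simp_all)
  qed
  ultimately show ?thesis unfolding SYT_def by (intro CollectI conjI)
qed

subsection \<open>Eigenvalues of the Jucys--Murphy operators\<close>

abbreviation "bv T \<equiv> pt 1 (vv T)"

lemma pt_1_scale: "pt 1 (\<lambda>U. c * u U) = fsc c (pt 1 u)"
  by (rule pt_scale)

lemma tw_zeta_bv:
  assumes "a < n" "T \<in> ST"
  shows "tw (zeta_mat r n a 1) (bv T) = fsc (zeta r ^ beta (T a)) (bv T)"
  using assms by (simp add: tw_pt zeta_mat_1_Grp Ssp_vv rho_zeta pt_1_scale)

text \<open>Every \<open>r\<close>-th root of unity is a power of \<open>\<zeta>\<close>.\<close>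

lemma tw_diag_bv:
  assumes a: "a < n" and T: "T \<in> ST" and z: "z \<in> roots r"
  shows "tw (rmat n a a z) (bv T) = fsc (z ^ beta (T a)) (bv T)"
proof -
  have *: "tw (rmat n a a (zeta r ^ l)) (bv T) = fsc ((zeta r ^ l) ^ beta (T a)) (bv T)" for l
  proof (induction l)
    case 0
    have "rmat n a a 1 = 1\<^sub>m n" unfolding rmat_def mono_mat_one by (rule mono_mat_cong) auto
    then show ?case using T by (simp add: tw_one V_basis)
  next
    case (Suc l)
    have e: "rmat n a a (zeta r ^ Suc l) = zeta_mat r n a 1 * rmat n a a (zeta r ^ l)"
      unfolding zeta_mat_1 rmat_def mono_mat_mult[OF transpose_permutes[OF a a]]
      by (rule mono_mat_cong) auto
    have "rmat n a a (zeta r ^ l) \<in> Grp r n" using a zeta_pow_pow by (intro rmat_roots) (auto simp: roots_def)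
    then show ?case unfolding e using a T Suc
      by (simp add: tw_mult zeta_mat_1_Grp V_basis lin_scale[OF flin_tw] tw_zeta_bv power_mult_distrib mult.commute)
  qed
  obtain l where "z = zeta r ^ l" using z bij_zeta_roots[OF r_pos] by (auto simp: bij_betw_def)
  then show ?thesis using * by simp
qed

lemma swap_mat_Grp: "a < n \<Longrightarrow> b < n \<Longrightarrow> swap_mat n a b \<in> Grp r n"
  unfolding swap_mat_def perm_mat_mono by (rule GrpI[OF r_pos transpose_permutes]) auto

lemma pm_swap_mat: "a < n \<Longrightarrow> b < n \<Longrightarrow> pm n (swap_mat n a b) j = Transposition.transpose a b j"
  unfolding swap_mat_def perm_mat_mono by (rule pm_mono_mat[OF transpose_permutes]) auto

text \<open>A reflection is a transposition conjugated by a diagonal matrix, which contributes the character of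
roots of unity with exponent \<open>\<beta>(T(a)) - \<beta>(T(b))\<close>; the sum vanishes unless this is trivial.\<close>

lemma sgo_bv:
  assumes ab: "a < n" "b < n" "a \<noteq> b" and T: "T \<in> ST"
  shows "sgo a b (bv T) = (if beta (T a) = beta (T b) then fsc (of_nat r) (tw (swap_mat n a b) (bv T)) else 0)"
proof -
  have "tw (rmat n a b z) (bv T) = fsc (z ^ beta (T b) * inverse z ^ beta (T a)) (tw (swap_mat n a b) (bv T))"
    if z: "z \<in> roots r" for z
  proof -
    have iz: "inverse z \<in> roots r" using z by (simp add: roots_def power_inverse)
    have e: "rmat n a b z = swap_mat n a b * (rmat n a a (inverse z) * rmat n b b z)"
      unfolding rmat_def swap_mat_def perm_mat_mono mono_mat_mult[OF transpose_permutes[OF ab(2) ab(2)]]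
      by (subst mono_mat_mult) (use ab in \<open>auto intro!: mono_mat_cong permutes_compose transpose_permutes\<close>)
    show ?thesis unfolding e using ab T z iz
      by (simp add: tw_mult swap_mat_Grp rmat_roots Grp_mult(1)[OF r_pos] V_basis tw_diag_bv
          lin_scale[OF flin_tw] V_tw mult.commute)
  qed
  then have "sgo a b (bv T) = fsc (\<Sum>z\<in>roots r. z ^ beta (T b) * inverse z ^ beta (T a)) (tw (swap_mat n a b) (bv T))"
    unfolding sgo_def fsc.scale_sum_left by (intro sum.cong) auto
  then show ?thesis using sum_roots_power[OF r_pos beta_less[OF T ab(2)] beta_less[OF T ab(1)]] by simp
qed

text \<open>Conjugating by the transposition shifts the Jucys-Murphy element, up to the one term that is missing.\<close>

lemma jmo_swap:
  assumes k: "Suc k < n" and F: "F \<in> V"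
  shows "jmo (Suc k) F = tw (swap_mat n k (Suc k)) (jmo k (tw (swap_mat n k (Suc k)) F)) + sgo (Suc k) k F"
proof -
  let ?s = "swap_mat n k (Suc k)"
  have s: "?s \<in> Grp r n" using k by (intro swap_mat_Grp) auto
  have ss: "?s * ?s = 1\<^sub>m n"
    unfolding swap_mat_def perm_mat_mono mono_mat_one
    by (subst mono_mat_mult) (use k in \<open>auto intro!: mono_mat_cong transpose_permutes\<close>)
  have inv: "tw ?s (tw ?s F) = F"
    using tw_mult[OF s s F] by (simp add: ss tw_one F)
  have "tw ?s (jmo k (tw ?s F)) = (\<Sum>j<k. sgo (Suc k) j F)"
    unfolding jmo_def lin_sum[OF flin_tw] using k
    by (intro sum.cong refl)
      (auto simp: tw_sgo[OF s _ _ V_tw[OF s F]] inv pm_swap_mat Transposition.transpose_def)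
  then show ?thesis by (simp add: jmo_def)
qed

lemma tw_swap_bv:
  assumes "Suc k < n" "T \<in> ST"
  shows "tw (swap_mat n k (Suc k)) (bv T) =
    (if beta (T k) \<noteq> beta (T (Suc k)) then bv (swap_tab k T)
     else let a = real_of_int (ct (T (Suc k)) - ct (T k)) in
       fsc (complex_of_real (1 / a)) (bv T) +
       (if swap_tab k T \<in> ST then fsc (complex_of_real (sqrt (1 - 1 / a\<^sup>2))) (bv (swap_tab k T)) else 0))"
proof -
  have "tw (swap_mat n k (Suc k)) (bv T) = pt 1 (rho (swap_mat n k (Suc k)) (vv T))"
    using assms by (simp add: tw_pt swap_mat_Grp Ssp_vv)
  moreover have "pt 1 (\<lambda>U. 0) = (0 :: tableau \<Rightarrow> mpoly)" by (simp add: pt_def zero_fun_def)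
  ultimately show ?thesis unfolding rho_swap[OF assms]
    by (cases "swap_tab k T \<in> ST"; cases "beta (T k) = beta (T (Suc k))")
      (simp_all only: Let_def pt_add_right pt_1_scale if_True if_False simp_thms)
qed

text \<open>By induction on \<open>k\<close>, conjugating with \<open>s\<^sub>k\<close>. If \<open>k\<close> and \<open>k + 1\<close> lie in different components, \<open>s\<^sub>k\<close>
simply exchanges them. Otherwise the coefficient \<open>1/a\<close>, with \<open>a\<close> the difference of contents, is exactly
what makes the vector an eigenvector for the next element.\<close>

lemma jmo_bv:
  assumes "k < n" "T \<in> ST"
  shows "jmo k (bv T) = fsc (of_nat r * of_int (ct (T k))) (bv T)"
  using assms
proof (induction k arbitrary: T)
  case 0
  then show ?case by (simp add: jmo_def ct_first)
next
  case (Suc k)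
  let ?s = "swap_mat n k (Suc k)" and ?T = "swap_tab k T"
  have k: "k < n" using Suc by simp
  have T1: "?T k = T (Suc k)" "?T (Suc k) = T k"
    by (simp_all add: swap_tab_def)
  have s: "?s \<in> Grp r n" using Suc by (intro swap_mat_Grp) auto
  have ss: "?s * ?s = 1\<^sub>m n"
    unfolding swap_mat_def perm_mat_mono mono_mat_one
    by (subst mono_mat_mult) (use Suc in \<open>auto intro!: mono_mat_cong transpose_permutes\<close>)
  have inv: "tw ?s (tw ?s (bv T)) = bv T"
    using tw_mult[OF s s V_basis[OF Suc(3)]] unfolding ss tw_one[OF V_basis[OF Suc(3)]] by (rule sym)
  have swap: "swap_mat n (Suc k) k = ?s" by (simp add: swap_mat_def transpose_commute)
  show ?case
  proof (cases "beta (T k) = beta (T (Suc k))")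
    case False
    then have T': "?T \<in> ST" using swap_tab_ST Suc by simp
    have s1: "tw ?s (bv T) = bv ?T" using tw_swap_bv[OF Suc(2,3)] False by simp
    have "jmo (Suc k) (bv T) = tw ?s (jmo k (bv ?T)) + sgo (Suc k) k (bv T)"
      using jmo_swap[OF Suc(2) V_basis[OF Suc(3)]] s1 by simp
    also have "sgo (Suc k) k (bv T) = 0" using sgo_bv[OF Suc(2) k _ Suc(3)] False by simp
    also have "tw ?s (jmo k (bv ?T)) = fsc (of_nat r * of_int (ct (T (Suc k)))) (tw ?s (bv ?T))"
      using Suc(1)[OF k T'] T1 by (simp add: lin_scale[OF flin_tw])
    also have "tw ?s (bv ?T) = bv T" using inv s1 by simp
    finally show ?thesis by simp
  next
    case True
    let ?a = "real_of_int (ct (T (Suc k)) - ct (T k))"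
    have a: "complex_of_real ?a \<noteq> 0" using ct_consecutive[OF Suc(3,2) True] by simp
    let ?G = "if ?T \<in> ST then fsc (complex_of_real (sqrt (1 - 1 / ?a\<^sup>2))) (bv ?T) else 0"
    have s1: "tw ?s (bv T) = fsc (1 / complex_of_real ?a) (bv T) + ?G"
      using tw_swap_bv[OF Suc(2,3)] True by (simp add: Let_def)
    have G: "jmo k ?G = fsc (of_nat r * of_int (ct (T (Suc k)))) ?G"
      using Suc(1)[OF k, of ?T] T1 by (auto simp: lin_scale[OF flin_jmo] lin_zero[OF flin_jmo] mult.commute)
    have c: "of_nat r * of_int (ct (T k)) / complex_of_real ?a
        = of_nat r * of_int (ct (T (Suc k))) / complex_of_real ?a - of_nat r"
      using a by (simp add: field_simps)
    have "jmo k (tw ?s (bv T)) = fsc (of_nat r * of_int (ct (T k)) / complex_of_real ?a) (bv T)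
        + fsc (of_nat r * of_int (ct (T (Suc k)))) ?G"
      unfolding s1 lin_add[OF flin_jmo] lin_scale[OF flin_jmo] G Suc(1)[OF k Suc(3)]
      by simp
    also have "\<dots> = fsc (of_nat r * of_int (ct (T (Suc k)))) (tw ?s (bv T)) - fsc (of_nat r) (bv T)"
      unfolding c s1 fsc.scale_left_diff_distrib fsc.scale_right_distrib by simp
    finally have "tw ?s (jmo k (tw ?s (bv T)))
        = fsc (of_nat r * of_int (ct (T (Suc k)))) (bv T) - fsc (of_nat r) (tw ?s (bv T))"
      by (simp add: lin_diff[OF flin_tw] lin_scale[OF flin_tw] inv)
    moreover have "sgo (Suc k) k (bv T) = fsc (of_nat r) (tw ?s (bv T))"
      using sgo_bv[OF Suc(2) k _ Suc(3)] True swap by simp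
    ultimately show ?thesis using jmo_swap[OF Suc(2) V_basis[OF Suc(3)]] by simp
  qed
qed

end

section \<open>Commuting triangular operators\<close>

text \<open>Abstract setting for simultaneous eigenvectors: commuting operators that are triangular with respect
to a well-founded partial order on a basis. The last assumption expresses that joint generalized
eigenspaces are one-dimensional, in the only form that is needed: a vector that is an eigenvector
modulo an eigenvector of the same weight is proportional to it.\<close>

locale triangular_system = vector_space scale
  for scale :: "complex \<Rightarrow> 'v::ab_group_add \<Rightarrow> 'v" (infixr "*s" 75) +
  fixes V :: "'v set" and \<Gamma> :: "'s set" and e :: "'s \<Rightarrow> 'v" and coef :: "'s \<Rightarrow> 'v \<Rightarrow> complex"
    and lt :: "'s \<Rightarrow> 's \<Rightarrow> bool" and G :: "('v \<Rightarrow> 'v) set"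
  assumes subspace_V: "subspace V"
    and e_V: "s \<in> \<Gamma> \<Longrightarrow> e s \<in> V"
    and coef_add: "coef s (x + y) = coef s x + coef s y"
    and coef_scale: "coef s (c *s x) = c * coef s x"
    and coef_e: "s \<in> \<Gamma> \<Longrightarrow> t \<in> \<Gamma> \<Longrightarrow> coef s (e t) = (if s = t then 1 else 0)"
    and coef_finite: "x \<in> V \<Longrightarrow> finite {s \<in> \<Gamma>. coef s x \<noteq> 0}"
    and expand: "x \<in> V \<Longrightarrow> x = (\<Sum>s\<in>{s \<in> \<Gamma>. coef s x \<noteq> 0}. coef s x *s e s)"
    and finite_G: "finite G"
    and G_hom: "g \<in> G \<Longrightarrow> module_hom scale scale g"
    and G_V: "g \<in> G \<Longrightarrow> x \<in> V \<Longrightarrow> g x \<in> V"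
    and G_commute: "g \<in> G \<Longrightarrow> h \<in> G \<Longrightarrow> x \<in> V \<Longrightarrow> g (h x) = h (g x)"
    and wf_lt: "wf {(t, s). lt t s}"
    and lt_trans: "lt t s \<Longrightarrow> lt s u \<Longrightarrow> lt t u"
    and triangular: "g \<in> G \<Longrightarrow> s \<in> \<Gamma> \<Longrightarrow> t \<in> \<Gamma> \<Longrightarrow> coef t (g (e s)) \<noteq> 0 \<Longrightarrow> t = s \<or> lt t s"
    and simple: "x \<in> V \<Longrightarrow> y \<in> V \<Longrightarrow> x \<noteq> 0 \<Longrightarrow> (\<And>g. g \<in> G \<Longrightarrow> g x = \<chi> g *s x) \<Longrightarrow>
      (\<And>g. g \<in> G \<Longrightarrow> \<exists>c. g y - \<chi> g *s y = c *s x) \<Longrightarrow> \<exists>c. y = c *s x"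
begin

lemma lt_irrefl: "\<not> lt s s"
  using wf_lt by (metis (mono_tags) case_prodI mem_Collect_eq wf_not_refl)

lemma coef_0 [simp]: "coef s 0 = 0"
  using coef_scale[of s 0 0] by simp

lemma coef_diff: "coef s (x - y) = coef s x - coef s y"
  using coef_add[of s "x - y" y] by simp

lemma coef_sum: "coef s (\<Sum>t\<in>A. x t) = (\<Sum>t\<in>A. coef s (x t))"
  by (induction A rule: infinite_finite_induct) (auto simp: coef_add)

text \<open>The span of the basis vectors below \<open>s\<close>.\<close>

definition L :: "'s \<Rightarrow> 'v set"
  where "L s = {x \<in> V. \<forall>t\<in>\<Gamma>. coef t x \<noteq> 0 \<longrightarrow> lt t s}"

lemma subspace_L: "subspace (L s)"
  using subspace_V unfolding subspace_def L_def by (auto simp: coef_add coef_scale)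

text \<open>The weight of \<open>s\<close>, read off from the diagonal coefficient.\<close>

definition chi :: "('v \<Rightarrow> 'v) \<Rightarrow> 's \<Rightarrow> complex"
  where "chi g s = coef s (g (e s))"

definition eig :: "'s \<Rightarrow> 'v \<Rightarrow> bool"
  where "eig s f \<longleftrightarrow> f \<in> V \<and> f - e s \<in> L s \<and> (\<forall>g\<in>G. g f = chi g s *s f)"

lemma eig_V: "eig s f \<Longrightarrow> f \<in> V"
  and eig_G: "eig s f \<Longrightarrow> g \<in> G \<Longrightarrow> g f = chi g s *s f"
  by (simp_all add: eig_def)

lemma coef_eig:
  assumes "eig s f" "s \<in> \<Gamma>" "t \<in> \<Gamma>"
  shows "coef t f \<noteq> 0 \<Longrightarrow> t = s \<or> lt t s" and "coef s f = 1"
proof -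
  have *: "coef u (f - e s) = 0 \<or> lt u s" if "u \<in> \<Gamma>" for u
    using assms(1) that by (auto simp: eig_def L_def)
  show "coef t f \<noteq> 0 \<Longrightarrow> t = s \<or> lt t s"
    using *[OF assms(3)] assms by (auto simp: coef_diff coef_e split: if_splits)
  show "coef s f = 1"
    using *[OF assms(2)] assms lt_irrefl by (simp add: coef_diff coef_e)
qed

lemma eig_L: "eig t f \<Longrightarrow> t \<in> \<Gamma> \<Longrightarrow> lt t s \<Longrightarrow> f \<in> L s"
  using coef_eig(1)[of t f] lt_trans by (auto simp: L_def eig_V)

lemma span_family:
  assumes "x \<in> span (f ` B)"
  shows "\<exists>A c. finite A \<and> A \<subseteq> B \<and> x = (\<Sum>t\<in>A. c t *s f t)"
  using assms
proof (induction rule: span_induct_alt)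
  case base
  show ?case by (intro exI[of _ "{}"]) auto
next
  case (step c' v y)
  then obtain t A c where h: "t \<in> B" "v = f t" "finite A" "A \<subseteq> B" "y = (\<Sum>t\<in>A. c t *s f t)" by blast
  let ?c = "\<lambda>u. (if u = t then c' else 0) + (if u \<in> A then c u else 0)"
  have "(\<Sum>u\<in>insert t A. ?c u *s f u)
      = (\<Sum>u\<in>insert t A. (if u = t then c' *s f u else 0)) + (\<Sum>u\<in>insert t A. (if u \<in> A then c u *s f u else 0))"
    by (simp add: scale_left_distrib sum.distrib[symmetric] if_distrib[of "\<lambda>a. a *s f _"] cong: if_cong)
  also have "(\<Sum>u\<in>insert t A. (if u = t then c' *s f u else 0)) = c' *s f t"
    using h(3) by (simp add: sum.delta)
  also have "(\<Sum>u\<in>insert t A. (if u \<in> A then c u *s f u else 0)) = (\<Sum>u\<in>A. c u *s f u)"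
    using h(3) by (intro sum.mono_neutral_cong_right) auto
  finally show ?case using h by (intro exI[of _ "insert t A"] exI[of _ ?c]) auto
qed

lemma finite_maximal:
  assumes "finite A" "A \<noteq> {}"
  shows "\<exists>m\<in>A. \<forall>t\<in>A. \<not> lt m t"
  using assms
proof (induction A rule: finite_ne_induct)
  case (singleton x)
  then show ?case using lt_irrefl by simp
next
  case (insert x A)
  then obtain m where m: "m \<in> A" "\<forall>t\<in>A. \<not> lt m t" by blast
  show ?case
  proof (cases "lt m x")
    case True
    then have "\<forall>t\<in>insert x A. \<not> lt x t" using m lt_trans lt_irrefl by blast
    then show ?thesis by blast
  next
    case False
    then show ?thesis using m by blast
  qed
qed

text \<open>A maximal index with nonzero coefficient contributes a leading term that no other summand cancels.\<close>

lemma eig_independent: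
  assumes A: "finite A" "A \<subseteq> \<Gamma>" and f: "\<And>t. t \<in> A \<Longrightarrow> eig t (f t)"
    and zero: "(\<Sum>t\<in>A. c t *s f t) = 0" and t: "t \<in> A"
  shows "c t = 0"
proof (rule ccontr)
  assume "c t \<noteq> 0"
  let ?A = "{t \<in> A. c t \<noteq> 0}"
  have "finite ?A" "?A \<noteq> {}" using A t \<open>c t \<noteq> 0\<close> by auto
  then obtain m where m: "m \<in> A" "c m \<noteq> 0" and max: "\<And>u. u \<in> A \<Longrightarrow> c u \<noteq> 0 \<Longrightarrow> \<not> lt m u"
    using finite_maximal[of ?A] by blast
  have other: "c u * coef m (f u) = 0" if "u \<in> A" "u \<noteq> m" for u
    using coef_eig(1)[OF f[OF that(1)], of m] max[OF that(1)] that A m by auto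
  have "coef m (\<Sum>t\<in>A. c t *s f t) = (\<Sum>u\<in>A. c u * coef m (f u))"
    by (simp add: coef_sum coef_scale)
  also have "\<dots> = (\<Sum>u\<in>A. if u = m then c m * coef m (f m) else 0)"
    using other by (intro sum.cong) auto
  also have "\<dots> = c m * coef m (f m)"
    using A m by (simp add: sum.delta)
  also have "\<dots> = c m" using coef_eig(2)[OF f[OF m(1)], of m] m A by auto
  finally show False using zero m by simp
qed

lemma L_span:
  assumes f: "\<And>t. t \<in> \<Gamma> \<Longrightarrow> lt t s \<Longrightarrow> eig t (f t)" and x: "x \<in> L s"
  shows "x \<in> span (f ` {t \<in> \<Gamma>. lt t s})"
proof -
  have e: "e t \<in> span (f ` {u \<in> \<Gamma>. lt u s})" if "t \<in> \<Gamma>" "lt t s" for t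
    using that
  proof (induction t rule: wf_induct_rule[OF wf_lt])
    case (1 t)
    have "f t - e t \<in> L t" "f t - e t \<in> V" using f[OF 1(2,3)] by (auto simp: eig_def L_def)
    then have "f t - e t = (\<Sum>u\<in>{u \<in> \<Gamma>. coef u (f t - e t) \<noteq> 0}. coef u (f t - e t) *s e u)"
      and lt: "\<And>u. u \<in> \<Gamma> \<Longrightarrow> coef u (f t - e t) \<noteq> 0 \<Longrightarrow> lt u t"
      using expand by (auto simp: L_def)
    moreover have "(\<Sum>u\<in>{u \<in> \<Gamma>. coef u (f t - e t) \<noteq> 0}. coef u (f t - e t) *s e u)
        \<in> span (f ` {u \<in> \<Gamma>. lt u s})"
      using 1 lt lt_trans by (intro span_sum span_scale 1(1)) blast+
    ultimately have "f t - e t \<in> span (f ` {u \<in> \<Gamma>. lt u s})" by simp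
    moreover have "f t \<in> span (f ` {u \<in> \<Gamma>. lt u s})" using 1 by (intro span_base) auto
    ultimately have "f t - (f t - e t) \<in> span (f ` {u \<in> \<Gamma>. lt u s})" by (rule span_diff[rotated])
    then show ?case by simp
  qed
  have "x = (\<Sum>u\<in>{u \<in> \<Gamma>. coef u x \<noteq> 0}. coef u x *s e u)" using expand x by (simp add: L_def)
  also have "\<dots> \<in> span (f ` {u \<in> \<Gamma>. lt u s})"
    using x by (intro span_sum span_scale e) (auto simp: L_def)
  finally show ?thesis .
qed

text \<open>Two eigenvectors with the same weight would be proportional, yet they have different leading terms.\<close>

lemma eig_distinct:
  assumes s: "s \<in> \<Gamma>" "eig s f" and t: "t \<in> \<Gamma>" "eig t f'" and eq: "\<And>g. g \<in> G \<Longrightarrow> chi g s = chi g t"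
  shows "s = t"
proof (rule ccontr)
  assume ne: "s \<noteq> t"
  have "f \<noteq> 0" using coef_eig(2)[OF s(2,1,1)] by auto
  have "\<exists>c. f' = c *s f"
  proof (rule simple[where \<chi> = "\<lambda>g. chi g s"])
    show "\<exists>c. g f' - chi g s *s f' = c *s f" if "g \<in> G" for g
      using eig_G[OF t(2) that] eq[OF that] by (intro exI[of _ 0]) simp
  qed (use s t \<open>f \<noteq> 0\<close> in \<open>auto simp: eig_V eig_G\<close>)
  then obtain c where c: "f' = c *s f" by blast
  let ?f = "\<lambda>u. if u = s then f else f'" and ?c = "\<lambda>u. if u = s then c else -1"
  have "?c t = 0"
    by (rule eig_independent[where A = "{s, t}" and f = ?f])
      (use s t ne c in auto)
  then show False using ne by auto
qed

text \<open>The correction of \<open>e s\<close> is sought in the span of the lower eigenvectors. Commutativity makes the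
error terms proportional to differences of weights, so they can be removed for every lower index of
different weight. A lower index of the same weight is unique and contradicts simplicity.\<close>

lemma eig_step:
  assumes s: "s \<in> \<Gamma>" and f: "\<And>t. t \<in> \<Gamma> \<Longrightarrow> lt t s \<Longrightarrow> eig t (f t)"
  shows "\<exists>x. eig s x"
proof -
  note G_add = module_hom.add[OF G_hom] and G_scale = module_hom.scale[OF G_hom] and G_sum = module_hom.sum[OF G_hom]
  have ex: "\<exists>A c. finite A \<and> A \<subseteq> {t \<in> \<Gamma>. lt t s} \<and> g (e s) - chi g s *s e s = (\<Sum>t\<in>A. c t *s f t)"
    if g: "g \<in> G" for g
  proof (rule span_family, rule L_span)
    have "g (e s) - chi g s *s e s \<in> V"
      by (rule subspace_diff[OF subspace_V G_V[OF g e_V[OF s]] subspace_scale[OF subspace_V e_V[OF s]]])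
    moreover have "lt t s" if "t \<in> \<Gamma>" "coef t (g (e s) - chi g s *s e s) \<noteq> 0" for t
      using triangular[OF g s that(1)] that s
      by (cases "t = s") (auto simp: coef_diff coef_scale coef_e chi_def)
    ultimately show "g (e s) - chi g s *s e s \<in> L s" by (auto simp: L_def)
  qed (use f in auto)
  have "\<forall>g\<in>G. \<exists>p. finite (fst p) \<and> fst p \<subseteq> {t \<in> \<Gamma>. lt t s} \<and>
      g (e s) - chi g s *s e s = (\<Sum>t\<in>fst p. snd p t *s f t)"
    using ex by (simp add: split_paired_Ex)
  from bchoice[OF this] obtain P where P: "\<forall>g\<in>G. finite (fst (P g)) \<and> fst (P g) \<subseteq> {t \<in> \<Gamma>. lt t s} \<and>
      g (e s) - chi g s *s e s = (\<Sum>t\<in>fst (P g). snd (P g) t *s f t)" ..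
  define A' c' where "A' g = fst (P g)" and "c' g = snd (P g)" for g
  have A': "finite (A' g)" "A' g \<subseteq> {t \<in> \<Gamma>. lt t s}"
    and c': "g (e s) - chi g s *s e s = (\<Sum>t\<in>A' g. c' g t *s f t)" if "g \<in> G" for g
    using P that by (auto simp: A'_def c'_def)
  define A where "A = (\<Union>g\<in>G. A' g)"
  define c where "c g t = (if t \<in> A' g then c' g t else 0)" for g t
  have A: "finite A" "A \<subseteq> \<Gamma>" "\<And>t. t \<in> A \<Longrightarrow> lt t s" "\<And>t. t \<in> A \<Longrightarrow> eig t (f t)"
    using A' finite_G f by (auto simp: A_def)
  have ge: "g (e s) = chi g s *s e s + (\<Sum>t\<in>A. c g t *s f t)" if g: "g \<in> G" for g
  proof -
    have "(\<Sum>t\<in>A. c g t *s f t) = (\<Sum>t\<in>A' g. c' g t *s f t)"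
      using A(1) g by (intro sum.mono_neutral_cong_right) (auto simp: A_def c_def)
    then show ?thesis using c'[OF g] by (simp add: algebra_simps)
  qed
  have gf: "g (\<Sum>t\<in>B. b t *s f t) = (\<Sum>t\<in>B. (b t * chi g t) *s f t)" if "g \<in> G" "B \<subseteq> A" for g b B
    unfolding G_sum[OF that(1)]
  proof (rule sum.cong[OF refl])
    fix t assume "t \<in> B"
    then have "g (f t) = chi g t *s f t" using that A(4) by (intro eig_G) auto
    then show "g (b t *s f t) = (b t * chi g t) *s f t" by (simp add: G_scale[OF that(1)])
  qed
  \<comment> \<open>compare the coefficients of the lower eigenvectors in \<open>g (h (e s)) = h (g (e s))\<close>\<close>
  have cons: "c g t * (chi h s - chi h t) = c h t * (chi g s - chi g t)"
    if g: "g \<in> G" and h: "h \<in> G" and t: "t \<in> A" for g h t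
  proof -
    have *: "g (h (e s)) = (chi h s * chi g s) *s e s + (\<Sum>t\<in>A. (chi h s * c g t + c h t * chi g t) *s f t)"
      if g: "g \<in> G" and h: "h \<in> G" for g h
      unfolding ge[OF h] G_add[OF g] G_scale[OF g] ge[OF g] gf[OF g order_refl]
      by (simp add: scale_right_distrib scale_sum_right sum.distrib scale_left_distrib add.assoc)
    have "(\<Sum>t\<in>A. ((chi h s * c g t + c h t * chi g t) - (chi g s * c h t + c g t * chi h t)) *s f t) = 0"
      using G_commute[OF g h e_V[OF s]] unfolding *[OF g h] *[OF h g]
      by (simp add: scale_left_diff_distrib sum_subtractf mult.commute)
    from eig_independent[OF A(1,2,4) this t] show ?thesis by (simp add: algebra_simps)
  qed
  \<comment> \<open>the lower indices with the same weight as \<open>s\<close>, for which the error term cannot be divided away\<close>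
  define B where "B = {t \<in> A. \<forall>g\<in>G. chi g t = chi g s}"
  have "\<exists>d. \<forall>g\<in>G. c g t = d * (chi g s - chi g t)" if t: "t \<in> A - B" for t
  proof -
    obtain h where h: "h \<in> G" "chi h t \<noteq> chi h s" using t by (auto simp: B_def)
    have "c g t = (c h t / (chi h s - chi h t)) * (chi g s - chi g t)" if "g \<in> G" for g
      using cons[OF that h(1), of t] h t by (simp add: field_simps)
    then show ?thesis by blast
  qed
  then obtain d where d: "\<And>t g. t \<in> A - B \<Longrightarrow> g \<in> G \<Longrightarrow> c g t = d t * (chi g s - chi g t)" by metis
  define x where "x = e s + (\<Sum>t\<in>A - B. d t *s f t)"
  have "(\<Sum>t\<in>A - B. d t *s f t) \<in> L s"
    using A by (intro subspace_sum[OF subspace_L] subspace_scale[OF subspace_L] eig_L[of _ "f _"]) auto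
  then have xe: "x - e s \<in> L s" by (simp add: x_def)
  then have xV: "x \<in> V" using subspace_add[OF subspace_V, of "x - e s" "e s"] e_V[OF s] by (simp add: L_def)
  have gx: "g x - chi g s *s x = (\<Sum>t\<in>B. c g t *s f t)" if g: "g \<in> G" for g
  proof -
    have BA: "B \<subseteq> A" by (auto simp: B_def)
    have "g x = chi g s *s e s + (\<Sum>t\<in>A. c g t *s f t) + (\<Sum>t\<in>A - B. (d t * chi g t) *s f t)"
      unfolding x_def G_add[OF g] ge[OF g] gf[OF g Diff_subset] ..
    also have "(\<Sum>t\<in>A. c g t *s f t) = (\<Sum>t\<in>A - B. c g t *s f t) + (\<Sum>t\<in>B. c g t *s f t)"
      using A(1) BA by (rule sum.subset_diff[rotated])
    also have "(\<Sum>t\<in>A - B. c g t *s f t) = (\<Sum>t\<in>A - B. (d t * (chi g s - chi g t)) *s f t)"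
      using d g by (intro sum.cong) auto
    finally show ?thesis
      by (simp add: x_def scale_right_distrib scale_sum_right right_diff_distrib
        scale_left_diff_distrib sum_subtractf mult.commute)
  qed
  have coef_x: "coef s x = 1"
    using xe s lt_irrefl by (auto simp: L_def coef_diff coef_e)
  have "B = {}"
  proof (rule ccontr)
    assume "B \<noteq> {}"
    then obtain t where t: "t \<in> B" by blast
    have tA: "t \<in> A" "t \<in> \<Gamma>" using t A(2) by (auto simp: B_def)
    have "u = t" if u: "u \<in> B" for u
    proof (rule eig_distinct)
      show "u \<in> \<Gamma>" "t \<in> \<Gamma>" "eig u (f u)" "eig t (f t)" using u t A by (auto simp: B_def)
      show "chi g u = chi g t" if "g \<in> G" for g using u t that by (simp add: B_def)
    qed
    then have B: "B = {t}" using t by blast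
    have "\<exists>b. x = b *s f t"
    proof (rule simple[where \<chi> = "\<lambda>g. chi g s"])
      show "f t \<in> V" "f t \<noteq> 0" using coef_eig(2)[OF A(4)[OF tA(1)] tA(2,2)] A(4)[OF tA(1)] by (auto simp: eig_V)
      show "g (f t) = chi g s *s f t" if "g \<in> G" for g
        using eig_G[OF A(4)[OF tA(1)] that] t that by (simp add: B_def)
      show "\<exists>b. g x - chi g s *s x = b *s f t" if "g \<in> G" for g
        using gx[OF that] by (simp add: B)
    qed (rule xV)
    then obtain b where "x = b *s f t" by blast
    then have "coef s (f t) \<noteq> 0" using coef_x by (auto simp: coef_scale)
    then have "s = t \<or> lt s t" using coef_eig(1)[OF A(4)[OF tA(1)] tA(2) s] by blast
    then show False using A(3)[OF tA(1)] lt_trans lt_irrefl by blast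
  qed
  then have "g x = chi g s *s x" if "g \<in> G" for g using gx[OF that] by simp
  then have "eig s x" using xe xV by (simp add: eig_def)
  then show ?thesis by blast
qed

definition ef :: "'s \<Rightarrow> 'v"
  where "ef s = (SOME x. eig s x)"

lemma eig_ef: "s \<in> \<Gamma> \<Longrightarrow> eig s (ef s)"
proof (induction s rule: wf_induct_rule[OF wf_lt])
  case (1 s)
  then have "\<exists>x. eig s x" by (intro eig_step[where f = ef]) auto
  then show ?case unfolding ef_def by (rule someI_ex)
qed

lemma ef_V: "s \<in> \<Gamma> \<Longrightarrow> ef s \<in> V"
  and ef_G: "s \<in> \<Gamma> \<Longrightarrow> g \<in> G \<Longrightarrow> g (ef s) = chi g s *s ef s"
  and ef_nonzero: "s \<in> \<Gamma> \<Longrightarrow> ef s \<noteq> 0"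
  using eig_ef eig_V eig_G coef_eig(2)[OF eig_ef] by (fastforce)+

lemma weights_distinct:
  "s \<in> \<Gamma> \<Longrightarrow> t \<in> \<Gamma> \<Longrightarrow> s \<noteq> t \<Longrightarrow> \<exists>g\<in>G. chi g s \<noteq> chi g t"
  using eig_distinct[OF _ eig_ef _ eig_ef] by blast

lemma ef_independent:
  "finite A \<Longrightarrow> A \<subseteq> \<Gamma> \<Longrightarrow> (\<Sum>t\<in>A. c t *s ef t) = 0 \<Longrightarrow> t \<in> A \<Longrightarrow> c t = 0"
  by (rule eig_independent[where f = ef]) (auto intro: eig_ef)

lemma ef_spans:
  assumes "x \<in> V"
  shows "\<exists>A c. finite A \<and> A \<subseteq> \<Gamma> \<and> x = (\<Sum>t\<in>A. c t *s ef t)"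
proof (rule span_family)
  have e: "e s \<in> span (ef ` \<Gamma>)" if s: "s \<in> \<Gamma>" for s
  proof -
    have "ef s - e s \<in> span (ef ` {t \<in> \<Gamma>. lt t s})"
      using eig_ef s by (intro L_span) (auto simp: eig_def)
    then have "ef s - e s \<in> span (ef ` \<Gamma>)" by (rule subsetD[OF span_mono, rotated]) auto
    from span_diff[OF span_base[OF imageI[OF s]] this] show ?thesis by simp
  qed
  have "(\<Sum>s\<in>{s \<in> \<Gamma>. coef s x \<noteq> 0}. coef s x *s e s) \<in> span (ef ` \<Gamma>)"
    by (intro span_sum span_scale e) auto
  then show "x \<in> span (ef ` \<Gamma>)" using expand[OF assms] by simp
qed

text \<open>The difference to \<open>ef s\<close> is a combination of lower eigenvectors, whose weights differ from that of
\<open>s\<close>.\<close>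

lemma ef_unique:
  assumes s: "s \<in> \<Gamma>" and m: "m \<in> V" "m - e s \<in> L s" and g: "\<And>g. g \<in> G \<Longrightarrow> \<exists>c. g m = c *s m"
  shows "m = ef s"
proof -
  have "m - e s - (ef s - e s) \<in> L s"
    by (rule subspace_diff[OF subspace_L m(2)]) (use eig_ef[OF s] in \<open>simp add: eig_def\<close>)
  then have "m - ef s \<in> L s" by simp
  then have "m - ef s \<in> span (ef ` {t \<in> \<Gamma>. lt t s})"
    by (rule L_span[rotated]) (rule eig_ef)
  from span_family[OF this] obtain A c
    where A: "finite A" "A \<subseteq> {t \<in> \<Gamma>. lt t s}" "m - ef s = (\<Sum>t\<in>A. c t *s ef t)" by blast
  have coef_m: "coef s m = 1" using m(2) s lt_irrefl by (auto simp: L_def coef_diff coef_e)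
  have coef_t: "coef s (ef t) = 0" if "t \<in> A" for t
    using coef_eig(1)[OF eig_ef _ s, of t] that A(2) lt_trans lt_irrefl by blast
  have m_eq: "m = ef s + (\<Sum>t\<in>A. c t *s ef t)" using A(3) by (simp add: algebra_simps)
  have "c t = 0" if t: "t \<in> A" for t
  proof -
    have "t \<in> \<Gamma>" "t \<noteq> s" using t A(2) lt_irrefl by auto
    then obtain h where h: "h \<in> G" "chi h t \<noteq> chi h s" using weights_distinct s by blast
    have hm: "h m = chi h s *s ef s + (\<Sum>t\<in>A. (c t * chi h t) *s ef t)"
      unfolding m_eq module_hom.add[OF G_hom[OF h(1)]] module_hom.sum[OF G_hom[OF h(1)]]
      using A(2) h by (auto simp: ef_G s module_hom.scale[OF G_hom[OF h(1)]] intro!: sum.cong)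
    obtain b where b: "h m = b *s m" using g[OF h(1)] by blast
    have "coef s (h m) = chi h s"
      unfolding hm using coef_eig(2)[OF eig_ef s s] s coef_t
      by (simp add: coef_add coef_scale coef_sum sum.neutral)
    then have "b = chi h s" using b coef_m by (simp add: coef_scale)
    then have "h m = chi h s *s ef s + (\<Sum>t\<in>A. (chi h s * c t) *s ef t)"
      using b m_eq by (simp add: scale_right_distrib scale_sum_right)
    then have "(\<Sum>t\<in>A. (c t * chi h t - chi h s * c t) *s ef t) = 0"
      using hm by (simp add: scale_left_diff_distrib sum_subtractf)
    then have "c t * chi h t - chi h s * c t = 0"
      by (intro ef_independent[OF A(1) _ _ t, of "\<lambda>t. c t * chi h t - chi h s * c t"]) (use A(2) in auto)
    then have "c t * (chi h t - chi h s) = 0" by (simp add: algebra_simps)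
    then show ?thesis using h(2) by simp
  qed
  then show ?thesis using m_eq by simp
qed

text \<open>Since the weights differ, applying \<open>g - \<chi>\<close> removes one summand at a time and keeps the others.\<close>

lemma ef_separate:
  assumes N: "subspace N" "\<And>g x. g \<in> G \<Longrightarrow> x \<in> N \<Longrightarrow> g x \<in> N"
    and A: "finite A" "A \<subseteq> \<Gamma>" "t \<in> A" and c: "c t \<noteq> 0" and x: "(\<Sum>u\<in>A. c u *s ef u) \<in> N"
  shows "ef t \<in> N"
  using A c x
proof (induction "card A" arbitrary: A c rule: less_induct)
  case less
  show ?case
  proof (cases "A = {t}")
    case True
    then have "c t *s ef t \<in> N" using less.prems by simp
    then have "inverse (c t) *s (c t *s ef t) \<in> N" by (rule subspace_scale[OF N(1)])
    moreover have "inverse (c t) *s (c t *s ef t) = ef t" using less.prems(4) by simp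
    ultimately show ?thesis by (simp only:)
  next
    case False
    then obtain u where u: "u \<in> A" "u \<noteq> t" using less.prems by blast
    then obtain g where g: "g \<in> G" "chi g t \<noteq> chi g u"
      using weights_distinct less.prems by (metis subsetD)
    let ?x = "\<Sum>u\<in>A. c u *s ef u"
    have "g ?x = (\<Sum>v\<in>A. (c v * chi g v) *s ef v)"
      unfolding module_hom.sum[OF G_hom[OF g(1)]]
      using less.prems g by (auto simp: ef_G module_hom.scale[OF G_hom[OF g(1)]] intro!: sum.cong)
    then have "g ?x - chi g u *s ?x = (\<Sum>v\<in>A. (c v * (chi g v - chi g u)) *s ef v)"
      by (simp add: scale_sum_right right_diff_distrib scale_left_diff_distrib sum_subtractf mult.commute)
    also have "\<dots> = (\<Sum>v\<in>A - {u}. (c v * (chi g v - chi g u)) *s ef v)"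
      using less.prems u by (subst sum.remove[of A u]) auto
    finally have "g ?x - chi g u *s ?x = (\<Sum>v\<in>A - {u}. (c v * (chi g v - chi g u)) *s ef v)" .
    moreover have "g ?x - chi g u *s ?x \<in> N"
      using less.prems(5) by (intro subspace_diff[OF N(1)] subspace_scale[OF N(1)] N(2)[OF g(1)])
    ultimately have "(\<Sum>v\<in>A - {u}. (c v * (chi g v - chi g u)) *s ef v) \<in> N" by simp
    then show ?thesis
      using less.prems u g card_Diff1_less[of A u]
      by (intro less.hyps[of "A - {u}" "\<lambda>v. c v * (chi g v - chi g u)"]) auto
  qed
qed

end

section \<open>Triangularity\<close>

definition ex :: "(nat \<Rightarrow> nat) \<Rightarrow> nat \<Rightarrow>\<^sub>0 nat"
  where "ex \<mu> = Abs_poly_mapping \<mu>"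

definition xp :: "(nat \<Rightarrow> nat) \<Rightarrow> mpoly"
  where "xp \<mu> = mon (ex \<mu>)"

lemma lookup_ex: "\<mu> \<in> compositions n \<Longrightarrow> lookup (ex \<mu>) = \<mu>"
proof -
  assume "\<mu> \<in> compositions n"
  then have "{i. \<mu> i \<noteq> 0} \<subseteq> {..<n}" by (auto simp: compositions_def not_less[symmetric])
  then have "finite {i. \<mu> i \<noteq> 0}" by (rule finite_subset) simp
  then show ?thesis by (simp add: ex_def lookup_Abs_poly_mapping)
qed

lemma keys_ex:
  assumes \<mu>: "\<mu> \<in> compositions n"
  shows "keys (ex \<mu>) \<subseteq> {..<n}"
proof
  fix k assume "k \<in> keys (ex \<mu>)"
  then have "\<mu> k \<noteq> 0" by (simp add: in_keys_iff lookup_ex[OF \<mu>])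
  then show "k \<in> {..<n}" using \<mu> unfolding compositions_def by (metis (mono_tags) lessThan_iff mem_Collect_eq not_less)
qed

lemma ex_lookup: "ex (lookup m) = m"
  by (simp add: ex_def)

lemma lookup_compositions: "keys m \<subseteq> {..<n} \<Longrightarrow> lookup m \<in> compositions n"
  by (auto simp: compositions_def in_keys_iff subset_iff not_less[symmetric])

lemma ex_inj: "\<mu> \<in> compositions n \<Longrightarrow> \<nu> \<in> compositions n \<Longrightarrow> ex \<mu> = ex \<nu> \<longleftrightarrow> \<mu> = \<nu>"
  using lookup_ex by metis

lemma compositions_upd: "\<mu> \<in> compositions n \<Longrightarrow> i < n \<Longrightarrow> \<mu>(i := p) \<in> compositions n"
  by (auto simp: compositions_def)

lemma compositions_swap: "\<mu> \<in> compositions n \<Longrightarrow> i < n \<Longrightarrow> j < n \<Longrightarrow>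
    \<mu> \<circ> Transposition.transpose i j \<in> compositions n"
  by (auto simp: compositions_def Transposition.transpose_def)

lemma var_xp:
  assumes "\<mu> \<in> compositions n" "i < n"
  shows "var i * xp \<mu> = xp (\<mu>(i := Suc (\<mu> i)))"
proof -
  have "ex \<mu> + Poly_Mapping.single i 1 = ex (\<mu>(i := Suc (\<mu> i)))"
    by (rule poly_mapping_eqI)
      (auto simp: lookup_add lookup_ex[OF assms(1)] lookup_ex[OF compositions_upd[OF assms]] lookup_single when_def)
  then show ?thesis unfolding xp_def var_mult_mon by simp
qed

lemma subst_xp: "\<mu> \<in> compositions n \<Longrightarrow> subst \<theta> (xp \<mu>) = (\<Prod>k<n. \<theta> k ^ \<mu> k)"
  unfolding xp_def by (subst subst_mon[of "{..<n}"]) (auto simp: keys_ex lookup_ex)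

lemma subst_var_id: "subst var f = f"
proof (rule plin_eqI[OF plin_subst plin_id])
  fix m :: "nat \<Rightarrow>\<^sub>0 nat"
  show "subst var (mon m) = mon m"
  proof (induction m rule: exponent_induct[where K = UNIV])
    case (step m k)
    then show ?case unfolding var_mult_mon[symmetric] subst_mult by simp
  qed simp_all
qed

lemma xp_prod: "\<mu> \<in> compositions n \<Longrightarrow> xp \<mu> = (\<Prod>k<n. var k ^ \<mu> k)"
  using subst_xp[of \<mu> n var] by (simp add: subst_var_id)

lemma psc_power: "psc c (f :: mpoly) ^ e = psc (c ^ e) (f ^ e)"
  by (induction e) (simp_all add: mult_psc_left mult_psc_right mult.commute)

definition xp2 :: "(nat \<Rightarrow> nat) \<Rightarrow> nat \<Rightarrow> nat \<Rightarrow> nat \<Rightarrow> nat \<Rightarrow> mpoly"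
  where "xp2 \<mu> i j p q = xp (\<mu>(i := p, j := q))"

lemma xp2_factor:
  assumes "\<mu> \<in> compositions n" "i < n" "j < n" "i \<noteq> j"
  shows "subst \<theta> (xp2 \<mu> i j p q) = \<theta> i ^ p * \<theta> j ^ q * (\<Prod>k\<in>{..<n} - {i, j}. \<theta> k ^ \<mu> k)"
proof -
  let ?\<nu> = "\<mu>(i := p, j := q)"
  have "?\<nu> \<in> compositions n" using assms by (intro compositions_upd)
  then have "subst \<theta> (xp2 \<mu> i j p q) = (\<Prod>k<n. \<theta> k ^ ?\<nu> k)" by (simp add: xp2_def subst_xp)
  also have "\<dots> = (\<Prod>k\<in>{..<n} - {i, j}. \<theta> k ^ ?\<nu> k) * (\<Prod>k\<in>{i, j}. \<theta> k ^ ?\<nu> k)"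
    using assms by (intro prod.subset_diff) auto
  also have "(\<Prod>k\<in>{..<n} - {i, j}. \<theta> k ^ ?\<nu> k) = (\<Prod>k\<in>{..<n} - {i, j}. \<theta> k ^ \<mu> k)"
    by (intro prod.cong) auto
  finally show ?thesis using assms by (simp add: mult_ac)
qed

context cherednik_rep
begin

text \<open>Together with \<open>LowV\<close>, its analogue for families, the space in which the error terms of the triangularity
statement lie.\<close>

definition LowP :: "(nat \<Rightarrow> nat) \<Rightarrow> mpoly set"
  where "LowP \<mu> = {f \<in> Pn. \<forall>m\<in>keys f. comp_less n (lookup m) \<mu>}"

lemma LowP_0: "0 \<in> LowP \<mu>"
  and LowP_psc: "f \<in> LowP \<mu> \<Longrightarrow> psc c f \<in> LowP \<mu>"
  by (auto simp: LowP_def Pn_psc in_keys_iff)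

lemma LowP_add: "f \<in> LowP \<mu> \<Longrightarrow> g \<in> LowP \<mu> \<Longrightarrow> f + g \<in> LowP \<mu>"
  unfolding LowP_def using Pn_add keys_add[of f g] by blast

lemma LowP_uminus: "f \<in> LowP \<mu> \<Longrightarrow> - f \<in> LowP \<mu>"
  using LowP_psc[of f \<mu> "-1"] by simp

lemma LowP_diff: "f \<in> LowP \<mu> \<Longrightarrow> g \<in> LowP \<mu> \<Longrightarrow> f - g \<in> LowP \<mu>"
  using LowP_add[of f \<mu> "- g"] LowP_uminus[of g] by simp

lemma LowP_sum: "(\<And>s. s \<in> A \<Longrightarrow> g s \<in> LowP \<mu>) \<Longrightarrow> sum g A \<in> LowP \<mu>"
  by (rule closed_sum) (auto simp: LowP_0 LowP_add)

lemma LowP_xp: "\<nu> \<in> compositions n \<Longrightarrow> comp_less n \<nu> \<mu> \<Longrightarrow> xp \<nu> \<in> LowP \<mu>"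
  by (simp add: LowP_def xp_def Pn_mon keys_ex lookup_ex)

lemma Pn_xp: "\<nu> \<in> compositions n \<Longrightarrow> xp \<nu> \<in> Pn"
  by (simp add: xp_def Pn_mon keys_ex)

lemma theta_rmat:
  assumes "a < n" "b < n" "a \<noteq> b" "z \<in> roots r"
  shows "theta (rmat n a b z) k = (if k = a then psc z (var b) else if k = b then psc (inverse z) (var a) else var k)"
  using assms unfolding theta_def
  by (simp add: pm_rmat[OF r_pos] ph_rmat[OF r_pos] roots_def Transposition.transpose_def)

lemma divided_difference_roots:
  "a < n \<Longrightarrow> b < n \<Longrightarrow> z \<in> roots r \<Longrightarrow> divided_difference (theta (rmat n a b z)) (alv a b z) (be a b z)"
  by (rule divided_difference_rmat) (simp add: Rf_def)

lemma subst_xp2: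
  assumes \<mu>: "\<mu> \<in> compositions n" and ij: "i < n" "j < n" "i \<noteq> j" and z: "z \<in> roots r"
  shows "subst (theta (rmat n i j z)) (xp2 \<mu> i j p q) = psc (z ^ p * inverse z ^ q) (xp2 \<mu> i j q p)"
proof -
  let ?\<theta> = "theta (rmat n i j z)"
  have "(\<Prod>k\<in>{..<n} - {i, j}. ?\<theta> k ^ \<mu> k) = (\<Prod>k\<in>{..<n} - {i, j}. var k ^ \<mu> k)"
    using theta_rmat[OF ij z] by (intro prod.cong) auto
  then have "subst ?\<theta> (xp2 \<mu> i j p q)
      = psc z (var j) ^ p * psc (inverse z) (var i) ^ q * (\<Prod>k\<in>{..<n} - {i, j}. var k ^ \<mu> k)"
    using theta_rmat[OF ij z] ij by (simp add: xp2_factor[OF \<mu> ij])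
  also have "\<dots> = psc (z ^ p * inverse z ^ q) (var i ^ q * var j ^ p * (\<Prod>k\<in>{..<n} - {i, j}. var k ^ \<mu> k))"
    by (simp only: psc_power mult_psc_left mult_psc_right psc.scale_scale) (simp add: mult_ac)
  also have "var i ^ q * var j ^ p * (\<Prod>k\<in>{..<n} - {i, j}. var k ^ \<mu> k) = xp2 \<mu> i j q p"
    using xp2_factor[OF \<mu> ij, of var q p] by (simp add: subst_var_id)
  finally show ?thesis .
qed

lemma var_xp2:
  assumes \<mu>: "\<mu> \<in> compositions n" and ij: "i < n" "j < n" "i \<noteq> j"
  shows "var i * xp2 \<mu> i j p q = xp2 \<mu> i j (Suc p) q" "var j * xp2 \<mu> i j p q = xp2 \<mu> i j p (Suc q)"
proof -
  have c: "\<mu>(i := p, j := q) \<in> compositions n" using assms by (intro compositions_upd)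
  show "var i * xp2 \<mu> i j p q = xp2 \<mu> i j (Suc p) q" "var j * xp2 \<mu> i j p q = xp2 \<mu> i j p (Suc q)"
    unfolding xp2_def var_xp[OF c ij(1)] var_xp[OF c ij(2)]
    using ij by (simp_all add: fun_upd_twist[of i j])
qed

text \<open>Divided differences of monomials are geometric sums. The terms are
  \<open>z\<^sup>a\<^sup>-\<^sup>p x\<^sub>i\<^sup>p x\<^sub>j\<^sup>a\<^sup>+\<^sup>b\<^sup>-\<^sup>p\<close> with \<open>a = \<mu>\<^sub>i\<close> and \<open>b = \<mu>\<^sub>j\<close>.\<close>

definition geo :: "(nat \<Rightarrow> nat) \<Rightarrow> nat \<Rightarrow> nat \<Rightarrow> complex \<Rightarrow> nat \<Rightarrow> mpoly"
  where "geo \<mu> i j z p = psc (z ^ \<mu> i * inverse z ^ p) (xp2 \<mu> i j p (\<mu> i + \<mu> j - p))"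

text \<open>The product of the linear form with the partial sums of the geometric progression telescopes.\<close>

lemma ddiv_geo:
  assumes \<mu>: "\<mu> \<in> compositions n" and ij: "i < n" "j < n" "i \<noteq> j" and z: "z \<in> roots r"
  shows "ddiv (theta (rmat n i j z)) (alv i j z) (var i * xp \<mu>) =
    (if \<mu> j \<le> \<mu> i then \<Sum>p=\<mu> j..<Suc (\<mu> i). geo \<mu> i j z p else - (\<Sum>p=Suc (\<mu> i)..<\<mu> j. geo \<mu> i j z p))"
proof -
  interpret divided_difference "theta (rmat n i j z)" "alv i j z" "be i j z"
    by (rule divided_difference_roots[OF ij(1,2) z])
  have z0: "z \<noteq> 0" using z root_nonzero[OF r_pos] by (auto simp: roots_def)
  \<comment> \<open>the telescoping terms; \<open>?h (Suc (\<mu> i))\<close> is \<open>x\<^sub>i x\<^sup>\<mu>\<close> and \<open>?h (\<mu> j)\<close> its image under the reflection\<close>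
  let ?h = "\<lambda>p. psc (z * z ^ \<mu> i * inverse z ^ p) (xp2 \<mu> i j p (Suc (\<mu> i + \<mu> j) - p))"
  have tele: "alv i j z * geo \<mu> i j z p = ?h (Suc p) - ?h p" if p: "p \<le> \<mu> i + \<mu> j" for p
  proof -
    have "alv i j z * geo \<mu> i j z p = var i * geo \<mu> i j z p - psc z (var j * geo \<mu> i j z p)"
      using ij by (simp add: alv_def left_diff_distrib mult_psc_left)
    also have "var i * geo \<mu> i j z p = ?h (Suc p)"
      using z0 by (simp add: geo_def mult_psc_right var_xp2[OF \<mu> ij])
    also have "psc z (var j * geo \<mu> i j z p) = ?h p"
      using p by (simp add: geo_def mult_psc_right var_xp2[OF \<mu> ij] Suc_diff_le mult.assoc)
    finally show ?thesis .
  qed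
  have sum: "alv i j z * (\<Sum>p=c..<d. geo \<mu> i j z p) = ?h d - ?h c" if "c \<le> d" "d \<le> Suc (\<mu> i + \<mu> j)" for c d
  proof -
    have "alv i j z * (\<Sum>p=c..<d. geo \<mu> i j z p) = (\<Sum>p=c..<d. ?h (Suc p) - ?h p)"
      unfolding sum_distrib_left using that by (intro sum.cong refl tele) auto
    also have "\<dots> = ?h d - ?h c" using that by (intro sum_Suc_diff') auto
    finally show ?thesis .
  qed
  have x1: "var i * xp \<mu> = xp2 \<mu> i j (Suc (\<mu> i)) (\<mu> j)"
  proof -
    have "(\<mu>(i := Suc (\<mu> i))) = \<mu>(i := Suc (\<mu> i), j := \<mu> j)" using ij by (auto simp: fun_eq_iff)
    then show ?thesis by (simp only: var_xp[OF \<mu> ij(1)] xp2_def)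
  qed
  have ha: "?h (Suc (\<mu> i)) = xp2 \<mu> i j (Suc (\<mu> i)) (\<mu> j)"
    using z0 by (simp add: power_inverse field_simps)
  have hb: "?h (\<mu> j) = subst (theta (rmat n i j z)) (var i * xp \<mu>)"
    unfolding x1 subst_xp2[OF \<mu> ij z] by simp
  show ?thesis
  proof (rule ddiv_unique)
    show "alv i j z * (if \<mu> j \<le> \<mu> i then \<Sum>p=\<mu> j..<Suc (\<mu> i). geo \<mu> i j z p
        else - (\<Sum>p=Suc (\<mu> i)..<\<mu> j. geo \<mu> i j z p))
      = var i * xp \<mu> - subst (theta (rmat n i j z)) (var i * xp \<mu>)"
    proof (cases "\<mu> j \<le> \<mu> i")
      case True
      then have "alv i j z * (\<Sum>p=\<mu> j..<Suc (\<mu> i). geo \<mu> i j z p) = ?h (Suc (\<mu> i)) - ?h (\<mu> j)"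
        by (intro sum) auto
      then show ?thesis unfolding ha hb x1[symmetric] using True by simp
    next
      case False
      then have "alv i j z * (\<Sum>p=Suc (\<mu> i)..<\<mu> j. geo \<mu> i j z p) = ?h (\<mu> j) - ?h (Suc (\<mu> i))"
        by (intro sum) auto
      then show ?thesis unfolding ha hb x1[symmetric] using False by simp
    qed
  qed
qed

lemma geo_LowP:
  assumes \<mu>: "\<mu> \<in> compositions n" and ij: "i < n" "j < n" "i \<noteq> j"
    and p: "min (\<mu> i) (\<mu> j) < p" "p < max (\<mu> i) (\<mu> j)"
  shows "geo \<mu> i j z p \<in> LowP \<mu>"
  unfolding geo_def xp2_def
proof (intro LowP_psc LowP_xp compositions_upd \<mu> ij(1,2))
  show "comp_less n (\<mu>(i := p, j := \<mu> i + \<mu> j - p)) \<mu>"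
    by (rule comp_less_squeeze[OF ij]) (use p ij in auto)
qed

text \<open>The divided difference contains the terms \<open>x\<^sup>\<mu>\<close> and \<open>s x\<^sup>\<mu>\<close> at the ends of a geometric sum whose inner
terms are lower. The end \<open>s x\<^sup>\<mu>\<close> is cancelled by the summand of \<open>\<phi>\<^sub>i\<close> when \<open>j < i\<close>, and is itself
lower otherwise; the end \<open>x\<^sup>\<mu>\<close> is present exactly when \<open>w\<^sub>\<mu>(j) < w\<^sub>\<mu>(i)\<close>, which
is how the permutation \<open>w\<^sub>\<mu>\<close> enters.\<close>

lemma triangular_term:
  assumes \<mu>: "\<mu> \<in> compositions n" and ij: "i < n" "j < n" "i \<noteq> j" and z: "z \<in> roots r"
  shows "- ddiv (theta (rmat n i j z)) (alv i j z) (var i * xp \<mu>)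
    + (if j < i then subst (theta (rmat n i j z)) (xp \<mu>) else 0)
    + (if w_of n \<mu> j < w_of n \<mu> i then xp \<mu> else 0) \<in> LowP \<mu>"
proof -
  have z0: "z \<noteq> 0" using z root_nonzero[OF r_pos] by (auto simp: roots_def)
  let ?s = "subst (theta (rmat n i j z)) (xp \<mu>)"
  let ?g = "geo \<mu> i j z"
  have x: "xp \<mu> = xp2 \<mu> i j (\<mu> i) (\<mu> j)" by (simp add: xp2_def)
  have ga: "?g (\<mu> i) = xp \<mu>" using z0 by (simp add: geo_def x power_inverse)
  have gb: "?g (\<mu> j) = ?s" unfolding x subst_xp2[OF \<mu> ij z] by (simp add: geo_def)
  have swap: "\<mu>(i := \<mu> j, j := \<mu> i) = \<mu> \<circ> Transposition.transpose i j"
    by (auto simp: Transposition.transpose_def fun_eq_iff)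
  have sx: "?s = psc (z ^ \<mu> i * inverse z ^ \<mu> j) (xp (\<mu> \<circ> Transposition.transpose i j))"
    unfolding x subst_xp2[OF \<mu> ij z] by (simp add: xp2_def swap)
  have sLow: "?s \<in> LowP \<mu>" if "comp_less n (\<mu> \<circ> Transposition.transpose i j) \<mu>"
    unfolding sx by (intro LowP_psc LowP_xp compositions_swap \<mu> ij that)
  have prec: "w_of n \<mu> j < w_of n \<mu> i \<longleftrightarrow> \<mu> j < \<mu> i \<or> \<mu> j = \<mu> i \<and> i < j"
    using w_of_less_iff[OF ij(1,2)] by (simp add: precedes_def)
  consider "\<mu> j < \<mu> i" | "\<mu> j = \<mu> i" | "\<mu> i < \<mu> j" by linarith
  then show ?thesis
  proof cases
    case 1
    have "(\<Sum>p=\<mu> j..<Suc (\<mu> i). ?g p) = ?g (\<mu> j) + (\<Sum>p=Suc (\<mu> j)..<\<mu> i. ?g p) + ?g (\<mu> i)"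
      using 1 by (simp add: sum.atLeast_Suc_lessThan)
    then have e: "ddiv (theta (rmat n i j z)) (alv i j z) (var i * xp \<mu>)
        = ?s + (\<Sum>p=Suc (\<mu> j)..<\<mu> i. ?g p) + xp \<mu>"
      using 1 by (simp add: ddiv_geo[OF \<mu> ij z] ga gb)
    have m: "(\<Sum>p=Suc (\<mu> j)..<\<mu> i. ?g p) \<in> LowP \<mu>"
      by (intro LowP_sum geo_LowP \<mu> ij) auto
    show ?thesis
    proof (cases "j < i")
      case True
      then show ?thesis using 1 LowP_uminus[OF m] by (simp add: e prec)
    next
      case False
      then have "?s \<in> LowP \<mu>" using 1 ij by (intro sLow comp_less_swap) auto
      then show ?thesis using False 1 LowP_diff[OF LowP_uminus[of ?s] m] by (simp add: e prec)
    qed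
  next
    case 2
    have "(\<Sum>p=\<mu> j..<Suc (\<mu> i). ?g p) = xp \<mu>" using 2 ga by simp
    then have "ddiv (theta (rmat n i j z)) (alv i j z) (var i * xp \<mu>) = xp \<mu>"
      using 2 by (simp add: ddiv_geo[OF \<mu> ij z])
    moreover have "?s = xp \<mu>" using ga gb 2 by simp
    ultimately show ?thesis using 2 ij LowP_0 by (simp add: prec)
  next
    case 3
    have e: "ddiv (theta (rmat n i j z)) (alv i j z) (var i * xp \<mu>) = - (\<Sum>p=Suc (\<mu> i)..<\<mu> j. ?g p)"
      using 3 by (simp add: ddiv_geo[OF \<mu> ij z])
    have m: "(\<Sum>p=Suc (\<mu> i)..<\<mu> j. ?g p) \<in> LowP \<mu>"
      by (intro LowP_sum geo_LowP \<mu> ij) auto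
    have "?s \<in> LowP \<mu>" if "j < i"
    proof (rule sLow)
      have "comp_less n (\<mu> \<circ> Transposition.transpose j i) \<mu>"
        using that 3 ij by (intro comp_less_swap) auto
      then show "comp_less n (\<mu> \<circ> Transposition.transpose i j) \<mu>" by (simp add: transpose_commute)
    qed
    then show ?thesis using 3 m LowP_add[OF m, of ?s] by (auto simp: e prec)
  qed
qed

subsection \<open>The operators on pure tensors\<close>

lemma dl_pt:
  assumes "a < n" "b < n" "z \<in> roots r" "u \<in> Ssp"
  shows "dl a b z (pt f u) = pt (ddiv (theta (rmat n a b z)) (alv a b z) f) (rho (rmat n a b z) u)"
  unfolding dl_def
  by (rule tens_pt[OF divided_difference.plin_ddiv[OF divided_difference_roots[OF assms(1-3)]]
      rmat_roots[OF assms(1-3)] assms(4)])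

text \<open>The two triples describing the same reflection give proportional operators.\<close>

lemma dl_swap:
  assumes "a < n" "b < n" "a \<noteq> b" "z \<in> roots r"
  shows "fsc (- z) (dl b a z F) = dl a b (inverse z) F"
proof -
  have z0: "z \<noteq> 0" using assms root_nonzero[OF r_pos] by (auto simp: roots_def)
  have iz: "inverse z \<in> roots r" using assms by (simp add: roots_def power_inverse)
  interpret d1: divided_difference "theta (rmat n b a z)" "alv b a z" "be b a z"
    using assms by (intro divided_difference_roots)
  interpret d2: divided_difference "theta (rmat n a b (inverse z))" "alv a b (inverse z)" "be a b (inverse z)"
    using assms iz by (intro divided_difference_roots)
  have r: "rmat n b a z = rmat n a b (inverse z)" by (rule rmat_swap[OF assms(3)])
  have alv: "alv b a z = psc (- z) (alv a b (inverse z))"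
    using assms z0 by (simp add: alv_def psc.scale_right_diff_distrib)
  have dd: "ddiv (theta (rmat n a b (inverse z))) (alv a b (inverse z)) f = psc (- z) (ddiv (theta (rmat n b a z)) (alv b a z) f)" for f
  proof (rule d2.ddiv_unique)
    have "alv a b (inverse z) * psc (- z) (ddiv (theta (rmat n b a z)) (alv b a z) f)
        = alv b a z * ddiv (theta (rmat n b a z)) (alv b a z) f"
      unfolding alv[unfolded r] by (simp add: alv mult_psc_left mult_psc_right)
    then show "alv a b (inverse z) * psc (- z) (ddiv (theta (rmat n b a z)) (alv b a z) f)
        = f - subst (theta (rmat n a b (inverse z))) f"
      using d1.ddiv[of f] by (simp add: r)
  qed
  have "psc (- z) (dl b a z F U) = dl a b (inverse z) F U" for U
    unfolding dl_def tens_def r[symmetric] dd[unfolded r[symmetric]]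
    by (cases "U \<in> ST") (simp_all only: if_True if_False psc.scale_sum_right psc.scale_scale mult.commute psc.scale_zero_right)
  then show ?thesis by (intro ext) (simp only: fsc_apply)
qed

lemma yo_explicit:
  assumes i: "i < n"
  shows "yo i F = (\<lambda>T. pdv i (F T)) - (\<Sum>z\<in>roots r. fsc (cc i i z) (dl i i z F))
    - fsc c0 (\<Sum>j\<in>{..<n} - {i}. \<Sum>z\<in>roots r. dl i j z F)"
proof -
  let ?s = "\<lambda>b. \<Sum>z\<in>roots r. dl i b z F"
  let ?d = "\<Sum>z\<in>roots r. fsc (cc i i z) (dl i i z F)"
  let ?f = "\<lambda>a b z. fsc (cc a b z * al a b z i) (dl a b z F)"
  have diag: "(\<Sum>z\<in>roots r. ?f i i z) = ?d"
    by (simp add: al_def)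
  have off1: "(\<Sum>z\<in>roots r. ?f i b z) = fsc (c0 / 2) (?s b)" if "b \<noteq> i" for b
    using that by (auto simp: cc_def al_def fsc.scale_sum_right intro!: sum.cong)
  have off2: "(\<Sum>z\<in>roots r. ?f a i z) = fsc (c0 / 2) (?s a)" if a: "a \<noteq> i" "a < n" for a
  proof -
    have "(\<Sum>z\<in>roots r. ?f a i z) = (\<Sum>z\<in>roots r. fsc (c0 / 2) (dl i a (inverse z) F))"
    proof (rule sum.cong[OF refl])
      fix z assume z: "z \<in> roots r"
      have "cc a i z * al a i z i = c0 / 2 * - z" using a by (simp add: cc_def al_def)
      then have "?f a i z = fsc (c0 / 2) (fsc (- z) (dl a i z F))"
        by (simp only: fsc.scale_scale)
      then show "?f a i z = fsc (c0 / 2) (dl i a (inverse z) F)"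
        by (simp only: dl_swap[OF i a(2) a(1)[symmetric] z])
    qed
    also have "\<dots> = (\<Sum>z\<in>roots r. fsc (c0 / 2) (dl i a z F))"
      by (rule sum_roots_inverse)
    finally show ?thesis by (simp add: fsc.scale_sum_right)
  qed
  have none: "(\<Sum>z\<in>roots r. ?f a b z) = 0" if "a \<noteq> i" "b \<noteq> i" for a b
    using that by (auto simp: al_def)
  have row: "(\<Sum>b<n. \<Sum>z\<in>roots r. ?f a b z) = (if a = i then ?d + (\<Sum>b\<in>{..<n} - {i}. fsc (c0 / 2) (?s b))
      else fsc (c0 / 2) (?s a))" if "a < n" for a
  proof (cases "a = i")
    case True
    then show ?thesis using i diag off1 by (simp add: sum.remove[of "{..<n}" i])
  next
    case False
    then show ?thesis using i off2 none that
      by (simp add: sum.remove[of "{..<n}" i] sum.neutral)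
  qed
  have "(\<Sum>(a, b, z)\<in>Rf. ?f a b z)
      = ?d + (\<Sum>b\<in>{..<n} - {i}. fsc (c0 / 2) (?s b)) + (\<Sum>a\<in>{..<n} - {i}. fsc (c0 / 2) (?s a))"
    unfolding sum_Rf using i by (simp add: row sum.remove[of "{..<n}" i])
  also have "\<dots> = ?d + fsc c0 (\<Sum>b\<in>{..<n} - {i}. ?s b)"
    by (simp add: fsc.scale_sum_right add.assoc flip: sum.distrib fsc.scale_left_distrib)
  finally show ?thesis by (simp add: yo_def diff_diff_eq)
qed

definition winv :: "(nat \<Rightarrow> nat) \<Rightarrow> complex mat"
  where "winv \<mu> = perm_mat n (inv_into UNIV (w_of n \<mu>))"

text \<open>\<open>v\<^sub>T\<^sup>\<mu>\<close> and \<open>x\<^sup>\<mu> v\<^sub>T\<^sup>\<mu>\<close>.\<close>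

definition vm :: "(nat \<Rightarrow> nat) \<Rightarrow> tableau \<Rightarrow> tableau \<Rightarrow> complex"
  where "vm \<mu> T = rho (winv \<mu>) (vv T)"

definition em :: "(nat \<Rightarrow> nat) \<Rightarrow> tableau \<Rightarrow> tableau \<Rightarrow> mpoly"
  where "em \<mu> T = pt (xp \<mu>) (vm \<mu> T)"

lemma w_inv_permutes: "inv_into UNIV (w_of n \<mu>) permutes {..<n}"
  using permutes_inv[OF w_of_permutes] by simp

lemma winv_Grp: "winv \<mu> \<in> Grp r n"
  unfolding winv_def perm_mat_mono by (rule GrpI[OF r_pos w_inv_permutes]) simp

lemma pm_winv: "pm n (winv \<mu>) j = inv_into UNIV (w_of n \<mu>) j"
  unfolding winv_def perm_mat_mono by (rule pm_mono_mat[OF w_inv_permutes]) simp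

lemma w_inv: "inv_into UNIV (w_of n \<mu>) (w_of n \<mu> i) = i" "w_of n \<mu> (inv_into UNIV (w_of n \<mu>) i) = i"
  using permutes_inverses[OF w_of_permutes[of n \<mu>]] by auto

lemma vm_Ssp: "T \<in> ST \<Longrightarrow> vm \<mu> T \<in> Ssp"
  unfolding vm_def by (intro rho_closed winv_Grp Ssp_vv)

lemma pt_vm: "T \<in> ST \<Longrightarrow> pt 1 (vm \<mu> T) = tw (winv \<mu>) (bv T)"
  unfolding vm_def by (simp add: tw_pt winv_Grp Ssp_vv)

lemma V_em: "\<mu> \<in> compositions n \<Longrightarrow> T \<in> ST \<Longrightarrow> em \<mu> T \<in> V"
  unfolding em_def by (intro V_pt Pn_xp vm_Ssp)

text \<open>Multiplication by a polynomial reduces statements about pure tensors to constants.\<close>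

definition mulf :: "mpoly \<Rightarrow> (tableau \<Rightarrow> mpoly) \<Rightarrow> tableau \<Rightarrow> mpoly"
  where "mulf f F = (\<lambda>T. f * F T)"

lemma flin_mulf: "flin (mulf f)"
  unfolding mulf_def by (rule flin_pointwise[OF plin_mult])

lemma pt_mulf: "pt f u = mulf f (pt 1 u)"
  by (simp add: pt_def mulf_def mult_psc_right)

lemma pt_1_inj: "pt 1 u = pt 1 v \<Longrightarrow> u = v"
proof
  fix T assume "pt 1 u = pt 1 v"
  then have "lookup (pt 1 u T) 0 = lookup (pt 1 v T) 0" by simp
  then show "u T = v T" by (simp add: pt_def lookup_one)
qed

text \<open>Moving the diagonal matrix past \<open>w\<^sub>\<mu>\<^sup>-\<^sup>1\<close> turns its index \<open>i\<close> into \<open>w\<^sub>\<mu>(i)\<close>.\<close>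

lemma diag_vm:
  assumes T: "T \<in> ST" and i: "i < n" and z: "z \<in> roots r"
  shows "rho (rmat n i i z) (vm \<mu> T) = (\<lambda>U. z ^ beta (T (w_of n \<mu> i)) * vm \<mu> T U)"
proof (rule pt_1_inj)
  let ?k = "w_of n \<mu> i"
  have k: "?k < n" using i by (rule w_of_lt)
  have zr: "z ^ r = 1" using z by (simp add: roots_def)
  have "winv \<mu> * rmat n ?k ?k z = rmat n i i z * winv \<mu>"
    using rmat_conj[OF r_pos winv_Grp k k zr, of \<mu>] GrpD(2)[OF r_pos winv_Grp, of \<mu>] root_nonzero[OF r_pos]
    by (simp add: pm_winv w_inv)
  then have "tw (rmat n i i z) (tw (winv \<mu>) (bv T)) = tw (winv \<mu>) (tw (rmat n ?k ?k z) (bv T))"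
    using tw_mult[OF rmat_roots[OF i i z] winv_Grp V_basis[OF T]] tw_mult[OF winv_Grp rmat_roots[OF k k z] V_basis[OF T]]
    by metis
  also have "\<dots> = fsc (z ^ beta (T ?k)) (tw (winv \<mu>) (bv T))"
    by (simp add: tw_diag_bv k T z lin_scale[OF flin_tw])
  finally show "pt 1 (rho (rmat n i i z) (vm \<mu> T)) = pt 1 (\<lambda>U. z ^ beta (T ?k) * vm \<mu> T U)"
    using T by (simp add: tw_pt rmat_roots i z vm_Ssp pt_1_scale flip: pt_vm)
qed

text \<open>The indices \<open>j\<close> with \<open>w\<^sub>\<mu>(j) < w\<^sub>\<mu>(i)\<close> are the translates under \<open>w\<^sub>\<mu>\<^sup>-\<^sup>1\<close> of those below \<open>w\<^sub>\<mu>(i)\<close>, so the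
sum is a conjugate of a Jucys-Murphy element acting on \<open>v\<^sub>T\<^sup>\<mu>\<close>.\<close>

lemma jm_vm:
  assumes T: "T \<in> ST" and i: "i < n"
  shows "(\<Sum>j\<in>{j \<in> {..<n}. w_of n \<mu> j < w_of n \<mu> i}. \<Sum>z\<in>roots r. pt 1 (rho (rmat n i j z) (vm \<mu> T)))
    = fsc (of_nat r * of_int (ct (T (w_of n \<mu> i)))) (pt 1 (vm \<mu> T))"
proof -
  let ?k = "w_of n \<mu> i" and ?v = "inv_into UNIV (w_of n \<mu>)"
  have k: "?k < n" using i by (rule w_of_lt)
  have "fsc (of_nat r * of_int (ct (T ?k))) (pt 1 (vm \<mu> T)) = tw (winv \<mu>) (jmo ?k (bv T))"
    by (simp add: jmo_bv k T lin_scale[OF flin_tw] pt_vm)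
  also have "\<dots> = (\<Sum>l<?k. sgo (?v ?k) (?v l) (tw (winv \<mu>) (bv T)))"
    unfolding jmo_def lin_sum[OF flin_tw] using k
    by (intro sum.cong refl) (auto simp: tw_sgo winv_Grp V_basis T pm_winv)
  also have "\<dots> = (\<Sum>l<?k. sgo i (?v l) (pt 1 (vm \<mu> T)))" by (simp add: w_inv pt_vm T)
  also have "\<dots> = (\<Sum>j\<in>{j \<in> {..<n}. w_of n \<mu> j < ?k}. sgo i j (pt 1 (vm \<mu> T)))"
    by (rule sum.reindex_bij_witness[where i = "w_of n \<mu>" and j = ?v])
      (use k permutes_lt[OF w_inv_permutes[of \<mu>]] in \<open>auto simp: w_inv\<close>)
  also have "\<dots> = (\<Sum>j\<in>{j \<in> {..<n}. w_of n \<mu> j < ?k}. \<Sum>z\<in>roots r. pt 1 (rho (rmat n i j z) (vm \<mu> T)))"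
    unfolding sgo_def using i T by (intro sum.cong refl) (auto simp: tw_pt rmat_roots vm_Ssp)
  finally show ?thesis ..
qed

definition LowV :: "(nat \<Rightarrow> nat) \<Rightarrow> (tableau \<Rightarrow> mpoly) set"
  where "LowV \<mu> = {F \<in> V. \<forall>T. F T \<in> LowP \<mu>}"

lemma LowV_add: "F \<in> LowV \<mu> \<Longrightarrow> G \<in> LowV \<mu> \<Longrightarrow> F + G \<in> LowV \<mu>"
  and LowV_fsc: "F \<in> LowV \<mu> \<Longrightarrow> fsc c F \<in> LowV \<mu>"
  and LowV_0: "0 \<in> LowV \<mu>"
  by (auto simp: LowV_def fapp LowP_add LowP_psc LowP_0 V_add V_fsc V_0)

lemma LowV_sum:
  assumes "\<And>s. s \<in> A \<Longrightarrow> g s \<in> LowV \<mu>"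
  shows "sum g A \<in> LowV \<mu>"
  by (rule closed_sum[where Q = "\<lambda>F. F \<in> LowV \<mu>"]) (simp_all add: LowV_0 LowV_add assms)

lemma LowV_pt: "f \<in> LowP \<mu> \<Longrightarrow> u \<in> Ssp \<Longrightarrow> pt f u \<in> LowV \<mu>"
proof -
  assume f: "f \<in> LowP \<mu>" and u: "u \<in> Ssp"
  have "pt f u T \<in> LowP \<mu>" for T unfolding pt_def by (rule LowP_psc[OF f])
  moreover have "pt f u \<in> V" using f u by (intro V_pt) (simp_all add: LowP_def)
  ultimately show ?thesis by (simp add: LowV_def)
qed

lemma pt_uminus_left: "pt (- f) u = - pt f u"
  by (simp add: pt_def fun_eq_iff uminus_apply)

lemma pt_0_left: "pt 0 u = 0"
  by (simp add: pt_def zero_fun_def)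

lemma jmo_pt:
  assumes "i < n" "u \<in> Ssp"
  shows "jmo i (pt f u) = (\<Sum>j\<in>{..<n} - {i}. \<Sum>z\<in>roots r.
    pt (if j < i then subst (theta (rmat n i j z)) f else 0) (rho (rmat n i j z) u))"
proof -
  have "jmo i (pt f u) = (\<Sum>j<i. \<Sum>z\<in>roots r. pt (subst (theta (rmat n i j z)) f) (rho (rmat n i j z) u))"
    unfolding jmo_def sgo_def using assms by (intro sum.cong refl) (simp add: tw_pt rmat_roots)
  also have "\<dots> = (\<Sum>j\<in>{..<n} - {i}. \<Sum>z\<in>roots r.
    pt (if j < i then subst (theta (rmat n i j z)) f else 0) (rho (rmat n i j z) u))"
    by (rule sum.mono_neutral_cong_left) (use assms in \<open>auto simp: pt_0_left\<close>)
  finally show ?thesis .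
qed

lemma ddiv_diag:
  assumes \<mu>: "\<mu> \<in> compositions n" and i: "i < n" and z: "z \<in> roots r"
  shows "ddiv (theta (rmat n i i z)) (alv i i z) (var i * xp \<mu>) = psc (1 - inverse z ^ Suc (\<mu> i)) (xp \<mu>)"
proof -
  interpret divided_difference "theta (rmat n i i z)" "alv i i z" "be i i z"
    by (rule divided_difference_roots[OF i i z])
  let ?\<theta> = "theta (rmat n i i z)"
  have th: "?\<theta> k = (if k = i then psc (inverse z) (var i) else var k)" for k
    using i z unfolding theta_def
    by (simp add: pm_rmat[OF r_pos] ph_rmat[OF r_pos] roots_def)
  have split: "(\<Prod>k<n. g k ^ \<mu> k) = g i ^ \<mu> i * (\<Prod>k\<in>{..<n} - {i}. g k ^ \<mu> k)" for g :: "nat \<Rightarrow> mpoly"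
    using i by (simp add: prod.remove[of "{..<n}" i])
  have "subst ?\<theta> (xp \<mu>) = psc (inverse z ^ \<mu> i) (var i ^ \<mu> i) * (\<Prod>k\<in>{..<n} - {i}. var k ^ \<mu> k)"
    unfolding subst_xp[OF \<mu>] split by (simp add: th psc_power)
  also have "\<dots> = psc (inverse z ^ \<mu> i) (xp \<mu>)"
    unfolding xp_prod[OF \<mu>] split by (simp add: mult_psc_left)
  finally have s: "subst ?\<theta> (xp \<mu>) = psc (inverse z ^ \<mu> i) (xp \<mu>)" .
  show ?thesis
  proof (rule ddiv_unique)
    show "alv i i z * psc (1 - inverse z ^ Suc (\<mu> i)) (xp \<mu>) = var i * xp \<mu> - subst ?\<theta> (var i * xp \<mu>)"
      by (simp add: alv_def subst_mult th s mult_psc_left mult_psc_right psc.scale_left_diff_distrib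
        right_diff_distrib mult.commute[of "inverse z"])
  qed
qed

lemma pdv_xp:
  assumes \<mu>: "\<mu> \<in> compositions n" and i: "i < n"
  shows "pdv i (var i * xp \<mu>) = psc (of_nat (Suc (\<mu> i))) (xp \<mu>)"
proof -
  have "lookup (ex \<mu> + Poly_Mapping.single i 1) i = Suc (\<mu> i)"
    by (simp add: lookup_add lookup_ex[OF \<mu>])
  then show ?thesis by (simp add: xp_def var_mult_mon pdv_def)
qed

text \<open>Applied to a pure tensor, the leading parts of the divided differences in \<open>y\<^sub>i x\<^sub>i\<close> and of \<open>\<phi>\<^sub>i\<close> combine,
by \<open>triangular_term\<close>, to the sum of reflections over the \<open>j\<close> with \<open>w\<^sub>\<mu>(j) < w\<^sub>\<mu>(i)\<close>, and this sum acts on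
\<open>v\<^sub>T\<^sup>\<mu>\<close> by a scalar.\<close>

lemma zo_em:
  assumes \<mu>: "\<mu> \<in> compositions n" and T: "T \<in> ST" and i: "i < n"
  shows "\<exists>c. zo i (em \<mu> T) - fsc c (em \<mu> T) \<in> LowV \<mu>"
proof -
  let ?u = "vm \<mu> T" and ?f = "var i * xp \<mu>" and ?J = "{..<n} - {i}"
  let ?\<theta> = "\<lambda>j z. theta (rmat n i j z)" and ?R = "\<lambda>j z. rho (rmat n i j z) (vm \<mu> T)"
  have u: "?u \<in> Ssp" using T by (rule vm_Ssp)
  have R: "?R j z \<in> Ssp" if "j < n" "z \<in> roots r" for j z
    using that i u by (intro rho_closed rmat_roots)
  let ?dd = "\<lambda>j z. ddiv (?\<theta> j z) (alv i j z) ?f"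
  let ?sb = "\<lambda>j z. if j < i then subst (?\<theta> j z) (xp \<mu>) else 0"
  let ?wx = "\<lambda>j. if w_of n \<mu> j < w_of n \<mu> i then xp \<mu> else 0"
  \<comment> \<open>the contributions of the derivative, the diagonal reflections and the remaining reflections to the eigenvalue\<close>
  let ?c1 = "of_nat (Suc (\<mu> i)) :: complex"
  let ?c2 = "\<Sum>z\<in>roots r. cc i i z * (1 - inverse z ^ Suc (\<mu> i)) * z ^ beta (T (w_of n \<mu> i))"
  let ?c3 = "of_nat r * of_int (ct (T (w_of n \<mu> i))) :: complex"
  have pd: "(\<lambda>T. pdv i (pt ?f ?u T)) = fsc ?c1 (pt (xp \<mu>) ?u)"
    using pdv_xp[OF \<mu> i] by (simp add: pt_def fun_eq_iff fsc_apply lin_scale[OF plin_pdv] mult.commute)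
  have dg: "(\<Sum>z\<in>roots r. fsc (cc i i z) (dl i i z (pt ?f ?u))) = fsc ?c2 (pt (xp \<mu>) ?u)"
    unfolding fsc.scale_sum_left
  proof (rule sum.cong[OF refl])
    fix z assume z: "z \<in> roots r"
    have "dl i i z (pt ?f ?u) = fsc (z ^ beta (T (w_of n \<mu> i))) (fsc (1 - inverse z ^ Suc (\<mu> i)) (pt (xp \<mu>) ?u))"
      unfolding dl_pt[OF i i z u] ddiv_diag[OF \<mu> i z] diag_vm[OF T i z] pt_psc pt_scale ..
    then show "fsc (cc i i z) (dl i i z (pt ?f ?u))
        = fsc (cc i i z * (1 - inverse z ^ Suc (\<mu> i)) * z ^ beta (T (w_of n \<mu> i))) (pt (xp \<mu>) ?u)"
      by (simp only: fsc.scale_scale mult_ac)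
  qed
  have off: "(\<Sum>j\<in>?J. \<Sum>z\<in>roots r. dl i j z (pt ?f ?u)) = (\<Sum>j\<in>?J. \<Sum>z\<in>roots r. pt (?dd j z) (?R j z))"
    using i u by (intro sum.cong refl) (auto simp: dl_pt)
  have jm: "(\<Sum>j\<in>?J. \<Sum>z\<in>roots r. pt (?wx j) (?R j z)) = fsc ?c3 (pt (xp \<mu>) ?u)"
  proof -
    have "(\<Sum>j\<in>?J. \<Sum>z\<in>roots r. pt (?wx j) (?R j z))
        = (\<Sum>j\<in>{j \<in> {..<n}. w_of n \<mu> j < w_of n \<mu> i}. \<Sum>z\<in>roots r. pt (xp \<mu>) (?R j z))"
      by (rule sum.mono_neutral_cong_right) (auto simp: pt_0_left)
    also have "\<dots> = (\<Sum>j\<in>{j \<in> {..<n}. w_of n \<mu> j < w_of n \<mu> i}. \<Sum>z\<in>roots r. mulf (xp \<mu>) (pt 1 (?R j z)))"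
      by (simp only: pt_mulf[of "xp \<mu>"])
    also have "\<dots> = mulf (xp \<mu>) (fsc ?c3 (pt 1 ?u))"
      by (simp only: lin_sum[OF flin_mulf, symmetric] jm_vm[OF T i])
    finally show ?thesis by (simp only: lin_scale[OF flin_mulf] pt_mulf[of "xp \<mu>" ?u, symmetric])
  qed
  have "(\<Sum>j\<in>?J. \<Sum>z\<in>roots r. pt (- ?dd j z + ?sb j z + ?wx j) (?R j z)) \<in> LowV \<mu>"
    using i by (intro LowV_sum LowV_pt triangular_term \<mu> R) auto
  moreover have "(\<Sum>j\<in>?J. \<Sum>z\<in>roots r. pt (- ?dd j z + ?sb j z + ?wx j) (?R j z))
      = - (\<Sum>j\<in>?J. \<Sum>z\<in>roots r. pt (?dd j z) (?R j z)) + jmo i (pt (xp \<mu>) ?u) + fsc ?c3 (pt (xp \<mu>) ?u)"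
    unfolding jm[symmetric] jmo_pt[OF i u]
    by (simp only: pt_add_left pt_uminus_left sum.distrib sum_negf)
  ultimately have low: "fsc c0 (- (\<Sum>j\<in>?J. \<Sum>z\<in>roots r. pt (?dd j z) (?R j z)) + jmo i (pt (xp \<mu>) ?u) + fsc ?c3 (pt (xp \<mu>) ?u)) \<in> LowV \<mu>"
    by (simp add: LowV_fsc)
  have "zo i (em \<mu> T) = fsc ?c1 (pt (xp \<mu>) ?u) - fsc ?c2 (pt (xp \<mu>) ?u)
      - fsc c0 (\<Sum>j\<in>?J. \<Sum>z\<in>roots r. pt (?dd j z) (?R j z)) + fsc c0 (jmo i (pt (xp \<mu>) ?u))"
    unfolding em_def zo_def ao_def xo_pt yo_explicit[OF i] pd dg off ..
  then have "zo i (em \<mu> T) - fsc (?c1 - ?c2 - c0 * ?c3) (em \<mu> T)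
      = fsc c0 (- (\<Sum>j\<in>?J. \<Sum>z\<in>roots r. pt (?dd j z) (?R j z)) + jmo i (pt (xp \<mu>) ?u) + fsc ?c3 (pt (xp \<mu>) ?u))"
    by (simp add: em_def fsc.scale_left_diff_distrib fsc.scale_right_distrib algebra_simps)
  then show ?thesis using low by metis
qed

lemma zeta_em:
  assumes \<mu>: "\<mu> \<in> compositions n" and T: "T \<in> ST" and i: "i < n"
  shows "\<exists>c. tw (zeta_mat r n i 1) (em \<mu> T) = fsc c (em \<mu> T)"
proof -
  have z: "zeta r \<in> roots r" by (rule zeta_in_roots)
  let ?\<theta> = "theta (rmat n i i (zeta r))"
  have th: "?\<theta> k = psc (if k = i then inverse (zeta r) else 1) (var k)" for k
    using i z unfolding theta_def
    by (simp add: pm_rmat[OF r_pos] ph_rmat[OF r_pos] roots_def)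
  have "subst ?\<theta> (xp \<mu>) = psc (\<Prod>k<n. (if k = i then inverse (zeta r) else 1) ^ \<mu> k) (xp \<mu>)"
  proof -
    have "(\<Prod>k\<in>A. psc (c k) (g k)) = psc (\<Prod>k\<in>A. c k) (\<Prod>k\<in>A. g k)" if "finite A"
      for A and c :: "nat \<Rightarrow> complex" and g :: "nat \<Rightarrow> mpoly"
      using that by (induction A) (auto simp: mult_psc_left mult_psc_right)
    then show ?thesis unfolding subst_xp[OF \<mu>] th psc_power by (simp add: xp_prod[OF \<mu>])
  qed
  then show ?thesis
    unfolding zeta_mat_1 em_def
    by (auto simp: tw_pt rmat_roots i z vm_Ssp T diag_vm pt_psc pt_scale)
qed

definition wm :: "(nat \<Rightarrow> nat) \<Rightarrow> complex mat"
  where "wm \<mu> = perm_mat n (w_of n \<mu>)"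

lemma wm_Grp: "wm \<mu> \<in> Grp r n"
  unfolding wm_def perm_mat_mono by (rule GrpI[OF r_pos w_of_permutes]) simp

lemma wm_winv: "wm \<mu> * winv \<mu> = 1\<^sub>m n" "winv \<mu> * wm \<mu> = 1\<^sub>m n"
  unfolding wm_def winv_def perm_mat_mono mono_mat_one
    mono_mat_mult[OF w_of_permutes] mono_mat_mult[OF w_inv_permutes]
  by (rule mono_mat_cong; simp add: w_inv)+

text \<open>The coefficient of \<open>x\<^sup>\<mu> v\<^sub>T\<^sup>\<mu>\<close>: apply \<open>w\<^sub>\<mu>\<close> to the coefficient of \<open>x\<^sup>\<mu>\<close> and take the coordinate at \<open>T\<close>.\<close>

definition coord :: "(nat \<Rightarrow> nat) \<times> tableau \<Rightarrow> (tableau \<Rightarrow> mpoly) \<Rightarrow> complex"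
  where "coord s F = (\<Sum>U\<in>ST. R (wm (fst s)) (snd s) U * lookup (F U) (ex (fst s)))"

lemma coord_add: "coord s (F + G) = coord s F + coord s G"
  by (simp add: coord_def fapp lookup_add algebra_simps sum.distrib)

lemma coord_fsc: "coord s (fsc c F) = c * coord s F"
  by (simp add: coord_def fapp sum_distrib_left mult_ac)

lemma coord_rho:
  assumes F: "F \<in> V"
  shows "coord (\<mu>, T) F = rho (wm \<mu>) (\<lambda>U. lookup (F U) (ex \<mu>)) T"
proof -
  have "(\<lambda>U. lookup (F U) (ex \<mu>)) \<in> Ssp" using F by (simp add: V_def Ssp_def)
  then show ?thesis by (simp add: coord_def rho_expand[OF wm_Grp])
qed

lemma coord_em:
  assumes "\<mu> \<in> compositions n" "\<nu> \<in> compositions n" "T \<in> ST" "S \<in> ST"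
  shows "coord (\<nu>, S) (em \<mu> T) = (if (\<nu>, S) = (\<mu>, T) then 1 else 0)"
proof -
  have l: "(\<lambda>U. lookup (em \<mu> T U) (ex \<nu>)) = (\<lambda>U. (if \<mu> = \<nu> then 1 else 0) * vm \<mu> T U)"
    using ex_inj[OF assms(1,2)] by (auto simp: em_def pt_def xp_def lookup_single when_def fun_eq_iff)
  have "rho (wm \<mu>) (vm \<mu> T) = vv T"
    unfolding vm_def using rho_mult[OF wm_Grp winv_Grp Ssp_vv[OF assms(3)], of \<mu> \<mu>]
    by (simp add: wm_winv rho_one Ssp_vv assms)
  then show ?thesis
    unfolding coord_rho[OF V_em[OF assms(1,3)]] l rho_scale[OF wm_Grp vm_Ssp[OF assms(3)]]
    by (auto simp: vv_def)
qed

lemma em_span: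
  assumes "\<nu> \<in> compositions n" "u \<in> Ssp"
  shows "pt (xp \<nu>) u = (\<Sum>S\<in>ST. fsc (rho (wm \<nu>) u S) (em \<nu> S))"
proof -
  let ?v = "rho (wm \<nu>) u"
  have v: "?v \<in> Ssp" using assms(2) by (intro rho_closed wm_Grp)
  have "u = rho (winv \<nu>) ?v"
    using rho_mult[OF winv_Grp wm_Grp assms(2), of \<nu> \<nu>] by (simp add: wm_winv rho_one assms)
  also have "\<dots> = (\<lambda>U. \<Sum>S\<in>ST. ?v S * vm \<nu> S U)"
    by (rule ext) (simp add: rho_expand[OF winv_Grp v] vm_def R_def mult.commute)
  finally have "pt (xp \<nu>) u = pt (xp \<nu>) (\<lambda>U. \<Sum>S\<in>ST. ?v S * vm \<nu> S U)" by metis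
  then show ?thesis
    by (simp add: em_def pt_def fun_eq_iff fun_sum_apply fsc_apply psc.scale_sum_left)
qed

lemma V_em_expand:
  assumes F: "F \<in> V" and M: "finite M" "\<And>T. keys (F T) \<subseteq> M" "\<And>m. m \<in> M \<Longrightarrow> keys m \<subseteq> {..<n}"
  shows "F = (\<Sum>m\<in>M. \<Sum>S\<in>ST. fsc (coord (lookup m, S) F) (em (lookup m) S))"
proof -
  have "F = (\<Sum>m\<in>M. pt (mon m) (\<lambda>U. lookup (F U) m))"
  proof
    fix U
    have "F U = (\<Sum>m\<in>M. Poly_Mapping.single m (lookup (F U) m))"
      using M(1) subsetD[OF M(2)[of U]] by (intro poly_mapping_eqI)
        (auto simp: lookup_sum lookup_single when_def in_keys_iff sum.delta)
    then show "F U = (\<Sum>m\<in>M. pt (mon m) (\<lambda>U. lookup (F U) m)) U"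
      by (simp add: fun_sum_apply pt_def)
  qed
  also have "\<dots> = (\<Sum>m\<in>M. \<Sum>S\<in>ST. fsc (coord (lookup m, S) F) (em (lookup m) S))"
  proof (rule sum.cong[OF refl])
    fix m assume m: "m \<in> M"
    have u: "(\<lambda>U. lookup (F U) m) \<in> Ssp" using F by (simp add: V_def Ssp_def)
    have "pt (mon m) (\<lambda>U. lookup (F U) m) = pt (xp (lookup m)) (\<lambda>U. lookup (F U) m)"
      by (simp add: xp_def ex_lookup)
    also have "\<dots> = (\<Sum>S\<in>ST. fsc (rho (wm (lookup m)) (\<lambda>U. lookup (F U) m) S) (em (lookup m) S))"
      by (rule em_span[OF lookup_compositions[OF M(3)[OF m]] u])
    finally show "pt (mon m) (\<lambda>U. lookup (F U) m) = (\<Sum>S\<in>ST. fsc (coord (lookup m, S) F) (em (lookup m) S))"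
      by (simp add: coord_rho[OF F] ex_lookup)
  qed
  finally show ?thesis .
qed

text \<open>Both sides are the class of the family with the same monomial in every place.\<close>

lemma psi_em: "\<mu> \<in> compositions n \<Longrightarrow> T \<in> ST \<Longrightarrow> psi (em \<mu> T) = xv \<mu> T"
proof -
  assume \<mu>: "\<mu> \<in> compositions n" and "T \<in> ST"
  have "emb (psc c (mon (ex \<mu>))) = xmon \<mu> * const c" for c
    by (simp add: lin_scale[OF plin_emb] emb_def lookup_ex[OF \<mu>] psc_const const_commute)
  then show ?thesis
    unfolding psi_def xv_def em_def pt_def xp_def vm_def winv_def
    by (simp add: tensor_fam[OF FF_xmon])
qed

end

section \<open>Submodules and weights in the model\<close>

lemma ring_complex_ring: "ring complex_ring"
proof (rule ringI)
  show "abelian_group complex_ring"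
  proof (rule abelian_groupI)
    show "\<exists>y\<in>carrier complex_ring. y \<oplus>\<^bsub>complex_ring\<^esub> x = \<zero>\<^bsub>complex_ring\<^esub>" for x
      by (rule bexI[of _ "- x"]) (simp_all add: complex_ring_def)
  qed (simp_all add: complex_ring_def)
  show "Group.monoid complex_ring"
    by (rule monoidI) (simp_all add: complex_ring_def)
qed (simp_all add: complex_ring_def algebra_simps)

lemma complex_ring_simps [simp]: "carrier complex_ring = UNIV"
  by (simp add: complex_ring_def)

context cherednik_rep
begin

lemma lmodule_restrict:
  assumes "lmodule HH M"
  shows "lmodule complex_ring (restrict_scalars M)"
proof -
  interpret M: lmodule HH M by (rule assms)
  let ?M = "restrict_scalars M"
  have s: "carrier ?M = carrier M" "add ?M = add M" "zero ?M = zero M"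
    "c \<odot>\<^bsub>?M\<^esub> m = hcl (const c) \<odot>\<^bsub>M\<^esub> m" for c m
    by (simp_all add: restrict_scalars_def)
  have c: "hcl (const c) \<in> carrier HH" for c by (intro hcl_closed FF_const)
  show ?thesis
  proof (intro lmodule.intro lmodule_axioms.intro ring_complex_ring)
    show "abelian_group ?M"
    proof (rule abelian_groupI)
      show "\<exists>y\<in>carrier ?M. y \<oplus>\<^bsub>?M\<^esub> x = \<zero>\<^bsub>?M\<^esub>" if "x \<in> carrier ?M" for x
        by (rule bexI[of _ "\<ominus>\<^bsub>M\<^esub> x"]) (use that in \<open>simp_all add: s M.M.l_neg\<close>)
    qed (simp_all add: s M.M.a_ac)
  qed (simp_all add: s c M.smult_l_distr M.smult_r_distr M.smult_assoc1[symmetric] hcl_1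
      complex_ring_def const_add hcl_add FF_const const_mult hcl_mult)
qed

lemma submodule_restrict_iff:
  assumes "lmodule HH M"
  shows "submodule N complex_ring (restrict_scalars M) \<longleftrightarrow> N \<subseteq> carrier M \<and> \<zero>\<^bsub>M\<^esub> \<in> N \<and>
    (\<forall>x\<in>N. \<forall>y\<in>N. x \<oplus>\<^bsub>M\<^esub> y \<in> N) \<and> (\<forall>c. \<forall>x\<in>N. hcl (const c) \<odot>\<^bsub>M\<^esub> x \<in> N)"
  unfolding lmodule.submodule_iff[OF lmodule_restrict[OF assms]]
  by (simp add: restrict_scalars_def)

interpretation MM: lmodule HH MM by (rule lmodule_MM)

lemma psi_uminus: "psi (- F) = \<ominus>\<^bsub>MM\<^esub> psi F"
proof -
  have "psi (- F) \<oplus>\<^bsub>MM\<^esub> psi F = \<zero>\<^bsub>MM\<^esub>" by (simp add: psi_0 flip: psi_add)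
  then show ?thesis by (intro MM.M.minus_equality[symmetric]) (simp_all add: psi_closed)
qed

lemma psi_diff: "psi (F - G) = psi F \<ominus>\<^bsub>MM\<^esub> psi G"
  using psi_add[of F "- G"] by (simp add: psi_uminus a_minus_def)

lemma psi_eq_iff: "F \<in> V \<Longrightarrow> G \<in> V \<Longrightarrow> psi F = psi G \<longleftrightarrow> F = G"
  using psi_inj by (auto dest: inj_onD)

lemma psi_mem_image: "F \<in> V \<Longrightarrow> B \<subseteq> V \<Longrightarrow> psi F \<in> psi ` B \<longleftrightarrow> F \<in> B"
  using psi_eq_iff by blast

text \<open>Spans can be computed in the model, where the theory of vector spaces applies.\<close>

lemma cspan_psi:
  assumes B: "B \<subseteq> V"
  shows "cspan MM (psi ` B) = psi ` fsc.span B"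
proof
  have sV: "fsc.span B \<subseteq> V" using B subspace_V by (rule fsc.span_minimal)
  have "submodule (psi ` fsc.span B) complex_ring (restrict_scalars MM)"
    unfolding submodule_restrict_iff[OF lmodule_MM]
  proof (intro conjI ballI allI)
    show "\<zero>\<^bsub>MM\<^esub> \<in> psi ` fsc.span B" using psi_0 fsc.span_zero by (metis imageI)
  qed (auto simp: psi_closed intro!: imageI fsc.span_add fsc.span_scale simp flip: psi_add psi_fsc)
  moreover have "psi ` B \<subseteq> psi ` fsc.span B" using fsc.span_superset by blast
  ultimately show "cspan MM (psi ` B) \<subseteq> psi ` fsc.span B"
    unfolding cspan_def gen_submodule_def by blast
  show "psi ` fsc.span B \<subseteq> cspan MM (psi ` B)"
    unfolding cspan_def gen_submodule_def
  proof (intro Inter_greatest, clarify)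
    fix N F assume N: "submodule N complex_ring (restrict_scalars MM)" "psi ` B \<subseteq> N" and F: "F \<in> fsc.span B"
    show "psi F \<in> N"
      using F N(1)[unfolded submodule_restrict_iff[OF lmodule_MM]] N(2)
      by (induction rule: fsc.span_induct_alt) (auto simp: psi_0 psi_add psi_fsc)
  qed
qed

text \<open>The subspaces of the model that correspond to submodules of the standard module under \<open>psi\<close>.\<close>

definition stable :: "(tableau \<Rightarrow> mpoly) set \<Rightarrow> bool"
  where "stable N \<longleftrightarrow> N \<subseteq> V \<and> fsc.subspace N \<and> (\<forall>p\<in>carrier FF. \<forall>F\<in>N. act p F \<in> N)"

lemma submodule_psi: "B \<subseteq> V \<Longrightarrow> submodule (psi ` B) HH MM \<longleftrightarrow> stable B"
proof
  assume B: "B \<subseteq> V"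
  note mem = psi_mem_image[OF _ B]
  assume "submodule (psi ` B) HH MM"
  note N = MM.submoduleD[OF this]
  show "stable B"
    unfolding stable_def fsc.subspace_def
  proof (intro conjI ballI allI B)
    show "0 \<in> B" using N(2) mem[OF V_0] by (simp add: psi_0)
    fix F assume F: "F \<in> B"
    show "F + F' \<in> B" if "F' \<in> B" for F'
      using N(3)[of "psi F" "psi F'"] mem[of "F + F'"] F that B by (auto simp: psi_add V_add subsetD)
    show "fsc c F \<in> B" for c
      using N(4)[OF hcl_closed[OF FF_const], of "psi F" c] mem[of "fsc c F"] F B
      by (auto simp: psi_fsc V_fsc subsetD)
    show "act p F \<in> B" if "p \<in> carrier FF" for p
      using N(4)[OF hcl_closed[OF that], of "psi F"] mem[of "act p F"] F B that
      by (auto simp: psi_act V_act subsetD)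
  qed
next
  assume B: "B \<subseteq> V"
  assume st: "stable B"
  then have s: "fsc.subspace B" by (simp add: stable_def)
  show "submodule (psi ` B) HH MM"
    unfolding MM.submodule_iff
  proof (intro conjI ballI)
    show "psi ` B \<subseteq> carrier MM" using psi_closed by auto
    show "\<zero>\<^bsub>MM\<^esub> \<in> psi ` B" using psi_0 fsc.subspace_0[OF s] by (metis imageI)
    show "x \<oplus>\<^bsub>MM\<^esub> y \<in> psi ` B" if "x \<in> psi ` B" "y \<in> psi ` B" for x y
      using that fsc.subspace_add[OF s] by (auto simp flip: psi_add)
    fix a x assume "a \<in> carrier HH" "x \<in> psi ` B"
    then obtain p F where "p \<in> carrier FF" "a = hcl p" "F \<in> B" "x = psi F" by (auto simp: carrier_HH)
    then have "act p F \<in> B" "a \<odot>\<^bsub>MM\<^esub> x = psi (act p F)"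
      using st B psi_act[of p F] by (auto simp: stable_def)
    then show "a \<odot>\<^bsub>MM\<^esub> x \<in> psi ` B" by (simp only: imageI)
  qed
qed

lemma submodule_obtain:
  assumes "submodule N HH MM"
  obtains B where "B \<subseteq> V" "N = psi ` B" "stable B"
proof -
  let ?B = "{F \<in> V. psi F \<in> N}"
  have "N = psi ` ?B"
  proof (intro equalityI subsetI)
    fix m assume m: "m \<in> N"
    then have "m \<in> psi ` V" using MM.submoduleD(1)[OF assms] unfolding psi_surj by (rule subsetD[rotated])
    then show "m \<in> psi ` ?B" using m by auto
  qed auto
  then show ?thesis using submodule_psi[of ?B] assms that[of ?B] by auto
qed

subsection \<open>The operators generating the weights\<close>

text \<open>The weights are detected by these generators of \<^const>\<open>tt\<close>.\<close>

definition GG :: "((tableau \<Rightarrow> mpoly) \<Rightarrow> tableau \<Rightarrow> mpoly) set"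
  where "GG = zo ` {..<n} \<union> (\<lambda>i. tw (zeta_mat r n i 1)) ` {..<n}"

lemma phi_FF: "i < n \<Longrightarrow> phi i \<in> carrier FF"
  unfolding phi_def by (intro FF_sum FF_T refl_in_Grp) auto

lemma zz_FF: "i < n \<Longrightarrow> zz i \<in> carrier FF"
  unfolding zz_def by (intro FF_intros phi_FF)

definition tt_gens :: "rca_elem set"
  where "tt_gens = range (\<lambda>c. hcl (const c))
    \<union> (\<lambda>i. hcl (zz i)) ` {..<n} \<union> (\<lambda>i. hcl (T\<^sub>g (zeta_mat r n i 1))) ` {..<n}"

lemma tt_eq: "tt = generate_ring HH tt_gens"
  by (simp add: tt_def tt_gens_def)

lemma GG_tt:
  assumes "g \<in> GG"
  shows "\<exists>p\<in>carrier FF. hcl p \<in> tt \<and> (\<forall>F. act p F = g F)"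
  using assms unfolding GG_def
proof (elim UnE imageE)
  fix i assume "g = zo i" "i \<in> {..<n}"
  then show ?thesis
    by (intro bexI[of _ "zz i"]) (auto simp: tt_eq tt_gens_def zz_FF act_zz intro!: generate_ring.incl)
next
  fix i assume "g = tw (zeta_mat r n i 1)" "i \<in> {..<n}"
  then show ?thesis
    by (intro bexI[of _ "T\<^sub>g (zeta_mat r n i 1)"])
      (auto simp: tt_eq tt_gens_def FF_T zeta_mat_1_Grp act_T intro!: generate_ring.incl)
qed

text \<open>On a common eigenvector \<open>x\<close> of the generators and a vector \<open>y\<close> that is an eigenvector of the same
weight modulo \<open>x\<close>, the algebra acts by triangular matrices of size two; these are closed under sums and
products, so the property extends from the generators to all of \<^const>\<open>tt\<close>.\<close>

lemma tt_character:
  assumes x: "x \<in> V" "\<And>g. g \<in> GG \<Longrightarrow> g x = fsc (\<chi> g) x"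
    and y: "y \<in> V" "\<And>g. g \<in> GG \<Longrightarrow> \<exists>c. g y - fsc (\<chi> g) y = fsc c x"
    and a: "a \<in> tt"
  shows "\<exists>p \<alpha> c. p \<in> carrier FF \<and> a = hcl p \<and> act p x = fsc \<alpha> x \<and> act p y = fsc \<alpha> y + fsc c x"
  using a unfolding tt_eq
proof (induction a rule: generate_ring.induct)
  case one
  show ?case by (intro exI[of _ 1] exI[of _ 0]) (auto simp: FF_1 hcl_1)
next
  case (incl h)
  have gen: ?case if p: "p \<in> carrier FF" "h = hcl p" "g \<in> GG" "\<And>F. act p F = g F" for p g
  proof -
    obtain c where "g y - fsc (\<chi> g) y = fsc c x" using y(2)[OF p(3)] by blast
    then have "g y = fsc (\<chi> g) y + fsc c x" by (simp add: algebra_simps)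
    then show ?thesis using p x(2)[OF p(3)]
      by (intro exI[of _ p] exI[of _ "\<chi> g"] exI[of _ c]) auto
  qed
  from incl show ?case
    unfolding tt_gens_def
  proof (elim UnE imageE rangeE)
    fix c assume "h = hcl (const c)"
    then show ?case
      by (intro exI[of _ "const c"] exI[of _ c] exI[of _ 0]) (auto simp: FF_const act_const)
  next
    fix i assume "h = hcl (zz i)" "i \<in> {..<n}"
    then show ?case by (intro gen[of "zz i" "zo i"]) (auto simp: zz_FF GG_def act_zz)
  next
    fix i assume "h = hcl (T\<^sub>g (zeta_mat r n i 1))" "i \<in> {..<n}"
    then show ?case
      by (intro gen[of "T\<^sub>g (zeta_mat r n i 1)" "tw (zeta_mat r n i 1)"])
        (auto simp: FF_T zeta_mat_1_Grp GG_def act_T)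
  qed
next
  case (a_inv h)
  then obtain p \<alpha> c where h: "p \<in> carrier FF" "h = hcl p" "act p x = fsc \<alpha> x" "act p y = fsc \<alpha> y + fsc c x" by blast
  then show ?case
    by (intro exI[of _ "- p"] exI[of _ "- \<alpha>"] exI[of _ "- c"])
      (auto simp: FF_uminus hcl_uminus act_uminus fapp uminus_apply fun_eq_iff)
next
  case (eng_add h k)
  then obtain p \<alpha> c q \<beta> d where h: "p \<in> carrier FF" "h = hcl p" "act p x = fsc \<alpha> x" "act p y = fsc \<alpha> y + fsc c x"
    and k: "q \<in> carrier FF" "k = hcl q" "act q x = fsc \<beta> x" "act q y = fsc \<beta> y + fsc d x" by blast
  then show ?case
    by (intro exI[of _ "p + q"] exI[of _ "\<alpha> + \<beta>"] exI[of _ "c + d"])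
      (auto simp: FF_add hcl_add act_add fsc.scale_left_distrib)
next
  case (eng_mult h k)
  then obtain p \<alpha> c q \<beta> d where h: "p \<in> carrier FF" "h = hcl p" "act p x = fsc \<alpha> x" "act p y = fsc \<alpha> y + fsc c x"
    and k: "q \<in> carrier FF" "k = hcl q" "act q x = fsc \<beta> x" "act q y = fsc \<beta> y + fsc d x" by blast
  then show ?case
    by (intro exI[of _ "p * q"] exI[of _ "\<alpha> * \<beta>"] exI[of _ "\<beta> * c + d * \<alpha>"])
      (auto simp: FF_mult hcl_mult act_mult lin_add[OF flin_act] lin_scale[OF flin_act]
        fsc.scale_left_distrib fsc.scale_right_distrib mult.commute)
qed

text \<open>Such \<open>x\<close> and \<open>y\<close> lie in one generalized weight space, which is one-dimensional.\<close>

lemma simple_weights: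
  assumes ss: simple_spectrum
    and x: "x \<in> V" "x \<noteq> 0" "\<And>g. g \<in> GG \<Longrightarrow> g x = fsc (\<chi> g) x"
    and y: "y \<in> V" "\<And>g. g \<in> GG \<Longrightarrow> \<exists>c. g y - fsc (\<chi> g) y = fsc c x"
  shows "\<exists>c. y = fsc c x"
proof -
  have "\<forall>a\<in>tt. \<exists>\<alpha>. \<exists>p c. p \<in> carrier FF \<and> a = hcl p \<and> act p x = fsc \<alpha> x \<and> act p y = fsc \<alpha> y + fsc c x"
    using tt_character[OF x(1,3) y] by blast
  from bchoice[OF this] obtain \<alpha> where \<alpha>: "\<And>a. a \<in> tt \<Longrightarrow> \<exists>p c. p \<in> carrier FF \<and> a = hcl p \<and>
      act p x = fsc (\<alpha> a) x \<and> act p y = fsc (\<alpha> a) y + fsc c x" by blast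
  let ?op = "\<lambda>a u. (a \<odot>\<^bsub>MM\<^esub> u) \<ominus>\<^bsub>MM\<^esub> (hcl (const (\<alpha> a)) \<odot>\<^bsub>MM\<^esub> u)"
  have op: "?op (hcl p) (psi F) = psi (act p F - fsc (\<alpha> (hcl p)) F)" if "p \<in> carrier FF" "F \<in> V" for p F
    using that by (simp add: psi_act psi_fsc psi_diff)
  have px: "psi x \<in> gen_weight_space \<alpha>"
    unfolding gen_weight_space_def
  proof (intro CollectI conjI ballI psi_closed)
    fix a assume "a \<in> tt"
    then obtain p where p: "p \<in> carrier FF" "a = hcl p" "act p x = fsc (\<alpha> a) x" using \<alpha> by blast
    then have "?op a (psi x) = \<zero>\<^bsub>MM\<^esub>" using op[OF p(1) x(1)] by (simp add: psi_0)
    then show "\<exists>k::nat. (?op a ^^ k) (psi x) = \<zero>\<^bsub>MM\<^esub>" by (intro exI[of _ 1]) simp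
  qed
  have py: "psi y \<in> gen_weight_space \<alpha>"
    unfolding gen_weight_space_def
  proof (intro CollectI conjI ballI psi_closed)
    fix a assume "a \<in> tt"
    then obtain p c where p: "p \<in> carrier FF" "a = hcl p" "act p x = fsc (\<alpha> a) x"
      "act p y = fsc (\<alpha> a) y + fsc c x" using \<alpha> by blast
    have "?op a (psi y) = psi (fsc c x)" using op[OF p(1) y(1)] p by simp
    moreover have "?op a (psi (fsc c x)) = \<zero>\<^bsub>MM\<^esub>"
      using op[OF p(1) V_fsc[OF x(1), of c]] p
      by (simp add: psi_0 lin_scale[OF flin_act] mult.commute)
    ultimately have "(?op a ^^ 2) (psi y) = \<zero>\<^bsub>MM\<^esub>" by (simp add: numeral_2_eq_2)
    then show "\<exists>k::nat. (?op a ^^ k) (psi y) = \<zero>\<^bsub>MM\<^esub>" by blast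
  qed
  have "psi x \<noteq> \<zero>\<^bsub>MM\<^esub>" using psi_eq_iff[OF x(1) V_0] x(2) by (simp add: psi_0)
  then have "gen_weight_space \<alpha> \<noteq> {\<zero>\<^bsub>MM\<^esub>}" using px by blast
  then obtain m where m: "m \<in> carrier MM" "gen_weight_space \<alpha> = cspan MM {m}"
    using ss unfolding simple_spectrum_def by blast
  then obtain F where F: "F \<in> V" "m = psi F" using psi_surj by blast
  have "gen_weight_space \<alpha> = psi ` fsc.span {F}" using m F cspan_psi[of "{F}"] by simp
  moreover have "fsc.span {F} \<subseteq> V" using F subspace_V by (intro fsc.span_minimal) auto
  ultimately have "x \<in> fsc.span {F}" "y \<in> fsc.span {F}"
    using px py x(1) y(1) psi_mem_image by auto
  then obtain a b where ab: "x = fsc a F" "y = fsc b F" by (auto simp: fsc.span_singleton)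
  then have "a \<noteq> 0" using x(2) by auto
  then have "y = fsc (b / a) x" using ab by simp
  then show ?thesis by blast
qed

lemma coord_nonzero:
  assumes "F \<in> V" "\<nu> \<in> compositions n" "coord (\<nu>, S) F \<noteq> 0"
  obtains U where "U \<in> ST" "ex \<nu> \<in> keys (F U)"
proof -
  have "\<exists>U\<in>ST. lookup (F U) (ex \<nu>) \<noteq> 0"
  proof (rule ccontr)
    assume "\<not> ?thesis"
    then have "coord (\<nu>, S) F = 0" unfolding coord_def by (intro sum.neutral ballI) simp
    then show False using assms(3) by simp
  qed
  then obtain U where "U \<in> ST" "lookup (F U) (ex \<nu>) \<noteq> 0" by blast
  then show ?thesis using that by (auto simp: in_keys_iff)
qed

lemma triangular_GG:
  assumes g: "g \<in> GG" and s: "s \<in> Gamma" and t: "t \<in> Gamma"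
    and nz: "coord t (g (em (fst s) (snd s))) \<noteq> 0"
  shows "t = s \<or> comp_less n (fst t) (fst s)"
proof -
  obtain \<mu> T \<nu> S where e: "s = (\<mu>, T)" "t = (\<nu>, S)" by (cases s, cases t)
  have st: "\<mu> \<in> compositions n" "T \<in> ST" "\<nu> \<in> compositions n" "S \<in> ST"
    using s t by (auto simp: e Gamma_def)
  have "\<exists>c. g (em \<mu> T) - fsc c (em \<mu> T) \<in> LowV \<mu>"
    using g unfolding GG_def
  proof (elim UnE imageE)
    fix i assume "g = tw (zeta_mat r n i 1)" "i \<in> {..<n}"
    then obtain c where "g (em \<mu> T) = fsc c (em \<mu> T)" using zeta_em[OF st(1,2), of i] by auto
    then show ?thesis using LowV_0 by (intro exI[of _ c]) simp
  qed (use zo_em[OF st(1,2)] in auto)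
  then obtain c where c: "g (em \<mu> T) - fsc c (em \<mu> T) \<in> LowV \<mu>" by blast
  let ?D = "g (em \<mu> T) - fsc c (em \<mu> T)"
  have "coord t (g (em \<mu> T)) = coord t ?D + c * coord t (em \<mu> T)"
    using coord_add[of t ?D "fsc c (em \<mu> T)"] by (simp add: coord_fsc)
  then have "coord t ?D \<noteq> 0 \<or> t = s"
    using nz coord_em[OF st(1,3,2,4)] by (auto simp: e split: if_splits)
  then show ?thesis
  proof
    assume "coord t ?D \<noteq> 0"
    then obtain U where "ex \<nu> \<in> keys (?D U)" using coord_nonzero[of ?D \<nu> S] c st by (auto simp: e LowV_def)
    then have "comp_less n (lookup (ex \<nu>)) \<mu>" using c by (auto simp: LowV_def LowP_def)
    then show ?thesis using lookup_ex[OF st(3)] by (simp add: e)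
  qed simp
qed

lemma coord_expand:
  assumes F: "F \<in> V"
  shows "finite {s \<in> Gamma. coord s F \<noteq> 0}"
    and "F = (\<Sum>s\<in>{s \<in> Gamma. coord s F \<noteq> 0}. fsc (coord s F) (em (fst s) (snd s)))"
proof -
  let ?M = "\<Union>T\<in>ST. keys (F T)"
  have M: "finite ?M" using finite_ST by simp
  have kM: "keys (F T) \<subseteq> ?M" for T
    using F by (cases "T \<in> ST") (auto simp: V_def)
  have Mn: "keys m \<subseteq> {..<n}" if "m \<in> ?M" for m using F that by (auto simp: V_def Pn_def)
  let ?h = "\<lambda>(m, S). (lookup m, S :: tableau)"
  have inj: "inj_on ?h (?M \<times> ST)" by (rule inj_onI) (auto simp: lookup_inject)
  have sub: "{s \<in> Gamma. coord s F \<noteq> 0} \<subseteq> ?h ` (?M \<times> ST)"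
  proof
    fix s assume s: "s \<in> {s \<in> Gamma. coord s F \<noteq> 0}"
    obtain \<nu> S where e: "s = (\<nu>, S)" by (cases s)
    have st: "\<nu> \<in> compositions n" "S \<in> ST" "coord (\<nu>, S) F \<noteq> 0" using s by (auto simp: e Gamma_def)
    then obtain U where "U \<in> ST" "ex \<nu> \<in> keys (F U)" using coord_nonzero[OF F] by blast
    then have "(ex \<nu>, S) \<in> ?M \<times> ST" using st by auto
    moreover have "?h (ex \<nu>, S) = s" using lookup_ex[OF st(1)] by (simp add: e)
    ultimately show "s \<in> ?h ` (?M \<times> ST)" by (metis imageI)
  qed
  show "finite {s \<in> Gamma. coord s F \<noteq> 0}" 
    by (rule finite_subset[OF sub finite_imageI[OF finite_cartesian_product[OF M finite_ST]]])
  have "F = (\<Sum>m\<in>?M. \<Sum>S\<in>ST. fsc (coord (lookup m, S) F) (em (lookup m) S))"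
    by (rule V_em_expand[OF F M kM Mn])
  also have "\<dots> = (\<Sum>(m, S)\<in>?M \<times> ST. fsc (coord (lookup m, S) F) (em (lookup m) S))"
    by (rule sum.cartesian_product)
  also have "\<dots> = (\<Sum>s\<in>?h ` (?M \<times> ST). fsc (coord s F) (em (fst s) (snd s)))"
    unfolding sum.reindex[OF inj] by (intro sum.cong) auto
  also have "\<dots> = (\<Sum>s\<in>{s \<in> Gamma. coord s F \<noteq> 0}. fsc (coord s F) (em (fst s) (snd s)))"
  proof (rule sum.mono_neutral_right)
    show "\<forall>s\<in>?h ` (?M \<times> ST) - {s \<in> Gamma. coord s F \<noteq> 0}. fsc (coord s F) (em (fst s) (snd s)) = 0"
    proof
      fix s assume s: "s \<in> ?h ` (?M \<times> ST) - {s \<in> Gamma. coord s F \<noteq> 0}"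
      then obtain x where "x \<in> ?M \<times> ST" "s = ?h x" by (elim DiffE imageE)
      then have m: "fst x \<in> ?M" "snd x \<in> ST" "s = (lookup (fst x), snd x)"
        by (auto simp: split_def)
      have "s \<in> Gamma" using m lookup_compositions[OF Mn[OF m(1)]] by (simp add: Gamma_def)
      then have "coord s F = 0" using s by blast
      then show "fsc (coord s F) (em (fst s) (snd s)) = 0" by simp
    qed
  qed (use sub M finite_ST in auto)
  finally show "F = (\<Sum>s\<in>{s \<in> Gamma. coord s F \<noteq> 0}. fsc (coord s F) (em (fst s) (snd s)))" .
qed

lemma GG_commute:
  assumes "g \<in> GG" "h \<in> GG" "F \<in> V"
  shows "g (h F) = h (g F)"
  using assms(1,2) unfolding GG_def
  by (elim UnE imageE)
    (simp_all add: zo_commute[OF _ _ assms(3)] tw_zeta_zo[OF _ _ assms(3)] tw_zeta_commute[OF _ _ assms(3)])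

lemma triangular_model:
  assumes ss: simple_spectrum
  shows "triangular_system fsc V Gamma (\<lambda>s. em (fst s) (snd s)) coord
    (\<lambda>t s. comp_less n (fst t) (fst s)) GG"
proof (intro triangular_system.intro triangular_system_axioms.intro fsc.vector_space_axioms)
  show "fsc.subspace V" by (rule subspace_V)
  show "em (fst s) (snd s) \<in> V" if "s \<in> Gamma" for s
    using that by (auto simp: Gamma_def V_em)
  show "coord s (em (fst t) (snd t)) = (if s = t then 1 else 0)" if "s \<in> Gamma" "t \<in> Gamma" for s t
    using that coord_em[of "fst t" "fst s" "snd t" "snd s"] by (auto simp: Gamma_def split: if_splits)
  show "finite GG" by (simp add: GG_def)
  show "module_hom fsc fsc g" if "g \<in> GG" for g
    using that flin_zo flin_tw by (auto simp: GG_def)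
  show "g x \<in> V" if "g \<in> GG" "x \<in> V" for g x
    using that by (auto simp: GG_def V_zo V_tw zeta_mat_1_Grp)
  show "g (h x) = h (g x)" if "g \<in> GG" "h \<in> GG" "x \<in> V" for g h x
    using that GG_commute by blast
  show "wf {(t, s :: (nat \<Rightarrow> nat) \<times> tableau). comp_less n (fst (t :: (nat \<Rightarrow> nat) \<times> tableau)) (fst s)}"
    by (rule wf_subset[OF wf_inv_image[OF wf_comp_less[of n], of fst]]) (auto simp: inv_image_def)
  show "comp_less n (fst t) (fst u)" if "comp_less n (fst t) (fst s)" "comp_less n (fst s) (fst u)"
    for t s u :: "(nat \<Rightarrow> nat) \<times> tableau"
    using that comp_less_trans by blast
  show "t = s \<or> comp_less n (fst t) (fst s)"
    if "g \<in> GG" "s \<in> Gamma" "t \<in> Gamma" "coord t (g (em (fst s) (snd s))) \<noteq> 0" for g s t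
    using triangular_GG that by blast
  show "\<exists>c. y = fsc c x" if "x \<in> V" "y \<in> V" "x \<noteq> 0" "\<And>g. g \<in> GG \<Longrightarrow> g x = fsc (\<chi> g) x"
    "\<And>g. g \<in> GG \<Longrightarrow> \<exists>c. g y - fsc (\<chi> g) y = fsc c x" for x y \<chi>
    using simple_weights[OF ss, of x \<chi> y] that by blast
  show "x = (\<Sum>s\<in>{s \<in> Gamma. coord s x \<noteq> 0}. fsc (coord s x) (em (fst s) (snd s)))" if "x \<in> V" for x
    using that by (rule coord_expand)
qed (simp_all only: coord_add coord_fsc coord_expand(1))

end

section \<open>The radical of the standard module\<close>

context cherednik_rep
begin

interpretation MM: lmodule HH MM by (rule lmodule_MM)

lemma stableD:
  assumes "stable N"
  shows "N \<subseteq> V" "fsc.subspace N" "p \<in> carrier FF \<Longrightarrow> F \<in> N \<Longrightarrow> act p F \<in> N"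
  using assms by (auto simp: stable_def)

lemma stable_GG: "stable N \<Longrightarrow> g \<in> GG \<Longrightarrow> F \<in> N \<Longrightarrow> g F \<in> N"
  using GG_tt[of g] stableD(3)[of N _ F] by fastforce

lemma lmodule_SS: "lmodule complex_ring SS"
proof (intro lmodule.intro lmodule_axioms.intro ring_complex_ring)
  show "abelian_group SS"
  proof (rule abelian_groupI)
    show "\<exists>g\<in>carrier SS. g \<oplus>\<^bsub>SS\<^esub> f = \<zero>\<^bsub>SS\<^esub>" if "f \<in> carrier SS" for f
      by (rule bexI[of _ "\<lambda>T. - f T"]) (use that in \<open>auto simp: SS_def\<close>)
  qed (auto simp: SS_def fun_eq_iff)
qed (auto simp: SS_def complex_ring_def fun_eq_iff algebra_simps)

text \<open>The constants in \<open>N\<close> form a nonzero subrepresentation of the irreducible \<open>S\<^sup>\<lambda>\<close>, and multiplication by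
the variables generates everything from the constants.\<close>

lemma stable_constants:
  assumes st: "stable N" and u: "u \<in> Ssp" "u \<noteq> (\<lambda>T. 0)" "pt 1 u \<in> N"
  shows "N = V"
proof
  note sub = stableD(2)[OF st]
  let ?U = "{u \<in> Ssp. pt 1 u \<in> N}"
  have "submodule ?U complex_ring SS"
    unfolding lmodule.submodule_iff[OF lmodule_SS] carrier_SS SS_simps
  proof (intro conjI ballI)
    have "pt 1 (\<lambda>T. 0) = (0 :: tableau \<Rightarrow> mpoly)" by (simp add: pt_def fun_eq_iff fapp)
    then show "(\<lambda>T. 0) \<in> ?U" using fsc.subspace_0[OF sub] by simp
    show "(\<lambda>T. f T + g T) \<in> ?U" if "f \<in> ?U" "g \<in> ?U" for f g
      using that fsc.subspace_add[OF sub, of "pt 1 f" "pt 1 g"] by (auto simp: pt_add_right)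
    show "(\<lambda>T. c * f T) \<in> ?U" if "f \<in> ?U" for c f
    proof -
      have "pt 1 (\<lambda>T. c * f T) = fsc c (pt 1 f)" by (simp add: pt_def fun_eq_iff fapp)
      then show ?thesis using that fsc.subspace_scale[OF sub, of "pt 1 f" c] by auto
    qed
  qed auto
  moreover have "\<forall>w\<in>Grp r n. rho w ` ?U \<subseteq> ?U"
  proof (intro ballI subsetI, elim imageE)
    fix w f g assume w: "w \<in> Grp r n" and f: "f \<in> ?U" "g = rho w f"
    have "pt 1 (rho w f) = act (T\<^sub>g w) (pt 1 f)" using w f by (simp add: act_T tw_pt)
    then show "g \<in> ?U" using stableD(3)[OF st FF_T[OF w], of "pt 1 f"] f w rho_closed by auto
  qed
  ultimately have "?U = {\<lambda>T. 0} \<or> ?U = Ssp" by (rule rho_irreducible)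
  then have U: "pt 1 f \<in> N" if "f \<in> Ssp" for f using u that by blast
  show "N \<subseteq> V" by (rule stableD(1)[OF st])
  show "V \<subseteq> N"
  proof
    fix F assume "F \<in> V"
    then show "F \<in> N"
    proof (induction F rule: V_induct)
      case (const f)
      then show ?case by (rule U)
    next
      case (add F G)
      then show ?case by (intro fsc.subspace_add[OF sub])
    next
      case (xo k F)
      then show ?case using stableD(3)[OF st FF_X, of k F] by (simp add: act_X)
    qed
  qed
qed

lemma mu_minus_mono: "i \<le> j \<Longrightarrow> j < n \<Longrightarrow> mu_minus n \<mu> i \<le> mu_minus n \<mu> j"
  unfolding mu_minus_def by (auto intro!: sorted_nth_mono)

lemma mu_minus_max:
  assumes "i < n"
  shows "\<mu> i \<le> mu_minus n \<mu> (n - 1)"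
proof -
  have "\<mu> i \<in> set (sort (map \<mu> [0..<n]))" using assms by auto
  then obtain k where "k < length (sort (map \<mu> [0..<n]))" "sort (map \<mu> [0..<n]) ! k = \<mu> i"
    unfolding in_set_conv_nth by blast
  then have "k < n" "mu_minus n \<mu> k = \<mu> i" by (simp_all add: mu_minus_def)
  then show ?thesis using mu_minus_mono[of k "n - 1" \<mu>] by simp
qed

lemma entry_ST:
  assumes "T \<in> ST" "b \<in> boxes lam"
  shows "entry n T b < n" "T (entry n T b) = b"
  using assms inv_into_into[of b T "{..<n}"] f_inv_into_f[of b T "{..<n}"]
  by (auto simp: entry_def ST_image)

lemma entry_apply: "T \<in> ST \<Longrightarrow> i < n \<Longrightarrow> entry n T (T i) = i"
  unfolding entry_def using ST_bij[of T] by (auto simp: bij_betw_def)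

lemma entry_mono:
  assumes "T \<in> ST" "a \<in> boxes lam" "b \<in> boxes lam" "beta b = beta a"
    and "box_col a \<le> box_col b" "box_row a \<le> box_row b"
  shows "entry n T a \<le> entry n T b"
  by (rule ST_mono[OF assms(1) entry_ST(1)[OF assms(1,2)] entry_ST(1)[OF assms(1,3)]])
    (simp_all only: entry_ST(2)[OF assms(1,2)] entry_ST(2)[OF assms(1,3)] assms)

text \<open>The part of \<open>\<mu>\<^sup>-\<close> at the entry of a box is followed along the chain. It drops by at most \<open>k\<^sub>i\<close> from
\<open>b\<^sub>2\<^sub>i\<close> to the next box, and does not drop from there to \<open>b\<^sub>2\<^sub>i\<^sub>+\<^sub>2\<close>, whose entry is at least as large.\<close>

lemma composition_bounded:
  fixes m :: nat and bs :: "nat \<Rightarrow> box" and ks :: "nat \<Rightarrow> nat"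
  assumes T: "T \<in> ST" and \<mu>: "\<mu> \<in> compositions n"
    and bs: "entry n T (bs 0) = n - 1" "\<forall>i\<le>2 * m. bs i \<in> boxes lam"
    and a: "\<forall>i\<in>{1..m}. beta (bs (2 * i)) = beta (bs (2 * i - 1)) \<and>
           box_col (bs (2 * i - 1)) \<le> box_col (bs (2 * i)) \<and>
           box_row (bs (2 * i - 1)) \<le> box_row (bs (2 * i))"
    and b: "\<forall>i<m. (\<mu>, T) \<notin> Gamma2 (bs (2 * i)) (bs (2 * i + 1)) (ks i)"
    and c: "(\<mu>, T) \<notin> Gamma1 (bs (2 * m)) (ks m)"
    and i: "i < n"
  shows "\<mu> i \<le> (\<Sum>j\<le>m. ks j)"
proof -
  let ?a = "\<lambda>j. mu_minus n \<mu> (entry n T (bs j))"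
  have G: "(\<mu>, T) \<in> Gamma" using T \<mu> by (simp add: Gamma_def)
  have "?a 0 \<le> (\<Sum>i<j. ks i) + ?a (2 * j)" if "j \<le> m" for j
    using that
  proof (induction j)
    case (Suc j)
    have j: "j < m" using Suc.prems by simp
    have "?a (2 * j) \<le> ?a (2 * j + 1) + ks j"
      using b[rule_format, OF j] G by (auto simp: Gamma2_def Let_def)
    moreover have "?a (2 * j + 1) \<le> ?a (2 * Suc j)"
    proof (rule mu_minus_mono)
      show "entry n T (bs (2 * j + 1)) \<le> entry n T (bs (2 * Suc j))"
        using a[rule_format, of "Suc j"] bs(2) j by (intro entry_mono[OF T]) auto
      show "entry n T (bs (2 * Suc j)) < n" using bs(2) j by (intro entry_ST[OF T]) auto
    qed
    ultimately show ?case using Suc.IH j by simp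
  qed simp
  from this[OF order_refl] have "?a 0 \<le> (\<Sum>i<m. ks i) + ?a (2 * m)" .
  moreover have "?a (2 * m) < ks m" using c G by (auto simp: Gamma1_def)
  ultimately have "?a 0 \<le> (\<Sum>j\<le>m. ks j)" by (simp add: lessThan_Suc_atMost[symmetric])
  then show ?thesis using mu_minus_max[OF i, of \<mu>] bs(1) by simp
qed

lemma ST_nonempty: "ST \<noteq> {}"
proof
  assume "ST = {}"
  then have "Ssp = {\<lambda>T. 0}" by (auto simp: Ssp_def)
  then show False using sp by (simp add: specht_module_def carrier_SS SS_simps)
qed

lemma mu_minus_0: "mu_minus n (\<lambda>_. 0) i = 0"
  by (simp add: mu_minus_def map_replicate_const sort_replicate)

lemma zero_notin_Gamma1: "k > 0 \<Longrightarrow> ((\<lambda>_. 0), T) \<notin> Gamma1 b k"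
  and zero_notin_Gamma2: "k > 0 \<Longrightarrow> ((\<lambda>_. 0), T) \<notin> Gamma2 b b' k"
  by (auto simp: Gamma1_def Gamma2_def Let_def mu_minus_0)

lemma finite_bounded_compositions: "finite {\<mu> \<in> compositions n. \<forall>i<n. \<mu> i \<le> C}"
proof -
  have "finite {\<mu>. \<forall>i. (i \<in> {..<n} \<longrightarrow> \<mu> i \<in> {..C}) \<and> (i \<notin> {..<n} \<longrightarrow> \<mu> i = (0 :: nat))}"
    by (rule finite_set_of_finite_funs) auto
  then show ?thesis by (rule rev_finite_subset) (auto simp: compositions_def)
qed

context
  assumes ss: simple_spectrum
begin

interpretation ts: triangular_system fsc V Gamma "\<lambda>s. em (fst s) (snd s)" coord
  "\<lambda>t s. comp_less n (fst t) (fst s)" GG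
  by (rule triangular_model[OF ss])

lemma L_eq_span:
  assumes "s \<in> Gamma"
  shows "ts.L s = fsc.span ((\<lambda>t. em (fst t) (snd t)) ` {t \<in> Gamma. comp_less n (fst t) (fst s)})"
    (is "_ = fsc.span ?B")
proof
  show "ts.L s \<subseteq> fsc.span ?B"
  proof
    fix x assume x: "x \<in> ts.L s"
    then have "(\<Sum>t\<in>{t \<in> Gamma. coord t x \<noteq> 0}. fsc (coord t x) (em (fst t) (snd t))) \<in> fsc.span ?B"
      by (intro fsc.span_sum fsc.span_scale fsc.span_base) (auto simp: ts.L_def)
    then show "x \<in> fsc.span ?B" using x ts.expand[of x] by (simp add: ts.L_def)
  qed
  show "fsc.span ?B \<subseteq> ts.L s"
  proof (rule fsc.span_minimal[OF _ ts.subspace_L], rule subsetI, elim imageE)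
    fix x t assume t: "t \<in> {t \<in> Gamma. comp_less n (fst t) (fst s)}" "x = em (fst t) (snd t)"
    then have "comp_less n (fst u) (fst s)" if "u \<in> Gamma" "coord u x \<noteq> 0" for u
      using ts.coef_e[OF that(1), of t] that(2) by (cases "u = t") auto
    then show "x \<in> ts.L s" using ts.e_V[of t] t by (simp add: ts.L_def)
  qed
qed

lemma eigenvector_ef:
  assumes s: "s \<in> Gamma"
  shows "eigenvector (psi (ts.ef s))"
  unfolding eigenvector_def
proof (intro conjI ballI psi_closed)
  show "psi (ts.ef s) \<noteq> \<zero>\<^bsub>MM\<^esub>"
    using psi_eq_iff[OF ts.ef_V[OF s] V_0] ts.ef_nonzero[OF s] by (simp add: psi_0)
  fix a assume a: "a \<in> tt"
  have "\<exists>c. g (ts.ef s) - fsc (ts.chi g s) (ts.ef s) = fsc c (ts.ef s)" if "g \<in> GG" for g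
    using ts.ef_G[OF s that] by (intro exI[of _ 0]) simp
  from tt_character[OF ts.ef_V[OF s] ts.ef_G[OF s] ts.ef_V[OF s] this a]
  obtain p \<alpha> where "p \<in> carrier FF" "a = hcl p" "act p (ts.ef s) = fsc \<alpha> (ts.ef s)" by blast
  then have "a \<odot>\<^bsub>MM\<^esub> psi (ts.ef s) = hcl (const \<alpha>) \<odot>\<^bsub>MM\<^esub> psi (ts.ef s)"
    using psi_act[of p "ts.ef s"] ts.ef_V[OF s] by (simp add: psi_fsc)
  then show "\<exists>c. a \<odot>\<^bsub>MM\<^esub> psi (ts.ef s) = hcl (const c) \<odot>\<^bsub>MM\<^esub> psi (ts.ef s)" by blast
qed

lemma eigenvector_GG:
  assumes "eigenvector (psi F)" "F \<in> V" "g \<in> GG"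
  shows "\<exists>c. g F = fsc c F"
proof -
  obtain p where p: "p \<in> carrier FF" "hcl p \<in> tt" "\<And>F. act p F = g F" using GG_tt[OF assms(3)] by blast
  then obtain c where "hcl p \<odot>\<^bsub>MM\<^esub> psi F = hcl (const c) \<odot>\<^bsub>MM\<^esub> psi F"
    using assms(1) unfolding eigenvector_def by blast
  then have "psi (g F) = psi (fsc c F)"
    using psi_act[OF p(1) assms(2)] p(3) by (simp add: psi_fsc)
  moreover have "g F \<in> V" using assms(2,3) by (rule ts.G_V[rotated])
  ultimately show ?thesis using psi_eq_iff[OF _ V_fsc[OF assms(2)]] by blast
qed

text \<open>The vectors \<open>f\<^bsub>\<mu>,T\<^esub>\<close> are the eigenvectors constructed in the model, by uniqueness.\<close>

lemma ff_eq:
  assumes s: "(\<mu>, T) \<in> Gamma"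
  shows "ff \<mu> T = psi (ts.ef (\<mu>, T))"
proof -
  let ?s = "(\<mu>, T)"
  have \<mu>: "\<mu> \<in> compositions n" "T \<in> ST" using s by (auto simp: Gamma_def)
  let ?B = "{t \<in> Gamma. comp_less n (fst t) \<mu>}" and ?X = "{xv \<nu> U |\<nu> U. \<nu> \<in> compositions n \<and> U \<in> ST \<and> comp_less n \<nu> \<mu>}"
  have "?X = psi ` (\<lambda>t. em (fst t) (snd t)) ` ?B"
  proof (intro equalityI subsetI)
    fix m assume "m \<in> ?X"
    then obtain \<nu> U where h: "m = xv \<nu> U" "\<nu> \<in> compositions n" "U \<in> ST" "comp_less n \<nu> \<mu>" by blast
    then have "m = psi (em (fst (\<nu>, U)) (snd (\<nu>, U)))" "(\<nu>, U) \<in> ?B" by (simp_all add: psi_em Gamma_def)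
    then show "m \<in> psi ` (\<lambda>t. em (fst t) (snd t)) ` ?B" by blast
  qed (force simp: Gamma_def psi_em)
  moreover have "(\<lambda>t. em (fst t) (snd t)) ` ?B \<subseteq> V" using ts.e_V by blast
  ultimately have X: "cspan MM ?X = psi ` ts.L ?s"
    using cspan_psi L_eq_span[OF s] by simp
  have LV: "ts.L ?s \<subseteq> V" by (auto simp: ts.L_def)
  have iff: "psi F \<ominus>\<^bsub>MM\<^esub> xv \<mu> T \<in> cspan MM ?X \<longleftrightarrow> F - em \<mu> T \<in> ts.L ?s" if F: "F \<in> V" for F
  proof -
    have "psi F \<ominus>\<^bsub>MM\<^esub> xv \<mu> T = psi (F - em \<mu> T)" using \<mu> by (simp add: psi_diff psi_em)
    then show ?thesis
      unfolding X using psi_mem_image[OF V_diff[OF F V_em[OF \<mu>]] LV] by simp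
  qed
  have ef: "ts.ef ?s \<in> V" "ts.ef ?s - em \<mu> T \<in> ts.L ?s"
    using ts.eig_ef[OF s] by (simp_all add: ts.eig_def)
  show ?thesis
    unfolding ff_def
  proof (rule the_equality)
    show "eigenvector (psi (ts.ef ?s)) \<and> psi (ts.ef ?s) \<ominus>\<^bsub>MM\<^esub> xv \<mu> T \<in> cspan MM ?X"
      using eigenvector_ef[OF s] iff[OF ef(1)] ef(2) by simp
    fix m assume m: "eigenvector m \<and> m \<ominus>\<^bsub>MM\<^esub> xv \<mu> T \<in> cspan MM ?X"
    then have "m \<in> psi ` V" unfolding psi_surj by (simp add: eigenvector_def)
    then obtain F where F: "F \<in> V" "m = psi F" by blast
    have "F = ts.ef ?s"
    proof (rule ts.ef_unique[OF s F(1)])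
      show "F - em (fst ?s) (snd ?s) \<in> ts.L ?s" using iff[OF F(1)] m F by simp
      show "\<exists>c. g F = fsc c F" if "g \<in> GG" for g using eigenvector_GG[OF _ F(1) that] m F by simp
    qed
    then show "m = psi (ts.ef ?s)" using F by simp
  qed
qed

lemma cspan_ff:
  assumes "B \<subseteq> Gamma"
  shows "cspan MM ((\<lambda>(\<mu>, T). ff \<mu> T) ` B) = psi ` fsc.span (ts.ef ` B)"
proof -
  have "(\<lambda>(\<mu>, T). ff \<mu> T) ` B = psi ` ts.ef ` B"
    unfolding image_image using assms by (intro image_cong refl) (auto simp: ff_eq)
  moreover have "ts.ef ` B \<subseteq> V" using assms ts.ef_V by blast
  ultimately show ?thesis using cspan_psi by simp
qed

lemma span_ef_V: "B \<subseteq> Gamma \<Longrightarrow> fsc.span (ts.ef ` B) \<subseteq> V"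
  using ts.ef_V by (intro fsc.span_minimal subspace_V) blast

text \<open>Linear independence of the eigenvectors.\<close>

lemma ef_span_iff:
  assumes B: "B \<subseteq> Gamma" and s: "s \<in> Gamma"
  shows "ts.ef s \<in> fsc.span (ts.ef ` B) \<longleftrightarrow> s \<in> B"
proof
  assume "ts.ef s \<in> fsc.span (ts.ef ` B)"
  from ts.span_family[OF this] obtain A c
    where A: "finite A" "A \<subseteq> B" "ts.ef s = (\<Sum>t\<in>A. fsc (c t) (ts.ef t))" by blast
  show "s \<in> B"
  proof (rule ccontr)
    assume nB: "s \<notin> B"
    \<comment> \<open>the expansion of \<open>ef s\<close> as a linear relation between eigenvectors\<close>
    let ?c = "\<lambda>t. if t = s then - 1 else c t"
    have "(\<Sum>t\<in>A. fsc (?c t) (ts.ef t)) = (\<Sum>t\<in>A. fsc (c t) (ts.ef t))"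
      using nB A(2) by (intro sum.cong) auto
    moreover have "s \<notin> A" using nB A(2) by blast
    ultimately have "(\<Sum>t\<in>insert s A. fsc (?c t) (ts.ef t)) = 0"
      using A(1,3) by (simp add: fsc.scale_minus_left)
    from ts.ef_independent[OF _ _ this, of s] A(1,2) B s show False by auto
  qed
qed (intro fsc.span_base imageI)

text \<open>The weights are distinct, so projecting to weight spaces stays inside a stable subspace.\<close>

lemma stable_eq_span:
  assumes st: "stable N"
  shows "N = fsc.span (ts.ef ` {t \<in> Gamma. ts.ef t \<in> N})"
proof
  show "fsc.span (ts.ef ` {t \<in> Gamma. ts.ef t \<in> N}) \<subseteq> N"
    by (rule fsc.span_minimal[OF _ stableD(2)[OF st]]) auto
  show "N \<subseteq> fsc.span (ts.ef ` {t \<in> Gamma. ts.ef t \<in> N})"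
  proof
    fix F assume F: "F \<in> N"
    then obtain A c where A: "finite A" "A \<subseteq> Gamma" "F = (\<Sum>t\<in>A. fsc (c t) (ts.ef t))"
      using ts.ef_spans[of F] stableD(1)[OF st] by blast
    have "fsc (c t) (ts.ef t) \<in> fsc.span (ts.ef ` {t \<in> Gamma. ts.ef t \<in> N})" if t: "t \<in> A" for t
    proof (cases "c t = 0")
      case True
      then show ?thesis by (simp add: fsc.span_zero)
    next
      case False
      have "ts.ef t \<in> N"
      proof (rule ts.ef_separate[where N = N and A = A and c = c])
        show "(\<Sum>u\<in>A. fsc (c u) (ts.ef u)) \<in> N" using F A(3) by simp
      qed (use A t False stable_GG[OF st] stableD(2)[OF st] in auto)
      then show ?thesis using A(2) t by (intro fsc.span_scale fsc.span_base) auto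
    qed
    then show "F \<in> fsc.span (ts.ef ` {t \<in> Gamma. ts.ef t \<in> N})"
      unfolding A(3) by (rule fsc.span_sum)
  qed
qed

text \<open>Indices of the eigenvectors that die in \<open>L(\<lambda>)\<close>.\<close>

definition K :: "((nat \<Rightarrow> nat) \<times> tableau) set"
  where "K = {t \<in> Gamma. \<exists>N. stable N \<and> N \<noteq> V \<and> ts.ef t \<in> N}"

text \<open>The sum of all proper submodules, in the model.\<close>

definition J :: "(tableau \<Rightarrow> mpoly) set"
  where "J = fsc.span (ts.ef ` K)"

lemma K_Gamma: "K \<subseteq> Gamma"
  by (auto simp: K_def)

lemma J_V: "J \<subseteq> V"
  unfolding J_def by (rule span_ef_V[OF K_Gamma])

lemma proper_stable_J:
  assumes "stable N" "N \<noteq> V"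
  shows "N \<subseteq> J"
proof -
  have "{t \<in> Gamma. ts.ef t \<in> N} \<subseteq> K" using assms by (auto simp: K_def)
  then have "fsc.span (ts.ef ` {t \<in> Gamma. ts.ef t \<in> N}) \<subseteq> J"
    unfolding J_def by (intro fsc.span_mono image_mono)
  then show ?thesis using stable_eq_span[OF assms(1)] by simp
qed

lemma stable_J: "stable J"
  unfolding stable_def
proof (intro conjI ballI J_V)
  show sJ: "fsc.subspace J" unfolding J_def by (rule fsc.subspace_span)
  fix p F assume p: "p \<in> carrier FF" and F: "F \<in> J"
  have "fsc.subspace {F. act p F \<in> J}"
    using sJ unfolding fsc.subspace_def by (auto simp: lin_add[OF flin_act] lin_scale[OF flin_act] lin_zero[OF flin_act])
  moreover have "ts.ef ` K \<subseteq> {F. act p F \<in> J}"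
    using proper_stable_J stableD(3)[OF _ p] by (fastforce simp: K_def)
  ultimately have "J \<subseteq> {F. act p F \<in> J}" unfolding J_def by (rule fsc.span_minimal[rotated])
  then show "act p F \<in> J" using F by blast
qed

lemma zero_Gamma: "T \<in> ST \<Longrightarrow> (\<lambda>_. 0, T) \<in> Gamma"
  by (simp add: Gamma_def compositions_def)

text \<open>No composition is below \<open>0\<close>, because comparable compositions have the same size.\<close>

lemma ef_zero:
  assumes T: "T \<in> ST"
  shows "ts.ef (\<lambda>_. 0, T) = em (\<lambda>_. 0) T"
proof -
  have "\<not> comp_less n \<nu> (\<lambda>_. 0)" if \<nu>: "\<nu> \<in> compositions n" for \<nu>
  proof
    assume l: "comp_less n \<nu> (\<lambda>_. 0)"
    then have "(\<Sum>k<n. \<nu> k) = 0" using comp_less_total[OF l] by simp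
    then have "\<nu> = (\<lambda>_. 0)" using \<nu> by (intro ext) (auto simp: compositions_def not_less[symmetric])
    then show False using l comp_less_irrefl by simp
  qed
  then have "{t \<in> Gamma. comp_less n (fst t) (fst (\<lambda>_. 0 :: nat, T))} = {}" by (auto simp: Gamma_def)
  then have "ts.L (\<lambda>_. 0, T) = {0}"
    unfolding L_eq_span[OF zero_Gamma[OF T]] by (simp only: image_empty fsc.span_empty)
  then show ?thesis using ts.eig_ef[OF zero_Gamma[OF T]] by (simp add: ts.eig_def)
qed

text \<open>The eigenvector is a nonzero constant, and a stable subspace containing one is the whole model.\<close>

lemma zero_notin_K:
  assumes T: "T \<in> ST"
  shows "(\<lambda>_. 0, T) \<notin> K"
proof
  let ?u = "vm (\<lambda>_. 0) T"
  assume "(\<lambda>_. 0, T) \<in> K"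
  then obtain N where N: "stable N" "N \<noteq> V" "em (\<lambda>_. 0) T \<in> N" by (auto simp: K_def ef_zero[OF T])
  have "ex (\<lambda>_. 0) = 0" by (simp only: ex_def zero_poly_mapping_def)
  then have e: "em (\<lambda>_. 0) T = pt 1 ?u" by (simp add: em_def xp_def)
  have "em (\<lambda>_. 0) T \<noteq> 0" using ts.ef_nonzero[OF zero_Gamma[OF T]] by (simp add: ef_zero[OF T])
  moreover have "em (\<lambda>_. 0) T = 0" if "?u = (\<lambda>T. 0)" unfolding e that by (simp add: pt_def fun_eq_iff fapp)
  ultimately have "?u \<noteq> (\<lambda>T. 0)" by blast
  from stable_constants[OF N(1) vm_Ssp[OF T] this N(3)[unfolded e]] show False using N(2) by simp
qed

lemma J_proper: "J \<noteq> V"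
proof
  obtain T where T: "T \<in> ST" using ST_nonempty by blast
  assume "J = V"
  then have "ts.ef (\<lambda>_. 0, T) \<in> fsc.span (ts.ef ` K)" using ts.ef_V[OF zero_Gamma[OF T]] by (simp add: J_def)
  then show False using ef_span_iff[OF K_Gamma zero_Gamma[OF T]] zero_notin_K[OF T] by blast
qed

text \<open>The span misses the eigenvectors with index \<open>(0,T)\<close>, hence is a proper submodule.\<close>

lemma Gamma_sub_K:
  assumes B: "B \<subseteq> Gamma" "\<And>T. (\<lambda>_. 0, T) \<notin> B"
    and sub: "submodule (cspan MM ((\<lambda>(\<mu>, T). ff \<mu> T) ` B)) HH MM"
  shows "B \<subseteq> K"
proof -
  let ?N = "fsc.span (ts.ef ` B)"
  obtain T where T: "T \<in> ST" using ST_nonempty by blast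
  have "stable ?N" using sub submodule_psi[OF span_ef_V[OF B(1)]] by (simp add: cspan_ff[OF B(1)])
  moreover have "?N \<noteq> V" using ef_span_iff[OF B(1) zero_Gamma[OF T]] B(2)[of T] ts.ef_V[OF zero_Gamma[OF T]] by blast
  moreover have "ts.ef t \<in> ?N" if "t \<in> B" for t using that by (intro fsc.span_base imageI)
  ultimately show ?thesis using B(1) by (auto simp: K_def)
qed

text \<open>A proper submodule is spanned by eigenvectors with index in \<open>K\<close>.\<close>

lemma the_maximal: "(THE N. maximal_proper_submodule N HH MM) = psi ` J"
proof (rule the_equality)
  have ne: "psi ` J \<noteq> carrier MM"
  proof
    assume "psi ` J = carrier MM"
    then have "psi ` J = psi ` V" by (simp add: psi_surj)
    then show False using J_proper inj_on_image_eq_iff[OF psi_inj J_V order_refl] by simp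
  qed
  have below: "N = carrier MM \<or> N \<subseteq> psi ` J" if N: "submodule N HH MM" for N
  proof -
    obtain B where B: "B \<subseteq> V" "N = psi ` B" "stable B" using submodule_obtain[OF N] .
    show ?thesis
    proof (cases "B = V")
      case True
      then show ?thesis using B psi_surj by simp
    next
      case False
      from image_mono[OF proper_stable_J[OF B(3) this]] show ?thesis unfolding B(2) by (rule disjI2)
    qed
  qed
  have subJ: "submodule (psi ` J) HH MM" using submodule_psi[OF J_V] stable_J by simp
  show "maximal_proper_submodule (psi ` J) HH MM"
    unfolding maximal_proper_submodule_def using subJ ne below by blast
  show "N = psi ` J" if "maximal_proper_submodule N HH MM" for N
    using that subJ ne below[of N] unfolding maximal_proper_submodule_def by blast
qed

text \<open>The images of the remaining eigenvectors span the quotient.\<close>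

lemma finite_dimensional_LL:
  assumes fin: "finite (Gamma - K)"
  shows "finite_dimensional LL"
proof -
  have subJ: "submodule (psi ` J) HH MM" using submodule_psi[OF J_V] stable_J by simp
  interpret Q: lmodule_quotient HH MM "psi ` J"
    by (intro lmodule_quotient.intro lmodule_quotient_axioms.intro lmodule_MM subJ)
  have LL: "LL = quot_module MM (psi ` J)" by (simp add: LL_def the_maximal)
  have lmod: "lmodule HH LL" unfolding LL by (rule Q.quotient_lmodule)
  let ?c = "\<lambda>F. Q.cl (psi F)"
  have add: "?c (F + G) = ?c F \<oplus>\<^bsub>LL\<^esub> ?c G" for F G
    unfolding LL using Q.add_quot[OF psi_closed psi_closed, of F G] by (simp add: psi_add)
  have scale: "?c (fsc c F) = hcl (const c) \<odot>\<^bsub>LL\<^esub> ?c F" for c F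
    unfolding LL using Q.smult_quot[OF hcl_closed[OF FF_const] psi_closed, of c F] by (simp add: psi_fsc)
  have zero: "?c F = \<zero>\<^bsub>LL\<^esub>" if "F \<in> J" for F
  proof -
    have "psi F \<ominus>\<^bsub>MM\<^esub> \<zero>\<^bsub>MM\<^esub> = psi F" using psi_closed[of F] by (simp add: a_minus_def)
    then show ?thesis
      unfolding LL Q.zero_quot using that Q.cl_eq[OF psi_closed MM.M.zero_closed, of F] by simp
  qed
  have carr: "carrier LL = ?c ` V"
    unfolding LL Q.carrier_quot psi_surj[symmetric] by (simp add: image_image)
  let ?A = "?c ` ts.ef ` (Gamma - K)"
  have A: "?A \<subseteq> carrier LL" unfolding carr using ts.ef_V by blast
  have "cspan LL ?A = carrier LL"
  proof
    have "submodule (carrier LL) complex_ring (restrict_scalars LL)"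
      using lmodule.submodule_carrier[OF lmodule_restrict[OF lmod]] by (simp add: restrict_scalars_def)
    then show "cspan LL ?A \<subseteq> carrier LL" using A unfolding cspan_def gen_submodule_def by blast
    show "carrier LL \<subseteq> cspan LL ?A"
      unfolding cspan_def gen_submodule_def
    proof (intro Inter_greatest)
      fix N assume "N \<in> {N. submodule N complex_ring (restrict_scalars LL) \<and> ?A \<subseteq> N}"
      then have N: "\<zero>\<^bsub>LL\<^esub> \<in> N" "\<And>x y. x \<in> N \<Longrightarrow> y \<in> N \<Longrightarrow> x \<oplus>\<^bsub>LL\<^esub> y \<in> N"
        "\<And>c x. x \<in> N \<Longrightarrow> hcl (const c) \<odot>\<^bsub>LL\<^esub> x \<in> N" and AN: "?A \<subseteq> N"
        by (simp_all add: submodule_restrict_iff[OF lmod])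
      have "fsc.subspace {F. ?c F \<in> N}"
        unfolding fsc.subspace_def
        using N zero[OF fsc.span_zero[of "ts.ef ` K", folded J_def]] by (auto simp: add scale)
      moreover have "?c (ts.ef t) \<in> N" if "t \<in> Gamma" for t
      proof (cases "t \<in> K")
        case True
        then have "ts.ef t \<in> J" unfolding J_def by (intro fsc.span_base imageI)
        then show ?thesis using N(1) zero by simp
      next
        case False
        then show ?thesis using AN that by blast
      qed
      ultimately have "fsc.span (ts.ef ` Gamma) \<subseteq> {F. ?c F \<in> N}"
        by (intro fsc.span_minimal) auto
      moreover have "V \<subseteq> fsc.span (ts.ef ` Gamma)"
      proof
        fix F assume "F \<in> V"
        then obtain A c where A: "A \<subseteq> Gamma" and F: "F = (\<Sum>t\<in>A. fsc (c t) (ts.ef t))"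
          using ts.ef_spans by blast
        show "F \<in> fsc.span (ts.ef ` Gamma)"
          unfolding F using A by (intro fsc.span_sum fsc.span_scale fsc.span_base) auto
      qed
      ultimately show "carrier LL \<subseteq> N" unfolding carr by blast
    qed
  qed
  then show ?thesis
    unfolding finite_dimensional_def using fin A by (intro exI[of _ ?A]) simp
qed

text \<open>Each tableau \<open>T\<close> gives its own bound, from the outside corner holding the largest entry; there are
finitely many tableaux.\<close>

lemma finite_dimensional_criterion:
  assumes chain: "\<And>b. outside_corner n lam b \<Longrightarrow>
      \<exists>(m::nat) (bs :: nat \<Rightarrow> box) (ks :: nat \<Rightarrow> nat).
        bs 0 = b \<and>
        (\<forall>i\<le>2 * m. bs i \<in> boxes lam) \<and>
        (\<forall>i\<le>m. ks i > 0) \<and>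
        (\<forall>i\<in>{1..m}. beta (bs (2 * i)) = beta (bs (2 * i - 1)) \<and>
           box_col (bs (2 * i - 1)) \<le> box_col (bs (2 * i)) \<and>
           box_row (bs (2 * i - 1)) \<le> box_row (bs (2 * i))) \<and>
        (\<forall>i<m. bs (2 * i) \<noteq> bs (2 * i + 1) \<and>
           submodule (M2 (bs (2 * i)) (bs (2 * i + 1)) (ks i)) HH MM) \<and>
        submodule (M1 (bs (2 * m)) (ks m)) HH MM"
  shows "finite_dimensional LL"
proof (rule finite_dimensional_LL)
  have "\<exists>C. \<forall>\<mu> i. (\<mu>, T) \<in> Gamma - K \<longrightarrow> i < n \<longrightarrow> \<mu> i \<le> C" if T: "T \<in> ST" for T
  proof -
    have n1: "n - 1 < n" using n_pos by simp
    have "outside_corner n lam (T (n - 1))"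
      unfolding outside_corner_def using ST_box[OF T n1] entry_apply[OF T n1] T by blast
    from chain[OF this] obtain m :: nat and bs :: "nat \<Rightarrow> box" and ks :: "nat \<Rightarrow> nat"
      where bs: "bs 0 = T (n - 1)" "\<forall>i\<le>2 * m. bs i \<in> boxes lam"
      and ks: "\<forall>i\<le>m. ks i > 0"
      and a: "\<forall>i\<in>{1..m}. beta (bs (2 * i)) = beta (bs (2 * i - 1)) \<and>
           box_col (bs (2 * i - 1)) \<le> box_col (bs (2 * i)) \<and>
           box_row (bs (2 * i - 1)) \<le> box_row (bs (2 * i))"
      and b: "\<forall>i<m. bs (2 * i) \<noteq> bs (2 * i + 1) \<and>
           submodule (M2 (bs (2 * i)) (bs (2 * i + 1)) (ks i)) HH MM"
      and c: "submodule (M1 (bs (2 * m)) (ks m)) HH MM" by blast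
    have K2: "Gamma2 (bs (2 * i)) (bs (2 * i + 1)) (ks i) \<subseteq> K" if i: "i < m" for i
    proof (rule Gamma_sub_K)
      show "Gamma2 (bs (2 * i)) (bs (2 * i + 1)) (ks i) \<subseteq> Gamma" by (auto simp: Gamma2_def)
      show "(\<lambda>_. 0, T) \<notin> Gamma2 (bs (2 * i)) (bs (2 * i + 1)) (ks i)" for T
        using ks i by (intro zero_notin_Gamma2) simp
    qed (use b i in \<open>simp add: M2_def\<close>)
    have K1: "Gamma1 (bs (2 * m)) (ks m) \<subseteq> K"
    proof (rule Gamma_sub_K)
      show "Gamma1 (bs (2 * m)) (ks m) \<subseteq> Gamma" by (auto simp: Gamma1_def)
      show "(\<lambda>_. 0, T) \<notin> Gamma1 (bs (2 * m)) (ks m)" for T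
        using ks by (intro zero_notin_Gamma1) simp
    qed (use c in \<open>simp add: M1_def\<close>)
    have "\<mu> i \<le> (\<Sum>j\<le>m. ks j)" if h: "(\<mu>, T) \<in> Gamma - K" "i < n" for \<mu> i
    proof (rule composition_bounded[OF T _ _ bs(2) a _ _ h(2)])
      show "\<mu> \<in> compositions n" using h(1) by (simp add: Gamma_def)
      show "entry n T (bs 0) = n - 1" using entry_apply[OF T n1] by (simp add: bs(1))
    qed (use K1 K2 h(1) in blast)+
    then show ?thesis by blast
  qed
  then obtain C where C: "\<And>T \<mu> i. T \<in> ST \<Longrightarrow> (\<mu>, T) \<in> Gamma - K \<Longrightarrow> i < n \<Longrightarrow> \<mu> i \<le> C T" by metis
  have "Gamma - K \<subseteq> (\<Union>T\<in>ST. {\<mu> \<in> compositions n. \<forall>i<n. \<mu> i \<le> C T} \<times> {T})"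
  proof
    fix s assume s: "s \<in> Gamma - K"
    obtain \<mu> T where e: "s = (\<mu>, T)" by (cases s)
    have "\<mu> \<in> compositions n" "T \<in> ST" using s by (auto simp: e Gamma_def)
    then show "s \<in> (\<Union>T\<in>ST. {\<mu> \<in> compositions n. \<forall>i<n. \<mu> i \<le> C T} \<times> {T})"
      using C[of T \<mu>] s by (auto simp: e)
  qed
  moreover have "finite (\<Union>T\<in>ST. {\<mu> \<in> compositions n. \<forall>i<n. \<mu> i \<le> C T} \<times> {T})"
    by (intro finite_UN_I finite_ST finite_cartesian_product finite_bounded_compositions) simp
  ultimately show "finite (Gamma - K)" by (rule finite_subset)
qed

end

end

theorem corollary8p1:
  fixes r n :: nat
    and c0 :: complex
    and d :: "nat \<Rightarrow> complex"
    and lam :: "nat list list"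
    and rho :: "complex mat \<Rightarrow> (tableau \<Rightarrow> complex) \<Rightarrow> tableau \<Rightarrow> complex"
  assumes "r \<ge> 1" and "n \<ge> 1" and "c0 \<noteq> 0"
    and "is_multipartition r n lam"
    and "cherednik.specht_module r n lam rho"
    and "cherednik.simple_spectrum r n c0 d lam rho"
    and "\<And>b. outside_corner n lam b \<Longrightarrow>
      \<exists>(m::nat) (bs :: nat \<Rightarrow> box) (ks :: nat \<Rightarrow> nat).
        bs 0 = b \<and>
        (\<forall>i\<le>2 * m. bs i \<in> boxes lam) \<and>
        (\<forall>i\<le>m. ks i > 0) \<and>
        (\<forall>i\<in>{1..m}. beta (bs (2 * i)) = beta (bs (2 * i - 1)) \<and>
           box_col (bs (2 * i - 1)) \<le> box_col (bs (2 * i)) \<and>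
           box_row (bs (2 * i - 1)) \<le> box_row (bs (2 * i))) \<and>
        (\<forall>i<m. bs (2 * i) \<noteq> bs (2 * i + 1) \<and>
           submodule (cherednik.M2 r n c0 d lam rho (bs (2 * i)) (bs (2 * i + 1)) (ks i))
             (cherednik.HH r n c0 d) (cherednik.MM r n c0 d lam rho)) \<and>
        submodule (cherednik.M1 r n c0 d lam rho (bs (2 * m)) (ks m))
          (cherednik.HH r n c0 d) (cherednik.MM r n c0 d lam rho)"
  shows "cherednik.finite_dimensional r n c0 d (cherednik.LL r n c0 d lam rho)"
proof -
  interpret cherednik_rep r n c0 d lam rho
    by unfold_locales (use assms(1,2,4,5) in auto)
  show ?thesis
    by (rule finite_dimensional_criterion[OF assms(6,7)])
qed

end
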